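(* Let $1<p<\infty$, let $a,b\in\mathbb{R}$, let $H$ be the Hilbert transform on the real line and $I$ the identity operator, and set $$B_p=\sup_{x\in\mathbb{R}}\frac{\left|ax-b+(bx+a)\tan\frac{\pi}{2p}\right|^p+\left|ax-b-(bx+a)\tan\frac{\pi}{2p}\right|^p}{\left|x+\tan\frac{\pi}{2p}\right|^p+\left|x-\tan\frac{\pi}{2p}\right|^p}.$$ Then for all smooth compactly supported functions $f$ on $\mathbb{R}$ we have $$\|(aI+bH)f\|_{L^p(\mathbb{R})}^p\le B_p\,\|f\|_{L^p(\mathbb{R})}^p,$$ and the constant $B_p$ is sharp (it is the smallest constant for which this holds for all such $f$). In other words, the operator norm of (the bounded extension of) $aI+bH$ satisfies $$\|aI+bH\|_{L^p(\mathbb{R})\to L^p(\mathbb{R})}=B_p^{1/p}.$$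
   Context: The Hilbert transform on the real line is defined, for a smooth compactly supported function $f$, by the principal value integral $$Hf(x)=\mathrm{p.v.}\,\frac1\pi\int_{\mathbb{R}}\frac{f(t)}{x-t}\,dt ,$$ and is extended to a bounded operator on $L^p(\mathbb{R})$, $1<p<\infty$, by density. Since $aI+bH$ maps real-valued functions to real-valued functions, its norm on real-valued $L^p$ functions and its norm on complex-valued $L^p$ functions coincide (Marcinkiewicz--Zygmund), so the functions may be taken either real-valued or complex-valued. *)

theory Defs
  imports "HOL-Analysis.Analysis"
begin

definition test_functions :: "(real \<Rightarrow> real) set" where
  "test_functions =
     {f. (\<forall>n. (deriv ^^ n) f differentiable_on UNIV) \<and> compact (closure {x. f x \<noteq> 0})}"

text \<open>The principal value integral is the limit of the integrals over \<open>\<bar>x - t\<bar> > \<epsilon>\<close>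
  as \<open>\<epsilon>\<close> decreases to 0; for a test function this limit exists at every point \<open>x\<close>.\<close>

definition hilbert :: "(real \<Rightarrow> real) \<Rightarrow> real \<Rightarrow> real" where
  "hilbert f x =
     Lim (at_right 0) (\<lambda>\<epsilon>. 1 / pi * (LBINT t:{t. \<epsilon> < \<bar>x - t\<bar>}. f t / (x - t)))"

text \<open>Elements of \<open>Lp p\<close> are functions, not equivalence classes: identities between them
  are to be read almost everywhere. \<open>Lp_norm p f\<close> is meaningful only for \<open>f \<in> Lp p\<close>, since the
  Bochner integral of a non-integrable function is 0.\<close>

definition Lp :: "real \<Rightarrow> (real \<Rightarrow> real) set" where
  "Lp p = {f \<in> borel_measurable lborel. integrable lborel (\<lambda>x. \<bar>f x\<bar> powr p)}"

definition Lp_norm :: "real \<Rightarrow> (real \<Rightarrow> real) \<Rightarrow> real" where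
  "Lp_norm p f = (\<integral>x. \<bar>f x\<bar> powr p \<partial>lborel) powr (1 / p)"

text \<open>Compatibility with almost-everywhere equality follows from linearity and boundedness.\<close>

definition bounded_linear_Lp :: "real \<Rightarrow> ((real \<Rightarrow> real) \<Rightarrow> real \<Rightarrow> real) \<Rightarrow> bool" where
  "bounded_linear_Lp p T \<longleftrightarrow>
     (\<forall>f\<in>Lp p. T f \<in> Lp p) \<and>
     (\<forall>f\<in>Lp p. \<forall>g\<in>Lp p. AE x in lborel. T (\<lambda>y. f y + g y) x = T f x + T g x) \<and>
     (\<forall>c. \<forall>f\<in>Lp p. AE x in lborel. T (\<lambda>y. c * f y) x = c * T f x) \<and>
     (\<exists>K. \<forall>f\<in>Lp p. Lp_norm p (T f) \<le> K * Lp_norm p f)"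

text \<open>By density of the test functions, such an extension is unique up to null sets.\<close>

definition hilbert_extension :: "real \<Rightarrow> ((real \<Rightarrow> real) \<Rightarrow> real \<Rightarrow> real) \<Rightarrow> bool" where
  "hilbert_extension p T \<longleftrightarrow>
     bounded_linear_Lp p T \<and>
     (\<forall>f\<in>test_functions. AE x in lborel. T f x = hilbert f x)"

text \<open>As in the library's \<^const>\<open>onorm\<close>, functions of norm 0 contribute the value 0.\<close>

definition Lp_onorm :: "real \<Rightarrow> ((real \<Rightarrow> real) \<Rightarrow> real \<Rightarrow> real) \<Rightarrow> real" where
  "Lp_onorm p T = (SUP f\<in>Lp p. Lp_norm p (T f) / Lp_norm p f)"

text \<open>For \<open>p > 1\<close> we have \<open>tan (pi / (2 * p)) > 0\<close>, so the denominator is positive and the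
  quotient is a bounded function of \<open>x\<close>.\<close>

definition B_const :: "real \<Rightarrow> real \<Rightarrow> real \<Rightarrow> real" where
  "B_const a b p =
     (SUP x. (\<bar>a * x - b + (b * x + a) * tan (pi / (2 * p))\<bar> powr p
              + \<bar>a * x - b - (b * x + a) * tan (pi / (2 * p))\<bar> powr p)
             / (\<bar>x + tan (pi / (2 * p))\<bar> powr p + \<bar>x - tan (pi / (2 * p))\<bar> powr p))"

end

theory Submission
  imports Defs "HOL-Complex_Analysis.Complex_Analysis"
begin

text \<open>Writing \<open>x = tan \<phi>\<close>, the constant \<open>B\<close> is the least number such that
  \<open>h t = B * \<bar>cos t\<bar>\<^sup>p - \<bar>a * cos t + b * sin t\<bar>\<^sup>p\<close> satisfies \<open>h t + h (t + pi / p) \<ge> 0\<close> for all \<open>t\<close>,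
  and equality holds for some \<open>t = \<alpha>\<close>.

  Upper bound: replacing \<open>h\<close> on \<open>[\<alpha>, \<alpha> + pi / p]\<close> by the sinusoid of frequency \<open>p\<close> that is tangent to
  it at both ends yields a function \<open>g \<le> h\<close> for which \<open>G (r e\<^sup>i\<^sup>t) = r\<^sup>p g t\<close> is subharmonic.
  If \<open>F\<close> is the holomorphic extension of \<open>f + \<i> H f\<close> to the upper half-plane, then
  \<open>G (F z)\<close> is subharmonic, so its integral over the real line is nonnegative, and integrating
  \<open>\<bar>a f + b H f\<bar>\<^sup>p \<le> B \<bar>f\<bar>\<^sup>p - G (f + \<i> H f)\<close> gives the bound.

  Sharpness: for \<open>f = Re (e\<^sup>i\<^sup>\<psi> (x + \<i>)\<^sup>-\<^sup>\<beta>)\<close> with \<open>\<beta>\<close> decreasing to \<open>1 / p\<close>, the quotient of the norms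
  tends to the quotient of the sums over the two angles \<open>\<psi>\<close> and \<open>\<psi> - pi / p\<close>.\<close>

section \<open>Trigonometrically convex minorants\<close>

text \<open>The angle \<open>pi / p\<close> is forced from two sides. If
  \<open>r\<^sup>p s(t)\<close> is locally harmonic off the origin, \<open>s\<close> is a sinusoid
  of frequency \<open>p\<close> and takes opposite values at \<open>t\<close> and
  \<open>t + pi / p\<close>; such a sinusoid below \<open>h\<close> at both angles forces their sum
  to be nonnegative. Conversely, \<open>x + \<i>\<close> to the power \<open>- 1 / p\<close> turns
  by exactly \<open>pi / p\<close> from one end of the line to the other. Tangency at the second end
  is automatic, because the pair sum is minimal at \<alpha>. What has to be earned is that the
  sinusoid stays below \<open>h\<close> on the arc and that \<open>h'' + p\<^sup>2 h\<close> is
  nonnegative off it; both follow from the position of its two sign changes per period. In the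
  analytic half the obstacle is regularity: \<open>G\<close> is singular at the origin, where
  \<open>F\<close> may vanish, and \<open>g\<close> is only C^1. So the angle is mollified and
  \<open>G\<close> is cut off near the origin, at the price of a small term that keeps the Laplacian
  nonnegative. As \<open>F\<close> decays, the cut-off function vanishes outside a bounded part of
  each half-plane \<open>Im z \<ge> y0\<close>, and Green's identity has no boundary terms from
  infinity.\<close>

lemma nondecreasing_except_finite:
  fixes f f' :: "real \<Rightarrow> real"
  assumes "u \<le> v" "continuous_on {u..v} f" "finite S"
    and der: "\<And>x. x \<in> {u<..<v} - S \<Longrightarrow> (f has_real_derivative f' x) (at x)"
    and nn: "\<And>x. x \<in> {u<..<v} - S \<Longrightarrow> 0 \<le> f' x"
  shows "f u \<le> f v"
proof -
  define k where "k x = (if x \<in> {u<..<v} - S then f' x else 0)" for x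
  have "(k has_integral f v - f u) {u..v}"
  proof (rule fundamental_theorem_of_calculus_interior_strong[OF \<open>finite S\<close> \<open>u \<le> v\<close> _ assms(2)])
    fix x assume "x \<in> {u<..<v} - S"
    then show "(f has_vector_derivative k x) (at x)"
      using der[of x] by (simp add: k_def has_real_derivative_iff_has_vector_derivative)
  qed
  moreover have "0 \<le> k x" for x using nn by (auto simp: k_def)
  ultimately have "0 \<le> f v - f u" by (rule has_integral_nonneg)
  then show ?thesis by simp
qed

text \<open>A strict gain near one non-exceptional point suffices; weak monotonicity on both sides
  carries it to the ends.\<close>

lemma increasing_except_finite:
  fixes f f' :: "real \<Rightarrow> real"
  assumes "u < v" and cont: "continuous_on {u..v} f" and "finite S"
    and der: "\<And>x. x \<in> {u<..<v} - S \<Longrightarrow> (f has_real_derivative f' x) (at x)"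
    and pos: "\<And>x. x \<in> {u<..<v} - S \<Longrightarrow> 0 < f' x"
  shows "f u < f v"
proof -
  have mono: "f x \<le> f y" if "u \<le> x" "x \<le> y" "y \<le> v" for x y
  proof (rule nondecreasing_except_finite[OF that(2) _ \<open>finite S\<close>])
    show "continuous_on {x..y} f" by (rule continuous_on_subset[OF cont]) (use that in auto)
    show "(f has_real_derivative f' z) (at z)" if "z \<in> {x<..<y} - S" for z
      using that \<open>u \<le> x\<close> \<open>y \<le> v\<close> by (intro der) auto
    show "0 \<le> f' z" if "z \<in> {x<..<y} - S" for z
      using that \<open>u \<le> x\<close> \<open>y \<le> v\<close> by (intro less_imp_le pos) auto
  qed
  have "infinite ({u<..<v} - S)" using \<open>u < v\<close> \<open>finite S\<close> by simp
  then obtain x0 where x0: "x0 \<in> {u<..<v} - S" by (metis finite.emptyI ex_in_conv)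
  obtain e where e: "e > 0" "\<And>k. 0 < k \<Longrightarrow> k < e \<Longrightarrow> f x0 < f (x0 + k)"
    using DERIV_pos_inc_right[OF der[OF x0] pos[OF x0]] by blast
  define k where "k = min (e/2) ((v - x0)/2)"
  have k: "0 < k" "k < e" "x0 + k \<le> v" using e(1) x0 by (auto simp: k_def min_def field_simps)
  have "f u \<le> f x0" using x0 by (intro mono) auto
  also have "\<dots> < f (x0 + k)" using e(2) k by blast
  also have "\<dots> \<le> f v" using k x0 by (intro mono) auto
  finally show ?thesis .
qed

lemma sin_neg_of: "sin x < 0" if "- pi < x" "x < 0" for x :: real
  using sin_gt_zero[of "-x"] that by simp

lemma periodic_int: "f (t - pi * of_int k) = f t" if f: "\<And>t. f (t + pi) = f t" for f :: "real \<Rightarrow> 'b"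
proof (induction k rule: int_induct[of _ 0])
  case (step1 i)
  have "f (t - pi * of_int (i + 1)) = f (t - pi * of_int (i + 1) + pi)" by (simp add: f)
  then show ?case using step1 by (simp add: algebra_simps)
next
  case (step2 i)
  have "f (t - pi * of_int (i - 1)) = f (t - pi * of_int i + pi)" by (simp add: algebra_simps)
  then show ?case using step2 by (simp add: f)
qed simp

text \<open>In polar coordinates the Laplacian of \<open>r powr p * h t\<close> is
  \<open>r powr (p - 2) * q t\<close>, so the sign of \<open>q\<close> decides subharmonicity. By
  \<open>sgn_q\<close>, up to shifts by \<open>pi\<close>, it is negative between \<open>n1\<close>
  and \<open>n2\<close> and positive between \<open>n2\<close> and \<open>n1 + pi\<close>. The
  locally finite set \<open>E\<close> collects the angles at which \<open>h1\<close> is not assumed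
  differentiable.\<close>

locale trig_minorant =
  fixes p :: real and h h1 q :: "real \<Rightarrow> real" and E :: "real set" and n1 n2 \<alpha> :: real
  assumes p: "1 < p"
    and per: "\<And>t. h (t + pi) = h t"
    and h1: "\<And>t. (h has_real_derivative h1 t) (at t)"
    and h1_cont: "continuous_on UNIV h1"
    and h2: "\<And>t. t \<notin> E \<Longrightarrow> (h1 has_real_derivative q t - p\<^sup>2 * h t) (at t)"
    and finE: "\<And>u v. finite (E \<inter> {u..v})"
    and sgn_q: "\<And>t. t \<notin> E \<Longrightarrow> sgn (q t) = sgn (sin (t - n1) * sin (t - n2))"
    and n12: "n1 < n2" "n2 < n1 + pi"
    and pair_nonneg: "\<And>t. 0 \<le> h t + h (t + pi / p)"
    and pair_zero: "h \<alpha> + h (\<alpha> + pi / p) = 0"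
    and n1: "\<alpha> \<le> n1" "n1 < \<alpha> + pi"
begin

definition "\<beta> = \<alpha> + pi / p"
text \<open>The solution of \<open>s'' = - p\<^sup>2 s\<close> that has the value and the slope of
  \<open>h\<close> at \<alpha>. Tangency at \<beta> is a consequence, not a part of the
  definition.\<close>

definition "s t = h \<alpha> * cos (p * (t - \<alpha>)) + h1 \<alpha> / p * sin (p * (t - \<alpha>))"
definition "s1 t = - (p * h \<alpha> * sin (p * (t - \<alpha>))) + h1 \<alpha> * cos (p * (t - \<alpha>))"
definition "d t = h t - s t"
definition "d1 t = h1 t - s1 t"
text \<open>The Wronskian of \<open>d\<close> and \<open>sin (p * (t - c))\<close>. Its derivative
  \<open>q t * sin (p * (t - c))\<close> no longer contains \<open>d\<close>, while its value at
  \<open>c\<close> is \<open>- p * d c\<close>; monotonicity of \<open>W c\<close> thus turns the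
  sign of \<open>q\<close> into the sign of \<open>d\<close>.\<close>

definition "W c t = d1 t * sin (p * (t - c)) - p * d t * cos (p * (t - c))"

lemma \<alpha>_less_\<beta>: "\<alpha> < \<beta>" using p by (simp add: \<beta>_def)
lemma \<beta>_less: "\<beta> < \<alpha> + pi" using p by (simp add: \<beta>_def field_simps)

lemma s_der: "(s has_real_derivative s1 t) (at t)"
  unfolding s_def[abs_def] s1_def using p
  by (auto intro!: derivative_eq_intros)

lemma s1_der: "(s1 has_real_derivative - (p\<^sup>2 * s t)) (at t)"
  unfolding s_def s1_def[abs_def] using p
  by (auto intro!: derivative_eq_intros simp: power2_eq_square algebra_simps)

lemma d_der: "(d has_real_derivative d1 t) (at t)"
  unfolding d_def[abs_def] d1_def by (intro DERIV_diff h1 s_der)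

lemma d1_der: "t \<notin> E \<Longrightarrow> (d1 has_real_derivative q t - p\<^sup>2 * d t) (at t)"
  unfolding d1_def[abs_def] d_def
  by (rule DERIV_cong[OF DERIV_diff[OF h2 s1_der]]) (auto simp: algebra_simps)

lemma d_cont: "continuous_on A d"
  by (rule DERIV_continuous_on) (use d_der has_field_derivative_at_within in blast)

lemma s1_cont: "continuous_on A s1"
  by (rule DERIV_continuous_on) (use s1_der has_field_derivative_at_within in blast)

lemma d1_cont: "continuous_on A d1"
  unfolding d1_def[abs_def]
  by (intro continuous_on_diff s1_cont continuous_on_subset[OF h1_cont]) auto

text \<open>The sum \<open>h t + h (t + pi / p)\<close> has a minimum at \<alpha>, so its derivative
  vanishes there. Since \<open>s\<close> changes sign over its half period \<open>pi / p\<close>,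
  this makes it tangent to \<open>h\<close> at \<beta> too.\<close>

lemma h1_\<beta>: "h1 \<beta> = - h1 \<alpha>"
proof -
  define m where "m t = h t + h (t + pi / p)" for t
  have der: "(m has_real_derivative h1 t + h1 (t + pi/p)) (at t)" for t
    unfolding m_def[abs_def]
    by (auto intro!: derivative_eq_intros h1 DERIV_chain2[where f = h and g = "\<lambda>t. t + pi/p"])
  have "h1 \<alpha> + h1 (\<alpha> + pi/p) = 0"
    by (rule DERIV_local_min[OF der, of 1]) (use pair_nonneg pair_zero in \<open>auto simp: m_def\<close>)
  then show ?thesis by (simp add: \<beta>_def)
qed

lemma h_\<beta>: "h \<beta> = - h \<alpha>" using pair_zero by (simp add: \<beta>_def)

lemma p_\<beta>: "p * (\<beta> - \<alpha>) = pi" using p by (simp add: \<beta>_def)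

lemma d_ends: "d \<alpha> = 0" "d1 \<alpha> = 0" "d \<beta> = 0" "d1 \<beta> = 0"
  by (simp_all add: d_def d1_def s_def s1_def p_\<beta> h_\<beta> h1_\<beta>)

lemma W_ends: "W c \<alpha> = 0" "W c \<beta> = 0"
  by (simp_all add: W_def d_ends)

lemma W_der: "t \<notin> E \<Longrightarrow> (W c has_real_derivative q t * sin (p * (t - c))) (at t)"
  unfolding W_def[abs_def]
  by (rule derivative_eq_intros d1_der d_der | simp)+
     (simp add: power2_eq_square algebra_simps)

lemma W_cont: "continuous_on A (W c)"
  unfolding W_def[abs_def] by (intro continuous_intros d_cont d1_cont)

lemma W_mono:
  assumes "u \<le> v" and "\<And>t. u < t \<Longrightarrow> t < v \<Longrightarrow> t \<notin> E \<Longrightarrow> 0 \<le> k * (q t * sin (p * (t - c)))"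
  shows "k * W c u \<le> k * W c v"
proof (rule nondecreasing_except_finite[OF assms(1) _ finE[of u v]])
  show "continuous_on {u..v} (\<lambda>t. k * W c t)" by (intro continuous_intros W_cont)
  show "((\<lambda>t. k * W c t) has_real_derivative k * (q x * sin (p * (x - c)))) (at x)"
    if "x \<in> {u<..<v} - E \<inter> {u..v}" for x
    by (rule DERIV_cmult[OF W_der]) (use that in auto)
  show "0 \<le> k * (q x * sin (p * (x - c)))" if "x \<in> {u<..<v} - E \<inter> {u..v}" for x
    by (rule assms(2)) (use that in auto)
qed

text \<open>Since \<open>d\<close> and its derivative vanish at both ends of the arc, \<open>q\<close> is orthogonal on the
  arc to every sinusoid of frequency \<open>p\<close>.\<close>

lemma no_sign:
  assumes S: "finite S" and pos: "\<And>t. \<alpha> < t \<Longrightarrow> t < \<beta> \<Longrightarrow> t \<notin> E \<Longrightarrow> t \<notin> S \<Longrightarrow> 0 < k * (q t * sin (p * (t - c)))"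
  shows False
proof -
  have "k * W c \<alpha> < k * W c \<beta>"
  proof (rule increasing_except_finite[OF \<alpha>_less_\<beta>, of _ "(E \<inter> {\<alpha>..\<beta>}) \<union> S"])
    show "continuous_on {\<alpha>..\<beta>} (\<lambda>t. k * W c t)" by (intro continuous_intros W_cont)
    show "finite (E \<inter> {\<alpha>..\<beta>} \<union> S)" using finE S by simp
    show "((\<lambda>t. k * W c t) has_real_derivative k * (q x * sin (p * (x - c)))) (at x)"
      if "x \<in> {\<alpha><..<\<beta>} - (E \<inter> {\<alpha>..\<beta>} \<union> S)" for x
      by (rule DERIV_cmult[OF W_der]) (use that in auto)
    show "0 < k * (q x * sin (p * (x - c)))" if "x \<in> {\<alpha><..<\<beta>} - (E \<inter> {\<alpha>..\<beta>} \<union> S)" for x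
      by (rule pos) (use that in auto)
  qed
  then show False by (simp add: W_ends)
qed

lemma q_pos: "t \<notin> E \<Longrightarrow> 0 < sin (t - n1) * sin (t - n2) \<Longrightarrow> 0 < q t"
  using sgn_q[of t] by (metis sgn_1_pos)

lemma q_neg: "t \<notin> E \<Longrightarrow> sin (t - n1) * sin (t - n2) < 0 \<Longrightarrow> q t < 0"
  using sgn_q[of t] by (metis sgn_1_neg)

text \<open>As \<open>n1\<close> lies in the period that starts at \<alpha>, the only possible sign
  changes of \<open>q\<close> inside this period are \<open>n2 - pi\<close>, \<open>n1\<close> and
  \<open>n2\<close>.\<close>

lemma signs:
  assumes "\<alpha> < t" "t < \<alpha> + pi" "t \<notin> E"
  shows "t < n2 - pi \<Longrightarrow> q t < 0"
    and "n2 - pi < t \<Longrightarrow> t < n1 \<Longrightarrow> 0 < q t"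
    and "n1 < t \<Longrightarrow> t < n2 \<Longrightarrow> q t < 0"
    and "n2 < t \<Longrightarrow> 0 < q t"
proof -
  have e: "sin (t - n2) = - sin (t - n2 + pi)" by simp
  show "q t < 0" if "t < n2 - pi"
  proof (rule q_neg[OF assms(3)], rule mult_neg_pos)
    show "sin (t - n1) < 0" using that n12 n1 assms by (intro sin_neg_of) linarith+
    have "sin (t - n2 + pi) < 0" using that n12 n1 assms by (intro sin_neg_of) linarith+
    then show "0 < sin (t - n2)" by (simp only: e)
  qed
  show "0 < q t" if "n2 - pi < t" "t < n1"
    by (rule q_pos[OF assms(3)], rule mult_neg_neg)
       (use that n12 n1 assms in \<open>intro sin_neg_of; linarith\<close>)+
  show "q t < 0" if "n1 < t" "t < n2"
    by (rule q_neg[OF assms(3)], rule mult_pos_neg)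
       (use that n12 n1 assms in \<open>(intro sin_neg_of sin_gt_zero; linarith)+\<close>)
  show "0 < q t" if "n2 < t"
    by (rule q_pos[OF assms(3)], rule mult_pos_pos)
       (use that n12 n1 assms in \<open>(intro sin_neg_of sin_gt_zero; linarith)+\<close>)
qed

lemma sin_p:
  assumes "\<alpha> < t" "t < \<beta>" "\<alpha> \<le> c" "c \<le> \<beta>"
  shows "c < t \<Longrightarrow> 0 < sin (p * (t - c))" and "t < c \<Longrightarrow> sin (p * (t - c)) < 0"
proof -
  show "0 < sin (p * (t - c))" if "c < t"
  proof (rule sin_gt_zero)
    show "0 < p * (t - c)" using that p by simp
    have "p * (t - c) < p * (\<beta> - \<alpha>)" using p assms by (intro mult_strict_left_mono) linarith+
    then show "p * (t - c) < pi" by (simp add: p_\<beta>)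
  qed
  show "sin (p * (t - c)) < 0" if "t < c"
  proof (rule sin_neg_of)
    show "p * (t - c) < 0" using that p by (simp add: mult_pos_neg)
    have "p * (c - t) < p * (\<beta> - \<alpha>)" using p assms by (intro mult_strict_left_mono) linarith+
    then have "p * (c - t) < pi" by (simp add: p_\<beta>)
    then show "- pi < p * (t - c)" by (simp add: algebra_simps)
  qed
qed

text \<open>At \<open>\<alpha>\<close> the nonnegative function \<open>h t + h (t + pi / p)\<close> has its minimum, so \<open>q\<close> cannot be
  negative near both ends of the arc.\<close>

lemma not_both_neg:
  assumes "0 < \<epsilon>"
    and neg: "\<And>t. \<alpha> < t \<Longrightarrow> t < \<alpha> + \<epsilon> \<Longrightarrow> t \<notin> E \<Longrightarrow> q t < 0"
             "\<And>t. \<beta> < t \<Longrightarrow> t < \<beta> + \<epsilon> \<Longrightarrow> t \<notin> E \<Longrightarrow> q t < 0"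
  shows False
proof -
  define m where "m t = h t + h (t + pi / p)" for t
  define m1 where "m1 t = h1 t + h1 (t + pi / p)" for t
  define S where "S = (E \<inter> {\<alpha>..\<alpha>+\<epsilon>}) \<union> (\<lambda>t. t - pi/p) ` (E \<inter> {\<beta>..\<beta>+\<epsilon>})"
  have finS: "finite S" using finE by (simp add: S_def)
  have m_der: "(m has_real_derivative m1 t) (at t)" for t
    unfolding m_def[abs_def] m1_def
    by (auto intro!: derivative_eq_intros h1 DERIV_chain2[where f = h and g = "\<lambda>t. t + pi/p"])
  have m1_der: "(m1 has_real_derivative (q t + q (t + pi/p) - p\<^sup>2 * m t)) (at t)"
    if "t \<notin> E" "t + pi/p \<notin> E" for t
    unfolding m1_def[abs_def]
    by (rule derivative_eq_intros h2[OF that(1)] DERIV_chain2[where f = h1 and g = "\<lambda>t. t + pi/p", OF h2[OF that(2)]] | simp)+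
       (simp add: m_def algebra_simps)
  have nS: "t \<notin> E \<and> t + pi/p \<notin> E" if "t \<in> {\<alpha><..<\<alpha>+\<epsilon>} - S" for t
  proof -
    have "t + pi/p \<in> {\<beta>..\<beta>+\<epsilon>}" using that by (auto simp: \<beta>_def)
    moreover have "t = (t + pi/p) - pi/p" by simp
    ultimately have "t + pi/p \<notin> E" using that unfolding S_def by blast
    then show ?thesis using that by (auto simp: S_def)
  qed
  have m1_cont: "continuous_on A m1" for A
    unfolding m1_def[abs_def]
    by (intro continuous_intros continuous_on_compose2[OF h1_cont]) auto
  have m1_neg: "m1 t < 0" if t: "\<alpha> < t" "t < \<alpha> + \<epsilon>" for t
  proof -
    have "- m1 \<alpha> < - m1 t"
    proof (rule increasing_except_finite[OF t(1) _ finS])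
      show "continuous_on {\<alpha>..t} (\<lambda>x. - m1 x)" by (intro continuous_intros m1_cont)
      fix x assume x: "x \<in> {\<alpha><..<t} - S"
      then have xE: "x \<notin> E" "x + pi/p \<notin> E" using nS[of x] t by auto
      show "((\<lambda>x. - m1 x) has_real_derivative - (q x + q (x + pi/p) - p\<^sup>2 * m x)) (at x)"
        by (rule DERIV_minus[OF m1_der[OF xE]])
      have "q x < 0" using neg(1)[of x] xE x t by auto
      moreover have "q (x + pi/p) < 0" using neg(2)[of "x + pi/p"] xE x t by (auto simp: \<beta>_def)
      moreover have "0 \<le> p\<^sup>2 * m x" using pair_nonneg by (simp add: m_def)
      ultimately show "0 < - (q x + q (x + pi/p) - p\<^sup>2 * m x)" by linarith
    qed
    then show ?thesis using h1_\<beta> by (simp add: m1_def \<beta>_def)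
  qed
  have "- m \<alpha> < - m (\<alpha> + \<epsilon>/2)"
  proof (rule increasing_except_finite[of \<alpha> "\<alpha>+\<epsilon>/2" "\<lambda>x. - m x" "{}" "\<lambda>x. - m1 x"])
    show "continuous_on {\<alpha>..\<alpha>+\<epsilon>/2} (\<lambda>x. - m x)"
      by (intro continuous_intros DERIV_continuous_on[of _ m m1]) (use m_der has_field_derivative_at_within in blast)
    show "((\<lambda>x. - m x) has_real_derivative - m1 x) (at x)" for x by (rule DERIV_minus[OF m_der])
    show "0 < - m1 x" if "x \<in> {\<alpha><..<\<alpha>+\<epsilon>/2} - {}" for x using m1_neg[of x] that assms(1) by auto
  qed (use assms(1) in auto)
  then show False using pair_nonneg[of "\<alpha> + \<epsilon>/2"] pair_zero by (simp add: m_def)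
qed

text \<open>If \<open>n2\<close> were not below \<beta>, \<open>q\<close> could change sign on the
  arc only at \<open>n2 - pi\<close> and \<open>n1\<close>. With at most one change, a sinusoid
  vanishing at the change, or at \<alpha> if there is none, gives the product with \<open>q\<close>
  a constant sign, against orthogonality. With two changes \<open>q\<close> is negative just after
  both ends of the arc, against the minimality of the pair sum at \<alpha>.\<close>

lemma arc: "n2 < \<beta>"
proof (rule ccontr)
  assume n2: "\<not> n2 < \<beta>"
  have sg: "0 < (-1) * (q t * x)" if "q t < 0" "0 < x" for t x using that by (simp add: mult_neg_pos)
  consider "\<beta> \<le> n2 - pi" | "n2 - pi \<le> \<alpha>" "\<beta> \<le> n1" | "n2 - pi \<le> \<alpha>" "n1 < \<beta>"
    | "\<alpha> < n2 - pi" "n2 - pi < \<beta>" "\<beta> \<le> n1" | "\<alpha> < n2 - pi" "n1 < \<beta>"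
    using n12 by linarith
  then show False
  proof cases
    case 1
    show False
    proof (rule no_sign[of "{}" "-1" \<alpha>])
      fix t assume t: "\<alpha> < t" "t < \<beta>" "t \<notin> E"
      show "0 < -1 * (q t * sin (p * (t - \<alpha>)))"
        by (intro sg signs(1) sin_p(1)) (use t 1 \<alpha>_less_\<beta> \<beta>_less in linarith)+
    qed simp
  next
    case 2
    show False
    proof (rule no_sign[of "{}" 1 \<alpha>])
      fix t assume t: "\<alpha> < t" "t < \<beta>" "t \<notin> E"
      have "0 < q t" by (rule signs(2)) (use t 2 \<alpha>_less_\<beta> \<beta>_less in linarith)+
      moreover have "0 < sin (p * (t - \<alpha>))" by (rule sin_p(1)) (use t 2 \<alpha>_less_\<beta> in linarith)+
      ultimately show "0 < 1 * (q t * sin (p * (t - \<alpha>)))" by simp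
    qed simp
  next
    case 3
    show False
    proof (rule no_sign[of "{n1}" "-1" n1])
      fix t assume t: "\<alpha> < t" "t < \<beta>" "t \<notin> E" "t \<notin> {n1}"
      show "0 < -1 * (q t * sin (p * (t - n1)))"
      proof (cases "t < n1")
        case True
        have "0 < q t" by (rule signs(2)) (use t 3 True \<alpha>_less_\<beta> \<beta>_less in linarith)+
        moreover have "sin (p * (t - n1)) < 0" by (rule sin_p(2)) (use t 3 n1 True \<alpha>_less_\<beta> in linarith)+
        ultimately show ?thesis by (simp add: mult_pos_neg)
      next
        case False
        then have "n1 < t" using t by auto
        then show ?thesis
          by (intro sg signs(3) sin_p(1)) (use t 3 n1 n2 \<alpha>_less_\<beta> \<beta>_less in linarith)+
      qed
    qed simp
  next
    case 4
    show False
    proof (rule no_sign[of "{n2 - pi}" 1 "n2 - pi"])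
      fix t assume t: "\<alpha> < t" "t < \<beta>" "t \<notin> E" "t \<notin> {n2 - pi}"
      show "0 < 1 * (q t * sin (p * (t - (n2 - pi))))"
      proof (cases "t < n2 - pi")
        case True
        have "q t < 0" by (rule signs(1)) (use t 4 True \<alpha>_less_\<beta> \<beta>_less in linarith)+
        moreover have "sin (p * (t - (n2 - pi))) < 0" by (rule sin_p(2)) (use t 4 n1 True \<alpha>_less_\<beta> in linarith)+
        ultimately show ?thesis by (simp add: mult_neg_neg)
      next
        case False
        then have f: "n2 - pi < t" using t by auto
        have "0 < q t" by (rule signs(2)) (use t 4 f \<alpha>_less_\<beta> \<beta>_less in linarith)+
        moreover have "0 < sin (p * (t - (n2 - pi)))" by (rule sin_p(1)) (use t 4 n1 f \<alpha>_less_\<beta> in linarith)+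
        ultimately show ?thesis by simp
      qed
    qed simp
  next
    case 5
    \<comment> \<open>The first bound stays below the sign change \<open>n2 - pi\<close>; the second
      keeps the points just after \<beta> below \<open>\<alpha> + pi\<close>, which in this case is
      below \<open>n2\<close>.\<close>
    define \<epsilon> where "\<epsilon> = min (n2 - pi - \<alpha>) (\<alpha> + pi - \<beta>)"
    show False
    proof (rule not_both_neg[of \<epsilon>])
      show "0 < \<epsilon>" using 5 \<beta>_less by (simp add: \<epsilon>_def)
      show "q t < 0" if "\<alpha> < t" "t < \<alpha> + \<epsilon>" "t \<notin> E" for t
        by (rule signs(1)) (use that 5 n12 n1 \<alpha>_less_\<beta> in \<open>auto simp: \<epsilon>_def\<close>)
      show "q t < 0" if "\<beta> < t" "t < \<beta> + \<epsilon>" "t \<notin> E" for t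
        by (rule signs(3)) (use that 5 n12 n1 \<alpha>_less_\<beta> in \<open>auto simp: \<epsilon>_def\<close>)
    qed
  qed
qed

text \<open>On the outer pieces \<open>{\<alpha>..n1}\<close> and \<open>{n2..\<beta>}\<close>,
  where \<open>q\<close> is positive, the Wronskian centred at \<open>t\<close> is monotone between
  \<open>t\<close> and the end of the arc on that side, where it vanishes. This settles in
  particular \<open>n1\<close> and \<open>n2\<close>; between them \<open>q\<close> is negative, and
  the Wronskians centred at these two points are combined.\<close>

lemma d_nonneg:
  assumes t: "\<alpha> \<le> t" "t \<le> \<beta>"
  shows "0 \<le> d t"
proof -
  have n3: "n2 - pi < \<alpha>" using arc \<beta>_less by linarith
  have A: "0 \<le> d t" if t: "\<alpha> \<le> t" "t \<le> n1" for t
  proof -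
    have "-1 * W t \<alpha> \<le> -1 * W t t"
    proof (rule W_mono[OF t(1)])
      fix x assume x: "\<alpha> < x" "x < t" "x \<notin> E"
      have "0 < q x" by (rule signs(2)) (use x t n3 n1 in linarith)+
      moreover have "sin (p * (x - t)) < 0" by (rule sin_p(2)) (use x t arc n12 in linarith)+
      ultimately show "0 \<le> -1 * (q x * sin (p * (x - t)))" by (simp add: mult_pos_neg less_imp_le)
    qed
    then have "0 \<le> p * d t" by (simp add: W_ends) (simp add: W_def)
    then show ?thesis using p by (simp add: zero_le_mult_iff)
  qed
  have B: "0 \<le> d t" if t: "n2 \<le> t" "t \<le> \<beta>" for t
  proof -
    have "1 * W t t \<le> 1 * W t \<beta>"
    proof (rule W_mono[OF t(2)])
      fix x assume x: "t < x" "x < \<beta>" "x \<notin> E"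
      have "0 < q x" by (rule signs(4)) (use x t n3 n1 n12 \<beta>_less in linarith)+
      moreover have "0 < sin (p * (x - t))" by (rule sin_p(1)) (use x t arc n1 n12 in linarith)+
      ultimately show "0 \<le> 1 * (q x * sin (p * (x - t)))" by simp
    qed
    then have "0 \<le> p * d t" by (simp add: W_ends) (simp add: W_def)
    then show ?thesis using p by (simp add: zero_le_mult_iff)
  qed
  have C: "0 \<le> d t" if t: "n1 < t" "t < n2" for t
  proof -
    have "-1 * W n1 n1 \<le> -1 * W n1 t"
    proof (rule W_mono)
      fix x assume x: "n1 < x" "x < t" "x \<notin> E"
      have "q x < 0" by (rule signs(3)) (use x t n3 n1 n12 arc \<beta>_less in linarith)+
      moreover have "0 < sin (p * (x - n1))" by (rule sin_p(1)) (use x t arc n1 n12 in linarith)+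
      ultimately show "0 \<le> -1 * (q x * sin (p * (x - n1)))" by (simp add: mult_neg_pos less_imp_le)
    qed (use t in simp)
    moreover have "W n1 n1 = - (p * d n1)" by (simp add: W_def)
    moreover have "0 \<le> p * d n1" using A[of n1] n1 p by simp
    ultimately have W1: "W n1 t \<le> 0" by linarith
    have "1 * W n2 t \<le> 1 * W n2 n2"
    proof (rule W_mono)
      fix x assume x: "t < x" "x < n2" "x \<notin> E"
      have "q x < 0" by (rule signs(3)) (use x t n3 n1 n12 arc \<beta>_less in linarith)+
      moreover have "sin (p * (x - n2)) < 0" by (rule sin_p(2)) (use x t arc n1 n12 in linarith)+
      ultimately show "0 \<le> 1 * (q x * sin (p * (x - n2)))" by (simp add: mult_neg_neg less_imp_le)
    qed (use t in simp)
    moreover have "W n2 n2 = - (p * d n2)" by (simp add: W_def)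
    moreover have "0 \<le> p * d n2" using B[of n2] arc p by simp
    ultimately have W2: "W n2 t \<le> 0" by linarith
    have s1: "0 < sin (p * (t - n1))" by (rule sin_p(1)) (use t arc n1 n12 in linarith)+
    have s2: "sin (p * (t - n2)) < 0" by (rule sin_p(2)) (use t arc n1 n12 in linarith)+
    have "0 < sin (p * (n2 - n1))" by (rule sin_p(1)) (use t arc n1 n12 in linarith)+
    also have "sin (p * (n2 - n1)) = sin (p * (t - n1) - p * (t - n2))" by (simp add: algebra_simps)
    also have "\<dots> = sin (p * (t - n1)) * cos (p * (t - n2)) - cos (p * (t - n1)) * sin (p * (t - n2))"
      by (simp add: sin_diff)
    finally have s3: "0 < \<dots>" .
    \<comment> \<open>Eliminating the derivative of \<open>d\<close> from the two Wronskians leaves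
      \<open>p * d t * sin (p * (n2 - n1))\<close>; the sine is positive because \<open>n1\<close>
      and \<open>n2\<close> are less than \<open>pi / p\<close> apart.\<close>
    have "sin (p * (t - n2)) * W n1 t - sin (p * (t - n1)) * W n2 t
        = p * d t * (sin (p * (t - n1)) * cos (p * (t - n2)) - cos (p * (t - n1)) * sin (p * (t - n2)))"
      by (simp add: W_def algebra_simps)
    moreover have "0 \<le> sin (p * (t - n2)) * W n1 t" using s2 W1 by (simp add: mult_nonpos_nonpos)
    moreover have "sin (p * (t - n1)) * W n2 t \<le> 0" using s1 W2 by (simp add: mult_nonneg_nonpos)
    ultimately have "0 \<le> p * d t * (sin (p * (t - n1)) * cos (p * (t - n2)) - cos (p * (t - n1)) * sin (p * (t - n2)))"
      by linarith
    then have "0 \<le> p * d t" using s3 by (simp add: zero_le_mult_iff)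
    then show ?thesis using p by (simp add: zero_le_mult_iff)
  qed
  show ?thesis using A[of t] B[of t] C[of t] t by linarith
qed

text \<open>\<open>wrap\<close> moves an angle by a multiple of \<open>pi\<close> into the period
  \<open>[\<alpha>, \<alpha> + pi)\<close>, so that \<open>ext d\<close> is the
  \<open>pi\<close>-periodic function equal to \<open>d\<close> on the arc and to 0 on the rest of
  the period.\<close>

definition "wrap t = t - pi * of_int \<lfloor>(t - \<alpha>) / pi\<rfloor>"
definition "trunc f t = (if \<alpha> \<le> t \<and> t \<le> \<beta> then f t else (0::real))"
definition "ext f t = trunc f (wrap t)"

lemma wrap_eq:
  assumes "\<alpha> + pi * of_int k \<le> t" "t < \<alpha> + pi * of_int k + pi"
  shows "wrap t = t - pi * of_int k"
proof -
  have "\<lfloor>(t - \<alpha>) / pi\<rfloor> = k"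
    by (rule floor_unique) (use assms in \<open>auto simp: field_simps\<close>)
  then show ?thesis by (simp add: wrap_def)
qed

lemma wrap_bounds: "\<alpha> \<le> wrap t" "wrap t < \<alpha> + pi"
proof -
  define k :: real where "k = of_int \<lfloor>(t - \<alpha>) / pi\<rfloor>"
  have "k \<le> (t - \<alpha>) / pi" "(t - \<alpha>) / pi < k + 1" unfolding k_def by linarith+
  then have "\<alpha> + pi * k \<le> t" "t < \<alpha> + pi * k + pi"
    by (simp_all add: field_simps del: of_int_floor_le)
  then show "\<alpha> \<le> wrap t" "wrap t < \<alpha> + pi"
    by (simp_all add: wrap_def flip: k_def)
qed

lemma wrap_periodic: "wrap (t + pi) = wrap t"
proof -
  have "(t + pi - \<alpha>) / pi = (t - \<alpha>) / pi + 1" by (simp add: field_simps)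
  then show ?thesis by (simp add: wrap_def algebra_simps)
qed

lemma ext_local: "\<exists>k::int. wrap t = t - pi * of_int k \<and> (\<forall>\<^sub>F x in nhds t. ext f x = trunc f (x - pi * of_int k))"
proof -
  define k where "k = \<lfloor>(t - \<alpha>) / pi\<rfloor>"
  have wt: "wrap t = t - pi * of_int k" by (simp add: wrap_def k_def)
  have b: "\<alpha> + pi * of_int k \<le> t" "t < \<alpha> + pi * of_int k + pi"
    using wrap_bounds[of t] wt by auto
  \<comment> \<open>The neighbourhood reaches back into the gap between the arcs of two consecutive
    periods. There both sides of the local identity are 0, so a single translate serves also at the
    left end of a period.\<close>
  define I where "I = {\<alpha> + pi * of_int k - (\<alpha> + pi - \<beta>) <..< \<alpha> + pi * of_int k + pi}"
  have "\<forall>\<^sub>F x in nhds t. x \<in> I"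
    by (rule eventually_nhds_in_open) (use b \<beta>_less in \<open>auto simp: I_def\<close>)
  moreover have "ext f x = trunc f (x - pi * of_int k)" if "x \<in> I" for x
  proof (cases "\<alpha> + pi * of_int k \<le> x")
    case True
    then show ?thesis using that wrap_eq[of k x] by (simp add: ext_def I_def)
  next
    case False
    have "wrap x = x - pi * of_int (k - 1)"
      by (rule wrap_eq) (use that False \<alpha>_less_\<beta> in \<open>auto simp: I_def algebra_simps\<close>)
    then have "\<beta> < wrap x" using that by (simp add: I_def algebra_simps)
    then show ?thesis using False by (simp add: ext_def trunc_def)
  qed
  ultimately have "\<forall>\<^sub>F x in nhds t. ext f x = trunc f (x - pi * of_int k)"
    by (rule eventually_mono)
  then show ?thesis using wt by blast
qed

text \<open>At both ends of the arc \<open>d\<close> reaches 0 with slope 0, so the extension by 0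
  stays differentiable. This is where tangency at both ends enters.\<close>

lemma trunc_d_der: "(trunc d has_real_derivative trunc d1 t) (at t)"
proof -
  have ends: "(trunc d has_real_derivative 0) (at t)" if z: "d t = 0" "d1 t = 0" for t
  proof -
    have "((\<lambda>k. (d (t + k) - d t) / k) \<longlongrightarrow> 0) (at 0)"
      using d_der[of t] z by (simp add: DERIV_def)
    then have "((\<lambda>k. (trunc d (t + k) - trunc d t) / k) \<longlongrightarrow> 0) (at 0)"
    proof (rule Lim_transform_bound[rotated])
      show "\<forall>\<^sub>F k in at 0. norm ((trunc d (t + k) - trunc d t) / k) \<le> norm ((d (t + k) - d t) / k)"
        using z by (intro always_eventually) (auto simp: trunc_def divide_right_mono)
    qed
    then show ?thesis by (simp add: DERIV_def)
  qed
  consider "t < \<alpha>" | "t = \<alpha>" | "\<alpha> < t" "t < \<beta>" | "t = \<beta>" | "\<beta> < t" by linarith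
  then show ?thesis
  proof cases
    case 1
    have "((\<lambda>_. 0) has_real_derivative trunc d1 t) (at t)" using 1 by (simp add: trunc_def)
    then show ?thesis
      by (rule has_field_derivative_transform_within_open[of _ _ _ "{..<\<alpha>}"]) (use 1 in \<open>auto simp: trunc_def\<close>)
  next
    case 2
    then show ?thesis using ends[of \<alpha>] \<alpha>_less_\<beta> by (simp add: d_ends trunc_def)
  next
    case 3
    have "(d has_real_derivative trunc d1 t) (at t)" using 3 d_der[of t] by (simp add: trunc_def)
    then show ?thesis
      by (rule has_field_derivative_transform_within_open[of _ _ _ "{\<alpha><..<\<beta>}"]) (use 3 in \<open>auto simp: trunc_def\<close>)
  next
    case 4
    then show ?thesis using ends[of \<beta>] \<alpha>_less_\<beta> by (simp add: d_ends trunc_def)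
  next
    case 5
    have "((\<lambda>_. 0) has_real_derivative trunc d1 t) (at t)" using 5 by (simp add: trunc_def)
    then show ?thesis
      by (rule has_field_derivative_transform_within_open[of _ _ _ "{\<beta><..}"]) (use 5 in \<open>auto simp: trunc_def\<close>)
  qed
qed

lemma trunc_d1_cont: "continuous_on UNIV (trunc d1)"
proof -
  \<comment> \<open>Clamping the argument to the arc agrees with truncation because
    \<open>d1\<close> vanishes at both ends.\<close>
  have "trunc d1 t = d1 (max \<alpha> (min \<beta> t))" for t
    using \<alpha>_less_\<beta> d_ends by (auto simp: trunc_def max_def min_def)
  then have "trunc d1 = (\<lambda>t. d1 (max \<alpha> (min \<beta> t)))" by auto
  then show ?thesis by (simp only:) (intro continuous_on_compose2[OF d1_cont[of UNIV]] continuous_intros; simp)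
qed

lemma ext_d_der: "(ext d has_real_derivative ext d1 t) (at t)"
proof -
  obtain k where k: "wrap t = t - pi * of_int k" "\<forall>\<^sub>F x in nhds t. ext d x = trunc d (x - pi * of_int k)"
    using ext_local by blast
  have "((\<lambda>x. trunc d (x - pi * of_int k)) has_real_derivative trunc d1 (t - pi * of_int k) * 1) (at t)"
    by (rule DERIV_chain2[OF trunc_d_der]) (auto intro!: derivative_eq_intros)
  then have "((\<lambda>x. trunc d (x - pi * of_int k)) has_real_derivative ext d1 t) (at t)"
    by (simp add: ext_def k(1))
  then show ?thesis using DERIV_cong_ev[OF refl k(2) refl] by simp
qed

lemma ext_d1_cont: "continuous_on UNIV (ext d1)"
proof -
  have "isCont (ext d1) t" for t
  proof -
    obtain k where k: "\<forall>\<^sub>F x in nhds t. ext d1 x = trunc d1 (x - pi * of_int k)"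
      using ext_local by blast
    have "isCont (\<lambda>x. trunc d1 (x - pi * of_int k)) t"
      by (rule continuous_on_interior[of UNIV])
         (auto intro!: continuous_on_compose2[OF trunc_d1_cont] continuous_intros)
    then show ?thesis using isCont_cong[OF k] by simp
  qed
  then show ?thesis by (simp add: continuous_at_imp_continuous_on)
qed

lemma h1_periodic: "h1 (t + pi) = h1 t"
proof -
  have "((\<lambda>t. h (t + pi)) has_real_derivative h1 (t + pi) * 1) (at t)"
    by (rule DERIV_chain2[OF h1]) (auto intro!: derivative_eq_intros)
  then have "(h has_real_derivative h1 (t + pi)) (at t)" by (simp add: per)
  then show ?thesis using DERIV_unique h1 by blast
qed

lemma finite_lattice: "finite {t \<in> {u..v}. \<exists>k::int. t = c + pi * of_int k}"
proof (rule finite_subset)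
  show "{t \<in> {u..v}. \<exists>k::int. t = c + pi * of_int k} \<subseteq> (\<lambda>k. c + pi * of_int k) ` {\<lfloor>(u-c)/pi\<rfloor>..\<lceil>(v-c)/pi\<rceil>}"
  proof
    fix t assume "t \<in> {t \<in> {u..v}. \<exists>k::int. t = c + pi * of_int k}"
    then obtain k where k: "u \<le> t" "t \<le> v" "t = c + pi * of_int k" by auto
    have "(u-c)/pi \<le> of_int k" "of_int k \<le> (v-c)/pi" using k by (auto simp: field_simps)
    then have "\<lfloor>(u-c)/pi\<rfloor> \<le> k" "k \<le> \<lceil>(v-c)/pi\<rceil>" by linarith+
    then show "t \<in> (\<lambda>k. c + pi * of_int k) ` {\<lfloor>(u-c)/pi\<rfloor>..\<lceil>(v-c)/pi\<rceil>}" using k(3) by auto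
  qed
qed auto

text \<open>On the translates of the arc this is the translated sinusoid \<open>s\<close>, elsewhere
  it is \<open>h\<close>. Written as \<open>h\<close> minus a periodic correction it inherits its
  derivative from the two terms, without a case distinction.\<close>

definition "g t = h t - ext d t"
definition "g1 t = h1 t - ext d1 t"

lemma g_der: "(g has_real_derivative g1 t) (at t)"
  unfolding g_def[abs_def] g1_def by (intro DERIV_diff h1 ext_d_der)

lemma g1_cont: "continuous_on UNIV g1"
  unfolding g1_def[abs_def] by (intro continuous_intros h1_cont ext_d1_cont)

lemma g_periodic: "g (t + pi) = g t"
  by (simp add: g_def per ext_def wrap_periodic)

lemma g_le_h: "g t \<le> h t"
  using d_nonneg[of "wrap t"] by (auto simp: g_def ext_def trunc_def)

text \<open>On the arc \<open>g\<close> is a sinusoid of frequency \<open>p\<close> and the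
  expression is 0. Off the arc it equals \<open>q\<close>, which is positive there because by
  \<open>arc\<close> the interval from \<open>n1\<close> to \<open>n2\<close> lies within the
  arc.\<close>

lemma g1_der:
  assumes "t \<notin> E" "wrap t \<noteq> \<alpha>" "wrap t \<noteq> \<beta>"
  shows "\<exists>y. (g1 has_real_derivative y) (at t) \<and> 0 \<le> y + p\<^sup>2 * g t"
proof -
  obtain k where k: "wrap t = t - pi * of_int k" "\<forall>\<^sub>F x in nhds t. ext d1 x = trunc d1 (x - pi * of_int k)"
    using ext_local by blast
  have "\<alpha> < wrap t" "wrap t < \<alpha> + pi" using wrap_bounds[of t] assms by auto
  show ?thesis
  proof (cases "wrap t < \<beta>")
    case True
    have "\<forall>\<^sub>F x in nhds t. x \<in> {\<alpha> + pi * of_int k <..< \<beta> + pi * of_int k}"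
      by (rule eventually_nhds_in_open) (use \<open>\<alpha> < wrap t\<close> True k(1) in auto)
    with k(2) have ev: "\<forall>\<^sub>F x in nhds t. g1 x = s1 (x - pi * of_int k)"
    proof eventually_elim
      case (elim x)
      then have "ext d1 x = d1 (x - pi * of_int k)" by (auto simp: trunc_def)
      then show ?case
        using periodic_int[of h1 x k, OF h1_periodic] by (simp add: g1_def d1_def)
    qed
    have "((\<lambda>x. s1 (x - pi * of_int k)) has_real_derivative - (p\<^sup>2 * s (t - pi * of_int k)) * 1) (at t)"
      by (rule DERIV_chain2[OF s1_der]) (auto intro!: derivative_eq_intros)
    then have "(g1 has_real_derivative - (p\<^sup>2 * s (t - pi * of_int k))) (at t)"
      using DERIV_cong_ev[OF refl ev refl] by simp
    moreover have "g t = s (t - pi * of_int k)"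
      using True \<open>\<alpha> < wrap t\<close> periodic_int[of h t k, OF per]
      by (simp add: g_def ext_def trunc_def k(1) d_def)
    ultimately show ?thesis by (intro exI conjI) auto
  next
    case False
    then have b: "\<beta> < wrap t" using assms by auto
    have "\<forall>\<^sub>F x in nhds t. x \<in> {\<beta> + pi * of_int k <..}"
      by (rule eventually_nhds_in_open) (use b k(1) in auto)
    with k(2) have ev: "\<forall>\<^sub>F x in nhds t. g1 x = h1 x"
      by eventually_elim (auto simp: trunc_def g1_def)
    have "(g1 has_real_derivative q t - p\<^sup>2 * h t) (at t)"
      using DERIV_cong_ev[OF refl ev refl] h2[OF assms(1)] by simp
    moreover have "g t = h t" using b by (simp add: g_def ext_def trunc_def)
    moreover have "0 < q t"
    proof (rule q_pos[OF assms(1)])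
      define P where "P t = sin (t - n1) * sin (t - n2)" for t
      have "P (t + pi) = P t" for t by (simp add: P_def sin_add sin_diff algebra_simps)
      then have "P (wrap t) = P t" unfolding k(1) by (rule periodic_int)
      moreover have "0 < P (wrap t)"
        unfolding P_def by (intro mult_pos_pos sin_gt_zero)
          (use b arc n12 n1 \<open>wrap t < \<alpha> + pi\<close> in linarith)+
      ultimately show "0 < sin (t - n1) * sin (t - n2)" by (simp add: P_def)
    qed
    ultimately show ?thesis by (intro exI conjI) auto
  qed
qed

end

section \<open>Trigonometric convexity in integrated form\<close>

lemma trig_convex_integral:
  fixes g g1 :: "real \<Rightarrow> real"
  assumes "u \<le> v" and g: "continuous_on {u..v} g" "continuous_on {u..v} g1" and S: "finite S"
    and der: "\<And>t. t \<in> {u<..<v} - S \<Longrightarrow> \<exists>y. (g1 has_real_derivative y) (at t) \<and> 0 \<le> y + c * g t"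
  shows "0 \<le> g1 v - g1 u + c * integral {u..v} g"
proof -
  define V where "V t = g1 t + c * integral {u..t} g" for t
  obtain y where y: "\<And>t. t \<in> {u<..<v} - S \<Longrightarrow> (g1 has_real_derivative y t) (at t) \<and> 0 \<le> y t + c * g t"
    using der by metis
  have "V u \<le> V v"
  proof (rule nondecreasing_except_finite[OF \<open>u \<le> v\<close> _ S, of V "\<lambda>t. y t + c * g t"])
    show "continuous_on {u..v} V"
      unfolding V_def[abs_def]
      by (intro continuous_intros g indefinite_integral_continuous_1 integrable_continuous_interval)
    fix t assume t: "t \<in> {u<..<v} - S"
    have "((\<lambda>t. integral {u..t} g) has_real_derivative g t) (at t within {u..v})"
      by (rule integral_has_real_derivative[OF g(1)]) (use t in auto)
    then have "((\<lambda>t. integral {u..t} g) has_real_derivative g t) (at t)"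
      using t by (simp add: at_within_Icc_at)
    then show "(V has_real_derivative y t + c * g t) (at t)"
      unfolding V_def[abs_def] using y[OF t] by (auto intro!: derivative_eq_intros)
    show "0 \<le> y t + c * g t" using y[OF t] by simp
  qed
  then show ?thesis by (simp add: V_def)
qed

text \<open>The condition \<open>g'' + p\<^sup>2 g \<ge> 0\<close> integrated once, since
  \<open>g1\<close> may have corners. In this form it passes directly to averages of
  \<open>g\<close>, which are twice differentiable.\<close>

definition trig_convex :: "real \<Rightarrow> (real \<Rightarrow> real) \<Rightarrow> bool" where
  "trig_convex p g \<longleftrightarrow> (\<forall>t. g (t + pi) = g t) \<and>
     (\<exists>g1. (\<forall>t. (g has_real_derivative g1 t) (at t)) \<and> continuous_on UNIV g1 \<and>
        (\<forall>u v. u \<le> v \<longrightarrow> 0 \<le> g1 v - g1 u + p\<^sup>2 * integral {u..v} g))"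

lemma (in trig_minorant) minorant: "trig_convex p g" "\<And>t. g t \<le> h t"
proof -
  show "\<And>t. g t \<le> h t" by (rule g_le_h)
  have gc: "continuous_on A g" for A
    by (rule DERIV_continuous_on) (use g_der has_field_derivative_at_within in blast)
  have "0 \<le> g1 v - g1 u + p\<^sup>2 * integral {u..v} g" if uv: "u \<le> v" for u v
  proof (rule trig_convex_integral[OF uv gc])
    let ?L = "\<lambda>c. {t \<in> {u..v}. \<exists>k::int. t = c + pi * of_int k}"
    show "finite (E \<inter> {u..v} \<union> ?L \<alpha> \<union> ?L \<beta>)" by (intro finite_UnI finE finite_lattice)
    fix t assume t: "t \<in> {u<..<v} - (E \<inter> {u..v} \<union> ?L \<alpha> \<union> ?L \<beta>)"
    have w: "t = wrap t + pi * of_int \<lfloor>(t - \<alpha>) / pi\<rfloor>" by (simp add: wrap_def)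
    have "wrap t \<noteq> \<alpha>" "wrap t \<noteq> \<beta>"
    proof -
      have "c = \<alpha> \<or> c = \<beta> \<Longrightarrow> wrap t \<noteq> c" for c
      proof
        assume c: "c = \<alpha> \<or> c = \<beta>" and "wrap t = c"
        then have "t = c + pi * of_int \<lfloor>(t - \<alpha>) / pi\<rfloor>" using w by simp
        then have "\<exists>k::int. t = c + pi * of_int k" by blast
        then have "t \<in> ?L c" using t by auto
        then show False using c t by auto
      qed
      then show "wrap t \<noteq> \<alpha>" "wrap t \<noteq> \<beta>" by auto
    qed
    then show "\<exists>y. (g1 has_real_derivative y) (at t) \<and> 0 \<le> y + p\<^sup>2 * g t"
      by (intro g1_der) (use t in auto)
  qed (rule continuous_on_subset[OF g1_cont], simp)
  then show "trig_convex p g"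
    unfolding trig_convex_def using g_periodic g_der g1_cont by blast
qed

section \<open>Derivatives of powers of absolute values, and zeros of sinusoids\<close>

lemma abs_powr_less_self:
  fixes x p :: real assumes "1 < p" "x \<noteq> 0" shows "sgn x * \<bar>x\<bar> powr (p - 1) * x = \<bar>x\<bar> powr p"
proof -
  have "\<bar>x\<bar> powr p = \<bar>x\<bar> powr (p - 1) * \<bar>x\<bar>" using assms by (simp add: powr_diff)
  then show ?thesis using assms by (cases "0 < x") (auto simp: sgn_if)
qed

lemma abs_powr_der_nz:
  fixes x r :: real assumes "x \<noteq> 0"
  shows "((\<lambda>x. \<bar>x\<bar> powr r) has_real_derivative r * sgn x * \<bar>x\<bar> powr (r - 1)) (at x)"
proof (cases "0 < x")
  case True
  have "((\<lambda>x. x powr r) has_real_derivative r * x powr (r - 1)) (at x)"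
    using DERIV_fun_powr[OF DERIV_ident, of x r] True by simp
  then have "((\<lambda>x. x powr r) has_real_derivative r * sgn x * \<bar>x\<bar> powr (r - 1)) (at x)" using True by simp
  then show ?thesis
    by (rule has_field_derivative_transform_within_open[of _ _ _ "{0<..}"]) (use True in auto)
next
  case False
  then have x: "0 < - x" using assms by auto
  have "((\<lambda>x. (- x) powr r) has_real_derivative r * (- x) powr (r - 1) * (-1)) (at x)"
    using DERIV_fun_powr[of uminus "-1" x r] x by (simp add: DERIV_minus)
  then have "((\<lambda>x. (- x) powr r) has_real_derivative r * sgn x * \<bar>x\<bar> powr (r - 1)) (at x)" using x by simp
  then show ?thesis
    by (rule has_field_derivative_transform_within_open[of _ _ _ "{..<0}"]) (use x in auto)
qed

lemma tendsto_abs_powr_0: "0 < r \<Longrightarrow> ((\<lambda>x::real. \<bar>x\<bar> powr r) \<longlongrightarrow> 0) (at 0)"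
proof -
  assume "0 < r"
  have "((\<lambda>x::real. \<bar>x\<bar> powr r) \<longlongrightarrow> 0 powr r) (at 0)"
    by (rule tendsto_powr'[OF _ tendsto_const]) (use \<open>0 < r\<close> in \<open>auto intro!: tendsto_eq_intros always_eventually\<close>)
  then show ?thesis by simp
qed

text \<open>At 0 the difference quotient is bounded by \<open>\<bar>k\<bar> powr (p - 1)\<close>,
  which tends to 0 because \<open>p > 1\<close>. Powers of sinusoids are therefore differentiable
  even at their zeros.\<close>

lemma abs_powr_der:
  fixes x p :: real assumes "1 < p"
  shows "((\<lambda>x. \<bar>x\<bar> powr p) has_real_derivative p * sgn x * \<bar>x\<bar> powr (p - 1)) (at x)"
proof (cases "x = 0")
  case True
  have "((\<lambda>k. (\<bar>0 + k\<bar> powr p - \<bar>0\<bar> powr p) / k) \<longlongrightarrow> 0) (at (0::real))"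
  proof (rule Lim_transform_bound[OF _ tendsto_abs_powr_0[of "p - 1"]])
    show "\<forall>\<^sub>F k in at 0. norm ((\<bar>0 + k\<bar> powr p - \<bar>0\<bar> powr p) / k) \<le> norm (\<bar>k\<bar> powr (p - 1))"
      using assms by (auto simp: eventually_at_filter powr_diff intro!: always_eventually)
  qed (use assms in auto)
  then show ?thesis using True by (simp add: DERIV_def)
qed (rule abs_powr_der_nz)

lemma sgn_powr_der:
  fixes x r :: real assumes "x \<noteq> 0"
  shows "((\<lambda>x. sgn x * \<bar>x\<bar> powr r) has_real_derivative r * \<bar>x\<bar> powr (r - 1)) (at x)"
proof -
  have "((\<lambda>y. sgn x * \<bar>y\<bar> powr r) has_real_derivative sgn x * (r * sgn x * \<bar>x\<bar> powr (r - 1))) (at x)"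
    by (intro DERIV_cmult abs_powr_der_nz assms)
  moreover have "sgn x * (r * sgn x * \<bar>x\<bar> powr (r - 1)) = r * \<bar>x\<bar> powr (r - 1)"
    using assms by (simp add: sgn_if)
  ultimately have "((\<lambda>y. sgn x * \<bar>y\<bar> powr r) has_real_derivative r * \<bar>x\<bar> powr (r - 1)) (at x)"
    by simp
  moreover have "\<forall>\<^sub>F y in nhds x. sgn y = sgn x"
  proof (cases "0 < x")
    case True
    then show ?thesis using eventually_nhds_in_open[of "{0<..}" x] by (auto elim!: eventually_mono)
  next
    case False
    then show ?thesis using eventually_nhds_in_open[of "{..<0}" x] assms by (auto elim!: eventually_mono)
  qed
  then have "\<forall>\<^sub>F y in nhds x. sgn y * \<bar>y\<bar> powr r = sgn x * \<bar>y\<bar> powr r"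
    by eventually_elim simp
  ultimately show ?thesis
    using DERIV_cong_ev[of x x "\<lambda>x. sgn x * \<bar>x\<bar> powr r" "\<lambda>y. sgn x * \<bar>y\<bar> powr r"] by simp
qed

lemma sgn_powr_cont: "0 < r \<Longrightarrow> continuous_on UNIV (\<lambda>x::real. sgn x * \<bar>x\<bar> powr r)"
proof -
  assume r: "0 < r"
  have "isCont (\<lambda>x::real. sgn x * \<bar>x\<bar> powr r) x" for x
  proof (cases "x = 0")
    case True
    have "((\<lambda>x::real. sgn x * \<bar>x\<bar> powr r) \<longlongrightarrow> 0) (at 0)"
      by (rule Lim_transform_bound[OF _ tendsto_abs_powr_0[OF r]]) (auto simp: abs_mult abs_sgn_eq)
    then show ?thesis using True by (simp add: isCont_def)
  qed (blast intro: DERIV_isCont sgn_powr_der)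
  then show ?thesis by (simp add: continuous_at_imp_continuous_on)
qed

lemma sgn_powr_diff:
  fixes x y r :: real assumes "0 < x" "0 < y" "r \<noteq> 0"
  shows "sgn (x powr r - y powr r) = sgn r * sgn (x - y)"
proof (cases x y rule: linorder_cases)
  case less
  then show ?thesis
    using assms powr_less_mono2[of r x y] powr_less_mono2_neg[of r x y] by (cases "0 < r") (auto simp: sgn_if)
next
  case greater
  then show ?thesis
    using assms powr_less_mono2[of r y x] powr_less_mono2_neg[of r y x] by (cases "0 < r") (auto simp: sgn_if)
qed simp

text \<open>A linear factor in sine and cosine becomes a positive multiple of a single sine, so that
  a product of two such factors has the sign pattern that \<open>trig_minorant\<close> asks
  for.\<close>

lemma sin_minus_tan:
  fixes x t :: real
  shows "sin t - x * cos t = sqrt (1 + x\<^sup>2) * sin (t - arctan x)"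
proof -
  have "cos (arctan x) \<noteq> 0" using cos_arctan_not_zero by blast
  have "sin (t - arctan x) = sin t * cos (arctan x) - cos t * sin (arctan x)" by (rule sin_diff)
  also have "\<dots> = (sin t - x * cos t) / sqrt (1 + x\<^sup>2)"
    by (simp add: cos_arctan sin_arctan diff_divide_distrib)
  finally show ?thesis using sum_power2_gt_zero_iff[of 1 x] by (simp add: field_simps)
qed

lemma finite_zeros_sinusoid:
  fixes a b u v :: real assumes "a \<noteq> 0 \<or> b \<noteq> 0"
  shows "finite ({t. a * cos t + b * sin t = 0} \<inter> {u..v})"
proof -
  obtain r c where rc: "a = r * cos c" "b = r * sin c" using polar_Ex by blast
  have "r \<noteq> 0" using assms rc by auto
  have "a * cos t + b * sin t = r * cos (t - c)" for t by (simp add: rc cos_diff algebra_simps)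
  then have "{t. a * cos t + b * sin t = 0} = {t. cos (t - c) = 0}" using \<open>r \<noteq> 0\<close> by simp
  moreover have "{t. cos (t - c) = 0} \<inter> {u..v} \<subseteq> (\<lambda>i. of_int i * (pi/2) + c) ` {\<lfloor>(u-c)/(pi/2)\<rfloor>..\<lceil>(v-c)/(pi/2)\<rceil>}"
  proof
    fix t assume t: "t \<in> {t. cos (t - c) = 0} \<inter> {u..v}"
    then obtain i :: int where i: "t - c = of_int i * (pi/2)" by (auto simp: cos_zero_iff_int)
    have "(u-c)/(pi/2) \<le> of_int i" "of_int i \<le> (v-c)/(pi/2)" using t i by (auto simp: field_simps)
    then have "\<lfloor>(u-c)/(pi/2)\<rfloor> \<le> i" "i \<le> \<lceil>(v-c)/(pi/2)\<rceil>" by linarith+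
    moreover have "t = of_int i * (pi/2) + c" using i by simp
    ultimately show "t \<in> (\<lambda>i. of_int i * (pi/2) + c) ` {\<lfloor>(u-c)/(pi/2)\<rfloor>..\<lceil>(v-c)/(pi/2)\<rceil>}" by auto
  qed
  ultimately show ?thesis by (simp add: finite_subset)
qed

section \<open>The angular function and its minorant\<close>

definition hfun :: "real \<Rightarrow> real \<Rightarrow> real \<Rightarrow> real \<Rightarrow> real \<Rightarrow> real" where
  "hfun p B a b t = B * \<bar>cos t\<bar> powr p - \<bar>a * cos t + b * sin t\<bar> powr p"

lemma hfun_periodic: "hfun p B a b (t + pi) = hfun p B a b t"
proof -
  have "a * cos (t + pi) + b * sin (t + pi) = - (a * cos t + b * sin t)" by simp
  then have "\<bar>a * cos (t + pi) + b * sin (t + pi)\<bar> = \<bar>a * cos t + b * sin t\<bar>" by (simp only: abs_minus_cancel)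
  then show ?thesis by (simp add: hfun_def)
qed

lemma cos_pair_pos:
  fixes p t :: real assumes "1 < p"
  shows "0 < \<bar>cos t\<bar> powr p + \<bar>cos (t + pi/p)\<bar> powr p"
proof -
  have "0 < sin (pi/p)" using assms by (intro sin_gt_zero) (auto simp: field_simps)
  have "cos t \<noteq> 0 \<or> cos (t + pi/p) \<noteq> 0"
  proof (rule ccontr)
    assume *: "\<not> (cos t \<noteq> 0 \<or> cos (t + pi/p) \<noteq> 0)"
    then have "sin t * sin (pi/p) = 0" by (simp add: cos_add)
    then have "sin t = 0" using \<open>0 < sin (pi/p)\<close> by simp
    then show False using * sin_cos_squared_add[of t] by simp
  qed
  then show ?thesis by (auto intro: add_pos_nonneg add_nonneg_pos)
qed

lemma hfun_pair: "hfun p B a b t + hfun p B a b s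
   = B * (\<bar>cos t\<bar> powr p + \<bar>cos s\<bar> powr p) - (\<bar>a * cos t + b * sin t\<bar> powr p + \<bar>a * cos s + b * sin s\<bar> powr p)"
  by (simp add: hfun_def algebra_simps)

definition hfun1 :: "real \<Rightarrow> real \<Rightarrow> real \<Rightarrow> real \<Rightarrow> real \<Rightarrow> real" where
  "hfun1 p B a b t = p * (- B * (sgn (cos t) * \<bar>cos t\<bar> powr (p - 1)) * sin t
     - sgn (a * cos t + b * sin t) * \<bar>a * cos t + b * sin t\<bar> powr (p - 1) * (b * cos t - a * sin t))"

lemma hfun_der:
  assumes "1 < p" shows "(hfun p B a b has_real_derivative hfun1 p B a b t) (at t)"
proof -
  have 1: "((\<lambda>t. \<bar>cos t\<bar> powr p) has_real_derivative p * sgn (cos t) * \<bar>cos t\<bar> powr (p - 1) * - sin t) (at t)"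
    by (rule DERIV_chain2[OF abs_powr_der[OF assms]]) (auto intro!: derivative_eq_intros)
  have 2: "((\<lambda>t. \<bar>a * cos t + b * sin t\<bar> powr p) has_real_derivative
    p * sgn (a * cos t + b * sin t) * \<bar>a * cos t + b * sin t\<bar> powr (p - 1) * (b * cos t - a * sin t)) (at t)"
    by (rule DERIV_chain2[OF abs_powr_der[OF assms]]) (auto intro!: derivative_eq_intros)
  show ?thesis
    unfolding hfun_def[abs_def] hfun1_def
    by (rule DERIV_cong[OF DERIV_diff[OF DERIV_cmult[OF 1] 2]]) (simp add: algebra_simps)
qed

lemma hfun1_cont:
  assumes "1 < p" shows "continuous_on UNIV (hfun1 p B a b)"
proof -
  have c: "continuous_on UNIV (\<lambda>t. sgn (f t) * \<bar>f t\<bar> powr (p - 1))" if "continuous_on UNIV f" for f :: "real \<Rightarrow> real"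
    by (rule continuous_on_compose2[OF sgn_powr_cont[of "p - 1"] that]) (use assms in auto)
  have 1: "continuous_on UNIV (\<lambda>t::real. sgn (cos t) * \<bar>cos t\<bar> powr (p - 1))"
    by (rule c) (intro continuous_intros)
  have 2: "continuous_on UNIV (\<lambda>t. sgn (a * cos t + b * sin t) * \<bar>a * cos t + b * sin t\<bar> powr (p - 1))"
    by (rule c) (intro continuous_intros)
  have 3: "continuous_on UNIV (\<lambda>t::real. sin t)" "continuous_on UNIV (\<lambda>t. b * cos t - a * sin t)"
    by (intro continuous_intros)+
  show ?thesis
    unfolding hfun1_def[abs_def]
    by (rule continuous_on_mult[OF continuous_on_const continuous_on_diff[OF
          continuous_on_mult[OF continuous_on_mult[OF continuous_on_const 1] 3(1)] continuous_on_mult[OF 2 3(2)]]])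
qed

text \<open>A sinusoid \<open>l\<close> of frequency 1 and amplitude \<open>R\<close> satisfies
  \<open>l'\<^sup>2 = R\<^sup>2 - l\<^sup>2\<close>, so the second derivative of
  \<open>\<bar>l\<bar> powr p\<close> is \<open>p * (p - 1) * R\<^sup>2 * \<bar>l\<bar> powr (p - 2)
  - p\<^sup>2 * \<bar>l\<bar> powr p\<close>. Taking \<open>cos\<close>, of amplitude 1, and the
  linear form, of squared amplitude \<open>a\<^sup>2 + b\<^sup>2\<close>, isolates the multiple
  \<open>p\<^sup>2\<close> of \<open>hfun\<close>.\<close>

lemma hfun1_der:
  assumes p: "1 < p" and c: "cos t \<noteq> 0" and l: "a * cos t + b * sin t \<noteq> 0"
  shows "(hfun1 p B a b has_real_derivative
    p * (p - 1) * (B * \<bar>cos t\<bar> powr (p - 2) - (a\<^sup>2 + b\<^sup>2) * \<bar>a * cos t + b * sin t\<bar> powr (p - 2))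
     - p\<^sup>2 * hfun p B a b t) (at t)"
proof -
  define l where "l = a * cos t + b * sin t"
  define l' where "l' = b * cos t - a * sin t"
  have l: "l \<noteq> 0" using assms(3) by (simp add: l_def)
  have 1: "((\<lambda>t. sgn (cos t) * \<bar>cos t\<bar> powr (p - 1)) has_real_derivative (p - 1) * \<bar>cos t\<bar> powr (p - 1 - 1) * - sin t) (at t)"
    by (rule DERIV_chain2[where f = "\<lambda>x. sgn x * \<bar>x\<bar> powr (p - 1)", OF sgn_powr_der[OF c] DERIV_cos])
  have 2: "((\<lambda>t. sgn (a * cos t + b * sin t) * \<bar>a * cos t + b * sin t\<bar> powr (p - 1)) has_real_derivative
     (p - 1) * \<bar>a * cos t + b * sin t\<bar> powr (p - 1 - 1) * (b * cos t - a * sin t)) (at t)"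
    by (rule DERIV_chain2[where f = "\<lambda>x. sgn x * \<bar>x\<bar> powr (p - 1)" and g = "\<lambda>t. a * cos t + b * sin t", OF sgn_powr_der[OF assms(3)]])
       (auto intro!: derivative_eq_intros)
  have 3: "((\<lambda>t. b * cos t - a * sin t) has_real_derivative - (a * cos t + b * sin t)) (at t)"
    by (auto intro!: derivative_eq_intros)
  have cp: "\<bar>cos t\<bar> powr p = \<bar>cos t\<bar> powr (p - 2) * (cos t)\<^sup>2" "\<bar>l\<bar> powr p = \<bar>l\<bar> powr (p - 2) * l\<^sup>2"
    using c l powr_realpow[of "\<bar>cos t\<bar>" 2] powr_realpow[of "\<bar>l\<bar>" 2] by (auto simp: powr_diff)
  have cs: "sgn (cos t) * \<bar>cos t\<bar> powr (p - 1) * cos t = \<bar>cos t\<bar> powr p"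
           "sgn l * \<bar>l\<bar> powr (p - 1) * l = \<bar>l\<bar> powr p"
    using abs_powr_less_self[OF p] c l by auto
  have sq: "(sin t)\<^sup>2 = 1 - (cos t)\<^sup>2" by (simp add: sin_squared_eq)
  have "l'\<^sup>2 + l\<^sup>2 = (a\<^sup>2 + b\<^sup>2) * ((sin t)\<^sup>2 + (cos t)\<^sup>2)"
    unfolding l_def l'_def by algebra
  then have lq: "l'\<^sup>2 = (a\<^sup>2 + b\<^sup>2) - l\<^sup>2" by simp
  define d where "d = p * ((-B) * (((p - 1) * \<bar>cos t\<bar> powr (p - 1 - 1) * - sin t) * sin t
      + cos t * (sgn (cos t) * \<bar>cos t\<bar> powr (p - 1)))
     - (((p - 1) * \<bar>l\<bar> powr (p - 1 - 1) * l') * l' + (- l) * (sgn l * \<bar>l\<bar> powr (p - 1))))"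
  have D: "(hfun1 p B a b has_real_derivative d) (at t)"
    unfolding hfun1_def[abs_def] mult.assoc[of "-B"] d_def l_def l'_def
    by (intro DERIV_cmult DERIV_diff DERIV_mult 1 2 3 DERIV_sin)
  have "d = p * (B * ((p - 1) * \<bar>cos t\<bar> powr (p - 2) * (sin t)\<^sup>2 - sgn (cos t) * \<bar>cos t\<bar> powr (p - 1) * cos t)
     - ((p - 1) * \<bar>l\<bar> powr (p - 2) * l'\<^sup>2 - sgn l * \<bar>l\<bar> powr (p - 1) * l))"
    by (simp add: d_def power2_eq_square algebra_simps)
  also have "\<dots> = p * (B * ((p - 1) * \<bar>cos t\<bar> powr (p - 2) * (1 - (cos t)\<^sup>2) - \<bar>cos t\<bar> powr (p - 2) * (cos t)\<^sup>2)
     - ((p - 1) * \<bar>l\<bar> powr (p - 2) * ((a\<^sup>2 + b\<^sup>2) - l\<^sup>2) - \<bar>l\<bar> powr (p - 2) * l\<^sup>2))"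
    by (simp only: cs cp sq lq)
  also have "\<dots> = p * (p - 1) * (B * \<bar>cos t\<bar> powr (p - 2) - (a\<^sup>2 + b\<^sup>2) * \<bar>l\<bar> powr (p - 2))
     - p\<^sup>2 * (B * (\<bar>cos t\<bar> powr (p - 2) * (cos t)\<^sup>2) - \<bar>l\<bar> powr (p - 2) * l\<^sup>2)"
    by (simp add: power2_eq_square algebra_simps)
  finally show ?thesis using D unfolding hfun_def l_def[symmetric] cp by simp
qed

text \<open>Both sines acquire the same sign, which cancels. The pair of sign changes may thus be
  moved together by any multiple of \<open>pi\<close>.\<close>

lemma sin_shift_prod: "sin (t - (n1 - pi * of_int k)) * sin (t - (n2 - pi * of_int k)) = sin (t - n1) * sin (t - n2)"
proof -
  have c: "cos (pi * real_of_int k) * cos (pi * real_of_int k) = 1"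
    using sin_cos_squared_add2[of "pi * real_of_int k"] by (simp add: power2_eq_square)
  have "sin (t - (n - pi * of_int k)) = sin (t - n) * cos (pi * of_int k)" for n
  proof -
    have "t - (n - pi * of_int k) = (t - n) + pi * of_int k" by simp
    then show ?thesis by (simp only: sin_add) simp
  qed
  then show ?thesis using c by (metis (no_types, opaque_lifting) mult.assoc mult.left_commute mult.right_neutral)
qed

text \<open>Two degenerate cases escape the sign pattern: for \<open>b = 0\<close> equality at
  \<alpha> forces \<open>B = \<bar>a\<bar> powr p\<close> and \<open>h\<close> vanishes identically;
  for \<open>p = 2\<close> it forces \<open>B = a\<^sup>2 + b\<^sup>2\<close> and \<open>h\<close>
  is itself a sinusoid of frequency 2. Otherwise \<open>h'' + p\<^sup>2 h\<close> compares the
  powers \<open>p - 2\<close> of \<open>\<bar>cos t\<bar>\<close> and of a multiple of the linear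
  form, and changes sign exactly where the two agree, twice per period.\<close>

theorem angular_minorant:
  assumes p: "1 < p"
    and nonneg: "\<And>t. 0 \<le> hfun p B a b t + hfun p B a b (t + pi/p)"
    and zero: "hfun p B a b \<alpha> + hfun p B a b (\<alpha> + pi/p) = 0"
  shows "\<exists>g. trig_convex p g \<and> (\<forall>t. g t \<le> hfun p B a b t)"
proof -
  let ?h = "hfun p B a b"
  have hc: "continuous_on A ?h" for A
    by (rule DERIV_continuous_on) (use hfun_der[OF p] has_field_derivative_at_within in blast)
  consider "b = 0" | "b \<noteq> 0" "p = 2" | "b \<noteq> 0" "p \<noteq> 2" by blast
  then show ?thesis
  proof cases
    case 1
    have "?h t = (B - \<bar>a\<bar> powr p) * \<bar>cos t\<bar> powr p" for t
      using 1 by (simp add: hfun_def abs_mult powr_mult algebra_simps)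
    moreover from this have "(B - \<bar>a\<bar> powr p) * (\<bar>cos \<alpha>\<bar> powr p + \<bar>cos (\<alpha> + pi/p)\<bar> powr p) = 0"
      using zero by (simp only: distrib_left)
    ultimately have "?h t = 0" for t using cos_pair_pos[OF p, of \<alpha>] by simp
    moreover have "trig_convex p (\<lambda>_. 0)"
      unfolding trig_convex_def by (auto intro!: exI[of _ "\<lambda>_. 0"])
    ultimately show ?thesis by (intro exI[of _ "\<lambda>_. 0"]) auto
  next
    case 2
    have h2: "?h t = B * (cos t)\<^sup>2 - (a * cos t + b * sin t)\<^sup>2" for t
      using 2 by (auto simp: hfun_def powr_numeral)
    have cs: "cos (\<alpha> + pi/p) = - sin \<alpha>" "sin (\<alpha> + pi/p) = cos \<alpha>"
      using \<open>p = 2\<close> by (simp_all add: cos_add sin_add)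
    have "?h \<alpha> + ?h (\<alpha> + pi/p) = (B - (a\<^sup>2 + b\<^sup>2)) * ((cos \<alpha>)\<^sup>2 + (sin \<alpha>)\<^sup>2)"
      unfolding h2 cs by algebra
    then have B: "B = a\<^sup>2 + b\<^sup>2" using zero by simp
    have h1: "hfun1 p B a b = (\<lambda>t. 2 * (- B * cos t * sin t - (a * cos t + b * sin t) * (b * cos t - a * sin t)))"
      unfolding hfun1_def fun_eq_iff \<open>p = 2\<close> by (simp add: sgn_mult_abs)
    have der: "(hfun1 p B a b has_real_derivative - (p\<^sup>2 * ?h t)) (at t)" for t
    proof -
      have "(hfun1 p B a b has_real_derivative
         2 * (- B * ((cos t)\<^sup>2 - (sin t)\<^sup>2) - ((b * cos t - a * sin t)\<^sup>2 - (a * cos t + b * sin t)\<^sup>2))) (at t)"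
        unfolding h1 by (auto intro!: derivative_eq_intros simp: power2_eq_square algebra_simps)
      moreover have "2 * (- B * ((cos t)\<^sup>2 - (sin t)\<^sup>2) - ((b * cos t - a * sin t)\<^sup>2 - (a * cos t + b * sin t)\<^sup>2))
         + p\<^sup>2 * ?h t = 2 * (B - (a\<^sup>2 + b\<^sup>2)) * ((cos t)\<^sup>2 + (sin t)\<^sup>2)"
        unfolding h2 unfolding \<open>p = 2\<close> by algebra
      moreover have "B - (a\<^sup>2 + b\<^sup>2) = 0" using B by simp
      ultimately show ?thesis by (simp only: mult_zero_left mult_zero_right) (simp only: add_eq_0_iff2)
    qed
    have "trig_convex p ?h"
      unfolding trig_convex_def
    proof (intro conjI exI[of _ "hfun1 p B a b"] allI impI)
      fix u v :: real assume uv: "u \<le> v"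
      show "0 \<le> hfun1 p B a b v - hfun1 p B a b u + p\<^sup>2 * integral {u..v} ?h"
        by (rule trig_convex_integral[OF uv hc _ finite.emptyI])
           (use der continuous_on_subset[OF hfun1_cont[OF p]] in force)+
    qed (use hfun_periodic hfun_der[OF p] hfun1_cont[OF p] in auto)
    then show ?thesis by blast
  next
    case 3
    define l where "l t = a * cos t + b * sin t" for t
    define R2 where "R2 = a\<^sup>2 + b\<^sup>2"
    have R2: "0 < R2" using 3 by (simp add: R2_def sum_power2_gt_zero_iff)
    have Bpos: "0 < B"
    proof (rule ccontr)
      assume "\<not> 0 < B"
      then have "B * \<bar>cos t\<bar> powr p \<le> 0" for t by (intro mult_nonpos_nonneg) auto
      then have hn: "?h t \<le> - (\<bar>l t\<bar> powr p)" for t by (simp add: hfun_def l_def)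
      have "l t = 0" for t
      proof -
        have "\<bar>l t\<bar> powr p \<le> 0"
          using hn[of t] hn[of "t + pi/p"] nonneg[of t] powr_ge_zero[of "\<bar>l (t+pi/p)\<bar>" p] by linarith
        then show ?thesis by (simp add: antisym)
      qed
      from this[of "pi/2"] 3 show False by (simp add: l_def)
    qed
    \<comment> \<open>Chosen so that \<open>R2 = B * \<kappa> powr (p - 2)\<close>; then
      \<open>q\<close> is a positive multiple of \<open>\<bar>cos t\<bar> powr (p - 2) - (\<kappa> *
      \<bar>l t\<bar>) powr (p - 2)\<close>.\<close>
    define \<kappa> where "\<kappa> = (R2 / B) powr (1 / (p - 2))"
    have lam: "0 < \<kappa>" using R2 Bpos by (simp add: \<kappa>_def)
    have lamp: "R2 = B * \<kappa> powr (p - 2)" using R2 Bpos 3 by (simp add: \<kappa>_def powr_powr)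
    define q where "q t = p * (p - 1) * (B * \<bar>cos t\<bar> powr (p - 2) - R2 * \<bar>l t\<bar> powr (p - 2))" for t
    define E where "E = {t. cos t = 0} \<union> {t. l t = 0}"
    \<comment> \<open>\<open>x1\<close> and \<open>x2\<close> are the values of \<open>tan t\<close>
      at which \<open>\<bar>cos t\<bar> = \<kappa> * \<bar>l t\<bar>\<close>.\<close>
    define x1 where "x1 = - a / b - 1 / (\<kappa> * \<bar>b\<bar>)"
    define x2 where "x2 = - a / b + 1 / (\<kappa> * \<bar>b\<bar>)"
    have x12: "x1 < x2" using lam 3 by (simp add: x1_def x2_def)
    have fact: "(cos t)\<^sup>2 - (\<kappa> * l t)\<^sup>2 = - (\<kappa>\<^sup>2 * b\<^sup>2) * ((sin t - x1 * cos t) * (sin t - x2 * cos t))" for t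
    proof -
      have "b\<^sup>2 * ((sin t - x1 * cos t) * (sin t - x2 * cos t))
          = b\<^sup>2 * ((sin t + a/b * cos t)\<^sup>2 - (1 / (\<kappa> * \<bar>b\<bar>))\<^sup>2 * (cos t)\<^sup>2)"
        by (simp add: x1_def x2_def power2_eq_square algebra_simps)
      also have "\<dots> = (b * (sin t + a/b * cos t))\<^sup>2 - (b / (\<kappa> * \<bar>b\<bar>))\<^sup>2 * (cos t)\<^sup>2"
        by (simp add: power2_eq_square algebra_simps)
      also have "b * (sin t + a/b * cos t) = l t" using 3 by (simp add: l_def algebra_simps)
      also have "(b / (\<kappa> * \<bar>b\<bar>))\<^sup>2 = 1 / \<kappa>\<^sup>2" using 3 by (simp add: power_divide power_mult_distrib)
      finally have *: "b\<^sup>2 * ((sin t - x1 * cos t) * (sin t - x2 * cos t)) = (l t)\<^sup>2 - 1 / \<kappa>\<^sup>2 * (cos t)\<^sup>2" .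
      have "- (\<kappa>\<^sup>2 * b\<^sup>2) * ((sin t - x1 * cos t) * (sin t - x2 * cos t))
          = - (\<kappa>\<^sup>2 * ((l t)\<^sup>2 - 1 / \<kappa>\<^sup>2 * (cos t)\<^sup>2))"
        unfolding *[symmetric] by simp
      also have "\<dots> = (cos t)\<^sup>2 - (\<kappa> * l t)\<^sup>2" using lam by (simp add: power_mult_distrib field_simps)
      finally show ?thesis by simp
    qed
    define m1 where "m1 = arctan x1"
    define m2 where "m2 = arctan x2"
    have m12: "m1 < m2" "m2 < m1 + pi"
      using x12 arctan_bounded[of x1] arctan_bounded[of x2] by (simp_all add: m1_def m2_def arctan_less_iff)
    have sg: "sgn ((cos t)\<^sup>2 - (\<kappa> * l t)\<^sup>2) = - sgn (sin (t - m1) * sin (t - m2))" for t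
    proof -
      define K where "K = (\<kappa>\<^sup>2 * b\<^sup>2) * (sqrt (1 + x1\<^sup>2) * sqrt (1 + x2\<^sup>2))"
      have sq: "0 < sqrt (1 + x\<^sup>2)" for x :: real by (simp add: add_pos_nonneg)
      have "0 < K" using lam 3 sq[of x1] sq[of x2] by (simp add: K_def)
      have "(cos t)\<^sup>2 - (\<kappa> * l t)\<^sup>2 = - (K * (sin (t - m1) * sin (t - m2)))"
        unfolding fact sin_minus_tan K_def m1_def m2_def by (simp only: mult_ac mult_minus_left mult_minus_right)
      then have "sgn ((cos t)\<^sup>2 - (\<kappa> * l t)\<^sup>2) = - sgn (K * (sin (t - m1) * sin (t - m2)))"
        by (simp only: sgn_minus)
      also have "\<dots> = - sgn (sin (t - m1) * sin (t - m2))"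
        unfolding sgn_mult[of K] using \<open>0 < K\<close> by simp
      finally show ?thesis .
    qed
    have sgn_q: "sgn (q t) = sgn (p - 2) * (- sgn (sin (t - m1) * sin (t - m2)))" if "t \<notin> E" for t
    proof -
      have nz: "cos t \<noteq> 0" "l t \<noteq> 0" using that by (auto simp: E_def)
      have "q t = (p * (p - 1) * B) * (\<bar>cos t\<bar> powr (p - 2) - (\<kappa> * \<bar>l t\<bar>) powr (p - 2))"
        using lam by (simp add: q_def lamp powr_mult algebra_simps)
      then have "sgn (q t) = sgn (\<bar>cos t\<bar> powr (p - 2) - (\<kappa> * \<bar>l t\<bar>) powr (p - 2))"
        using p Bpos by (simp add: sgn_mult)
      also have "\<dots> = sgn (p - 2) * sgn (\<bar>cos t\<bar> - \<kappa> * \<bar>l t\<bar>)"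
        using nz lam 3 by (intro sgn_powr_diff) auto
      also have "sgn (\<bar>cos t\<bar> - \<kappa> * \<bar>l t\<bar>) = sgn ((\<bar>cos t\<bar> - \<kappa> * \<bar>l t\<bar>) * (\<bar>cos t\<bar> + \<kappa> * \<bar>l t\<bar>))"
        using nz lam by (simp add: sgn_mult add_pos_pos)
      also have "(\<bar>cos t\<bar> - \<kappa> * \<bar>l t\<bar>) * (\<bar>cos t\<bar> + \<kappa> * \<bar>l t\<bar>) = (cos t)\<^sup>2 - (\<kappa> * l t)\<^sup>2"
      proof -
        have "(\<bar>cos t\<bar> - \<kappa> * \<bar>l t\<bar>) * (\<bar>cos t\<bar> + \<kappa> * \<bar>l t\<bar>) = \<bar>cos t\<bar>\<^sup>2 - \<kappa>\<^sup>2 * \<bar>l t\<bar>\<^sup>2"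
          by (simp add: power2_eq_square algebra_simps)
        then show ?thesis by (simp add: power_mult_distrib)
      qed
      finally show ?thesis by (simp only: sg)
    qed
    have "\<exists>n1 n2. n1 < n2 \<and> n2 < n1 + pi \<and> (\<forall>t. t \<notin> E \<longrightarrow> sgn (q t) = sgn (sin (t - n1) * sin (t - n2)))"
    proof (cases "p < 2")
      case True
      then show ?thesis using m12 sgn_q by (intro exI[of _ m1] exI[of _ m2]) simp
    next
      case False
      \<comment> \<open>For \<open>p > 2\<close> the sign of \<open>q\<close> is reversed. This
        amounts to exchanging the roles of the two sign changes: \<open>m2\<close> comes first and
        \<open>m1 + pi\<close> second.\<close>
      have "sin (t - (m1 + pi)) = - sin (t - m1)" for t by (simp add: sin_diff)
      then show ?thesis using m12 sgn_q False 3
        by (intro exI[of _ m2] exI[of _ "m1 + pi"]) (auto simp: sgn_mult mult.commute)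
    qed
    then obtain m1 m2 where m: "m1 < m2" "m2 < m1 + pi" "\<And>t. t \<notin> E \<Longrightarrow> sgn (q t) = sgn (sin (t - m1) * sin (t - m2))"
      by blast
    \<comment> \<open>The multiple of \<open>pi\<close> that brings the first sign change into the
      period \<open>[\<alpha>, \<alpha> + pi)\<close> required by the locale.\<close>
    define k where "k = \<lfloor>(m1 - \<alpha>) / pi\<rfloor>"
    have k: "of_int k \<le> (m1 - \<alpha>) / pi" "(m1 - \<alpha>) / pi < of_int k + 1" unfolding k_def by linarith+
    then have k': "\<alpha> + pi * of_int k \<le> m1" "m1 < \<alpha> + pi * of_int k + pi"
      unfolding k_def[symmetric] by (simp_all add: field_simps)
    interpret trig_minorant p ?h "hfun1 p B a b" q E "m1 - pi * of_int k" "m2 - pi * of_int k" \<alpha>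
    proof
      show "(hfun1 p B a b has_real_derivative q t - p\<^sup>2 * ?h t) (at t)" if "t \<notin> E" for t
        using hfun1_der[OF p, of t a b B] that by (auto simp: E_def l_def q_def R2_def)
      show "finite (E \<inter> {u..v})" for u v
        using finite_zeros_sinusoid[of 1 0 u v] finite_zeros_sinusoid[of a b u v] 3
        by (simp add: E_def l_def Int_Un_distrib2)
      show "sgn (q t) = sgn (sin (t - (m1 - pi * of_int k)) * sin (t - (m2 - pi * of_int k)))" if "t \<notin> E" for t
        by (simp only: sin_shift_prod m(3)[OF that])
    qed (use p hfun_periodic hfun_der[OF p] hfun1_cont[OF p] m k' nonneg zero in auto)
    show ?thesis using minorant by blast
  qed
qed

section \<open>The constant as a condition on pairs of angles\<close>

text \<open>With \<open>x = tan \<phi>\<close> and \<open>\<gamma> = pi / (2 * p)\<close> the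
  addition formulas turn \<open>x + \<tau>\<close> and \<open>x - \<tau>\<close> into sines,
  \<open>1 - x * \<tau>\<close> and \<open>1 + x * \<tau>\<close> into cosines of
  \<open>\<phi> + \<gamma>\<close> and \<open>\<phi> - \<gamma>\<close>, all divided by
  \<open>cos \<phi> * cos \<gamma>\<close>. That factor cancels from the quotient, and the shift by
  \<open>pi / 2\<close> turns the sines into the cosines of \<open>t + pi / p\<close> and
  \<open>t\<close>.\<close>

lemma B_const_quotient:
  fixes p a b \<phi> :: real
  assumes p: "1 < p" and c: "cos \<phi> \<noteq> 0"
  defines "\<tau> \<equiv> tan (pi / (2 * p))" and "t \<equiv> \<phi> - pi/2 - pi/(2*p)"
  shows "(\<bar>a * tan \<phi> - b + (b * tan \<phi> + a) * \<tau>\<bar> powr p + \<bar>a * tan \<phi> - b - (b * tan \<phi> + a) * \<tau>\<bar> powr p)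
       / (\<bar>tan \<phi> + \<tau>\<bar> powr p + \<bar>tan \<phi> - \<tau>\<bar> powr p)
     = (\<bar>a * cos t + b * sin t\<bar> powr p + \<bar>a * cos (t + pi/p) + b * sin (t + pi/p)\<bar> powr p)
       / (\<bar>cos t\<bar> powr p + \<bar>cos (t + pi/p)\<bar> powr p)"
proof -
  define \<gamma> where "\<gamma> = pi / (2 * p)"
  have g: "0 < \<gamma>" "\<gamma> < pi/2" using p by (auto simp: \<gamma>_def field_simps)
  have cg: "cos \<gamma> \<noteq> 0" using g by (intro less_imp_neq[symmetric] cos_gt_zero_pi) auto
  define w where "w = cos \<phi> * cos \<gamma>"
  have w: "w \<noteq> 0" using c cg by (simp add: w_def)
  have tau: "\<tau> = sin \<gamma> / cos \<gamma>" by (simp add: \<tau>_def \<gamma>_def tan_def)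
  have t1: "t = (\<phi> - \<gamma>) - pi/2" by (simp add: t_def \<gamma>_def)
  have t2: "t + pi/p = (\<phi> + \<gamma>) - pi/2" using p by (simp add: t_def \<gamma>_def field_simps)
  have ct: "cos t = sin (\<phi> - \<gamma>)" "sin t = - cos (\<phi> - \<gamma>)"
    "cos (t + pi/p) = sin (\<phi> + \<gamma>)" "sin (t + pi/p) = - cos (\<phi> + \<gamma>)"
    unfolding t2 unfolding t1 by (simp_all add: cos_diff sin_diff)
  have e: "tan \<phi> + \<tau> = sin (\<phi> + \<gamma>) / w" "tan \<phi> - \<tau> = sin (\<phi> - \<gamma>) / w"
     "1 - tan \<phi> * \<tau> = cos (\<phi> + \<gamma>) / w" "1 + tan \<phi> * \<tau> = cos (\<phi> - \<gamma>) / w"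
    using c cg by (simp_all add: tan_def tau w_def sin_add sin_diff cos_add cos_diff field_simps)
  have "a * tan \<phi> - b + (b * tan \<phi> + a) * \<tau> = a * (tan \<phi> + \<tau>) - b * (1 - tan \<phi> * \<tau>)"
    by (simp add: algebra_simps)
  also have "\<dots> = (a * cos (t + pi/p) + b * sin (t + pi/p)) / w"
    unfolding e ct by (simp add: diff_divide_distrib)
  finally have e1: "a * tan \<phi> - b + (b * tan \<phi> + a) * \<tau> = (a * cos (t + pi/p) + b * sin (t + pi/p)) / w" .
  have "a * tan \<phi> - b - (b * tan \<phi> + a) * \<tau> = a * (tan \<phi> - \<tau>) - b * (1 + tan \<phi> * \<tau>)"
    by (simp add: algebra_simps)
  also have "\<dots> = (a * cos t + b * sin t) / w"
    unfolding e ct by (simp add: diff_divide_distrib)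
  finally have e2: "a * tan \<phi> - b - (b * tan \<phi> + a) * \<tau> = (a * cos t + b * sin t) / w" .
  have d: "\<bar>x / w\<bar> powr p = \<bar>x\<bar> powr p / \<bar>w\<bar> powr p" for x
    by (simp add: abs_divide powr_divide)
  have wp: "0 < \<bar>w\<bar> powr p" using w by simp
  show ?thesis
    unfolding e1 e2 e(1,2) d ct(1,3)[symmetric] add_divide_distrib[symmetric]
    using wp by (simp add: add.commute)
qed

definition pair_quot :: "real \<Rightarrow> real \<Rightarrow> real \<Rightarrow> real \<Rightarrow> real" where
  "pair_quot p a b t = (\<bar>a * cos t + b * sin t\<bar> powr p + \<bar>a * cos (t + pi/p) + b * sin (t + pi/p)\<bar> powr p)
       / (\<bar>cos t\<bar> powr p + \<bar>cos (t + pi/p)\<bar> powr p)"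

lemma abs_powr_cont: "1 < p \<Longrightarrow> continuous_on A f \<Longrightarrow> continuous_on A (\<lambda>x. \<bar>f x :: real\<bar> powr p)"
  by (rule continuous_on_powr'[OF continuous_on_rabs continuous_on_const]) auto

lemma pair_quot_cont: "1 < p \<Longrightarrow> continuous_on A (pair_quot p a b)"
  unfolding pair_quot_def[abs_def]
  by (intro continuous_on_divide continuous_on_add abs_powr_cont continuous_on_mult continuous_on_cos
      continuous_on_sin continuous_on_const continuous_on_id) (use cos_pair_pos in \<open>auto simp: less_imp_neq[symmetric]\<close>)

lemma pair_quot_periodic: "pair_quot p a b (t + pi) = pair_quot p a b t"
proof -
  have "hfun p B a b (t + pi + pi/p) = hfun p B a b (t + pi/p)" for B a b
    using hfun_periodic[of p B a b "t + pi/p"] by (simp add: algebra_simps)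
  from this[of 0 a b] this[of 1 0 0] hfun_periodic[of p 0 a b t] hfun_periodic[of p 1 0 0 t]
  show ?thesis by (simp add: pair_quot_def hfun_def)
qed

lemma pair_quot_le_iff:
  assumes "1 < p" shows "pair_quot p a b t \<le> B \<longleftrightarrow> 0 \<le> hfun p B a b t + hfun p B a b (t + pi/p)"
  unfolding pair_quot_def hfun_pair using cos_pair_pos[OF assms, of t] by (simp add: pos_divide_le_eq)

lemma pair_quot_eq_iff:
  assumes "1 < p" shows "pair_quot p a b t = B \<longleftrightarrow> hfun p B a b t + hfun p B a b (t + pi/p) = 0"
  unfolding pair_quot_def hfun_pair using cos_pair_pos[OF assms, of t] by (auto simp: field_simps)

lemma pair_quot_max:
  assumes "1 < p" obtains \<alpha> where "\<And>t. pair_quot p a b t \<le> pair_quot p a b \<alpha>"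
proof -
  obtain \<alpha> where al: "\<And>t. t \<in> {0..pi} \<Longrightarrow> pair_quot p a b t \<le> pair_quot p a b \<alpha>"
    using continuous_attains_sup[OF compact_Icc _ pair_quot_cont[OF assms], of 0 pi a b] by fastforce
  have "pair_quot p a b t \<le> pair_quot p a b \<alpha>" for t
  proof -
    define k where "k = \<lfloor>t / pi\<rfloor>"
    have "of_int k \<le> t / pi" "t / pi < of_int k + 1" unfolding k_def by linarith+
    then have "t - pi * of_int k \<in> {0..pi}" unfolding k_def[symmetric] by (simp add: field_simps)
    then show ?thesis using al periodic_int[of "pair_quot p a b" t k, OF pair_quot_periodic] by metis
  qed
  then show ?thesis using that by blast
qed

lemma B_const_eq:
  assumes p: "1 < p" shows "B_const a b p = (SUP x. pair_quot p a b (arctan x - pi/2 - pi/(2*p)))"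
  unfolding B_const_def pair_quot_def
  using B_const_quotient[OF p cos_arctan_not_zero, of a _ b] unfolding tan_arctan by (intro SUP_cong refl)

text \<open>Real \<open>x\<close> cover all angles except those with \<open>cos \<phi> = 0\<close>,
  which correspond to \<open>x\<close> at infinity. They are limits of covered angles, so continuity
  of \<open>pair_quot\<close> extends the bound to them.\<close>

lemma B_const_upper:
  assumes p: "1 < p" shows "pair_quot p a b t \<le> B_const a b p"
proof (rule ccontr)
  let ?\<rho> = "pair_quot p a b"
  have bdd: "bdd_above (range (\<lambda>x. ?\<rho> (arctan x - pi/2 - pi/(2*p))))"
  proof -
    obtain \<alpha> where "\<And>t. ?\<rho> t \<le> ?\<rho> \<alpha>" using pair_quot_max[OF p, of a b] by blast
    then show ?thesis by (intro bdd_aboveI2[of _ _ "?\<rho> \<alpha>"])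
  qed
  have good: "?\<rho> s \<le> B_const a b p" if c: "cos (s + pi/2 + pi/(2*p)) \<noteq> 0" for s
  proof -
    define \<phi> where "\<phi> = s + pi/2 + pi/(2*p)"
    have s: "s = \<phi> - pi/2 - pi/(2*p)" by (simp add: \<phi>_def)
    have "?\<rho> (\<phi> - pi/2 - pi/(2*p)) = ?\<rho> (arctan (tan \<phi>) - pi/2 - pi/(2*p))"
      using B_const_quotient[OF p c[folded \<phi>_def], of a b]
        B_const_quotient[OF p cos_arctan_not_zero, of a "tan \<phi>" b]
      unfolding pair_quot_def tan_arctan by (rule trans[OF sym])
    also have "\<dots> \<le> B_const a b p"
      unfolding B_const_eq[OF p] by (rule cSUP_upper[OF UNIV_I bdd])
    finally show ?thesis using s by simp
  qed
  assume "\<not> ?\<rho> t \<le> B_const a b p"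
  then have gt: "B_const a b p < ?\<rho> t" by simp
  then have c0: "cos (t + pi/2 + pi/(2*p)) = 0" using good by fastforce
  have "isCont ?\<rho> t" using pair_quot_cont[OF p, of UNIV] by (simp add: continuous_on_eq_continuous_at)
  then have "\<forall>\<^sub>F s in nhds t. B_const a b p < ?\<rho> s"
    using gt by (intro order_tendstoD(1)) (simp_all add: isCont_def tendsto_at_iff_tendsto_nhds)
  then obtain e where e: "e > 0" "\<And>s. dist s t < e \<Longrightarrow> B_const a b p < ?\<rho> s"
    by (auto simp: eventually_nhds_metric)
  \<comment> \<open>Below \<open>e\<close>, so that the strict inequality persists, and below
    \<open>pi\<close>, so that \<open>t + k\<close> is not again an exceptional angle.\<close>
  define k where "k = min (e/2) 1"
  have k: "0 < k" "k < e" "k < pi" using e pi_gt3 by (auto simp: k_def)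
  define \<phi> where "\<phi> = t + pi/2 + pi/(2*p)"
  have "sin \<phi> \<noteq> 0" using c0 sin_cos_squared_add[of \<phi>] by (auto simp flip: \<phi>_def)
  moreover have "cos (\<phi> + k) = - (sin \<phi> * sin k)" using c0 by (simp add: cos_add flip: \<phi>_def)
  moreover have "t + k + pi/2 + pi/(2*p) = \<phi> + k" by (simp add: \<phi>_def)
  ultimately have "cos (t + k + pi/2 + pi/(2*p)) \<noteq> 0" using sin_gt_zero[of k] k by (metis mult_eq_0_iff neg_equal_0_iff_equal less_irrefl)
  then show False using good[of "t + k"] e(2)[of "t + k"] k by (simp add: dist_real_def)
qed

lemma B_const_least:
  assumes p: "1 < p" and C: "\<And>t. 0 \<le> hfun p C a b t + hfun p C a b (t + pi/p)"
  shows "B_const a b p \<le> C"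
  unfolding B_const_eq[OF p] by (rule cSUP_least) (simp_all only: pair_quot_le_iff[OF p] C UNIV_not_empty simp_thms)

lemma B_const_pair_nonneg:
  assumes p: "1 < p"
  shows "0 \<le> hfun p (B_const a b p) a b t + hfun p (B_const a b p) a b (t + pi/p)"
  unfolding pair_quot_le_iff[OF p, symmetric] by (rule B_const_upper[OF p])

text \<open>The supremum over real \<open>x\<close> may be approached only at infinity; over angles
  it is a maximum, because \<open>pair_quot\<close> is continuous and periodic.\<close>

lemma B_const_attained:
  assumes p: "1 < p"
  shows "\<exists>\<alpha>. hfun p (B_const a b p) a b \<alpha> + hfun p (B_const a b p) a b (\<alpha> + pi/p) = 0"
proof -
  obtain \<alpha> where al: "\<And>t. pair_quot p a b t \<le> pair_quot p a b \<alpha>" using pair_quot_max[OF p, of a b] by blast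
  have "B_const a b p \<le> pair_quot p a b \<alpha>"
    by (rule B_const_least[OF p]) (simp only: pair_quot_le_iff[OF p, symmetric] al)
  then have "pair_quot p a b \<alpha> = B_const a b p" using B_const_upper[OF p, of a b \<alpha>] by simp
  then show ?thesis unfolding pair_quot_eq_iff[OF p] by (rule exI)
qed

lemma B_const_nonneg:
  assumes "1 < p" shows "0 \<le> B_const a b p"
proof -
  have "0 \<le> pair_quot p a b 0" by (simp add: pair_quot_def)
  also have "\<dots> \<le> B_const a b p" by (rule B_const_upper[OF assms])
  finally show ?thesis .
qed

theorem B_const_minorant:
  assumes p: "1 < p"
  shows "\<exists>g. trig_convex p g \<and> (\<forall>t. g t \<le> hfun p (B_const a b p) a b t)"
proof -
  define B where "B = B_const a b p"
  have 1: "\<exists>\<alpha>. hfun p B a b \<alpha> + hfun p B a b (\<alpha> + pi/p) = 0"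
    unfolding B_def by (rule B_const_attained[OF p])
  then obtain \<alpha> where 2: "hfun p B a b \<alpha> + hfun p B a b (\<alpha> + pi/p) = 0" by (elim exE)
  have 3: "0 \<le> hfun p B a b t + hfun p B a b (t + pi/p)" for t
    unfolding B_def by (rule B_const_pair_nonneg[OF p])
  show ?thesis unfolding B_def[symmetric] by (rule angular_minorant[OF p 3 2])
qed

section \<open>Subharmonicity along holomorphic functions\<close>

text \<open>Green's identity against the harmonic weight \<open>y - y0\<close>, which vanishes on
  the bottom edge. Integrating by parts twice in \<open>y\<close> leaves exactly the integral of
  \<open>U\<close> along that edge, and the second \<open>x\<close>-derivatives integrate to 0
  because \<open>U1\<close> vanishes on the lateral sides.\<close>

lemma laplacian_strip:
  fixes U U1 U11 V1 V11 :: "real \<Rightarrow> real \<Rightarrow> real"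
  assumes ab: "a \<le> b" and Y: "y0 \<le> Y"
    and U11: "\<And>x y. y0 \<le> y \<Longrightarrow> ((\<lambda>x. U1 x y) has_real_derivative U11 x y) (at x)"
    and V1: "\<And>x y. y0 \<le> y \<Longrightarrow> ((\<lambda>y. U x y) has_real_derivative V1 x y) (at y)"
    and V11: "\<And>x y. y0 \<le> y \<Longrightarrow> ((\<lambda>y. V1 x y) has_real_derivative V11 x y) (at y)"
    and cU: "continuous_on ({a..b} \<times> {y0..Y}) (\<lambda>z. U11 (fst z) (snd z))"
    and cV: "continuous_on ({a..b} \<times> {y0..Y}) (\<lambda>z. V11 (fst z) (snd z))"
    and z: "\<And>y. y0 \<le> y \<Longrightarrow> U1 a y = 0" "\<And>y. y0 \<le> y \<Longrightarrow> U1 b y = 0" "\<And>x. U x Y = 0" "\<And>x. V1 x Y = 0"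
    and pos: "\<And>x y. y0 \<le> y \<Longrightarrow> 0 \<le> U11 x y + V11 x y"
  shows "0 \<le> integral {a..b} (\<lambda>x. U x y0)"
proof -
  define K where "K x = integral {y0..Y} (\<lambda>y. (y - y0) * U11 x y)" for x
  define J where "J x = integral {y0..Y} (\<lambda>y. (y - y0) * V11 x y)" for x
  have cK: "continuous_on (cbox (a, y0) (b, Y)) (\<lambda>(x, y). (y - y0) * U11 x y)"
    unfolding cbox_Pair_eq split_beta box_real by (intro continuous_intros cU)
  have cJ: "continuous_on (cbox (a, y0) (b, Y)) (\<lambda>(x, y). (y - y0) * V11 x y)"
    unfolding cbox_Pair_eq split_beta box_real by (intro continuous_intros cV)
  have sect: "continuous_on {y0..Y} (\<lambda>y. f (x, y))" if "continuous_on (cbox (a, y0) (b, Y)) f" "x \<in> {a..b}"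
    for f :: "real \<times> real \<Rightarrow> real" and x
    by (rule continuous_on_compose2[OF that(1)]) (use that in \<open>auto intro!: continuous_intros simp: cbox_Pair_eq\<close>)
  have J: "J x = U x y0" for x
  proof -
    have "((\<lambda>y. (y - y0) * V11 x y) has_integral ((Y - y0) * V1 x Y - U x Y) - ((y0 - y0) * V1 x y0 - U x y0)) {y0..Y}"
    proof (rule fundamental_theorem_of_calculus[OF Y])
      fix y assume "y \<in> {y0..Y}"
      then have "((\<lambda>y. (y - y0) * V1 x y - U x y) has_real_derivative (y - y0) * V11 x y) (at y)"
        by (auto intro!: derivative_eq_intros V1 V11)
      then show "((\<lambda>y. (y - y0) * V1 x y - U x y) has_vector_derivative (y - y0) * V11 x y) (at y within {y0..Y})"
        by (simp add: has_field_derivative_at_within flip: has_real_derivative_iff_has_vector_derivative)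
    qed
    then show ?thesis using z by (simp add: J_def integral_unique)
  qed
  have "integral {a..b} K = integral {y0..Y} (\<lambda>y. integral {a..b} (\<lambda>x. (y - y0) * U11 x y))"
    using integral_swap_continuous[OF cK] by (simp add: K_def[abs_def])
  also have "\<dots> = integral {y0..Y} (\<lambda>y. 0)"
  proof (rule integral_cong)
    fix y assume y: "y \<in> {y0..Y}"
    have "((\<lambda>x. (y - y0) * U11 x y) has_integral (y - y0) * U1 b y - (y - y0) * U1 a y) {a..b}"
    proof (rule fundamental_theorem_of_calculus[OF ab])
      fix x assume "x \<in> {a..b}"
      have "((\<lambda>x. (y - y0) * U1 x y) has_real_derivative (y - y0) * U11 x y) (at x)"
        using y by (intro DERIV_cmult U11) auto
      then show "((\<lambda>x. (y - y0) * U1 x y) has_vector_derivative (y - y0) * U11 x y) (at x within {a..b})"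
        by (simp add: has_field_derivative_at_within flip: has_real_derivative_iff_has_vector_derivative)
    qed
    then have "integral {a..b} (\<lambda>x. (y - y0) * U11 x y) = (y - y0) * U1 b y - (y - y0) * U1 a y"
      by (rule integral_unique)
    also have "\<dots> = 0" using z y by simp
    finally show "integral {a..b} (\<lambda>x. (y - y0) * U11 x y) = 0" .
  qed
  finally have K0: "integral {a..b} K = 0" by simp
  have cKx: "continuous_on {a..b} K"
    using integral_continuous_on_param[of "{a..b}" y0 Y "\<lambda>x y. (y - y0) * U11 x y"] cK
    by (simp add: K_def[abs_def] cbox_Pair_eq)
  have cJx: "continuous_on {a..b} J"
    using integral_continuous_on_param[of "{a..b}" y0 Y "\<lambda>x y. (y - y0) * V11 x y"] cJ
    by (simp add: J_def[abs_def] cbox_Pair_eq)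
  have "0 \<le> integral {a..b} (\<lambda>x. K x + J x)"
  proof (rule integral_nonneg)
    show "(\<lambda>x. K x + J x) integrable_on {a..b}"
      by (intro integrable_continuous_interval continuous_intros cKx cJx)
    fix x assume x: "x \<in> {a..b}"
    have i: "(\<lambda>y. (y - y0) * U11 x y) integrable_on {y0..Y}" "(\<lambda>y. (y - y0) * V11 x y) integrable_on {y0..Y}"
      using sect[OF cK x] sect[OF cJ x] by (auto intro: integrable_continuous_interval)
    have "K x + J x = integral {y0..Y} (\<lambda>y. (y - y0) * U11 x y + (y - y0) * V11 x y)"
      unfolding K_def J_def by (rule integral_add[symmetric, OF i])
    also have "0 \<le> \<dots>"
    proof (rule integral_nonneg[OF integrable_add[OF i]])
      fix y assume "y \<in> {y0..Y}"
      then have "0 \<le> (y - y0) * (U11 x y + V11 x y)" using pos by simp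
      then show "0 \<le> (y - y0) * U11 x y + (y - y0) * V11 x y" by (simp add: distrib_left)
    qed
    finally show "0 \<le> K x + J x" .
  qed
  also have "\<dots> = integral {a..b} K + integral {a..b} J"
    by (intro integral_add integrable_continuous_interval cKx cJx)
  finally show ?thesis using K0 J by (simp add: J fun_eq_iff cong: integral_cong)
qed

section \<open>Polar coordinates along curves\<close>

lemma periodic_cis:
  fixes g :: "real \<Rightarrow> 'b" assumes g: "\<And>t. g (t + pi) = g t" and "cis x = cis y"
  shows "g x = g y"
proof -
  have "sin x = sin y \<and> cos x = cos y" using assms(2) by (simp add: complex_eq_iff)
  then obtain n :: int where n: "x = y + 2 * pi * n" by (auto simp: sin_cos_eq_iff)
  have "g x = g (y - pi * of_int (- 2 * n))" using n by (simp add: algebra_simps)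
  also have "\<dots> = g y" by (rule periodic_int[of g, OF g])
  finally show ?thesis .
qed

text \<open>Near \<open>w0\<close> the expression \<open>Arg w0 + Im (Ln (w / w0))\<close> is a
  smooth branch of the argument, even on the cut of \<open>Arg\<close>. By
  \<open>periodic_cis\<close> a function of period \<open>pi\<close> cannot tell the two
  apart.\<close>

lemma cis_Arg_mult:
  assumes "w \<noteq> 0" "w0 \<noteq> 0" shows "cis (Arg w) = cis (Arg w0 + Im (Ln (w / w0)))"
proof -
  have "w / w0 \<noteq> 0" using assms by simp
  then have "Im (Ln (w / w0)) = Arg (w / w0)" by (simp add: Arg_eq_Im_Ln)
  then have "cis (Arg w0 + Im (Ln (w / w0))) = sgn w0 * sgn (w / w0)"
    using assms by (simp add: cis_mult[symmetric] cis_Arg)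
  also have "\<dots> = sgn w" using assms by (simp add: sgn_divide sgn_zero_iff)
  finally show ?thesis using assms by (simp add: cis_Arg)
qed

text \<open>The logarithm of \<open>\<Gamma> t / \<Gamma> s\<close> has derivative
  \<open>v / \<Gamma> s\<close> at \<open>s\<close>; its real part is the change of the logarithmic
  modulus, its imaginary part the change of the angle.\<close>

lemma polar_chain:
  fixes \<Gamma> :: "real \<Rightarrow> complex"
  assumes v: "(\<Gamma> has_vector_derivative v) (at s)" and nz: "\<Gamma> s \<noteq> 0"
  shows "((\<lambda>t. ln (cmod (\<Gamma> t))) has_real_derivative Re (v / \<Gamma> s)) (at s)"
    and "\<lbrakk>\<And>t. g (t + pi) = g t; \<And>t. (g has_real_derivative g1 t) (at t)\<rbrakk>
      \<Longrightarrow> ((\<lambda>t. g (Arg (\<Gamma> t))) has_real_derivative g1 (Arg (\<Gamma> s)) * Im (v / \<Gamma> s)) (at s)"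
proof -
  define M where "M t = Ln (\<Gamma> t / \<Gamma> s)" for t
  have 1: "((\<lambda>t. \<Gamma> t / \<Gamma> s) has_vector_derivative v / \<Gamma> s) (at s)"
    using has_vector_derivative_mult_left[OF v, of "1 / \<Gamma> s"] by simp
  have "(Ln has_field_derivative inverse 1) (at (\<Gamma> s / \<Gamma> s))"
    using nz has_field_derivative_Ln[of 1] by simp
  from field_vector_diff_chain_at[OF 1 this]
  have M: "(M has_vector_derivative v / \<Gamma> s) (at s)" by (simp add: M_def[abs_def] o_def)
  have Re: "((\<lambda>t. Re (M t)) has_real_derivative Re (v / \<Gamma> s)) (at s)"
    using bounded_linear.has_vector_derivative[OF bounded_linear_Re M]
    by (simp add: has_real_derivative_iff_has_vector_derivative)
  have Im: "((\<lambda>t. Im (M t)) has_real_derivative Im (v / \<Gamma> s)) (at s)"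
    using bounded_linear.has_vector_derivative[OF bounded_linear_Im M]
    by (simp add: has_real_derivative_iff_has_vector_derivative)
  have "isCont \<Gamma> s" using v by (rule has_vector_derivative_continuous)
  then have ev: "\<forall>\<^sub>F t in nhds s. \<Gamma> t \<noteq> 0"
    using nz by (auto simp: isCont_def tendsto_at_iff_tendsto_nhds intro: tendsto_imp_eventually_ne)
  have ev1: "\<forall>\<^sub>F t in nhds s. ln (cmod (\<Gamma> t)) = ln (cmod (\<Gamma> s)) + Re (M t)"
    using ev
  proof eventually_elim
    case (elim t)
    then show ?case using nz by (simp add: M_def norm_divide ln_div)
  qed
  have "((\<lambda>t. ln (cmod (\<Gamma> s)) + Re (M t)) has_real_derivative Re (v / \<Gamma> s)) (at s)"
    using DERIV_add[OF DERIV_const Re] by simp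
  then show "((\<lambda>t. ln (cmod (\<Gamma> t))) has_real_derivative Re (v / \<Gamma> s)) (at s)"
    using DERIV_cong_ev[OF refl ev1 refl] by simp
  assume g: "\<And>t. g (t + pi) = g t" and g1: "\<And>t. (g has_real_derivative g1 t) (at t)"
  have ev2: "\<forall>\<^sub>F t in nhds s. g (Arg (\<Gamma> t)) = g (Arg (\<Gamma> s) + Im (M t))"
    using ev
  proof eventually_elim
    case (elim t)
    then show ?case unfolding M_def by (intro periodic_cis[of g, OF g] cis_Arg_mult nz)
  qed
  have M0: "Im (M s) = 0" using nz by (simp add: M_def)
  have "((\<lambda>t. Arg (\<Gamma> s) + Im (M t)) has_real_derivative Im (v / \<Gamma> s)) (at s)"
    using DERIV_add[OF DERIV_const Im] by simp
  from DERIV_chain2[OF _ this, of g "g1 (Arg (\<Gamma> s))"]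
  have "((\<lambda>t. g (Arg (\<Gamma> s) + Im (M t))) has_real_derivative g1 (Arg (\<Gamma> s)) * Im (v / \<Gamma> s)) (at s)"
    using g1[of "Arg (\<Gamma> s)"] M0 by simp
  then show "((\<lambda>t. g (Arg (\<Gamma> t))) has_real_derivative g1 (Arg (\<Gamma> s)) * Im (v / \<Gamma> s)) (at s)"
    using DERIV_cong_ev[OF refl ev2 refl] by simp
qed

lemma isCont_periodic_Arg:
  fixes g :: "real \<Rightarrow> real"
  assumes g: "\<And>t. g (t + pi) = g t" and c: "continuous_on UNIV g" and nz: "w0 \<noteq> 0"
  shows "isCont (\<lambda>w. g (Arg w)) w0"
proof -
  have "\<forall>\<^sub>F w in nhds w0. w \<noteq> 0" using nz by (intro t1_space_nhds)
  then have ev: "\<forall>\<^sub>F w in nhds w0. g (Arg w) = g (Arg w0 + Im (Ln (w / w0)))"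
  proof eventually_elim
    case (elim w)
    then show ?case by (intro periodic_cis[of g, OF g] cis_Arg_mult nz)
  qed
  have "isCont (\<lambda>w. Arg w0 + Im (Ln (w / w0))) w0"
    using nz by (intro continuous_intros isCont_Ln') auto
  moreover have "isCont g x" for x using c by (simp add: continuous_on_eq_continuous_at)
  ultimately have "isCont (\<lambda>w. g (Arg w0 + Im (Ln (w / w0)))) w0" by (rule isCont_o2)
  then show ?thesis using isCont_cong[OF ev] by simp
qed

lemma has_vector_derivative_horizontal:
  assumes "(f has_field_derivative D) (at (Complex x y))"
  shows "((\<lambda>x. f (Complex x y)) has_vector_derivative D) (at x)"
proof -
  have "((\<lambda>x. Complex x y) has_vector_derivative 1) (at x)"
    using has_vector_derivative_real_field[of "\<lambda>w. w + \<i> * of_real y" 1 x UNIV]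
    by (auto intro!: derivative_eq_intros simp: Complex_eq)
  from field_vector_diff_chain_at[OF this assms] show ?thesis by (simp add: o_def)
qed

lemma has_vector_derivative_vertical:
  assumes "(f has_field_derivative D) (at (Complex x y))"
  shows "((\<lambda>y. f (Complex x y)) has_vector_derivative \<i> * D) (at y)"
proof -
  have "((\<lambda>y. Complex x y) has_vector_derivative \<i>) (at y)"
    using has_vector_derivative_real_field[of "\<lambda>w. of_real x + \<i> * w" \<i> y UNIV]
    by (auto intro!: derivative_eq_intros simp: Complex_eq)
  from field_vector_diff_chain_at[OF this assms] show ?thesis by (simp add: o_def)
qed

text \<open>This describes functions \<open>A (ln r) * g \<theta> + X (ln r)\<close>. The expression
  in \<open>laplacian\<close> is \<open>r\<^sup>2\<close> times their Laplacian, since the polar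
  Laplacian becomes the flat one in the coordinates \<open>ln r\<close> and \<theta>. By
  \<open>vanish\<close> the function is 0 for \<open>r < exp T\<close>, which removes the
  singularity at the origin.\<close>

locale polar_function =
  fixes A A1 A2 X X1 X2 g g1 g2 :: "real \<Rightarrow> real" and T :: real
  assumes A: "\<And>r. (A has_real_derivative A1 r) (at r)" "\<And>r. (A1 has_real_derivative A2 r) (at r)"
    and X: "\<And>r. (X has_real_derivative X1 r) (at r)" "\<And>r. (X1 has_real_derivative X2 r) (at r)"
    and g: "\<And>t. (g has_real_derivative g1 t) (at t)" "\<And>t. (g1 has_real_derivative g2 t) (at t)"
    and cont: "continuous_on UNIV A2" "continuous_on UNIV X2" "continuous_on UNIV g2"
    and periodic: "\<And>t. g (t + pi) = g t"
    and vanish: "\<And>r. r < T \<Longrightarrow> A r = 0" "\<And>r. r < T \<Longrightarrow> A1 r = 0" "\<And>r. r < T \<Longrightarrow> A2 r = 0"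
      "\<And>r. r < T \<Longrightarrow> X r = 0" "\<And>r. r < T \<Longrightarrow> X1 r = 0" "\<And>r. r < T \<Longrightarrow> X2 r = 0"
    and laplacian: "\<And>r t. 0 \<le> A2 r * g t + X2 r + A r * g2 t"
begin

definition u :: "complex \<Rightarrow> real" where
  "u w = (if w = 0 then 0 else A (ln (cmod w)) * g (Arg w) + X (ln (cmod w)))"

text \<open>First and second derivatives of \<open>u\<close> along a curve through \<open>w\<close> with velocity \<open>v\<close> and
  acceleration \<open>a\<close>; the logarithm of the curve has velocity \<open>v / w\<close>.\<close>

definition du :: "complex \<Rightarrow> complex \<Rightarrow> real" where
  "du w v = (if w = 0 then 0 else
     (A1 (ln (cmod w)) * g (Arg w) + X1 (ln (cmod w))) * Re (v / w) + A (ln (cmod w)) * g1 (Arg w) * Im (v / w))"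

definition ddu :: "complex \<Rightarrow> complex \<Rightarrow> complex \<Rightarrow> real" where
  "ddu w v a = (if w = 0 then 0 else
     (A2 (ln (cmod w)) * g (Arg w) + X2 (ln (cmod w))) * (Re (v / w))\<^sup>2
     + 2 * A1 (ln (cmod w)) * g1 (Arg w) * Re (v / w) * Im (v / w)
     + A (ln (cmod w)) * g2 (Arg w) * (Im (v / w))\<^sup>2
     + (A1 (ln (cmod w)) * g (Arg w) + X1 (ln (cmod w))) * Re (a / w - (v / w)\<^sup>2)
     + A (ln (cmod w)) * g1 (Arg w) * Im (a / w - (v / w)\<^sup>2))"

lemma small:
  assumes "cmod w < exp T"
  shows "u w = 0" "du w v = 0" "ddu w v a = 0"
proof -
  have "ln (cmod w) < T" if "w \<noteq> 0" using that assms by (metis ln_exp ln_less_cancel_iff exp_gt_zero zero_less_norm_iff)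
  then show "u w = 0" "du w v = 0" "ddu w v a = 0"
    by (auto simp: u_def du_def ddu_def vanish)
qed

lemma g1_periodic: "g1 (t + pi) = g1 t"
proof -
  have "((\<lambda>t. g (t + pi)) has_real_derivative g1 (t + pi) * 1) (at t)"
    by (rule DERIV_chain2[OF g(1)]) (auto intro!: derivative_eq_intros)
  then have "(g has_real_derivative g1 (t + pi)) (at t)" by (simp add: periodic)
  then show ?thesis using DERIV_unique g(1) by blast
qed

lemma g2_periodic: "g2 (t + pi) = g2 t"
proof -
  have "((\<lambda>t. g1 (t + pi)) has_real_derivative g2 (t + pi) * 1) (at t)"
    by (rule DERIV_chain2[OF g(2)]) (auto intro!: derivative_eq_intros)
  then have "(g1 has_real_derivative g2 (t + pi)) (at t)" by (simp add: g1_periodic)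
  then show ?thesis using DERIV_unique g(2) by blast
qed

lemma eventually_small:
  assumes "isCont \<Gamma> s" "\<Gamma> s = (0::complex)"
  shows "\<forall>\<^sub>F t in nhds s. cmod (\<Gamma> t) < exp T"
proof -
  have "((\<lambda>t. cmod (\<Gamma> t)) \<longlongrightarrow> cmod (\<Gamma> s)) (nhds s)"
    using assms(1) by (intro tendsto_norm) (simp add: isCont_def tendsto_at_iff_tendsto_nhds)
  then show ?thesis using assms(2) by (intro order_tendstoD(2)) auto
qed

lemma u_der:
  assumes v: "(\<Gamma> has_vector_derivative v) (at s)"
  shows "((\<lambda>t. u (\<Gamma> t)) has_real_derivative du (\<Gamma> s) v) (at s)"
proof (cases "\<Gamma> s = 0")
  case True
  have "\<forall>\<^sub>F t in nhds s. u (\<Gamma> t) = 0"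
    using eventually_small[OF has_vector_derivative_continuous[OF v] True] by eventually_elim (rule small(1))
  then have "((\<lambda>t. u (\<Gamma> t)) has_real_derivative 0) (at s)"
    using DERIV_cong_ev[of s s "\<lambda>t. u (\<Gamma> t)" "\<lambda>_. 0"] by simp
  then show ?thesis using True by (simp add: du_def)
next
  case False
  let ?\<mu> = "v / \<Gamma> s"
  have L: "((\<lambda>t. ln (cmod (\<Gamma> t))) has_real_derivative Re ?\<mu>) (at s)"
    by (rule polar_chain(1)[OF v False])
  have G: "((\<lambda>t. g (Arg (\<Gamma> t))) has_real_derivative g1 (Arg (\<Gamma> s)) * Im ?\<mu>) (at s)"
    by (rule polar_chain(2)[OF v False periodic g(1)])
  have ev: "\<forall>\<^sub>F t in nhds s. u (\<Gamma> t) = A (ln (cmod (\<Gamma> t))) * g (Arg (\<Gamma> t)) + X (ln (cmod (\<Gamma> t)))"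
  proof -
    have "\<forall>\<^sub>F t in nhds s. \<Gamma> t \<noteq> 0"
      using has_vector_derivative_continuous[OF v] False
      by (auto simp: isCont_def tendsto_at_iff_tendsto_nhds intro: tendsto_imp_eventually_ne)
    then show ?thesis by eventually_elim (simp add: u_def)
  qed
  have "((\<lambda>t. A (ln (cmod (\<Gamma> t))) * g (Arg (\<Gamma> t)) + X (ln (cmod (\<Gamma> t)))) has_real_derivative du (\<Gamma> s) v) (at s)"
    by (rule DERIV_cong[OF DERIV_add[OF DERIV_mult[OF DERIV_chain2[OF A(1) L] G] DERIV_chain2[OF X(1) L]]])
       (use False in \<open>simp add: du_def algebra_simps\<close>)
  then show ?thesis using DERIV_cong_ev[OF refl ev refl] by blast
qed

lemma du_der:
  assumes v: "(\<Gamma> has_vector_derivative v s) (at s)" and a: "(v has_vector_derivative a) (at s)"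
  shows "((\<lambda>t. du (\<Gamma> t) (v t)) has_real_derivative ddu (\<Gamma> s) (v s) a) (at s)"
proof (cases "\<Gamma> s = 0")
  case True
  have "\<forall>\<^sub>F t in nhds s. du (\<Gamma> t) (v t) = 0"
    using eventually_small[OF has_vector_derivative_continuous[OF v] True] by eventually_elim (rule small(2))
  then have "((\<lambda>t. du (\<Gamma> t) (v t)) has_real_derivative 0) (at s)"
    using DERIV_cong_ev[of s s "\<lambda>t. du (\<Gamma> t) (v t)" "\<lambda>_. 0"] by simp
  then show ?thesis using True by (simp add: ddu_def)
next
  case False
  let ?\<mu> = "v s / \<Gamma> s"
  have L: "((\<lambda>t. ln (cmod (\<Gamma> t))) has_real_derivative Re ?\<mu>) (at s)"
    by (rule polar_chain(1)[OF v False])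
  have G: "((\<lambda>t. g (Arg (\<Gamma> t))) has_real_derivative g1 (Arg (\<Gamma> s)) * Im ?\<mu>) (at s)"
    by (rule polar_chain(2)[OF v False periodic g(1)])
  have G1: "((\<lambda>t. g1 (Arg (\<Gamma> t))) has_real_derivative g2 (Arg (\<Gamma> s)) * Im ?\<mu>) (at s)"
    by (rule polar_chain(2)[OF v False g1_periodic g(2)])
  have inv: "((\<lambda>t. inverse (\<Gamma> t)) has_vector_derivative v s * - (inverse (\<Gamma> s) * 1 * inverse (\<Gamma> s))) (at s)"
    using field_vector_diff_chain_at[OF v DERIV_inverse'[OF DERIV_ident False]] by (simp add: o_def)
  have M: "((\<lambda>t. v t / \<Gamma> t) has_vector_derivative a / \<Gamma> s - ?\<mu>\<^sup>2) (at s)"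
    using has_vector_derivative_mult[OF a inv] False
    by (simp add: divide_inverse power2_eq_square algebra_simps)
  have Re: "((\<lambda>t. Re (v t / \<Gamma> t)) has_real_derivative Re (a / \<Gamma> s - ?\<mu>\<^sup>2)) (at s)"
    using bounded_linear.has_vector_derivative[OF bounded_linear_Re M]
    by (simp add: has_real_derivative_iff_has_vector_derivative)
  have Im: "((\<lambda>t. Im (v t / \<Gamma> t)) has_real_derivative Im (a / \<Gamma> s - ?\<mu>\<^sup>2)) (at s)"
    using bounded_linear.has_vector_derivative[OF bounded_linear_Im M]
    by (simp add: has_real_derivative_iff_has_vector_derivative)
  have ev: "\<forall>\<^sub>F t in nhds s. du (\<Gamma> t) (v t) =
     (A1 (ln (cmod (\<Gamma> t))) * g (Arg (\<Gamma> t)) + X1 (ln (cmod (\<Gamma> t)))) * Re (v t / \<Gamma> t)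
     + A (ln (cmod (\<Gamma> t))) * g1 (Arg (\<Gamma> t)) * Im (v t / \<Gamma> t)"
  proof -
    have "\<forall>\<^sub>F t in nhds s. \<Gamma> t \<noteq> 0"
      using has_vector_derivative_continuous[OF v] False
      by (auto simp: isCont_def tendsto_at_iff_tendsto_nhds intro: tendsto_imp_eventually_ne)
    then show ?thesis by eventually_elim (simp add: du_def)
  qed
  have "((\<lambda>t. (A1 (ln (cmod (\<Gamma> t))) * g (Arg (\<Gamma> t)) + X1 (ln (cmod (\<Gamma> t)))) * Re (v t / \<Gamma> t)
     + A (ln (cmod (\<Gamma> t))) * g1 (Arg (\<Gamma> t)) * Im (v t / \<Gamma> t)) has_real_derivative ddu (\<Gamma> s) (v s) a) (at s)"
    by (rule DERIV_cong[OF DERIV_add[OF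
          DERIV_mult[OF DERIV_add[OF DERIV_mult[OF DERIV_chain2[OF A(2) L] G] DERIV_chain2[OF X(2) L]] Re]
          DERIV_mult[OF DERIV_mult[OF DERIV_chain2[OF A(1) L] G1] Im]]])
       (use False in \<open>simp add: ddu_def power2_eq_square algebra_simps\<close>)
  then show ?thesis using DERIV_cong_ev[OF refl ev refl] by blast
qed

text \<open>Along a holomorphic \<open>F\<close> a horizontal line has velocity \<open>F'\<close>
  and acceleration \<open>F''\<close>, a vertical one \<open>\<i> F'\<close> and
  \<open>- F''\<close>. In the sum the accelerations cancel, the mixed terms cancel because the
  velocities are orthogonal, and the expression in \<open>laplacian\<close> remains, multiplied by
  \<open>(cmod (v / w))\<^sup>2\<close>.\<close>

lemma ddu_sum: "0 \<le> ddu w v a + ddu w (\<i> * v) (- a)"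
proof (cases "w = 0")
  case False
  define \<mu> where "\<mu> = v / w"
  have e: "Re (\<i> * v / w) = - Im \<mu>" "Im (\<i> * v / w) = Re \<mu>"
    "(\<i> * v / w)\<^sup>2 = - (\<mu>\<^sup>2)" "- a / w = - (a / w)"
    by (simp_all add: \<mu>_def power_divide power_mult_distrib flip: times_divide_eq_right)
  have "ddu w v a + ddu w (\<i> * v) (- a) =
     (A2 (ln (cmod w)) * g (Arg w) + X2 (ln (cmod w)) + A (ln (cmod w)) * g2 (Arg w)) * ((Re \<mu>)\<^sup>2 + (Im \<mu>)\<^sup>2)"
    unfolding ddu_def e \<mu>_def[symmetric] using False by (simp add: algebra_simps power2_eq_square)
  also have "0 \<le> \<dots>" using laplacian by simp
  finally show ?thesis .
qed (simp add: ddu_def)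

lemma continuous_on_Arg_comp:
  assumes "f = g \<or> f = g1 \<or> f = g2" "w \<noteq> 0"
  shows "isCont (\<lambda>w. f (Arg w)) w"
proof -
  have c: "continuous_on UNIV g" "continuous_on UNIV g1"
    using g by (auto intro!: continuous_at_imp_continuous_on DERIV_isCont)
  show ?thesis
    using assms isCont_periodic_Arg[OF periodic c(1)] isCont_periodic_Arg[OF g1_periodic c(2)]
      isCont_periodic_Arg[OF g2_periodic cont(3)] by auto
qed

lemma ddu_cont:
  assumes F: "continuous_on S F" "continuous_on S V" "continuous_on S a"
  shows "continuous_on S (\<lambda>z. ddu (F z) (V z) (a z))"
proof -
  have "isCont (\<lambda>x::complex \<times> complex \<times> complex. ddu (fst x) (fst (snd x)) (snd (snd x))) x" for x
  proof (cases "fst x = 0")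
    case True
    have "((\<lambda>y::complex \<times> complex \<times> complex. cmod (fst y)) \<longlongrightarrow> cmod (fst x)) (nhds x)"
      by (intro tendsto_norm tendsto_fst filterlim_ident)
    then have "\<forall>\<^sub>F y in nhds x. cmod (fst y) < exp T" using True by (intro order_tendstoD(2)) auto
    then have ev: "\<forall>\<^sub>F y in nhds x. ddu (fst y) (fst (snd y)) (snd (snd y)) = 0"
      by eventually_elim (rule small(3))
    show ?thesis using isCont_cong[OF ev] by simp
  next
    case False
    have "((\<lambda>y::complex \<times> complex \<times> complex. fst y) \<longlongrightarrow> fst x) (nhds x)"
      by (intro tendsto_fst filterlim_ident)
    then have "\<forall>\<^sub>F y in nhds x. fst y \<noteq> 0" by (rule tendsto_imp_eventually_ne[OF _ False])
    then have ev: "\<forall>\<^sub>F y in nhds x. ddu (fst y) (fst (snd y)) (snd (snd y)) =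
     (A2 (ln (cmod (fst y))) * g (Arg (fst y)) + X2 (ln (cmod (fst y)))) * (Re (fst (snd y) / fst y))\<^sup>2
     + 2 * A1 (ln (cmod (fst y))) * g1 (Arg (fst y)) * Re (fst (snd y) / fst y) * Im (fst (snd y) / fst y)
     + A (ln (cmod (fst y))) * g2 (Arg (fst y)) * (Im (fst (snd y) / fst y))\<^sup>2
     + (A1 (ln (cmod (fst y))) * g (Arg (fst y)) + X1 (ln (cmod (fst y)))) * Re (snd (snd y) / fst y - (fst (snd y) / fst y)\<^sup>2)
     + A (ln (cmod (fst y))) * g1 (Arg (fst y)) * Im (snd (snd y) / fst y - (fst (snd y) / fst y)\<^sup>2)"
      by eventually_elim (simp add: ddu_def)
    have cf: "isCont (fst :: complex \<times> complex \<times> complex \<Rightarrow> complex) x" by (intro continuous_intros)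
    have Ac: "isCont (\<lambda>y::complex \<times> complex \<times> complex. f (Arg (fst y))) x" if "f = g \<or> f = g1 \<or> f = g2" for f
      by (rule isCont_o2[OF cf continuous_on_Arg_comp[OF that False]])
    have Lc: "isCont (\<lambda>y::complex \<times> complex \<times> complex. f (ln (cmod (fst y)))) x"
      if f: "f = A \<or> f = A1 \<or> f = A2 \<or> f = X \<or> f = X1 \<or> f = X2" for f
    proof (rule isCont_o2[where f = "\<lambda>y::complex \<times> complex \<times> complex. ln (cmod (fst y))" and g = f])
      show "isCont (\<lambda>y::complex \<times> complex \<times> complex. ln (cmod (fst y))) x"
        using False by (intro continuous_intros) auto
      have "isCont A2 r" "isCont X2 r" for r using cont by (auto simp: continuous_on_eq_continuous_at)
      then show "isCont f (ln (cmod (fst x)))" 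
        using f DERIV_isCont[OF A(1)] DERIV_isCont[OF A(2)] DERIV_isCont[OF X(1)] DERIV_isCont[OF X(2)] by auto
    qed
    show ?thesis
      unfolding isCont_cong[OF ev]
      by (intro continuous_add continuous_mult continuous_power continuous_Re continuous_Im continuous_diff
          continuous_divide continuous_fst continuous_snd continuous_ident continuous_const Ac Lc)
         (use False in auto)
  qed
  then have "continuous_on UNIV (\<lambda>x::complex \<times> complex \<times> complex. ddu (fst x) (fst (snd x)) (snd (snd x)))"
    by (simp add: continuous_at_imp_continuous_on)
  from continuous_on_compose2[OF this continuous_on_Pair[OF F(1) continuous_on_Pair[OF F(2,3)]]]
  show ?thesis by simp
qed

text \<open>On the vertical sides and the top of the rectangle of width \<open>2 * R\<close> and
  height \<open>R\<close> above the line, the modulus of \<open>F\<close> is below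
  \<open>exp T\<close>; so \<open>u\<close> and its derivatives vanish there and
  \<open>laplacian_strip\<close> applies.\<close>

lemma integral_u_nonneg:
  assumes F: "F holomorphic_on {z. 0 < Im z}" and y0: "0 < y0" and R: "0 < R"
    and decay: "\<And>z. y0 \<le> Im z \<Longrightarrow> R \<le> cmod z \<Longrightarrow> cmod (F z) < exp T"
  shows "0 \<le> integral {-R..R} (\<lambda>x. u (F (Complex x y0)))"
proof -
  define H where "H = {z. 0 < Im z}"
  have oH: "open H" unfolding H_def by (rule open_halfspace_Im_gt)
  define F1 where "F1 = deriv F"
  define F2 where "F2 = deriv F1"
  have hol: "F holomorphic_on H" "F1 holomorphic_on H" "F2 holomorphic_on H"
    using F oH by (auto simp: H_def F1_def F2_def intro!: holomorphic_deriv)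
  have d1: "(F has_field_derivative F1 z) (at z)" and d2: "(F1 has_field_derivative F2 z) (at z)" if "z \<in> H" for z
    using hol oH that by (auto simp: F1_def F2_def intro!: holomorphic_derivI)
  have in_H: "Complex x y \<in> H" if "y0 \<le> y" for x y using that y0 by (simp add: H_def)
  have cC: "continuous_on ({-R..R} \<times> {y0..y0+R}) (\<lambda>z. f (Complex (fst z) (snd z)))" if "f holomorphic_on H" for f
  proof (rule continuous_on_compose2[OF holomorphic_on_imp_continuous_on[OF that]])
    show "continuous_on ({-R..R} \<times> {y0..y0+R}) (\<lambda>z. Complex (fst z) (snd z))"
      unfolding Complex_eq by (intro continuous_intros)
  qed (auto intro: in_H)
  have edge: "cmod (F (Complex x y)) < exp T" if "y0 \<le> y" "R \<le> \<bar>x\<bar> \<or> R \<le> y" for x y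
    by (rule decay) (use that abs_Re_le_cmod[of "Complex x y"] abs_Im_le_cmod[of "Complex x y"] in auto)
  show ?thesis
  proof (rule laplacian_strip[of "-R" R y0 "y0 + R"
      "\<lambda>x y. du (F (Complex x y)) (F1 (Complex x y))"
      "\<lambda>x y. ddu (F (Complex x y)) (F1 (Complex x y)) (F2 (Complex x y))"
      "\<lambda>x y. u (F (Complex x y))"
      "\<lambda>x y. du (F (Complex x y)) (\<i> * F1 (Complex x y))"
      "\<lambda>x y. ddu (F (Complex x y)) (\<i> * F1 (Complex x y)) (- F2 (Complex x y))"])
    fix x y assume y: "y0 \<le> y"
    show "((\<lambda>x. du (F (Complex x y)) (F1 (Complex x y))) has_real_derivative
       ddu (F (Complex x y)) (F1 (Complex x y)) (F2 (Complex x y))) (at x)"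
      by (intro du_der has_vector_derivative_horizontal d1 d2 in_H y)
    show "((\<lambda>y. u (F (Complex x y))) has_real_derivative du (F (Complex x y)) (\<i> * F1 (Complex x y))) (at y)"
      by (intro u_der has_vector_derivative_vertical d1 in_H y)
    have "((\<lambda>y. \<i> * F1 (Complex x y)) has_vector_derivative - F2 (Complex x y)) (at y)"
      using has_vector_derivative_mult_right[OF has_vector_derivative_vertical[OF d2[OF in_H[OF y]]], of \<i> x] by simp
    then show "((\<lambda>y. du (F (Complex x y)) (\<i> * F1 (Complex x y))) has_real_derivative
       ddu (F (Complex x y)) (\<i> * F1 (Complex x y)) (- F2 (Complex x y))) (at y)"
      by (intro du_der[where v = "\<lambda>y. \<i> * F1 (Complex x y)"] has_vector_derivative_vertical d1 in_H y)
    show "0 \<le> ddu (F (Complex x y)) (F1 (Complex x y)) (F2 (Complex x y)) +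
          ddu (F (Complex x y)) (\<i> * F1 (Complex x y)) (- F2 (Complex x y))"
      by (rule ddu_sum)
  qed (use R y0 in \<open>auto intro!: ddu_cont cC hol continuous_intros holomorphic_intros small edge\<close>)
qed

lemma u_line_cont:
  assumes F: "F holomorphic_on {z. 0 < Im z}" and y: "0 < y"
  shows "continuous_on UNIV (\<lambda>x. u (F (Complex x y)))"
proof -
  have "(F has_field_derivative deriv F (Complex x y)) (at (Complex x y))" for x
    using y by (intro holomorphic_derivI[OF F open_halfspace_Im_gt]) simp
  from u_der[OF has_vector_derivative_horizontal[OF this]] show ?thesis
    by (intro continuous_at_imp_continuous_on ballI) (rule DERIV_isCont)
qed

end

section \<open>Cutoffs in the logarithm of the modulus\<close>

lemma pos_part_power_der:
  fixes x :: real assumes "1 < n"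
  shows "((\<lambda>x. (max 0 x) ^ n) has_real_derivative real n * (max 0 x) ^ (n - 1)) (at x)"
proof -
  consider "x < 0" | "x = 0" | "0 < x" by linarith
  then show ?thesis
  proof cases
    case 1
    have "((\<lambda>_. 0) has_real_derivative real n * (max 0 x) ^ (n - 1)) (at x)" using 1 assms by (simp add: max_def zero_power)
    then show ?thesis
      by (rule has_field_derivative_transform_within_open[of _ _ _ "{..<0}"]) (use 1 assms in \<open>auto simp: max_def\<close>)
  next
    case 2
    have "((\<lambda>k::real. \<bar>k\<bar> ^ (n - 1)) \<longlongrightarrow> \<bar>0\<bar> ^ (n - 1)) (at 0)" by (intro tendsto_intros)
    moreover have "\<bar>0::real\<bar> ^ (n - 1) = 0" using assms by (simp add: zero_power)
    ultimately have lim: "((\<lambda>k::real. \<bar>k\<bar> ^ (n - 1)) \<longlongrightarrow> 0) (at 0)" by (simp only:)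
    have "((\<lambda>k. ((max 0 (0 + k)) ^ n - (max 0 0) ^ n) / k) \<longlongrightarrow> 0) (at (0::real))"
    proof (rule Lim_transform_bound[OF _ lim])
      have "\<bar>max 0 k ^ n / k\<bar> \<le> \<bar>k\<bar> ^ (n - 1)" for k :: real
      proof (cases "0 < k")
        case True
        then have "k ^ n / k = k ^ (n - 1)" using assms by (simp add: power_diff)
        then show ?thesis using True by simp
      qed (use assms in \<open>simp add: max_def zero_power\<close>)
      then show "\<forall>\<^sub>F k in at 0. norm (((max 0 (0 + k)) ^ n - (max 0 0) ^ n) / k) \<le> norm (\<bar>k::real\<bar> ^ (n - 1))"
        using assms by (intro always_eventually) (simp add: zero_power)
    qed
    then show ?thesis using 2 assms by (simp add: DERIV_def zero_power)
  next
    case 3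
    have "((\<lambda>x. x ^ n) has_real_derivative real n * (max 0 x) ^ (n - 1)) (at x)"
      using 3 by (auto intro!: derivative_eq_intros simp: max_def)
    then show ?thesis
      by (rule has_field_derivative_transform_within_open[of _ _ _ "{0<..}"]) (use 3 in \<open>auto simp: max_def\<close>)
  qed
qed

text \<open>The cube is the lowest integer power of the positive part whose second derivative is
  continuous.\<close>

definition cube0 :: "real \<Rightarrow> real" where "cube0 x = (max 0 x) ^ 3"
definition cube1 :: "real \<Rightarrow> real" where "cube1 x = 3 * (max 0 x) ^ 2"
definition cube2 :: "real \<Rightarrow> real" where "cube2 x = 6 * max 0 x"

lemma cube0_der: "(cube0 has_real_derivative cube1 x) (at x)"
  unfolding cube0_def[abs_def] cube1_def using pos_part_power_der[of 3 x] by simp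

lemma cube1_der: "(cube1 has_real_derivative cube2 x) (at x)"
  unfolding cube1_def[abs_def] cube2_def using DERIV_cmult[OF pos_part_power_der[of 2 x], of 3] by simp

lemma cube_nonneg: "0 \<le> cube0 x" "0 \<le> cube1 x" "0 \<le> cube2 x"
  by (simp_all add: cube0_def cube1_def cube2_def)

lemma cube_neg: "x \<le> 0 \<Longrightarrow> cube0 x = 0" "x \<le> 0 \<Longrightarrow> cube1 x = 0" "x \<le> 0 \<Longrightarrow> cube2 x = 0"
  by (simp_all add: cube0_def cube1_def cube2_def max_def)

lemma cube2_cont: "continuous_on UNIV cube2"
  unfolding cube2_def[abs_def] by (intro continuous_intros)

text \<open>A twice continuously differentiable step from 0 to 1 whose first two derivatives are
  bounded and explicit.\<close>

definition ramp0 :: "real \<Rightarrow> real" where "ramp0 x = cube0 x / (1 + cube0 x)"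
definition ramp1 :: "real \<Rightarrow> real" where "ramp1 x = cube1 x / (1 + cube0 x)\<^sup>2"
definition ramp2 :: "real \<Rightarrow> real" where
  "ramp2 x = cube2 x / (1 + cube0 x)\<^sup>2 - 2 * (cube1 x)\<^sup>2 / (1 + cube0 x) ^ 3"

lemma cube0_1: "1 + cube0 x \<noteq> 0" "0 < 1 + cube0 x"
  using cube_nonneg(1)[of x] by linarith+

lemma ramp0_der: "(ramp0 has_real_derivative ramp1 x) (at x)"
proof -
  have "(ramp0 has_real_derivative (cube1 x * (1 + cube0 x) - cube0 x * (0 + cube1 x)) / ((1 + cube0 x) * (1 + cube0 x))) (at x)"
    unfolding ramp0_def[abs_def]
    by (intro DERIV_divide DERIV_add DERIV_const cube0_der cube0_1)
  then show ?thesis by (simp add: ramp1_def power2_eq_square algebra_simps)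
qed

lemma ramp1_der: "(ramp1 has_real_derivative ramp2 x) (at x)"
proof -
  have 1: "((\<lambda>x. (1 + cube0 x)\<^sup>2) has_real_derivative 2 * (1 + cube0 x) * cube1 x) (at x)"
    by (rule DERIV_cong[OF DERIV_power[OF DERIV_add[OF DERIV_const cube0_der], of _ 2]]) simp
  have "(ramp1 has_real_derivative (cube2 x * (1 + cube0 x)\<^sup>2 - cube1 x * (2 * (1 + cube0 x) * cube1 x))
     / ((1 + cube0 x)\<^sup>2 * (1 + cube0 x)\<^sup>2)) (at x)"
    unfolding ramp1_def[abs_def]
    by (intro DERIV_divide 1 cube1_der) (use cube0_1 in auto)
  also have "(cube2 x * (1 + cube0 x)\<^sup>2 - cube1 x * (2 * (1 + cube0 x) * cube1 x))
     / ((1 + cube0 x)\<^sup>2 * (1 + cube0 x)\<^sup>2) = ramp2 x"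
  proof -
    have "(u * c\<^sup>2 - v * (2 * c * v)) / (c\<^sup>2 * c\<^sup>2) = u / c\<^sup>2 - 2 * v\<^sup>2 / c ^ 3" if "c \<noteq> 0" for u v c :: real
      using that by (simp add: diff_divide_distrib power2_eq_square power3_eq_cube mult_ac)
    then show ?thesis unfolding ramp2_def using cube0_1(1) by blast
  qed
  finally show ?thesis .
qed

lemma ramp2_cont: "continuous_on UNIV ramp2"
proof -
  have "continuous_on UNIV cube0" "continuous_on UNIV cube1"
    using cube0_der cube1_der by (auto intro!: continuous_at_imp_continuous_on DERIV_isCont)
  then show ?thesis
    unfolding ramp2_def[abs_def] using cube0_1
    by (intro continuous_intros cube2_cont) auto
qed

lemma ramp_neg: "x \<le> 0 \<Longrightarrow> ramp0 x = 0" "x \<le> 0 \<Longrightarrow> ramp1 x = 0" "x \<le> 0 \<Longrightarrow> ramp2 x = 0"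
  by (simp_all add: ramp0_def ramp1_def ramp2_def cube_neg)

lemma ramp0_bounds: "0 \<le> ramp0 x" "ramp0 x \<le> 1"
  using cube_nonneg(1)[of x] by (simp_all add: ramp0_def field_simps)

text \<open>The values 3 and 24 = 6 + 18 come from \<open>m \<le> c\<close> and
  \<open>m\<^sup>2 \<le> c\<close> for \<open>c = 1 + m ^ 3\<close>. They reappear in the smallness
  condition on \<epsilon> as \<open>6 * p * \<epsilon> + 24 * \<epsilon>\<^sup>2\<close>.\<close>

lemma ramp_bounds: "\<bar>ramp1 x\<bar> \<le> 3" "\<bar>ramp2 x\<bar> \<le> 24"
proof -
  define m where "m = max 0 x"
  define c where "c = 1 + m ^ 3"
  have m: "0 \<le> m" by (simp add: m_def)
  then have c: "1 \<le> c" by (simp add: c_def)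
  have mc: "m \<le> c"
  proof (cases "m \<le> 1")
    case False
    then have "m ^ 1 \<le> m ^ 3" by (intro power_increasing) auto
    then show ?thesis by (simp add: c_def)
  qed (use c in linarith)
  have m2c: "m\<^sup>2 \<le> c"
  proof (cases "m \<le> 1")
    case True
    then show ?thesis using m c power_le_one[of m 2] by linarith
  next
    case False
    then have "m ^ 2 \<le> m ^ 3" by (intro power_increasing) auto
    then show ?thesis by (simp add: c_def)
  qed
  have c2: "c \<le> c\<^sup>2" using c by (simp add: self_le_power)
  have "3 * m\<^sup>2 / c\<^sup>2 \<le> 3"
    using m2c c c2 by (simp add: pos_divide_le_eq)
  moreover have "ramp1 x = 3 * m\<^sup>2 / c\<^sup>2" by (simp add: ramp1_def cube0_def cube1_def m_def c_def)
  ultimately show "\<bar>ramp1 x\<bar> \<le> 3" by simp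
  have r2: "ramp2 x = 6 * m / c\<^sup>2 - 2 * (3 * m\<^sup>2)\<^sup>2 / c ^ 3"
    by (simp add: ramp2_def cube0_def cube1_def cube2_def m_def c_def)
  have a: "6 * m / c\<^sup>2 \<le> 6" "0 \<le> 6 * m / c\<^sup>2" using mc c c2 m by (simp_all add: pos_divide_le_eq)
  have "(m\<^sup>2)\<^sup>2 \<le> c\<^sup>2" using m2c by (intro power_mono) auto
  also have "c\<^sup>2 \<le> c ^ 3" using c by (intro power_increasing) auto
  finally have b: "2 * (3 * m\<^sup>2)\<^sup>2 / c ^ 3 \<le> 18" "0 \<le> 2 * (3 * m\<^sup>2)\<^sup>2 / c ^ 3"
    using c by (simp_all add: pos_divide_le_eq power_mult_distrib)
  show "\<bar>ramp2 x\<bar> \<le> 24" unfolding r2 using a b by linarith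
qed

lemma ramp0_at_top: "(ramp0 \<longlongrightarrow> 1) at_top"
proof -
  have "((\<lambda>x::real. x ^ 3 / (1 + x ^ 3)) \<longlongrightarrow> 1) at_top" by real_asymp
  moreover have "\<forall>\<^sub>F x in at_top. x ^ 3 / (1 + x ^ 3) = ramp0 x"
    using eventually_gt_at_top[of 0] by eventually_elim (simp add: ramp0_def cube0_def max_def)
  ultimately show ?thesis by (rule Lim_transform_eventually)
qed

context
  fixes p \<epsilon> \<eta> T :: real
begin

text \<open>Here \<open>r\<close> is the logarithm of the modulus. For large \<open>r\<close> this
  behaves like \<open>\<eta> * exp (p * r)\<close>, that is, \<open>\<eta> * cmod w powr p\<close>;
  the cubed difference starts at \<open>T\<close> with two continuous derivatives, and its second
  derivative is nonnegative.\<close>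

definition "corr0 r = \<eta> * cube0 (exp (p / 3 * r) - exp (p / 3 * T))"
definition "corr1 r = \<eta> * (cube1 (exp (p / 3 * r) - exp (p / 3 * T)) * (p / 3 * exp (p / 3 * r)))"
definition "corr2 r = \<eta> * (cube2 (exp (p / 3 * r) - exp (p / 3 * T)) * (p / 3 * exp (p / 3 * r)) * (p / 3 * exp (p / 3 * r))
   + cube1 (exp (p / 3 * r) - exp (p / 3 * T)) * (p / 3 * (p / 3 * exp (p / 3 * r))))"
text \<open>From here on \<open>exp (p / 3 * r)\<close> is at least twice
  \<open>exp (p / 3 * T)\<close>, so that the correction already has its full order of growth when
  the main term sets in.\<close>

definition "onset = T + 3 * ln 2 / p"
text \<open>The ramp is stretched by \<open>1 / \<epsilon>\<close>: each derivative that falls on it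
  costs a factor \<epsilon> relative to \<open>exp (p * r)\<close>.\<close>

definition "main0 r = exp (p * r) * ramp0 (\<epsilon> * (r - onset))"
definition "main1 r = exp (p * r) * (p * ramp0 (\<epsilon> * (r - onset)) + \<epsilon> * ramp1 (\<epsilon> * (r - onset)))"
definition "main2 r = exp (p * r) * (p\<^sup>2 * ramp0 (\<epsilon> * (r - onset)) + 2 * p * \<epsilon> * ramp1 (\<epsilon> * (r - onset)) + \<epsilon>\<^sup>2 * ramp2 (\<epsilon> * (r - onset)))"

lemma corr_ders: "(corr0 has_real_derivative corr1 r) (at r)" "(corr1 has_real_derivative corr2 r) (at r)"
proof -
  have e: "((\<lambda>r. exp (p / 3 * r) - exp (p / 3 * T)) has_real_derivative p / 3 * exp (p / 3 * r)) (at r)"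
    "((\<lambda>r. p / 3 * exp (p / 3 * r)) has_real_derivative p / 3 * (p / 3 * exp (p / 3 * r))) (at r)"
    by (auto intro!: derivative_eq_intros)
  show "(corr0 has_real_derivative corr1 r) (at r)"
    unfolding corr0_def[abs_def] corr1_def by (intro DERIV_cmult DERIV_chain2[OF cube0_der e(1)])
  show "(corr1 has_real_derivative corr2 r) (at r)"
    unfolding corr1_def[abs_def] corr2_def
    by (rule DERIV_cong[OF DERIV_cmult[OF DERIV_mult[OF DERIV_chain2[OF cube1_der e(1)] e(2)]]])
       (simp add: algebra_simps)
qed

lemma main_ders: "(main0 has_real_derivative main1 r) (at r)" "(main1 has_real_derivative main2 r) (at r)"
proof -
  have l: "((\<lambda>r. \<epsilon> * (r - onset)) has_real_derivative \<epsilon>) (at r)"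
    and e: "((\<lambda>r. exp (p * r)) has_real_derivative p * exp (p * r)) (at r)"
    by (auto intro!: derivative_eq_intros)
  show "(main0 has_real_derivative main1 r) (at r)"
    unfolding main0_def[abs_def] main1_def
    by (rule DERIV_cong[OF DERIV_mult[OF e DERIV_chain2[OF ramp0_der l]]]) (simp add: algebra_simps)
  show "(main1 has_real_derivative main2 r) (at r)"
    unfolding main1_def[abs_def] main2_def
    by (rule DERIV_cong[OF DERIV_mult[OF e DERIV_add[OF DERIV_cmult[OF DERIV_chain2[OF ramp0_der l]]
            DERIV_cmult[OF DERIV_chain2[OF ramp1_der l]]]]])
       (simp add: algebra_simps power2_eq_square)
qed

lemma corr2_cont: "continuous_on UNIV corr2"
proof -
  have "continuous_on UNIV cube1"
    using cube1_der by (auto intro!: continuous_at_imp_continuous_on DERIV_isCont)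
  then have "continuous_on UNIV (\<lambda>r. cube1 (exp (p / 3 * r) - exp (p / 3 * T)))"
    by (rule continuous_on_compose2) (auto intro!: continuous_intros)
  moreover have "continuous_on UNIV (\<lambda>r. cube2 (exp (p / 3 * r) - exp (p / 3 * T)))"
    by (rule continuous_on_compose2[OF cube2_cont]) (auto intro!: continuous_intros)
  moreover have "continuous_on UNIV (\<lambda>r. exp (p / 3 * r))" by (intro continuous_intros)
  ultimately show ?thesis
    unfolding corr2_def[abs_def]
    by (intro continuous_on_mult continuous_on_add continuous_on_const)
qed

lemma main2_cont: "continuous_on UNIV main2"
proof -
  have "continuous_on UNIV ramp0" "continuous_on UNIV ramp1"
    using ramp0_der ramp1_der by (auto intro!: continuous_at_imp_continuous_on DERIV_isCont)
  then have "continuous_on UNIV f" if "f = ramp0 \<or> f = ramp1 \<or> f = ramp2" for f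
    using that ramp2_cont by blast
  then have "continuous_on UNIV (\<lambda>r. f (\<epsilon> * (r - onset)))" if "f = ramp0 \<or> f = ramp1 \<or> f = ramp2" for f
    by (rule continuous_on_compose2[OF _ _ subset_UNIV]) (use that in \<open>simp, intro continuous_intros\<close>)
  moreover have "continuous_on UNIV (\<lambda>r. exp (p * r))" by (intro continuous_intros)
  ultimately show ?thesis
    unfolding main2_def[abs_def]
    by (intro continuous_on_mult continuous_on_add continuous_on_const) auto
qed

text \<open>The term \<open>corr0\<close> absorbs the error that the cutoff \<open>ramp0\<close> makes in the Laplacian of
  \<open>exp (p * r) * g t\<close>.\<close>

lemma polar_cutoff:
  assumes p: "1 < p" and \<epsilon>: "0 < \<epsilon>" and \<eta>: "0 < \<eta>"
    and g: "\<And>t. (g has_real_derivative g1 t) (at t)" "\<And>t. (g1 has_real_derivative g2 t) (at t)"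
      "continuous_on UNIV g2" "\<And>t. g (t + pi) = g t"
    and conv: "\<And>t. 0 \<le> g2 t + p\<^sup>2 * g t" and M: "\<And>t. \<bar>g t\<bar> \<le> M"
    and small: "(6 * p * \<epsilon> + 24 * \<epsilon>\<^sup>2) * M \<le> \<eta> * p\<^sup>2 / 3"
  shows "polar_function main0 main1 main2 corr0 corr1 corr2 g g1 g2 T"
proof
  have TT: "T \<le> onset" using p by (simp add: onset_def)
  have sm: "\<epsilon> * (r - onset) \<le> 0" if "r < T" for r using that TT \<epsilon> by (intro mult_nonneg_nonpos) auto
  have se: "exp (p / 3 * r) - exp (p / 3 * T) \<le> 0" if "r < T" for r using that p by simp
  show "main0 r = 0" "main1 r = 0" "main2 r = 0" if "r < T" for r
    using ramp_neg[OF sm[OF that]] by (simp_all add: main0_def main1_def main2_def)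
  show "corr0 r = 0" "corr1 r = 0" "corr2 r = 0" if "r < T" for r
    using cube_neg[OF se[OF that]] by (simp_all add: corr0_def corr1_def corr2_def)
  have M0: "0 \<le> M" using M[of 0] by linarith
  fix r t
  let ?s = "\<epsilon> * (r - onset)"
  have e: "main2 r * g t + corr2 r + main0 r * g2 t =
     exp (p * r) * (ramp0 ?s * (g2 t + p\<^sup>2 * g t)) + exp (p * r) * ((2 * p * \<epsilon> * ramp1 ?s + \<epsilon>\<^sup>2 * ramp2 ?s) * g t) + corr2 r"
    by (simp add: main2_def main0_def algebra_simps)
  have a: "0 \<le> exp (p * r) * (ramp0 ?s * (g2 t + p\<^sup>2 * g t))"
    using conv[of t] ramp0_bounds(1)[of ?s] by simp
  have X2n: "0 \<le> corr2 r" using \<eta> p cube_nonneg by (simp add: corr2_def)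
  have "0 \<le> exp (p * r) * ((2 * p * \<epsilon> * ramp1 ?s + \<epsilon>\<^sup>2 * ramp2 ?s) * g t) + corr2 r"
  proof (cases "r \<le> onset")
    case True
    then have "?s \<le> 0" using \<epsilon> by (intro mult_nonneg_nonpos) auto
    then show ?thesis using X2n by (simp add: ramp_neg)
  next
    case False
    define E where "E = exp (p / 3 * r)"
    define E0 where "E0 = exp (p / 3 * T)"
    have E3: "exp (p * r) = E ^ 3" unfolding E_def exp_of_nat_mult[symmetric] by simp
    have "p / 3 * onset = p / 3 * T + ln 2" using p by (simp add: onset_def field_simps)
    then have "exp (p / 3 * onset) = 2 * E0" by (simp only: E0_def exp_add) simp
    moreover have "exp (p / 3 * onset) \<le> E" using False p by (simp add: E_def)
    ultimately have EE: "E / 2 \<le> E - E0" by simp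
    have Ep: "0 < E" by (simp add: E_def)
    have "\<bar>2 * p * \<epsilon> * ramp1 ?s + \<epsilon>\<^sup>2 * ramp2 ?s\<bar> \<le> 2 * p * \<epsilon> * 3 + \<epsilon>\<^sup>2 * 24"
      using p \<epsilon> ramp_bounds[of ?s]
      by (intro order_trans[OF abs_triangle_ineq] add_mono) (simp_all add: abs_mult mult_left_mono)
    then have "\<bar>(2 * p * \<epsilon> * ramp1 ?s + \<epsilon>\<^sup>2 * ramp2 ?s) * g t\<bar> \<le> (6 * p * \<epsilon> + 24 * \<epsilon>\<^sup>2) * M"
      unfolding abs_mult by (intro mult_mono) (use M p \<epsilon> in \<open>auto simp: algebra_simps\<close>)
    then have "- (\<eta> * p\<^sup>2 / 3) \<le> (2 * p * \<epsilon> * ramp1 ?s + \<epsilon>\<^sup>2 * ramp2 ?s) * g t" using small by linarith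
    then have b: "E ^ 3 * (- (\<eta> * p\<^sup>2 / 3)) \<le> exp (p * r) * ((2 * p * \<epsilon> * ramp1 ?s + \<epsilon>\<^sup>2 * ramp2 ?s) * g t)"
      unfolding E3 using Ep by (intro mult_left_mono) auto
    \<comment> \<open>The correction thereby contributes at least
      \<open>\<eta> * p\<^sup>2 / 3 * exp (p * r)\<close>, which is the amount that
      \<open>small\<close> allots to the error of the cutoff.\<close>
    have "3 * E \<le> cube2 (E - E0)" using EE Ep by (simp add: cube2_def max_def)
    then have "(3 * E) * (p / 3 * E) * (p / 3 * E) \<le> cube2 (E - E0) * (p / 3 * E) * (p / 3 * E)"
      using p Ep by (intro mult_right_mono) auto
    also have "\<dots> \<le> cube2 (E - E0) * (p / 3 * E) * (p / 3 * E) + cube1 (E - E0) * (p / 3 * (p / 3 * E))"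
      using p Ep cube_nonneg(2)[of "E - E0"] by simp
    finally have "\<eta> * ((3 * E) * (p / 3 * E) * (p / 3 * E)) \<le> corr2 r"
      unfolding corr2_def E_def[symmetric] E0_def[symmetric] using \<eta> by (intro mult_left_mono) auto
    moreover have "\<eta> * ((3 * E) * (p / 3 * E) * (p / 3 * E)) = E ^ 3 * (\<eta> * p\<^sup>2 / 3)"
      by (simp add: power2_eq_square power3_eq_cube)
    ultimately show ?thesis using b by linarith
  qed
  then show "0 \<le> main2 r * g t + corr2 r + main0 r * g2 t" unfolding e using a by simp
qed (use main_ders corr_ders main2_cont corr2_cont g in auto)

lemma cutoff_bounds:
  assumes "0 < \<eta>"
  shows "0 \<le> main0 r" "main0 r \<le> exp (p * r)" "0 \<le> corr0 r" "corr0 r \<le> \<eta> * exp (p * r)"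
proof -
  show "0 \<le> main0 r" "main0 r \<le> exp (p * r)" using ramp0_bounds by (simp_all add: main0_def mult_left_le)
  show "0 \<le> corr0 r" using assms cube_nonneg by (simp add: corr0_def)
  have "cube0 (exp (p / 3 * r) - exp (p / 3 * T)) \<le> exp (p / 3 * r) ^ 3"
    unfolding cube0_def by (intro power_mono) auto
  also have "\<dots> = exp (p * r)" unfolding exp_of_nat_mult[symmetric] by simp
  finally show "corr0 r \<le> \<eta> * exp (p * r)" using assms by (simp add: corr0_def)
qed

end

section \<open>Nonnegative integrals of homogeneous functions\<close>

lemma periodic_bounded:
  fixes g :: "real \<Rightarrow> real"
  assumes c: "continuous_on UNIV g" and per: "\<And>t. g (t + pi) = g t"
  obtains M where "0 \<le> M" "\<And>t. \<bar>g t\<bar> \<le> M"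
proof -
  have "compact (g ` {0..pi})" by (rule compact_continuous_image[OF continuous_on_subset[OF c]]) auto
  then have "bounded (g ` {0..pi})" by (rule compact_imp_bounded)
  then obtain M where M: "\<And>t. t \<in> {0..pi} \<Longrightarrow> \<bar>g t\<bar> \<le> M" by (fastforce simp: bounded_iff)
  have "\<bar>g t\<bar> \<le> M" for t
  proof -
    define k where "k = \<lfloor>t / pi\<rfloor>"
    have "of_int k \<le> t / pi" "t / pi < of_int k + 1" unfolding k_def by linarith+
    then have "t - pi * of_int k \<in> {0..pi}" unfolding k_def[symmetric] by (simp add: field_simps)
    then show ?thesis using M periodic_int[of g t k, OF per] by metis
  qed
  moreover have "0 \<le> M" using M[of 0] by auto
  ultimately show ?thesis using that by blast
qed

lemma lborel_integral_eq_interval: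
  fixes f :: "real \<Rightarrow> real"
  assumes "integrable lborel f" and z: "\<And>x. x \<notin> {a..b} \<Longrightarrow> f x = 0"
  shows "integral\<^sup>L lborel f = integral {a..b} f"
proof -
  have "(f has_integral integral\<^sup>L lborel f) UNIV" by (rule has_integral_integral_lborel[OF assms(1)])
  then have "integral\<^sup>L lborel f = integral UNIV f" by (simp add: integral_unique)
  also have "\<dots> = integral UNIV (\<lambda>x. if x \<in> {a..b} then f x else 0)"
    by (rule integral_cong) (use z in auto)
  also have "\<dots> = integral {a..b} f" by (rule integral_restrict_UNIV)
  finally show ?thesis .
qed

text \<open>The function \<open>r powr p * g \<theta>\<close> in polar coordinates; at the origin it
  is 0 because \<open>0 powr p = 0\<close>, whatever \<open>Arg 0\<close> is.\<close>

definition hom :: "real \<Rightarrow> (real \<Rightarrow> real) \<Rightarrow> complex \<Rightarrow> real" where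
  "hom p g w = cmod w powr p * g (Arg w)"

lemma hom_bound: "(\<And>t. \<bar>g t\<bar> \<le> M) \<Longrightarrow> \<bar>hom p g w\<bar> \<le> M * cmod w powr p"
  by (simp add: hom_def abs_mult mult.commute mult_right_mono)

lemma hom_cont:
  assumes p: "0 < p" and c: "continuous_on UNIV g" and per: "\<And>t. g (t + pi) = g t"
  shows "continuous_on UNIV (hom p g)"
proof -
  obtain M where M: "0 \<le> M" "\<And>t. \<bar>g t\<bar> \<le> M" using periodic_bounded[OF c per] by blast
  have "isCont (hom p g) w" for w
  proof (cases "w = 0")
    case True
    have "((\<lambda>w::complex. M * cmod w powr p) \<longlongrightarrow> M * cmod 0 powr p) (at 0)"
      using p by (intro tendsto_mult tendsto_const tendsto_powr' tendsto_norm tendsto_ident_at) auto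
    then have "((\<lambda>w::complex. M * cmod w powr p) \<longlongrightarrow> 0) (at 0)" by simp
    then have "(hom p g \<longlongrightarrow> 0) (at 0)"
      by (rule Lim_null_comparison[rotated]) (auto intro!: always_eventually hom_bound M)
    then show ?thesis using True by (simp add: isCont_def hom_def)
  next
    case False
    have "isCont (\<lambda>w. g (Arg w)) w" by (rule isCont_periodic_Arg[OF per c False])
    moreover have "isCont (\<lambda>w::complex. cmod w powr p) w"
      using False unfolding isCont_def by (intro tendsto_powr tendsto_norm tendsto_ident_at tendsto_const) auto
    ultimately show ?thesis unfolding hom_def[abs_def] by (intro continuous_mult)
  qed
  then show ?thesis by (simp add: continuous_at_imp_continuous_on)
qed

text \<open>The threshold \<open>T n\<close> moves to minus infinity while \<epsilon> stays fixed,
  which is possible because the smallness condition does not involve \<open>T\<close>. The cut-off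
  functions then tend to \<open>cmod w powr p * (g (Arg w) + \<eta>)\<close>, dominated by a
  multiple of the integrable function \<open>cmod (F z) powr p\<close>.\<close>

lemma hom_integral_smooth_eps:
  assumes F: "F holomorphic_on {z. 0 < Im z}" and y0: "0 < y0" and p: "1 < p" and \<eta>: "0 < \<eta>"
    and decay: "\<And>e. 0 < e \<Longrightarrow> \<exists>R>0. \<forall>z. y0 \<le> Im z \<longrightarrow> R \<le> cmod z \<longrightarrow> cmod (F z) < e"
    and int: "integrable lborel (\<lambda>x. cmod (F (Complex x y0)) powr p)"
    and g: "\<And>t. (g has_real_derivative g1 t) (at t)" "\<And>t. (g1 has_real_derivative g2 t) (at t)"
      "continuous_on UNIV g2" "\<And>t. g (t + pi) = g t"
    and conv: "\<And>t. 0 \<le> g2 t + p\<^sup>2 * g t"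
  shows "0 \<le> (\<integral>x. hom p (\<lambda>t. g t + \<eta>) (F (Complex x y0)) \<partial>lborel)"
proof -
  have gc: "continuous_on UNIV g" using g(1) by (auto intro!: continuous_at_imp_continuous_on DERIV_isCont)
  obtain M where M: "0 \<le> M" "\<And>t. \<bar>g t\<bar> \<le> M" using periodic_bounded[OF gc g(4)] by blast
  \<comment> \<open>The summand 1 keeps \<open>K\<close> positive when \<open>M = 0\<close>. Below,
    the bound \<open>\<epsilon> \<le> 1\<close> allows replacing \<open>\<epsilon>\<^sup>2\<close>
    by \<epsilon>.\<close>
  define K where "K = (6 * p + 24) * M + 1"
  have K: "0 < K" "(6 * p + 24) * M \<le> K" using p M(1) by (auto simp: K_def intro!: add_nonneg_pos)
  define \<epsilon> where "\<epsilon> = min 1 (\<eta> * p\<^sup>2 / 3 / K)"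
  have eps: "0 < \<epsilon>" "\<epsilon> \<le> 1" "\<epsilon> * K \<le> \<eta> * p\<^sup>2 / 3"
  proof -
    show "0 < \<epsilon>" "\<epsilon> \<le> 1" using \<eta> p K by (simp_all add: \<epsilon>_def)
    have "\<epsilon> * K \<le> (\<eta> * p\<^sup>2 / 3 / K) * K" using K by (intro mult_right_mono) (auto simp: \<epsilon>_def)
    then show "\<epsilon> * K \<le> \<eta> * p\<^sup>2 / 3" using K by simp
  qed
  have small: "(6 * p * \<epsilon> + 24 * \<epsilon>\<^sup>2) * M \<le> \<eta> * p\<^sup>2 / 3"
  proof -
    have "\<epsilon>\<^sup>2 \<le> \<epsilon>" using eps by (simp add: power2_eq_square mult_left_le)
    then have "(6 * p * \<epsilon> + 24 * \<epsilon>\<^sup>2) * M \<le> (6 * p * \<epsilon> + 24 * \<epsilon>) * M" using M by (intro mult_right_mono) auto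
    also have "\<dots> = \<epsilon> * ((6 * p + 24) * M)" by (simp add: algebra_simps)
    also have "\<dots> \<le> \<epsilon> * K" using eps K by (intro mult_left_mono) auto
    finally show ?thesis using eps by simp
  qed
  define T where "T n = - real n" for n :: nat
  define u where "u n = polar_function.u (main0 p \<epsilon> (T n)) (corr0 p \<eta> (T n)) g" for n
  have PF: "polar_function (main0 p \<epsilon> (T n)) (main1 p \<epsilon> (T n)) (main2 p \<epsilon> (T n)) (corr0 p \<eta> (T n)) (corr1 p \<eta> (T n)) (corr2 p \<eta> (T n)) g g1 g2 (T n)" for n
    by (rule polar_cutoff[OF p eps(1) \<eta> g conv M(2) small])
  have u_eq: "u n w = (if w = 0 then 0 else main0 p \<epsilon> (T n) (ln (cmod w)) * g (Arg w) + corr0 p \<eta> (T n) (ln (cmod w)))" for n w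
    unfolding u_def polar_function.u_def[OF PF] ..
  have expln: "exp (p * ln (cmod w)) = cmod w powr p" if "w \<noteq> 0" for w :: complex
    using that by (simp add: powr_def)
  have u_bound: "\<bar>u n w\<bar> \<le> (M + \<eta>) * cmod w powr p" for n w
  proof (cases "w = 0")
    case False
    let ?r = "ln (cmod w)"
    have "0 \<le> main0 p \<epsilon> (T n) ?r" "main0 p \<epsilon> (T n) ?r \<le> exp (p * ?r)"
      "0 \<le> corr0 p \<eta> (T n) ?r" "corr0 p \<eta> (T n) ?r \<le> \<eta> * exp (p * ?r)"
      by (rule cutoff_bounds[OF \<eta>])+
    note b = this[unfolded expln[OF False]]
    have "\<bar>main0 p \<epsilon> (T n) ?r * g (Arg w)\<bar> \<le> cmod w powr p * M"
      unfolding abs_mult using b M by (intro mult_mono) auto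
    then show ?thesis using b False by (simp add: u_eq algebra_simps)
  qed (simp add: u_eq)
  have u_lim: "(\<lambda>n. u n w) \<longlonglongrightarrow> hom p (\<lambda>t. g t + \<eta>) w" for w
  proof (cases "w = 0")
    case False
    let ?r = "ln (cmod w)"
    have "filterlim (\<lambda>n. \<epsilon> * (?r - onset p (T n))) at_top sequentially"
    proof -
      have "filterlim (\<lambda>n. (?r - 3 * ln 2 / p) + real n) at_top sequentially"
        by (rule filterlim_tendsto_add_at_top[OF tendsto_const filterlim_real_sequentially])
      then have "filterlim (\<lambda>n. \<epsilon> * ((?r - 3 * ln 2 / p) + real n)) at_top sequentially"
        by (rule filterlim_tendsto_pos_mult_at_top[OF tendsto_const eps(1)])
      then show ?thesis by (simp add: onset_def T_def algebra_simps)
    qed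
    then have "(\<lambda>n. ramp0 (\<epsilon> * (?r - onset p (T n)))) \<longlonglongrightarrow> 1"
      by (rule filterlim_compose[OF ramp0_at_top])
    then have "(\<lambda>n. exp (p * ?r) * ramp0 (\<epsilon> * (?r - onset p (T n)))) \<longlonglongrightarrow> exp (p * ?r) * 1"
      by (intro tendsto_mult tendsto_const)
    then have A: "(\<lambda>n. main0 p \<epsilon> (T n) ?r) \<longlonglongrightarrow> cmod w powr p"
      unfolding main0_def expln[OF False] by simp
    have "(\<lambda>n. exp (p / 3 * T n)) \<longlonglongrightarrow> 0"
      unfolding T_def using p by real_asymp
    then have "(\<lambda>n. exp (p / 3 * ?r) - exp (p / 3 * T n)) \<longlonglongrightarrow> exp (p / 3 * ?r) - 0"
      by (intro tendsto_diff tendsto_const)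
    then have "(\<lambda>n. cube0 (exp (p / 3 * ?r) - exp (p / 3 * T n))) \<longlonglongrightarrow> cube0 (exp (p / 3 * ?r) - 0)"
      by (rule isCont_tendsto_compose[OF DERIV_isCont[OF cube0_der]])
    moreover have "cube0 (exp (p / 3 * ?r) - 0) = cmod w powr p"
      unfolding expln[OF False, symmetric] by (simp add: cube0_def max_def exp_of_nat_mult[symmetric])
    ultimately have "(\<lambda>n. corr0 p \<eta> (T n) ?r) \<longlonglongrightarrow> \<eta> * cmod w powr p"
      unfolding corr0_def by (intro tendsto_mult tendsto_const) simp
    with A have "(\<lambda>n. main0 p \<epsilon> (T n) ?r * g (Arg w) + corr0 p \<eta> (T n) ?r) \<longlonglongrightarrow> cmod w powr p * g (Arg w) + \<eta> * cmod w powr p"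
      by (intro tendsto_add tendsto_mult tendsto_const)
    then show ?thesis using False by (simp add: u_eq hom_def algebra_simps)
  qed (simp add: u_eq hom_def)
  have meas: "(\<lambda>x. u n (F (Complex x y0))) \<in> borel_measurable lborel" for n
    using polar_function.u_line_cont[OF PF F y0] unfolding u_def
    by (simp add: borel_measurable_continuous_onI)
  have dom: "integrable lborel (\<lambda>x. (M + \<eta>) * cmod (F (Complex x y0)) powr p)"
    by (intro integrable_mult_right int)
  have int_u: "integrable lborel (\<lambda>x. u n (F (Complex x y0)))" for n
    by (rule Bochner_Integration.integrable_bound[OF dom meas]) (use u_bound in \<open>auto intro: order_trans[OF _ abs_ge_self]\<close>)
  have pos: "0 \<le> (\<integral>x. u n (F (Complex x y0)) \<partial>lborel)" for n
  proof -
    obtain R where R: "0 < R" "\<And>z. y0 \<le> Im z \<Longrightarrow> R \<le> cmod z \<Longrightarrow> cmod (F z) < exp (T n)"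
      using decay[of "exp (T n)"] by auto
    have "u n (F (Complex x y0)) = 0" if "x \<notin> {-R..R}" for x
    proof -
      have "R \<le> cmod (Complex x y0)" using that abs_Re_le_cmod[of "Complex x y0"] by auto
      then show ?thesis unfolding u_def by (intro polar_function.small(1)[OF PF] R) auto
    qed
    from lborel_integral_eq_interval[OF int_u this]
    have "(\<integral>x. u n (F (Complex x y0)) \<partial>lborel) = integral {-R..R} (\<lambda>x. u n (F (Complex x y0)))" .
    also have "0 \<le> \<dots>" unfolding u_def by (rule polar_function.integral_u_nonneg[OF PF F y0 R])
    finally show ?thesis .
  qed
  have "(\<lambda>n. \<integral>x. u n (F (Complex x y0)) \<partial>lborel) \<longlonglongrightarrow> (\<integral>x. hom p (\<lambda>t. g t + \<eta>) (F (Complex x y0)) \<partial>lborel)"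
  proof (rule integral_dominated_convergence[OF _ meas dom])
    show "(\<lambda>x. hom p (\<lambda>t. g t + \<eta>) (F (Complex x y0))) \<in> borel_measurable lborel"
      by (rule borel_measurable_LIMSEQ_real[OF u_lim meas])
  qed (use u_lim u_bound in auto)
  then show ?thesis by (rule LIMSEQ_le_const) (use pos in auto)
qed

text \<open>The surplus \<eta> enters linearly, multiplied by the finite integral of
  \<open>cmod (F z) powr p\<close>, and disappears as it tends to 0.\<close>

lemma hom_integral_smooth:
  assumes F: "F holomorphic_on {z. 0 < Im z}" and y0: "0 < y0" and p: "1 < p"
    and decay: "\<And>e. 0 < e \<Longrightarrow> \<exists>R>0. \<forall>z. y0 \<le> Im z \<longrightarrow> R \<le> cmod z \<longrightarrow> cmod (F z) < e"
    and int: "integrable lborel (\<lambda>x. cmod (F (Complex x y0)) powr p)"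
    and g: "\<And>t. (g has_real_derivative g1 t) (at t)" "\<And>t. (g1 has_real_derivative g2 t) (at t)"
      "continuous_on UNIV g2" "\<And>t. g (t + pi) = g t"
    and conv: "\<And>t. 0 \<le> g2 t + p\<^sup>2 * g t"
  shows "0 \<le> (\<integral>x. hom p g (F (Complex x y0)) \<partial>lborel)"
proof -
  have gc: "continuous_on UNIV g" using g(1) by (auto intro!: continuous_at_imp_continuous_on DERIV_isCont)
  obtain M where M: "0 \<le> M" "\<And>t. \<bar>g t\<bar> \<le> M" using periodic_bounded[OF gc g(4)] by blast
  have "continuous_on UNIV (\<lambda>x. F (Complex x y0))"
    by (rule continuous_on_compose2[OF holomorphic_on_imp_continuous_on[OF F]])
       (use y0 in \<open>auto simp: Complex_eq intro!: continuous_intros\<close>)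
  then have "continuous_on UNIV (\<lambda>x. hom p g (F (Complex x y0)))"
    using p by (intro continuous_on_compose2[OF hom_cont[OF _ gc g(4)]]) auto
  then have meas: "(\<lambda>x. hom p g (F (Complex x y0))) \<in> borel_measurable lborel"
    by (simp add: borel_measurable_continuous_onI)
  have hb: "\<bar>hom p g w\<bar> \<le> M * cmod w powr p" for w by (rule hom_bound) (rule M)
  have I: "integrable lborel (\<lambda>x. hom p g (F (Complex x y0)))"
    by (rule Bochner_Integration.integrable_bound[OF integrable_mult_right[OF int, of M] meas])
       (use hb in \<open>auto intro: order_trans[OF _ abs_ge_self]\<close>)
  define N where "N = (\<integral>x. cmod (F (Complex x y0)) powr p \<partial>lborel)"
  have "0 \<le> (\<integral>x. hom p g (F (Complex x y0)) \<partial>lborel) + \<eta> * N" if "0 < \<eta>" for \<eta>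
  proof -
    have "hom p (\<lambda>t. g t + \<eta>) w = hom p g w + \<eta> * cmod w powr p" for w
      by (simp add: hom_def algebra_simps)
    then have "(\<integral>x. hom p (\<lambda>t. g t + \<eta>) (F (Complex x y0)) \<partial>lborel) = (\<integral>x. hom p g (F (Complex x y0)) \<partial>lborel) + \<eta> * N"
      using I int by (simp add: N_def)
    then show ?thesis using hom_integral_smooth_eps[OF F y0 p that decay int g conv] by simp
  qed
  then have "- (\<integral>x. hom p g (F (Complex x y0)) \<partial>lborel) \<le> \<eta> * N" if "0 < \<eta>" for \<eta> using that by (smt (verit))
  moreover have "((\<lambda>\<eta>. \<eta> * N) \<longlongrightarrow> 0 * N) (at_right 0)" by (intro tendsto_intros)
  ultimately have "- (\<integral>x. hom p g (F (Complex x y0)) \<partial>lborel) \<le> 0 * N"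
    by (intro tendsto_lowerbound[of _ _ "at_right (0::real)"]) (auto simp: eventually_at_filter)
  then show ?thesis by simp
qed

text \<open>Averaging over a window of half-width \<epsilon> gains a derivative: \<open>G'\<close>
  is a difference quotient of \<open>g\<close> and \<open>G''\<close> one of \<open>g1\<close>.
  Multiplied by \<open>2 * \<epsilon>\<close>, the inequality
  \<open>G'' + p\<^sup>2 G \<ge> 0\<close> is precisely the integrated inequality of
  \<open>trig_convex\<close> on the window.\<close>

lemma trig_convex_mollify:
  fixes g :: "real \<Rightarrow> real"
  assumes g: "trig_convex p g" and e: "0 < \<epsilon>"
  defines "G \<equiv> (\<lambda>t. integral {-\<epsilon>..\<epsilon>} (\<lambda>s. g (t + s)) / (2 * \<epsilon>))"
  shows "\<exists>G1 G2. (\<forall>t. (G has_real_derivative G1 t) (at t)) \<and> (\<forall>t. (G1 has_real_derivative G2 t) (at t)) \<and>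
     continuous_on UNIV G2 \<and> (\<forall>t. G (t + pi) = G t) \<and> (\<forall>t. 0 \<le> G2 t + p\<^sup>2 * G t)"
proof -
  obtain g1 where per: "\<And>t. g (t + pi) = g t" and g1: "\<And>t. (g has_real_derivative g1 t) (at t)"
    and c1: "continuous_on UNIV g1"
    and conv: "\<And>u v. u \<le> v \<Longrightarrow> 0 \<le> g1 v - g1 u + p\<^sup>2 * integral {u..v} g"
    using g unfolding trig_convex_def by blast
  have cg: "continuous_on UNIV g" using g1 by (auto intro!: continuous_at_imp_continuous_on DERIV_isCont)
  define G1 where "G1 t = (g (t + \<epsilon>) - g (t - \<epsilon>)) / (2 * \<epsilon>)" for t
  define G2 where "G2 t = (g1 (t + \<epsilon>) - g1 (t - \<epsilon>)) / (2 * \<epsilon>)" for t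
  have gs: "((\<lambda>x. g (x + s)) has_real_derivative g1 (x + s)) (at x)" for x s
    using DERIV_shift g1 by blast
  have gs': "((\<lambda>s. g (x + s)) has_real_derivative g1 (x + s)) (at s)" for x s
    using gs[of x s] DERIV_shift[of g _ s x] g1[of "s + x"] by (simp add: add.commute)
  have cgx: "continuous_on S (\<lambda>s. g (x + s))" for x S
    by (intro continuous_on_compose2[OF cg]) (auto intro!: continuous_intros)
  have "((\<lambda>t. integral {-\<epsilon>..\<epsilon>} (\<lambda>s. g (t + s))) has_real_derivative integral {-\<epsilon>..\<epsilon>} (\<lambda>s. g1 (t + s))) (at t)" for t
  proof -
    have "((\<lambda>t. integral (cbox (-\<epsilon>) \<epsilon>) (\<lambda>s. g (t + s))) has_field_derivative integral (cbox (-\<epsilon>) \<epsilon>) (\<lambda>s. g1 (t + s))) (at t within UNIV)"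
    proof (rule leibniz_rule_field_derivative)
      show "continuous_on (UNIV \<times> cbox (-\<epsilon>) \<epsilon>) (\<lambda>(x, t). g1 (x + t))"
        unfolding split_beta by (intro continuous_on_compose2[OF c1]) (auto intro!: continuous_intros)
      show "(\<lambda>s. g (x + s)) integrable_on cbox (-\<epsilon>) \<epsilon>" for x by (intro integrable_continuous cgx)
    qed (use gs in auto)
    then show ?thesis by simp
  qed
  moreover have "integral {-\<epsilon>..\<epsilon>} (\<lambda>s. g1 (t + s)) = g (t + \<epsilon>) - g (t - \<epsilon>)" for t
  proof -
    have "((\<lambda>s. g1 (t + s)) has_integral g (t + \<epsilon>) - g (t + - \<epsilon>)) {-\<epsilon>..\<epsilon>}"
      by (rule fundamental_theorem_of_calculus)
         (use e gs' in \<open>auto simp: has_field_derivative_at_within simp flip: has_real_derivative_iff_has_vector_derivative\<close>)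
    then show ?thesis by (simp add: integral_unique)
  qed
  ultimately have d1: "(G has_real_derivative G1 t) (at t)" for t
    unfolding G_def G1_def by (intro DERIV_cdivide) simp
  have d2: "(G1 has_real_derivative G2 t) (at t)" for t
    unfolding G1_def[abs_def] G2_def
    using gs[of \<epsilon> t] gs[of "- \<epsilon>" t] by (intro DERIV_cdivide DERIV_diff) simp_all
  have cG2: "continuous_on UNIV G2"
    unfolding G2_def[abs_def] using e
    by (intro continuous_intros continuous_on_compose2[OF c1 _ subset_UNIV]) auto
  have pG: "G (t + pi) = G t" for t
  proof -
    have "g (t + pi + s) = g (t + s)" for s using per[of "t + s"] by (simp add: algebra_simps)
    then show ?thesis by (simp add: G_def)
  qed
  have "0 \<le> G2 t + p\<^sup>2 * G t" for t
  proof -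
    have "integral {-\<epsilon>..\<epsilon>} (g \<circ> (\<lambda>s. s + t)) = integral {-\<epsilon> + t..\<epsilon> + t} g"
      by (rule integral_shift) (rule continuous_on_subset[OF cg], simp)
    then have "integral {-\<epsilon>..\<epsilon>} (\<lambda>s. g (t + s)) = integral {t - \<epsilon>..t + \<epsilon>} g"
      by (simp add: o_def add.commute)
    then have "G2 t + p\<^sup>2 * G t = (g1 (t + \<epsilon>) - g1 (t - \<epsilon>) + p\<^sup>2 * integral {t - \<epsilon>..t + \<epsilon>} g) / (2 * \<epsilon>)"
      by (simp add: G2_def G_def add_divide_distrib)
    then show ?thesis using conv[of "t - \<epsilon>" "t + \<epsilon>"] e by simp
  qed
  then show ?thesis using d1 d2 cG2 pG by blast
qed

lemma mollify_bound:
  fixes g :: "real \<Rightarrow> real"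
  assumes c: "continuous_on UNIV g" and e: "0 < \<epsilon>" and M: "\<And>s. \<bar>s\<bar> \<le> \<epsilon> \<Longrightarrow> \<bar>g (t + s) - a\<bar> \<le> M"
  shows "\<bar>integral {-\<epsilon>..\<epsilon>} (\<lambda>s. g (t + s)) / (2 * \<epsilon>) - a\<bar> \<le> M"
proof -
  have i: "(\<lambda>s. g (t + s)) integrable_on {-\<epsilon>..\<epsilon>}"
    by (intro integrable_continuous_interval continuous_on_compose2[OF c]) (auto intro!: continuous_intros)
  have c': "integral {-\<epsilon>..\<epsilon>} (\<lambda>s. a) = 2 * \<epsilon> * a" using e by simp
  have "integral {-\<epsilon>..\<epsilon>} (\<lambda>s. g (t + s) - a) = integral {-\<epsilon>..\<epsilon>} (\<lambda>s. g (t + s)) - 2 * \<epsilon> * a"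
    using integral_diff[OF i integrable_const_ivl[of a]] c' by simp
  moreover have "norm (integral {-\<epsilon>..\<epsilon>} (\<lambda>s. g (t + s) - a)) \<le> M * (\<epsilon> - (-\<epsilon>))"
    by (rule integral_bound) (use e M in \<open>auto intro!: continuous_intros continuous_on_compose2[OF c]\<close>)
  ultimately have "\<bar>integral {-\<epsilon>..\<epsilon>} (\<lambda>s. g (t + s)) - 2 * \<epsilon> * a\<bar> \<le> M * (2 * \<epsilon>)" by simp
  moreover have "integral {-\<epsilon>..\<epsilon>} (\<lambda>s. g (t + s)) / (2 * \<epsilon>) - a = (integral {-\<epsilon>..\<epsilon>} (\<lambda>s. g (t + s)) - 2 * \<epsilon> * a) / (2 * \<epsilon>)"
    using e by (simp add: diff_divide_distrib)
  ultimately show ?thesis using e by (simp add: abs_divide pos_divide_le_eq)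
qed

text \<open>For a mollified \<open>g\<close> the inequality holds on every line at height
  \<open>1 / real (Suc n)\<close>. Dominated convergence with a multiple of \<open>D powr p\<close>
  carries it to the boundary values, and a second dominated convergence removes the
  mollification.\<close>

theorem hom_integral_nonneg:
  assumes p: "1 < p" and g: "trig_convex p g"
    and F: "F holomorphic_on {z. 0 < Im z}"
    and decay: "\<And>y0 e. 0 < y0 \<Longrightarrow> 0 < e \<Longrightarrow> \<exists>R>0. \<forall>z. y0 \<le> Im z \<longrightarrow> R \<le> cmod z \<longrightarrow> cmod (F z) < e"
    and D: "\<And>x y. 0 < y \<Longrightarrow> y \<le> 1 \<Longrightarrow> cmod (F (Complex x y)) \<le> D x"
    and D_int: "integrable lborel (\<lambda>x. D x powr p)"
    and lim: "\<And>x. (\<lambda>n. F (Complex x (1 / real (Suc n)))) \<longlonglongrightarrow> F0 x"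
  shows "integrable lborel (\<lambda>x. hom p g (F0 x))" and "0 \<le> (\<integral>x. hom p g (F0 x) \<partial>lborel)"
proof -
  have yn: "0 < 1 / real (Suc n)" "1 / real (Suc n) \<le> 1" for n by simp_all
  have cF: "continuous_on UNIV (\<lambda>x. F (Complex x y))" if "0 < y" for y
    by (rule continuous_on_compose2[OF holomorphic_on_imp_continuous_on[OF F]])
       (use that in \<open>auto simp: Complex_eq intro!: continuous_intros\<close>)
  have D0: "0 \<le> D x" for x using order_trans[OF norm_ge_zero D[of 1 x]] by simp
  have bF: "cmod (F (Complex x (1 / real (Suc n)))) powr p \<le> D x powr p" for x n
    using D[OF yn] p by (intro powr_mono2) auto
  have intF: "integrable lborel (\<lambda>x. cmod (F (Complex x (1 / real (Suc n)))) powr p)" for n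
  proof (rule Bochner_Integration.integrable_bound[OF D_int])
    show "(\<lambda>x. cmod (F (Complex x (1 / real (Suc n)))) powr p) \<in> borel_measurable lborel"
      using borel_measurable_continuous_onI[OF cF[OF yn(1)[of n]]] by simp
  qed (use bF in auto)
  have bF0: "cmod (F0 x) powr p \<le> D x powr p" for x
  proof -
    have "cmod (F0 x) \<le> D x"
      by (rule LIMSEQ_le_const2[OF tendsto_norm[OF lim]]) (use D[OF yn] in auto)
    then show ?thesis using p by (intro powr_mono2) auto
  qed
  have gen: "integrable lborel (\<lambda>x. hom p G (F0 x))"
       "(\<lambda>n. \<integral>x. hom p G (F (Complex x (1 / real (Suc n)))) \<partial>lborel) \<longlonglongrightarrow> (\<integral>x. hom p G (F0 x) \<partial>lborel)"
    if G: "continuous_on UNIV G" "\<And>t. G (t + pi) = G t" for G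
  proof -
    obtain M where M: "0 \<le> M" "\<And>t. \<bar>G t\<bar> \<le> M" using periodic_bounded[OF G] by blast
    have hc: "continuous_on UNIV (hom p G)" using p by (intro hom_cont G) auto
    have l: "(\<lambda>n. hom p G (F (Complex x (1 / real (Suc n))))) \<longlonglongrightarrow> hom p G (F0 x)" for x
      by (rule isCont_tendsto_compose[OF _ lim]) (use hc in \<open>auto simp: continuous_on_eq_continuous_at\<close>)
    have m: "(\<lambda>x. hom p G (F (Complex x (1 / real (Suc n))))) \<in> borel_measurable lborel" for n
      using borel_measurable_continuous_onI[OF continuous_on_compose2[OF hc cF[OF yn(1)[of n]] subset_UNIV]] by simp
    have m0: "(\<lambda>x. hom p G (F0 x)) \<in> borel_measurable lborel" by (rule borel_measurable_LIMSEQ_real[OF l m])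
    have b: "\<bar>hom p G w\<bar> \<le> M * D x powr p" if "cmod w powr p \<le> D x powr p" for w x
      using hom_bound[where g = G and M = M and p = p and w = w] M(2) mult_left_mono[OF that M(1)] by fastforce
    show "integrable lborel (\<lambda>x. hom p G (F0 x))"
      by (rule Bochner_Integration.integrable_bound[OF integrable_mult_right[OF D_int, of M] m0])
         (use b[OF bF0] in \<open>auto intro!: AE_I2 intro: order_trans[OF _ abs_ge_self]\<close>)
    show "(\<lambda>n. \<integral>x. hom p G (F (Complex x (1 / real (Suc n)))) \<partial>lborel) \<longlonglongrightarrow> (\<integral>x. hom p G (F0 x) \<partial>lborel)"
      by (rule integral_dominated_convergence[OF m0 m integrable_mult_right[OF D_int, of M]])
         (use l b[OF bF] in auto)
  qed
  have cg: "continuous_on UNIV g"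
  proof -
    have "isCont g t" for t using g unfolding trig_convex_def by (blast intro: DERIV_isCont)
    then show ?thesis by (simp add: continuous_at_imp_continuous_on)
  qed
  have per: "g (t + pi) = g t" for t using g unfolding trig_convex_def by blast
  obtain M where M: "0 \<le> M" "\<And>t. \<bar>g t\<bar> \<le> M" using periodic_bounded[OF cg per] by blast
  show "integrable lborel (\<lambda>x. hom p g (F0 x))" by (rule gen(1)[OF cg per])
  define G where "G k t = integral {-(1 / real (Suc k))..1 / real (Suc k)} (\<lambda>s. g (t + s)) / (2 * (1 / real (Suc k)))" for k t
  have pos: "0 \<le> (\<integral>x. hom p (G k) (F0 x) \<partial>lborel)" and intG: "integrable lborel (\<lambda>x. hom p (G k) (F0 x))" for k
  proof -
    obtain G1 G2 where G: "\<And>t. (G k has_real_derivative G1 t) (at t)" "\<And>t. (G1 has_real_derivative G2 t) (at t)"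
     "continuous_on UNIV G2" "\<And>t. G k (t + pi) = G k t" "\<And>t. 0 \<le> G2 t + p\<^sup>2 * G k t"
      using trig_convex_mollify[OF g yn(1)[of k]] unfolding G_def[abs_def] by blast
    have cG: "continuous_on UNIV (G k)" using G(1) by (auto intro!: continuous_at_imp_continuous_on DERIV_isCont)
    show "integrable lborel (\<lambda>x. hom p (G k) (F0 x))" by (rule gen(1)[OF cG G(4)])
    show "0 \<le> (\<integral>x. hom p (G k) (F0 x) \<partial>lborel)"
    proof (rule LIMSEQ_le_const[OF gen(2)[OF cG G(4)]], intro exI allI impI)
      fix n
      show "0 \<le> (\<integral>x. hom p (G k) (F (Complex x (1 / real (Suc n)))) \<partial>lborel)"
        by (rule hom_integral_smooth[OF F yn(1) p decay[OF yn(1)] intF G])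
    qed
  qed
  have Gb: "\<bar>G k t\<bar> \<le> M" for k t
    using mollify_bound[OF cg yn(1)[of k], of t 0 M] M(2) by (simp add: G_def)
  have Glim: "(\<lambda>k. G k t) \<longlonglongrightarrow> g t" for t
  proof (rule LIMSEQ_I)
    fix r :: real assume r: "0 < r"
    have "isCont g t" using cg by (simp add: continuous_on_eq_continuous_at)
    then obtain d where d: "0 < d" "\<And>s. \<bar>s - t\<bar> < d \<Longrightarrow> \<bar>g s - g t\<bar> < r / 2"
      using half_gt_zero[OF r] unfolding continuous_at_real_range real_norm_def by blast
    obtain k0 where k0: "1 / real (Suc k0) < d" using d(1) by (rule nat_approx_posE)
    have "norm (G k t - g t) < r" if "k0 \<le> k" for k
    proof -
      have "1 / real (Suc k) \<le> 1 / real (Suc k0)" using that by (simp add: frac_le)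
      then have "1 / real (Suc k) < d" using k0 by linarith
      then have "\<bar>G k t - g t\<bar> \<le> r / 2"
        unfolding G_def using d(2) by (intro mollify_bound[OF cg yn(1)]) (auto intro!: less_imp_le)
      then show ?thesis using r by simp
    qed
    then show "\<exists>no. \<forall>n\<ge>no. norm (G n t - g t) < r" by blast
  qed
  have "(\<lambda>k. \<integral>x. hom p (G k) (F0 x) \<partial>lborel) \<longlonglongrightarrow> (\<integral>x. hom p g (F0 x) \<partial>lborel)"
  proof (rule integral_dominated_convergence[OF _ _ integrable_mult_right[OF D_int, of M]])
    show "(\<lambda>x. hom p g (F0 x)) \<in> borel_measurable lborel" using gen(1)[OF cg per] by simp
    show "(\<lambda>x. hom p (G k) (F0 x)) \<in> borel_measurable lborel" for k using intG[of k] by simp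
    show "AE x in lborel. (\<lambda>k. hom p (G k) (F0 x)) \<longlonglongrightarrow> hom p g (F0 x)"
      unfolding hom_def by (intro AE_I2 tendsto_mult tendsto_const Glim)
    fix k
    have "\<bar>hom p (G k) (F0 x)\<bar> \<le> M * D x powr p" for x
    proof -
      have "\<bar>hom p (G k) (F0 x)\<bar> \<le> M * cmod (F0 x) powr p" by (rule hom_bound) (rule Gb)
      also have "\<dots> \<le> M * D x powr p" by (rule mult_left_mono[OF bF0 M(1)])
      finally show ?thesis .
    qed
    then show "AE x in lborel. norm (hom p (G k) (F0 x)) \<le> M * D x powr p" by simp
  qed
  then show "0 \<le> (\<integral>x. hom p g (F0 x) \<partial>lborel)" by (rule LIMSEQ_le_const) (use pos in auto)
qed

section \<open>Holomorphic extension of a test function\<close>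

lemma integrable_interval:
  fixes a b :: real
  shows "integrable lborel (indicator {a..b} :: real \<Rightarrow> real)" "integrable lborel (indicator {a<..b} :: real \<Rightarrow> real)"
  by (intro integrable_real_indicator; force intro!: emeasure_bounded_finite intro: bounded_subset[OF bounded_closed_interval[of a b]])+

lemma integrable_bounded_support:
  fixes h :: "real \<Rightarrow> real"
  assumes "h \<in> borel_measurable lborel" and K: "\<And>s. \<bar>h s\<bar> \<le> K" and A: "\<And>s. A < \<bar>s\<bar> \<Longrightarrow> h s = 0"
  shows "integrable lborel h"
proof (rule Bochner_Integration.integrable_bound[OF _ assms(1)])
  show "integrable lborel (\<lambda>s. indicator {-A..A} s * K)"
    by (intro integrable_mult_left integrable_interval)
  have "norm (h s) \<le> norm (indicator {-A..A} s * K)" for s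
  proof (cases "A < \<bar>s\<bar>")
    case False
    then have "s \<in> {-A..A}" by auto
    then show ?thesis using K[of s] by simp
  qed (simp add: A)
  then show "AE s in lborel. norm (h s) \<le> norm (indicator {-A..A} s * K)" by simp
qed

text \<open>Pairing \<open>s\<close> with \<open>- s\<close> is what makes odd singular kernels
  absolutely integrable: the difference of two values of a Lipschitz function absorbs a factor
  \<open>1 / s\<close>.\<close>

lemma integral_fold:
  fixes h :: "real \<Rightarrow> real"
  assumes "integrable lborel h"
  shows "integrable lborel (\<lambda>s. indicator {0<..} s * (h s + h (- s)))"
    and "(\<integral>s. h s \<partial>lborel) = (\<integral>s. indicator {0<..} s * (h s + h (- s)) \<partial>lborel)"
proof -
  have h': "integrable lborel (\<lambda>s. h (- s))"
    using lborel_integrable_real_affine[OF assms, of "-1" 0] by simp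
  have i1: "integrable lborel (\<lambda>s. indicator {0<..} s * h s)"
    and i2: "integrable lborel (\<lambda>s. indicator {0<..} s * h (- s))"
    and i3: "integrable lborel (\<lambda>s. indicator {..<0} s * h s)"
    using assms h' by (auto intro: integrable_real_mult_indicator simp: mult.commute)
  show "integrable lborel (\<lambda>s. indicator {0<..} s * (h s + h (- s)))"
    using Bochner_Integration.integrable_add[OF i1 i2] by (simp add: distrib_left)
  have "(\<integral>s. h s \<partial>lborel) = (\<integral>s. indicator {0<..} s * h s + indicator {..<0} s * h s \<partial>lborel)"
  proof (rule integral_cong_AE)
    have "AE s in lborel. s \<noteq> (0::real)" by (rule AE_lborel_singleton)
    then show "AE s in lborel. h s = indicator {0<..} s * h s + indicator {..<0} s * h s"
      by eventually_elim (auto simp: indicator_def)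
  qed (use assms i1 i3 in auto)
  also have "\<dots> = (\<integral>s. indicator {0<..} s * h s \<partial>lborel) + (\<integral>s. indicator {..<0} s * h s \<partial>lborel)"
    by (rule Bochner_Integration.integral_add[OF i1 i3])
  also have "(\<integral>s. indicator {..<0} s * h s \<partial>lborel) = (\<integral>s. indicator {0<..} s * h (- s) \<partial>lborel)"
    by (subst lborel_integral_real_affine[of "-1" _ 0]) (auto intro!: Bochner_Integration.integral_cong simp: indicator_def)
  also have "(\<integral>s. indicator {0<..} s * h s \<partial>lborel) + (\<integral>s. indicator {0<..} s * h (- s) \<partial>lborel)
     = (\<integral>s. indicator {0<..} s * (h s + h (- s)) \<partial>lborel)"
    using Bochner_Integration.integral_add[OF i1 i2] by (simp add: distrib_left)
  finally show "(\<integral>s. h s \<partial>lborel) = (\<integral>s. indicator {0<..} s * (h s + h (- s)) \<partial>lborel)" .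
qed

lemma poisson_kernel:
  shows "integrable lborel (\<lambda>s::real. indicator {0<..} s * (1 / (1 + s\<^sup>2)))"
    and "(\<integral>s. indicator {0<..} s * (1 / (1 + s\<^sup>2)) \<partial>lborel) = pi / 2"
proof -
  have "(\<integral>\<^sup>+ s. ennreal (1 / (1 + s\<^sup>2)) * indicator {0..} s \<partial>lborel) = ennreal (pi / 2 - arctan 0)"
  proof (rule nn_integral_FTC_atLeast[where F = arctan])
    show "(arctan has_real_derivative 1 / (1 + s\<^sup>2)) (at s)" for s
      using DERIV_arctan[of s] by (simp add: inverse_eq_divide)
  qed (auto intro: tendsto_arctan_at_top)
  moreover have "(\<integral>\<^sup>+ s. ennreal (1 / (1 + s\<^sup>2)) * indicator {0..} s \<partial>lborel)
      = (\<integral>\<^sup>+ s. ennreal (indicator {0<..} s * (1 / (1 + s\<^sup>2))) \<partial>lborel)"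
  proof (rule nn_integral_cong_AE)
    have "AE s in lborel. s \<noteq> (0::real)" by (rule AE_lborel_singleton)
    then show "AE s in lborel. ennreal (1 / (1 + s\<^sup>2)) * indicator {0..} s = ennreal (indicator {0<..} s * (1 / (1 + s\<^sup>2)))"
      by eventually_elim (auto simp: indicator_def)
  qed
  ultimately have n: "(\<integral>\<^sup>+ s. ennreal (indicator {0<..} s * (1 / (1 + s\<^sup>2))) \<partial>lborel) = ennreal (pi / 2)" by simp
  have "has_bochner_integral lborel (\<lambda>s::real. indicator {0<..} s * (1 / (1 + s\<^sup>2))) (pi / 2)"
    by (rule has_bochner_integral_nn_integral[OF _ _ _ n]) auto
  then show "integrable lborel (\<lambda>s::real. indicator {0<..} s * (1 / (1 + s\<^sup>2)))"
    and "(\<integral>s. indicator {0<..} s * (1 / (1 + s\<^sup>2)) \<partial>lborel) = pi / 2"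
    by (auto simp: has_bochner_integral_iff)
qed

lemma integrable_powr_tail:
  fixes a q :: real assumes "0 < a" "1 < q"
  shows "integrable lborel (\<lambda>x. indicator {a..} x * x powr (- q))"
proof -
  have "(\<integral>\<^sup>+ x. ennreal (x powr (- q)) * indicator {a..} x \<partial>lborel) = ennreal (0 - (a powr (1 - q) / (1 - q)))"
  proof (rule nn_integral_FTC_atLeast[where F = "\<lambda>x. x powr (1 - q) / (1 - q)" and T = 0])
    fix x assume "a \<le> x"
    then have "((\<lambda>x. x powr (1 - q)) has_real_derivative (1 - q) * x powr (1 - q - 1) * 1) (at x)"
      using assms DERIV_fun_powr[OF DERIV_ident, of x "1 - q"] by simp
    then have "((\<lambda>x. x powr (1 - q) / (1 - q)) has_real_derivative (1 - q) * x powr (1 - q - 1) * 1 / (1 - q)) (at x)"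
      by (rule DERIV_cdivide)
    then show "((\<lambda>x. x powr (1 - q) / (1 - q)) has_real_derivative x powr (- q)) (at x)" using assms by simp
  next
    show "((\<lambda>x. x powr (1 - q) / (1 - q)) \<longlongrightarrow> 0) at_top" using assms by real_asymp
  qed auto
  also have "(\<lambda>x. ennreal (x powr (- q)) * indicator {a..} x) = (\<lambda>x. ennreal (indicator {a..} x * x powr (- q)))"
    by (auto simp: indicator_def)
  finally have n: "(\<integral>\<^sup>+ x. ennreal (indicator {a..} x * x powr (- q)) \<partial>lborel) = ennreal (0 - (a powr (1 - q) / (1 - q)))" .
  show ?thesis by (rule integrableI_nn_integral_finite[OF _ _ n]) (use assms in \<open>auto simp: divide_nonneg_neg\<close>)
qed

section \<open>Principal values for Lipschitz functions of compact support\<close>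

locale lip_bump =
  fixes f :: "real \<Rightarrow> real" and r L :: real
  assumes r: "0 < r" and L: "0 \<le> L"
    and supp: "\<And>x. r \<le> \<bar>x\<bar> \<Longrightarrow> f x = 0"
    and lip: "\<And>x y. \<bar>f x - f y\<bar> \<le> L * \<bar>x - y\<bar>"
begin

lemma bound: "\<bar>f x\<bar> \<le> 2 * r * L"
proof (cases "r \<le> \<bar>x\<bar>")
  case False
  have "\<bar>f x - f r\<bar> \<le> L * \<bar>x - r\<bar>" by (rule lip)
  also have "\<dots> \<le> L * (2 * r)" using False L r by (intro mult_left_mono) auto
  finally show ?thesis using supp[of r] r by (simp add: mult_ac)
qed (use supp r L in simp)

lemma cont: "continuous_on UNIV f"
proof (rule continuous_at_imp_continuous_on, intro ballI)
  fix x
  have "((\<lambda>y. L * \<bar>y - x\<bar>) \<longlongrightarrow> L * \<bar>x - x\<bar>) (at x)" by (intro tendsto_intros)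
  then have "((\<lambda>y. f y - f x) \<longlongrightarrow> 0) (at x)"
    by (intro Lim_null_comparison[of "\<lambda>y. f y - f x" "\<lambda>y. L * \<bar>y - x\<bar>"]) (auto intro!: always_eventually lip)
  then show "isCont f x" unfolding isCont_def by (simp add: LIM_zero_iff)
qed

lemma meas [measurable]: "f \<in> borel_measurable borel"
  by (rule borel_measurable_continuous_onI[OF cont])

lemma difference_bound:
  assumes "0 < s" shows "\<bar>(f (x - s) - f (x + s)) / s\<bar> \<le> 2 * L * indicator {0<..r + \<bar>x\<bar>} s"
proof (cases "s \<le> r + \<bar>x\<bar>")
  case True
  have "\<bar>f (x - s) - f (x + s)\<bar> \<le> L * \<bar>(x - s) - (x + s)\<bar>" by (rule lip)
  also have "\<dots> = 2 * L * s" using assms by simp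
  finally have "\<bar>(f (x - s) - f (x + s)) / s\<bar> \<le> 2 * L" using assms by (simp add: abs_divide divide_le_eq)
  then show ?thesis using True assms by simp
next
  case False
  then have "f (x - s) = 0" "f (x + s) = 0" by (auto intro!: supp)
  then show ?thesis using L by simp
qed

text \<open>The folded Hilbert kernel. Being integrable, it turns the principal value into an
  ordinary integral over positive \<open>s\<close>.\<close>

definition "hk x s = indicator {0<..} s * ((f (x - s) - f (x + s)) / s)"

lemma hk_bound: "\<bar>hk x s\<bar> \<le> 2 * L * indicator {0<..r + \<bar>x\<bar>} s"
  using difference_bound[of s x] L by (cases "0 < s") (simp_all add: hk_def)

lemma integrable_bump: "integrable lborel (\<lambda>s. 2 * L * indicator {0<..r + \<bar>x\<bar>} s)"
  by (intro integrable_mult_right integrable_interval)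

lemma hk_integrable: "integrable lborel (hk x)"
proof (rule Bochner_Integration.integrable_bound[OF integrable_bump[of x]])
  show "hk x \<in> borel_measurable lborel" unfolding hk_def[abs_def] by measurable
qed (use hk_bound in \<open>auto intro: order_trans[OF _ abs_ge_self]\<close>)

lemma truncated_eq:
  assumes e: "0 < e"
  shows "(LBINT t:{t. e < \<bar>x - t\<bar>}. f t / (x - t)) = (\<integral>s. indicator {e<..} s * hk x s \<partial>lborel)"
proof -
  define h where "h s = indicator {s. e < \<bar>s\<bar>} s * (f (x - s) / s)" for s
  have m: "h \<in> borel_measurable lborel" unfolding h_def[abs_def] by measurable
  have i: "integrable lborel h"
  proof (rule integrable_bounded_support[OF m])
    show "\<bar>h s\<bar> \<le> 2 * r * L / e" for s
    proof (cases "e < \<bar>s\<bar>")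
      case True
      have "\<bar>f (x - s)\<bar> / \<bar>s\<bar> \<le> (2 * r * L) / e" using True bound[of "x - s"] e r L by (intro frac_le) auto
      then show ?thesis using True by (simp add: h_def abs_divide)
    qed (use r L e in \<open>simp add: h_def\<close>)
    show "h s = 0" if "r + \<bar>x\<bar> < \<bar>s\<bar>" for s
    proof -
      have "f (x - s) = 0" using that by (intro supp) linarith
      then show ?thesis by (simp add: h_def)
    qed
  qed
  have "(LBINT t:{t. e < \<bar>x - t\<bar>}. f t / (x - t)) = (\<integral>s. h s \<partial>lborel)"
    unfolding set_lebesgue_integral_def
    by (subst lborel_integral_real_affine[of "-1" _ x])
       (auto intro!: Bochner_Integration.integral_cong simp: h_def indicator_def)
  also have "\<dots> = (\<integral>s. indicator {0<..} s * (h s + h (- s)) \<partial>lborel)" by (rule integral_fold(2)[OF i])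
  also have "\<dots> = (\<integral>s. indicator {e<..} s * hk x s \<partial>lborel)"
    using e by (intro Bochner_Integration.integral_cong) (auto simp: h_def hk_def indicator_def diff_divide_distrib)
  finally show ?thesis .
qed

text \<open>Truncation at \<open>e\<close> removes a part of \<open>hk\<close> that is at most
  \<open>2 * L\<close> on an interval of length \<open>e\<close>. Hence the truncated integrals
  converge, and \<open>Lim\<close> in the definition of \<open>hilbert\<close> is a genuine
  limit.\<close>

lemma hilbert_eq: "hilbert f x = 1 / pi * (\<integral>s. hk x s \<partial>lborel)"
proof -
  define I where "I = (\<integral>s. hk x s \<partial>lborel)"
  have b: "\<bar>(\<integral>s. indicator {e<..} s * hk x s \<partial>lborel) - I\<bar> \<le> 2 * L * e" if "0 < e" for e
  proof -
    have i: "integrable lborel (\<lambda>s. indicator {e<..} s * hk x s)"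
      using integrable_real_mult_indicator[OF _ hk_integrable, of "{e<..}" x] by (simp add: mult.commute)
    have "I - (\<integral>s. indicator {e<..} s * hk x s \<partial>lborel) = (\<integral>s. hk x s - indicator {e<..} s * hk x s \<partial>lborel)"
      unfolding I_def by (rule Bochner_Integration.integral_diff[OF hk_integrable i, symmetric])
    moreover have "norm (\<integral>s. hk x s - indicator {e<..} s * hk x s \<partial>lborel) \<le> (\<integral>s. 2 * L * indicator {0<..e} s \<partial>lborel)"
    proof (rule Bochner_Integration.integral_norm_bound_integral)
      show "integrable lborel (\<lambda>s. 2 * L * indicator {0<..e} s)"
        by (intro integrable_mult_right integrable_interval)
      have "\<bar>hk x s\<bar> \<le> 2 * L" for s
        using hk_bound[of x s] L by (cases "s \<in> {0<..r + \<bar>x\<bar>}") auto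
      moreover have "hk x s = 0" if "s \<le> 0" for s using that by (simp add: hk_def)
      ultimately show "norm (hk x s - indicator {e<..} s * hk x s) \<le> 2 * L * indicator {0<..e} s" for s
        by (cases "s \<le> 0"; cases "e < s") (simp_all add: indicator_def)
    qed (intro Bochner_Integration.integrable_diff hk_integrable i)
    ultimately show ?thesis using that by simp
  qed
  have "((\<lambda>e. 2 * L * e) \<longlongrightarrow> 2 * L * 0) (at_right 0)" by (intro tendsto_intros)
  then have l0: "((\<lambda>e. 2 * L * e) \<longlongrightarrow> 0) (at_right 0)" by simp
  have "\<forall>\<^sub>F e in at_right 0. norm ((\<integral>s. indicator {e<..} s * hk x s \<partial>lborel) - I) \<le> 2 * L * e"
    using b by (simp add: eventually_at_filter)
  then have "((\<lambda>e. (\<integral>s. indicator {e<..} s * hk x s \<partial>lborel) - I) \<longlongrightarrow> 0) (at_right 0)"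
    by (rule Lim_null_comparison[OF _ l0])
  then have "((\<lambda>e. (\<integral>s. indicator {e<..} s * hk x s \<partial>lborel)) \<longlongrightarrow> I) (at_right 0)" by (simp add: LIM_zero_iff)
  then have "((\<lambda>e. 1 / pi * (\<integral>s. indicator {e<..} s * hk x s \<partial>lborel)) \<longlongrightarrow> 1 / pi * I) (at_right 0)"
    by (intro tendsto_mult tendsto_const)
  then have "((\<lambda>e. 1 / pi * (LBINT t:{t. e < \<bar>x - t\<bar>}. f t / (x - t))) \<longlongrightarrow> 1 / pi * I) (at_right 0)"
    by (rule Lim_transform_eventually) (auto simp: eventually_at_filter truncated_eq)
  then show ?thesis unfolding hilbert_def I_def by (intro tendsto_Lim) auto
qed

end

context lip_bump
begin

text \<open>The boundary values of this holomorphic function are \<open>f\<close> plus \<open>\<i>\<close> times the Hilbert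
  transform of \<open>f\<close>.\<close>

definition Fext :: "complex \<Rightarrow> complex" where
  "Fext z = \<i> / pi * integral {-r..r} (\<lambda>t. of_real (f t) / (z - of_real t))"

lemma kernel_integrable:
  assumes "0 < Im z" shows "(\<lambda>t. of_real (f t) / (z - of_real t) :: complex) integrable_on {-r..r}"
proof (rule integrable_continuous_interval)
  have "z - of_real t \<noteq> 0" for t using assms by (auto simp: complex_eq_iff)
  then show "continuous_on {-r..r} (\<lambda>t. of_real (f t) / (z - of_real t) :: complex)"
    by (intro continuous_on_divide continuous_on_of_real continuous_on_subset[OF cont] continuous_intros) auto
qed

lemma Fext_holomorphic: "Fext holomorphic_on {z. 0 < Im z}"
proof -
  have nz: "z - of_real t \<noteq> 0" if "0 < Im z" for z t using that by (auto simp: complex_eq_iff)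
  have "(\<lambda>z. integral (cbox (-r) r) (\<lambda>t. of_real (f t) / (z - of_real t) :: complex)) holomorphic_on {z. 0 < Im z}"
  proof (rule leibniz_rule_holomorphic)
    show "((\<lambda>z. of_real (f t) / (z - of_real t)) has_field_derivative - of_real (f t) / (z - of_real t)\<^sup>2)
       (at z within {z. 0 < Im z})" if "z \<in> {z. 0 < Im z}" for z t
      using that nz[of z t] by (auto intro!: derivative_eq_intros simp: power2_eq_square)
    show "(\<lambda>t. of_real (f t) / (z - of_real t) :: complex) integrable_on cbox (-r) r" if "z \<in> {z. 0 < Im z}" for z
      using kernel_integrable that by simp
    have "continuous_on ({z. 0 < Im z} \<times> cbox (-r) r) (\<lambda>x. f (snd x))"
      by (rule continuous_on_compose2[OF cont]) (auto intro!: continuous_intros)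
    then show "continuous_on ({z. 0 < Im z} \<times> cbox (-r) r) (\<lambda>(z, t). - of_real (f t) / (z - of_real t)\<^sup>2)"
      unfolding split_beta using nz
      by (intro continuous_on_divide continuous_on_minus continuous_on_of_real continuous_on_power
          continuous_on_diff continuous_on_fst continuous_on_snd continuous_on_id) auto
    show "convex {z. 0 < Im z}" by (rule convex_halfspace_Im_gt)
  qed
  then show ?thesis unfolding Fext_def[abs_def] by (auto intro!: holomorphic_intros)
qed

lemma Fext_norm:
  assumes z: "0 < Im z" and d: "0 < d" "\<And>t. \<bar>t\<bar> \<le> r \<Longrightarrow> d \<le> cmod (z - of_real t)"
  shows "cmod (Fext z) \<le> 4 * r\<^sup>2 * L / (pi * d)"
proof -
  have "norm (integral {-r..r} (\<lambda>t. of_real (f t) / (z - of_real t) :: complex)) \<le> (2 * r * L / d) * (r - - r)"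
  proof (rule integral_bound)
    have "z - of_real t \<noteq> 0" for t using z by (auto simp: complex_eq_iff)
    then show "continuous_on {-r..r} (\<lambda>t. of_real (f t) / (z - of_real t) :: complex)"
      by (intro continuous_on_divide continuous_on_of_real continuous_on_subset[OF cont] continuous_intros) auto
    fix t assume t: "t \<in> {-r..r}"
    show "norm (of_real (f t) / (z - of_real t)) \<le> 2 * r * L / d"
      unfolding norm_divide norm_of_real using d t bound[of t] r L by (intro frac_le) auto
  qed (use r in simp)
  then have "1 / pi * norm (integral {-r..r} (\<lambda>t. of_real (f t) / (z - of_real t) :: complex)) \<le> 1 / pi * ((2 * r * L / d) * (r - - r))"
    by (rule mult_left_mono) simp
  moreover have "cmod (Fext z) = 1 / pi * norm (integral {-r..r} (\<lambda>t. of_real (f t) / (z - of_real t) :: complex))"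
    by (simp only: Fext_def norm_mult norm_divide norm_ii norm_of_real) simp
  moreover have "1 / pi * ((2 * r * L / d) * (r - - r)) = 4 * r\<^sup>2 * L / (pi * d)" by (simp add: power2_eq_square)
  ultimately show ?thesis by linarith
qed

lemma Fext_decay:
  assumes "0 < y0" "0 < e"
  shows "\<exists>R>0. \<forall>z. y0 \<le> Im z \<longrightarrow> R \<le> cmod z \<longrightarrow> cmod (Fext z) < e"
proof -
  define d where "d = 4 * r\<^sup>2 * L / (pi * e) + 1"
  have d: "0 < d" using r L assms by (auto simp: d_def intro!: add_nonneg_pos)
  have "cmod (Fext z) < e" if z: "y0 \<le> Im z" "r + d \<le> cmod z" for z
  proof -
    have "cmod (Fext z) \<le> 4 * r\<^sup>2 * L / (pi * d)"
    proof (rule Fext_norm)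
      fix t assume "\<bar>t\<bar> \<le> r"
      then show "d \<le> cmod (z - of_real t)" using norm_triangle_ineq2[of z "of_real t"] z by simp
    qed (use z assms d in auto)
    also have "\<dots> < e"
    proof -
      have "4 * r\<^sup>2 * L / (pi * e) < d" by (simp add: d_def)
      then have "4 * r\<^sup>2 * L < d * (pi * e)" using assms by (simp add: pos_divide_less_eq)
      then show ?thesis using d by (simp add: pos_divide_less_eq mult_ac)
    qed
    finally show ?thesis .
  qed
  then show ?thesis using r d by (intro exI[of _ "r + d"]) auto
qed

lemma part_integral:
  assumes k: "continuous_on UNIV k"
  shows "integral {-r..r} (\<lambda>t. f t * k (x - t)) = (\<integral>s. indicator {0<..} s * (f (x - s) * k s + f (x + s) * k (- s)) \<partial>lborel)"
    and "integrable lborel (\<lambda>s. indicator {0<..} s * (f (x - s) * k s + f (x + s) * k (- s)))"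
proof -
  have [measurable]: "k \<in> borel_measurable borel" by (rule borel_measurable_continuous_onI[OF k])
  have "compact (k ` {-(r + \<bar>x\<bar>)..r + \<bar>x\<bar>})" by (rule compact_continuous_image[OF continuous_on_subset[OF k]]) auto
  then have "bounded (k ` {-(r + \<bar>x\<bar>)..r + \<bar>x\<bar>})" by (rule compact_imp_bounded)
  then obtain K0 where K0: "\<And>s. s \<in> {-(r + \<bar>x\<bar>)..r + \<bar>x\<bar>} \<Longrightarrow> \<bar>k s\<bar> \<le> K0" by (fastforce simp: bounded_iff)
  have i: "integrable lborel (\<lambda>s. f (x - s) * k s)"
  proof (rule integrable_bounded_support)
    have z: "f (x - s) = 0" if "r + \<bar>x\<bar> < \<bar>s\<bar>" for s using that by (intro supp) linarith
    have K00: "0 \<le> K0" using order_trans[OF abs_ge_zero K0[of 0]] r by simp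
    show "\<bar>f (x - s) * k s\<bar> \<le> 2 * r * L * K0" for s
    proof (cases "r + \<bar>x\<bar> < \<bar>s\<bar>")
      case False
      then show ?thesis unfolding abs_mult using bound r L by (intro mult_mono K0) auto
    qed (use z r L K00 in simp)
    show "f (x - s) * k s = 0" if "r + \<bar>x\<bar> < \<bar>s\<bar>" for s using z[OF that] by simp
  qed measurable
  then have i': "integrable lborel (\<lambda>t. f t * k (x - t))"
    using lborel_integrable_real_affine[of "\<lambda>s. f (x - s) * k s" "-1" x] by simp
  have "integral {-r..r} (\<lambda>t. f t * k (x - t)) = (\<integral>t. f t * k (x - t) \<partial>lborel)"
    by (rule lborel_integral_eq_interval[OF i', symmetric]) (use supp in \<open>auto simp: abs_if not_le\<close>)
  also have "\<dots> = (\<integral>s. f (x - s) * k s \<partial>lborel)"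
    by (subst lborel_integral_real_affine[of "-1" _ x]) auto
  also have "\<dots> = (\<integral>s. indicator {0<..} s * (f (x - s) * k s + f (x + s) * k (- s)) \<partial>lborel)"
    using integral_fold(2)[OF i] by simp
  finally show "integral {-r..r} (\<lambda>t. f t * k (x - t)) = (\<integral>s. indicator {0<..} s * (f (x - s) * k s + f (x + s) * k (- s)) \<partial>lborel)" .
  show "integrable lborel (\<lambda>s. indicator {0<..} s * (f (x - s) * k s + f (x + s) * k (- s)))"
    using integral_fold(1)[OF i] by simp
qed

text \<open>The real and imaginary parts of \<open>\<i> / (z - t)\<close> are
  \<open>y / ((x - t)\<^sup>2 + y\<^sup>2)\<close> and
  \<open>(x - t) / ((x - t)\<^sup>2 + y\<^sup>2)\<close>, up to the factor \<open>1 / pi\<close> the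
  Poisson kernel and its conjugate. After folding, the even kernel meets the sum of
  \<open>f (x - s)\<close> and \<open>f (x + s)\<close>, the odd one their difference.\<close>

lemma Fext_parts:
  assumes y: "0 < y"
  shows "Re (Fext (Complex x y)) = 1 / pi * (\<integral>s. indicator {0<..} s * ((f (x - s) + f (x + s)) * (y / (s\<^sup>2 + y\<^sup>2))) \<partial>lborel)"
    and "Im (Fext (Complex x y)) = 1 / pi * (\<integral>s. indicator {0<..} s * ((f (x - s) - f (x + s)) * (s / (s\<^sup>2 + y\<^sup>2))) \<partial>lborel)"
proof -
  let ?z = "Complex x y"
  let ?I = "integral {-r..r} (\<lambda>t. of_real (f t) / (?z - of_real t))"
  have i: "(\<lambda>t. of_real (f t) / (?z - of_real t)) integrable_on {-r..r}" using kernel_integrable[of ?z] y by simp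
  have nz: "s\<^sup>2 + y\<^sup>2 \<noteq> 0" for s using y by (metis less_irrefl sum_power2_gt_zero_iff)
  have c: "continuous_on UNIV (\<lambda>s. y / (s\<^sup>2 + y\<^sup>2))" "continuous_on UNIV (\<lambda>s. s / (s\<^sup>2 + y\<^sup>2))"
    using nz by (auto intro!: continuous_intros)
  have "Im ?I = integral {-r..r} (\<lambda>t. Im (of_real (f t) / (?z - of_real t)))"
    using integral_linear[OF i bounded_linear_Im] by (simp add: o_def)
  also have "\<dots> = integral {-r..r} (\<lambda>t. - (f t * (y / ((x - t)\<^sup>2 + y\<^sup>2))))"
    by (intro integral_cong) (simp add: Im_divide)
  also have "\<dots> = - integral {-r..r} (\<lambda>t. f t * (y / ((x - t)\<^sup>2 + y\<^sup>2)))" by (rule integral_neg)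
  also have "integral {-r..r} (\<lambda>t. f t * (y / ((x - t)\<^sup>2 + y\<^sup>2)))
     = (\<integral>s. indicator {0<..} s * (f (x - s) * (y / (s\<^sup>2 + y\<^sup>2)) + f (x + s) * (y / ((- s)\<^sup>2 + y\<^sup>2))) \<partial>lborel)"
    by (rule part_integral(1)[OF c(1)])
  finally have 1: "Im ?I = - (\<integral>s. indicator {0<..} s * ((f (x - s) + f (x + s)) * (y / (s\<^sup>2 + y\<^sup>2))) \<partial>lborel)"
    by (simp add: distrib_right add_divide_distrib)
  have "Re ?I = integral {-r..r} (\<lambda>t. Re (of_real (f t) / (?z - of_real t)))"
    using integral_linear[OF i bounded_linear_Re] by (simp add: o_def)
  also have "\<dots> = integral {-r..r} (\<lambda>t. f t * ((x - t) / ((x - t)\<^sup>2 + y\<^sup>2)))"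
    by (intro integral_cong) (simp add: Re_divide)
  also have "\<dots> = (\<integral>s. indicator {0<..} s * (f (x - s) * (s / (s\<^sup>2 + y\<^sup>2)) + f (x + s) * (- s / ((- s)\<^sup>2 + y\<^sup>2))) \<partial>lborel)"
    by (rule part_integral(1)[OF c(2)])
  finally have 2: "Re ?I = (\<integral>s. indicator {0<..} s * ((f (x - s) - f (x + s)) * (s / (s\<^sup>2 + y\<^sup>2))) \<partial>lborel)"
    by (simp add: left_diff_distrib diff_divide_distrib)
  have F: "Fext ?z = of_real (1 / pi) * (\<i> * ?I)" by (simp add: Fext_def)
  have RI: "Re (of_real c * (\<i> * w)) = c * - Im w" "Im (of_real c * (\<i> * w)) = c * Re w" for c w by simp_all
  have "Re (Fext ?z) = 1 / pi * - Im ?I" unfolding F by (rule RI)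
  then show "Re (Fext ?z) = 1 / pi * (\<integral>s. indicator {0<..} s * ((f (x - s) + f (x + s)) * (y / (s\<^sup>2 + y\<^sup>2))) \<partial>lborel)"
    unfolding 1 by simp
  have "Im (Fext ?z) = 1 / pi * Re ?I" unfolding F by (rule RI)
  then show "Im (Fext ?z) = 1 / pi * (\<integral>s. indicator {0<..} s * ((f (x - s) - f (x + s)) * (s / (s\<^sup>2 + y\<^sup>2))) \<partial>lborel)"
    unfolding 2 .
qed

text \<open>Replacing \<open>s / (s\<^sup>2 + y\<^sup>2)\<close> by the larger \<open>1 / s\<close>
  reduces this to \<open>difference_bound\<close>. The bound is uniform in \<open>y\<close> and so
  serves as domination when \<open>y\<close> tends to 0.\<close>

lemma Im_kernel_bound:
  "\<bar>indicator {0<..} s * ((f (x - s) - f (x + s)) * (s / (s\<^sup>2 + y\<^sup>2)))\<bar> \<le> 2 * L * indicator {0<..r + \<bar>x\<bar>} s"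
proof (cases "0 < s")
  case True
  have "s / (s\<^sup>2 + y\<^sup>2) \<le> s / s\<^sup>2" using True by (intro divide_left_mono) (auto intro!: mult_pos_pos add_pos_nonneg)
  also have "\<dots> = 1 / s" by (simp add: power2_eq_square)
  finally have "\<bar>(f (x - s) - f (x + s)) * (s / (s\<^sup>2 + y\<^sup>2))\<bar> \<le> \<bar>f (x - s) - f (x + s)\<bar> * (1 / s)"
    unfolding abs_mult using True by (intro mult_left_mono) auto
  also have "\<dots> = \<bar>(f (x - s) - f (x + s)) / s\<bar>" using True by (simp add: abs_divide)
  also have "\<dots> \<le> 2 * L * indicator {0<..r + \<bar>x\<bar>} s" by (rule difference_bound[OF True])
  finally show ?thesis using True by simp
qed (use L in simp)

lemma Im_Fext_bound: assumes "0 < y" shows "\<bar>Im (Fext (Complex x y))\<bar> \<le> 2 * L * (r + \<bar>x\<bar>)"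
proof -
  have "norm (\<integral>s. indicator {0<..} s * ((f (x - s) - f (x + s)) * (s / (s\<^sup>2 + y\<^sup>2))) \<partial>lborel)
      \<le> (\<integral>s. 2 * L * indicator {0<..r + \<bar>x\<bar>} s \<partial>lborel)"
  proof (rule Bochner_Integration.integral_norm_bound_integral[OF _ integrable_bump])
    show "integrable lborel (\<lambda>s. indicator {0<..} s * ((f (x - s) - f (x + s)) * (s / (s\<^sup>2 + y\<^sup>2))))"
      by (rule Bochner_Integration.integrable_bound[OF integrable_bump[of x]])
         (use Im_kernel_bound[of _ x y] L in auto)
  qed (use Im_kernel_bound in auto)
  then have "\<bar>Im (Fext (Complex x y))\<bar> \<le> 1 / pi * (2 * L * (r + \<bar>x\<bar>))"
    unfolding Fext_parts(2)[OF assms] abs_mult using r by (simp add: divide_right_mono)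
  also have "\<dots> \<le> 1 * (2 * L * (r + \<bar>x\<bar>))" using pi_gt3 r L by (intro mult_right_mono) auto
  finally show ?thesis by simp
qed

text \<open>Scaling \<open>s\<close> by \<open>y\<close> moves the dependence on \<open>y\<close>
  out of the Poisson kernel into the arguments of \<open>f\<close>, where continuity takes care of
  the limit; the kernel that remains is integrable and free of \<open>y\<close>.\<close>

lemma Re_kernel_scaled:
  assumes y: "0 < y"
  shows "Re (Fext (Complex x y)) = 1 / pi * (\<integral>s. indicator {0<..} s * ((f (x - y * s) + f (x + y * s)) * (1 / (1 + s\<^sup>2))) \<partial>lborel)"
proof -
  have aff: "(\<integral>s. g s \<partial>lborel) = (\<integral>s. y * g (y * s) \<partial>lborel)" for g :: "real \<Rightarrow> real"
    using lborel_integral_real_affine[of y g 0] y by simp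
  have "(\<integral>s. indicator {0<..} s * ((f (x - s) + f (x + s)) * (y / (s\<^sup>2 + y\<^sup>2))) \<partial>lborel)
     = (\<integral>s. y * (indicator {0<..} (y * s) * ((f (x - y * s) + f (x + y * s)) * (y / ((y * s)\<^sup>2 + y\<^sup>2)))) \<partial>lborel)"
    by (rule aff)
  also have "\<dots> = (\<integral>s. indicator {0<..} s * ((f (x - y * s) + f (x + y * s)) * (1 / (1 + s\<^sup>2))) \<partial>lborel)"
  proof (rule Bochner_Integration.integral_cong)
    fix s :: real
    have "y * (y / ((y * s)\<^sup>2 + y\<^sup>2)) = y\<^sup>2 / (y\<^sup>2 * (1 + s\<^sup>2))"
      by (simp add: power_mult_distrib power2_eq_square distrib_left add.commute)
    also have "\<dots> = 1 / (1 + s\<^sup>2)" using y by simp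
    finally have e: "y * (y / ((y * s)\<^sup>2 + y\<^sup>2)) = 1 / (1 + s\<^sup>2)" .
    have i: "indicator {0<..} (y * s) = (indicator {0<..} s :: real)" using y by (auto simp: indicator_def zero_less_mult_iff)
    show "y * (indicator {0<..} (y * s) * ((f (x - y * s) + f (x + y * s)) * (y / ((y * s)\<^sup>2 + y\<^sup>2))))
       = indicator {0<..} s * ((f (x - y * s) + f (x + y * s)) * (1 / (1 + s\<^sup>2)))"
      unfolding e[symmetric] i by (simp only: mult_ac)
  qed simp
  finally show ?thesis unfolding Fext_parts(1)[OF y] by simp
qed

lemma Re_kernel_bound:
  "\<bar>indicator {0<..} s * ((f u + f v) * (1 / (1 + s\<^sup>2)))\<bar> \<le> 4 * r * L * (indicator {0<..} s * (1 / (1 + s\<^sup>2)))"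
proof (cases "0 < s")
  case True
  have "\<bar>f u + f v\<bar> \<le> 4 * r * L" using bound[of u] bound[of v] by linarith
  then have "\<bar>f u + f v\<bar> * (1 / (1 + s\<^sup>2)) \<le> 4 * r * L * (1 / (1 + s\<^sup>2))" by (intro mult_right_mono) auto
  then show ?thesis using True by (simp add: abs_mult)
qed simp

lemma Re_Fext_bound: assumes "0 < y" shows "\<bar>Re (Fext (Complex x y))\<bar> \<le> 2 * r * L"
proof -
  have "norm (\<integral>s. indicator {0<..} s * ((f (x - y * s) + f (x + y * s)) * (1 / (1 + s\<^sup>2))) \<partial>lborel)
      \<le> (\<integral>s. 4 * r * L * (indicator {0<..} s * (1 / (1 + s\<^sup>2))) \<partial>lborel)"
  proof (rule Bochner_Integration.integral_norm_bound_integral[OF _ integrable_mult_right[OF poisson_kernel(1)]])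
    show "integrable lborel (\<lambda>s. indicator {0<..} s * ((f (x - y * s) + f (x + y * s)) * (1 / (1 + s\<^sup>2))))"
    proof (rule Bochner_Integration.integrable_bound[OF integrable_mult_right[OF poisson_kernel(1), of "4 * r * L"]])
      show "AE s in lborel. norm (indicator {0<..} s * ((f (x - y * s) + f (x + y * s)) * (1 / (1 + s\<^sup>2))))
         \<le> norm (4 * r * L * (indicator {0<..} s * (1 / (1 + s\<^sup>2))))"
        unfolding real_norm_def by (intro AE_I2 order_trans[OF Re_kernel_bound abs_ge_self])
    qed measurable
    show "norm (indicator {0<..} s * ((f (x - y * s) + f (x + y * s)) * (1 / (1 + s\<^sup>2)))) \<le> 4 * r * L * (indicator {0<..} s * (1 / (1 + s\<^sup>2)))" for s
      unfolding real_norm_def by (rule Re_kernel_bound)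
  qed
  also have "\<dots> = 4 * r * L * (pi / 2)" by (simp only: integral_mult_right_zero poisson_kernel(2))
  finally have "\<bar>Re (Fext (Complex x y))\<bar> \<le> 1 / pi * (4 * r * L * (pi / 2))"
    unfolding Re_kernel_scaled[OF assms] abs_mult by (intro mult_mono) auto
  then show ?thesis by (simp add: mult_ac)
qed

text \<open>In the real part the folded kernel has mass \<open>pi / 2\<close> and meets
  \<open>2 * f x\<close> in the limit; in the imaginary part the conjugate kernel tends to
  \<open>1 / s\<close>, which leaves the integral of \<open>hk\<close>.\<close>

lemma Fext_lim: "(\<lambda>n. Fext (Complex x (1 / real (Suc n)))) \<longlonglongrightarrow> Complex (f x) (hilbert f x)"
proof -
  have y: "0 < 1 / real (Suc n)" for n by simp
  have y0: "(\<lambda>n. 1 / real (Suc n)) \<longlonglongrightarrow> 0" by (rule LIMSEQ_Suc[OF lim_1_over_n])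
  have fc: "isCont f u" for u using cont by (simp add: continuous_on_eq_continuous_at)
  have "(\<lambda>n. \<integral>s. indicator {0<..} s * ((f (x - 1 / real (Suc n) * s) + f (x + 1 / real (Suc n) * s)) * (1 / (1 + s\<^sup>2))) \<partial>lborel)
     \<longlonglongrightarrow> (\<integral>s. 2 * f x * (indicator {0<..} s * (1 / (1 + s\<^sup>2))) \<partial>lborel)"
  proof (rule integral_dominated_convergence[OF _ _ integrable_mult_right[OF poisson_kernel(1), of "4 * r * L"]])
    show "AE s in lborel. (\<lambda>n. indicator {0<..} s * ((f (x - 1 / real (Suc n) * s) + f (x + 1 / real (Suc n) * s)) * (1 / (1 + s\<^sup>2))))
         \<longlonglongrightarrow> 2 * f x * (indicator {0<..} s * (1 / (1 + s\<^sup>2)))"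
    proof (rule AE_I2)
      fix s :: real
      have "(\<lambda>n. x - 1 / real (Suc n) * s) \<longlonglongrightarrow> x - 0 * s" "(\<lambda>n. x + 1 / real (Suc n) * s) \<longlonglongrightarrow> x + 0 * s"
        by (intro tendsto_intros y0)+
      then have "(\<lambda>n. f (x - 1 / real (Suc n) * s)) \<longlonglongrightarrow> f x" "(\<lambda>n. f (x + 1 / real (Suc n) * s)) \<longlonglongrightarrow> f x"
        using isCont_tendsto_compose[OF fc] by simp_all
      then have "(\<lambda>n. indicator {0<..} s * ((f (x - 1 / real (Suc n) * s) + f (x + 1 / real (Suc n) * s)) * (1 / (1 + s\<^sup>2))))
         \<longlonglongrightarrow> indicator {0<..} s * ((f x + f x) * (1 / (1 + s\<^sup>2)))"
        by (intro tendsto_mult tendsto_add tendsto_const)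
      then show "(\<lambda>n. indicator {0<..} s * ((f (x - 1 / real (Suc n) * s) + f (x + 1 / real (Suc n) * s)) * (1 / (1 + s\<^sup>2))))
         \<longlonglongrightarrow> 2 * f x * (indicator {0<..} s * (1 / (1 + s\<^sup>2)))"
        by (simp add: mult_ac)
    qed
    show "AE s in lborel. norm (indicator {0<..} s * ((f (x - 1 / real (Suc n) * s) + f (x + 1 / real (Suc n) * s)) * (1 / (1 + s\<^sup>2))))
        \<le> 4 * r * L * (indicator {0<..} s * (1 / (1 + s\<^sup>2)))" for n
      unfolding real_norm_def by (intro AE_I2 Re_kernel_bound)
  qed measurable
  then have "(\<lambda>n. 1 / pi * (\<integral>s. indicator {0<..} s * ((f (x - 1 / real (Suc n) * s) + f (x + 1 / real (Suc n) * s)) * (1 / (1 + s\<^sup>2))) \<partial>lborel))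
     \<longlonglongrightarrow> 1 / pi * (2 * f x * (pi / 2))"
    unfolding integral_mult_right_zero poisson_kernel(2) by (intro tendsto_mult tendsto_const)
  then have Re: "(\<lambda>n. Re (Fext (Complex x (1 / real (Suc n))))) \<longlonglongrightarrow> f x"
    unfolding Re_kernel_scaled[OF y] by simp
  have "(\<lambda>n. \<integral>s. indicator {0<..} s * ((f (x - s) - f (x + s)) * (s / (s\<^sup>2 + (1 / real (Suc n))\<^sup>2))) \<partial>lborel)
     \<longlonglongrightarrow> (\<integral>s. hk x s \<partial>lborel)"
  proof (rule integral_dominated_convergence[OF _ _ integrable_bump[of x]])
    show "hk x \<in> borel_measurable lborel" using hk_integrable by auto
    show "AE s in lborel. (\<lambda>n. indicator {0<..} s * ((f (x - s) - f (x + s)) * (s / (s\<^sup>2 + (1 / real (Suc n))\<^sup>2)))) \<longlonglongrightarrow> hk x s"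
    proof (rule AE_I2)
      fix s :: real
      show "(\<lambda>n. indicator {0<..} s * ((f (x - s) - f (x + s)) * (s / (s\<^sup>2 + (1 / real (Suc n))\<^sup>2)))) \<longlonglongrightarrow> hk x s"
      proof (cases "0 < s")
        case True
        have "(\<lambda>n. s / (s\<^sup>2 + (1 / real (Suc n))\<^sup>2)) \<longlonglongrightarrow> s / (s\<^sup>2 + 0\<^sup>2)"
          using True by (intro tendsto_intros y0) auto
        also have "s / (s\<^sup>2 + 0\<^sup>2) = 1 / s" by (simp add: power2_eq_square)
        finally have "(\<lambda>n. indicator {0<..} s * ((f (x - s) - f (x + s)) * (s / (s\<^sup>2 + (1 / real (Suc n))\<^sup>2))))
            \<longlonglongrightarrow> indicator {0<..} s * ((f (x - s) - f (x + s)) * (1 / s))"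
          by (intro tendsto_mult tendsto_const)
        then show ?thesis by (simp add: hk_def)
      qed (simp add: hk_def)
    qed
    show "AE s in lborel. norm (indicator {0<..} s * ((f (x - s) - f (x + s)) * (s / (s\<^sup>2 + (1 / real (Suc n))\<^sup>2)))) \<le> 2 * L * indicator {0<..r + \<bar>x\<bar>} s" for n
      unfolding real_norm_def by (intro AE_I2 Im_kernel_bound)
  qed measurable
  then have Im: "(\<lambda>n. Im (Fext (Complex x (1 / real (Suc n))))) \<longlonglongrightarrow> hilbert f x"
    unfolding Fext_parts(2)[OF y] hilbert_eq by (intro tendsto_mult tendsto_const)
  show ?thesis by (rule tendsto_complex_iff[THEN iffD2]) (use Re Im in auto)
qed

text \<open>Near the support the bounds \<open>2 * r * L\<close> and
  \<open>2 * L * (r + \<bar>x\<bar>)\<close> for the two parts of \<open>Fext\<close> add up to at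
  most \<open>8 * r * L\<close>. Further out the distance to the support is at least
  \<open>\<bar>x\<bar> / 2\<close>, and the resulting decay of order
  \<open>1 / \<bar>x\<bar>\<close> is \<open>p\<close>-integrable since
  \<open>p > 1\<close>.\<close>

definition "majorant x = (if \<bar>x\<bar> < 2 * r then 8 * r * L else 8 * r\<^sup>2 * L / (pi * \<bar>x\<bar>))"

lemma Fext_majorant:
  assumes "0 < y" shows "cmod (Fext (Complex x y)) \<le> majorant x"
proof (cases "\<bar>x\<bar> < 2 * r")
  case True
  have "cmod (Fext (Complex x y)) \<le> 2 * r * L + 2 * L * (r + \<bar>x\<bar>)"
    using cmod_le[of "Fext (Complex x y)"] Re_Fext_bound[OF assms, of x] Im_Fext_bound[OF assms, of x] by linarith
  also have "2 * L * (r + \<bar>x\<bar>) \<le> 2 * L * (3 * r)" using True L by (intro mult_left_mono) auto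
  also have "2 * r * L + 2 * L * (3 * r) = 8 * r * L" by simp
  finally show ?thesis using True by (simp add: majorant_def)
next
  case False
  have "cmod (Fext (Complex x y)) \<le> 4 * r\<^sup>2 * L / (pi * (\<bar>x\<bar> / 2))"
  proof (rule Fext_norm)
    fix t assume t: "\<bar>t\<bar> \<le> r"
    have "\<bar>x\<bar> / 2 \<le> \<bar>x - t\<bar>" using t False by linarith
    also have "\<dots> \<le> cmod (Complex x y - of_real t)" using abs_Re_le_cmod[of "Complex x y - of_real t"] by simp
    finally show "\<bar>x\<bar> / 2 \<le> cmod (Complex x y - of_real t)" .
  qed (use assms False r in auto)
  also have "4 * r\<^sup>2 * L / (pi * (\<bar>x\<bar> / 2)) = 8 * r\<^sup>2 * L / (pi * \<bar>x\<bar>)" by (simp add: divide_simps)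
  finally show ?thesis using False by (simp add: majorant_def)
qed

lemma majorant_integrable:
  assumes p: "1 < p" shows "integrable lborel (\<lambda>x. majorant x powr p)"
proof -
  define c where "c = 8 * r\<^sup>2 * L / pi"
  define h where "h x = indicator {-2*r..2*r} x * ((8 * r * L) powr p) + c powr p * (indicator {2*r..} x * x powr (- p))
     + c powr p * (indicator {2*r..} (- x) * (- x) powr (- p))" for x
  have i: "integrable lborel (\<lambda>x. indicator {2*r..} x * x powr (- p))" using r p by (intro integrable_powr_tail) auto
  then have "integrable lborel (\<lambda>x. indicator {2*r..} (- x) * (- x) powr (- p))"
    using lborel_integrable_real_affine[of "\<lambda>x. indicator {2*r..} x * x powr (- p)" "-1" 0] by simp
  then have hi: "integrable lborel h"
    unfolding h_def[abs_def]
    by (intro Bochner_Integration.integrable_add integrable_mult_left integrable_mult_right integrable_interval i)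
  have c0: "0 \<le> c" using r L by (simp add: c_def)
  have "majorant x powr p \<le> h x" for x
  proof (cases "\<bar>x\<bar> < 2 * r")
    case True
    then show ?thesis by (auto simp: majorant_def h_def indicator_def)
  next
    case False
    then have x: "0 < \<bar>x\<bar>" using r by linarith
    have "majorant x = c * \<bar>x\<bar> powr (- 1)" using False x by (simp add: majorant_def c_def powr_minus divide_inverse)
    then have "majorant x powr p = c powr p * \<bar>x\<bar> powr (- p)"
      by (simp only: powr_mult powr_powr) simp
    also have "\<dots> \<le> h x"
    proof (cases "0 < x")
      case True
      then have "x \<in> {2*r..}" using False by auto
      then show ?thesis using True by (simp add: h_def indicator_def)
    next
      case F: False
      then have "- x \<in> {2*r..}" using False by auto
      then show ?thesis using F x by (simp add: h_def indicator_def)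
    qed
    finally show ?thesis .
  qed
  then have "norm (majorant x powr p) \<le> norm (h x)" for x by (simp add: order_trans[OF _ abs_ge_self])
  moreover have "(\<lambda>x. majorant x powr p) \<in> borel_measurable lborel" unfolding majorant_def by measurable
  ultimately show ?thesis by (intro Bochner_Integration.integrable_bound[OF hi] AE_I2)
qed

lemma hilbert_measurable: "hilbert f \<in> borel_measurable lborel"
proof (rule borel_measurable_LIMSEQ_real)
  show "(\<lambda>n. Im (Fext (Complex x (1 / real (Suc n))))) \<longlonglongrightarrow> hilbert f x" for x
    using tendsto_Im[OF Fext_lim[of x]] by simp
  fix n
  have "continuous_on UNIV (\<lambda>x. Fext (Complex x (1 / real (Suc n))))"
    by (rule continuous_on_compose2[OF holomorphic_on_imp_continuous_on[OF Fext_holomorphic]])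
       (auto simp: Complex_eq intro!: continuous_intros)
  then have "continuous_on UNIV (\<lambda>x. Im (Fext (Complex x (1 / real (Suc n)))))" by (intro continuous_intros)
  then show "(\<lambda>x. Im (Fext (Complex x (1 / real (Suc n))))) \<in> borel_measurable lborel"
    by (simp add: borel_measurable_continuous_onI)
qed

lemma boundary_majorant: "cmod (Complex (f x) (hilbert f x)) \<le> majorant x"
  by (rule LIMSEQ_le_const2[OF tendsto_norm[OF Fext_lim]]) (use Fext_majorant in auto)

end

section \<open>Smooth functions\<close>

definition smooth :: "(real \<Rightarrow> real) \<Rightarrow> bool" where
  "smooth f \<longleftrightarrow> (\<forall>n. (deriv ^^ n) f differentiable_on UNIV)"

text \<open>Finite orders make induction possible: the derivative of a product of functions of order
  \<open>Suc n\<close> is a sum of products of functions of order \<open>n\<close>.\<close>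

definition smooth_upto :: "nat \<Rightarrow> (real \<Rightarrow> real) \<Rightarrow> bool" where
  "smooth_upto n f \<longleftrightarrow> (\<forall>k<n. (deriv ^^ k) f differentiable_on UNIV)"

lemma smooth_iff_upto: "smooth f \<longleftrightarrow> (\<forall>n. smooth_upto n f)"
  unfolding smooth_def smooth_upto_def by blast

lemma differentiable_on_UNIV_iff:
  "f differentiable_on UNIV \<longleftrightarrow> (\<forall>x. (f has_real_derivative deriv f x) (at x))" for f :: "real \<Rightarrow> real"
proof
  assume "f differentiable_on UNIV"
  then have "f differentiable (at x)" for x by (simp add: differentiable_on_def)
  then show "\<forall>x. (f has_real_derivative deriv f x) (at x)"
    by (metis DERIV_deriv_iff_real_differentiable)
next
  assume "\<forall>x. (f has_real_derivative deriv f x) (at x)"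
  then show "f differentiable_on UNIV"
    by (auto simp: differentiable_on_def intro: has_field_derivative_imp_has_derivative differentiableI)
qed

lemma smooth_upto_Suc:
  "smooth_upto (Suc n) f \<longleftrightarrow> (\<forall>x. (f has_real_derivative deriv f x) (at x)) \<and> smooth_upto n (deriv f)"
proof -
  have "(\<forall>k<Suc n. (deriv ^^ k) f differentiable_on UNIV) \<longleftrightarrow>
     f differentiable_on UNIV \<and> (\<forall>k<n. (deriv ^^ k) (deriv f) differentiable_on UNIV)"
    by (auto simp: less_Suc_eq_0_disj funpow_swap1 funpow_Suc_right simp del: funpow.simps(2))
  then show ?thesis by (simp add: smooth_upto_def differentiable_on_UNIV_iff)
qed

lemma smooth_upto_0 [simp]: "smooth_upto 0 f" by (simp add: smooth_upto_def)

lemma smooth_upto_mono: "smooth_upto (Suc n) f \<Longrightarrow> smooth_upto n f"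
  by (simp add: smooth_upto_def)

lemma smooth_upto_SucI:
  assumes "\<And>x. (f has_real_derivative f' x) (at x)" "smooth_upto n f'"
  shows "smooth_upto (Suc n) f"
proof -
  have "deriv f = f'" using assms(1) by (auto intro!: ext DERIV_imp_deriv)
  then show ?thesis using assms by (simp add: smooth_upto_Suc)
qed

lemma smooth_upto_const: "smooth_upto n (\<lambda>_. c)"
proof (induction n arbitrary: c)
  case (Suc n)
  show ?case by (rule smooth_upto_SucI[OF DERIV_const Suc])
qed simp

lemma smooth_upto_add: "smooth_upto n f \<Longrightarrow> smooth_upto n g \<Longrightarrow> smooth_upto n (\<lambda>x. f x + g x)"
proof (induction n arbitrary: f g)
  case (Suc n)
  show ?case
    by (rule smooth_upto_SucI[of _ "\<lambda>x. deriv f x + deriv g x"])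
       (use Suc in \<open>auto simp: smooth_upto_Suc intro!: DERIV_add\<close>)
qed simp

lemma smooth_upto_mult: "smooth_upto n f \<Longrightarrow> smooth_upto n g \<Longrightarrow> smooth_upto n (\<lambda>x. f x * g x)"
proof (induction n arbitrary: f g)
  case (Suc n)
  show ?case
  proof (rule smooth_upto_SucI)
    show "((\<lambda>x. f x * g x) has_real_derivative deriv f x * g x + deriv g x * f x) (at x)" for x
      using Suc.prems by (intro DERIV_mult) (auto simp: smooth_upto_Suc)
    show "smooth_upto n (\<lambda>x. deriv f x * g x + deriv g x * f x)"
      using Suc.prems by (intro smooth_upto_add Suc.IH) (auto simp: smooth_upto_Suc intro: smooth_upto_mono)
  qed
qed simp

lemma smooth_upto_affine: "smooth_upto n f \<Longrightarrow> smooth_upto n (\<lambda>x. f (a * x + c))"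
proof (induction n arbitrary: f)
  case (Suc n)
  show ?case
  proof (rule smooth_upto_SucI)
    have l: "((\<lambda>x. a * x + c) has_real_derivative a) (at x)" for x by (auto intro!: derivative_eq_intros)
    have d: "(f has_real_derivative deriv f x) (at x)" for x using Suc.prems by (simp add: smooth_upto_Suc)
    show "((\<lambda>x. f (a * x + c)) has_real_derivative deriv f (a * x + c) * a) (at x)" for x
      by (rule DERIV_chain2[OF d l])
    show "smooth_upto n (\<lambda>x. deriv f (a * x + c) * a)"
      using Suc by (intro smooth_upto_mult smooth_upto_const) (auto simp: smooth_upto_Suc)
  qed
qed simp

lemma smooth_const: "smooth (\<lambda>_. c)" using smooth_upto_const by (simp add: smooth_iff_upto)
lemma smooth_add: "smooth f \<Longrightarrow> smooth g \<Longrightarrow> smooth (\<lambda>x. f x + g x)" using smooth_upto_add by (simp add: smooth_iff_upto)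
lemma smooth_mult: "smooth f \<Longrightarrow> smooth g \<Longrightarrow> smooth (\<lambda>x. f x * g x)" using smooth_upto_mult by (simp add: smooth_iff_upto)
lemma smooth_affine: "smooth f \<Longrightarrow> smooth (\<lambda>x. f (a * x + c))" using smooth_upto_affine by (simp add: smooth_iff_upto)
lemma smooth_power: "smooth f \<Longrightarrow> smooth (\<lambda>x. f x ^ n)" by (induction n) (auto intro: smooth_const smooth_mult)
lemma smooth_diff: "smooth f \<Longrightarrow> smooth g \<Longrightarrow> smooth (\<lambda>x. f x - g x)"
  using smooth_add[of f "\<lambda>x. (-1) * g x"] smooth_mult[OF smooth_const, of g "-1"] by simp

text \<open>For a family closed under differentiation no formula for the higher derivatives is
  needed. The families in question are \<open>flat\<close>, indexed by polynomials, and real parts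
  of complex powers, indexed by coefficient and exponent.\<close>

lemma smooth_coinduct:
  assumes "f \<in> P" and "\<And>f. f \<in> P \<Longrightarrow> \<exists>f'\<in>P. \<forall>x. (f has_real_derivative f' x) (at x)"
  shows "smooth f"
proof -
  have "smooth_upto n f" if "f \<in> P" for n f
    using that
  proof (induction n arbitrary: f)
    case (Suc n)
    then obtain f' where "f' \<in> P" "\<And>x. (f has_real_derivative f' x) (at x)" using assms(2) by blast
    then show ?case using Suc.IH by (intro smooth_upto_SucI[of f f']) auto
  qed simp
  then show ?thesis using assms(1) by (simp add: smooth_iff_upto)
qed

lemma smooth_der: "smooth f \<Longrightarrow> (f has_real_derivative deriv f x) (at x)"
  using smooth_iff_upto[of f] smooth_upto_Suc[of 0 f] by blast

lemma smooth_deriv: "smooth f \<Longrightarrow> smooth (deriv f)"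
  unfolding smooth_iff_upto using smooth_upto_Suc by blast

lemma smooth_cont: "smooth f \<Longrightarrow> continuous_on UNIV f"
  by (intro continuous_at_imp_continuous_on ballI DERIV_isCont[OF smooth_der])

text \<open>The classical \<open>exp (- 1 / x)\<close>, extended by 0; the polynomial in
  \<open>1 / x\<close> closes the family under differentiation.\<close>

definition flat :: "real poly \<Rightarrow> real \<Rightarrow> real" where
  "flat q x = (if 0 < x then poly q (1 / x) * exp (- 1 / x) else 0)"

lemma flat_tendsto: fixes q :: "real poly" shows "((\<lambda>x. poly q (1 / x) * exp (- 1 / x)) \<longlongrightarrow> 0) (at_right 0)"
proof -
  have "((\<lambda>y. poly q y * exp (- y)) \<longlongrightarrow> 0) at_top"
  proof -
    have "((\<lambda>y. \<Sum>i\<le>degree q. coeff q i * (y ^ i * exp (- y))) \<longlongrightarrow> (\<Sum>i\<le>degree q. coeff q i * 0)) at_top"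
    proof (rule tendsto_sum)
      fix i
      have "((\<lambda>y::real. y ^ i * exp (- y)) \<longlongrightarrow> 0) at_top"
        using tendsto_power_div_exp_0[of i] by (simp add: exp_minus divide_inverse)
      then show "((\<lambda>y. coeff q i * (y ^ i * exp (- y))) \<longlongrightarrow> coeff q i * 0) at_top"
        by (rule tendsto_mult[OF tendsto_const])
    qed
    then show ?thesis by (simp add: poly_altdef sum_distrib_right mult.assoc)
  qed
  from filterlim_compose[OF this filterlim_inverse_at_top_right]
  show ?thesis by (simp add: divide_inverse)
qed

text \<open>In the variable \<open>y = 1 / x\<close> the derivative is \<open>- y\<^sup>2\<close>
  times the derivative in \<open>y\<close>, which takes \<open>q y * exp (- y)\<close> to
  \<open>y\<^sup>2 * (q y - q' y) * exp (- y)\<close>. At 0 the difference quotient from the right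
  is of the same type, with the polynomial \<open>y * q y\<close>, and tends to 0.\<close>

lemma flat_der:
  "(flat q has_real_derivative flat (monom 1 2 * (q - pderiv q)) x) (at x)"
proof -
  consider "x < 0" | "x = 0" | "0 < x" by linarith
  then show ?thesis
  proof cases
    case 1
    have "((\<lambda>_. 0) has_real_derivative flat (monom 1 2 * (q - pderiv q)) x) (at x)" using 1 by (simp add: flat_def)
    then show ?thesis
      by (rule has_field_derivative_transform_within_open[of _ _ _ "{..<0}"]) (use 1 in \<open>auto simp: flat_def\<close>)
  next
    case 2
    have "((\<lambda>k. flat q k / k) \<longlongrightarrow> 0) (at_right 0)"
    proof (rule Lim_transform_eventually[OF flat_tendsto[of "pCons 0 q"]])
      show "\<forall>\<^sub>F k in at_right 0. poly (pCons 0 q) (1 / k) * exp (- 1 / k) = flat q k / k"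
        by (auto simp: eventually_at_filter flat_def)
    qed
    moreover have "((\<lambda>k. flat q k / k) \<longlongrightarrow> 0) (at_left 0)"
      by (rule Lim_transform_eventually[OF tendsto_const]) (auto simp: eventually_at_filter flat_def)
    ultimately have "((\<lambda>k. flat q k / k) \<longlongrightarrow> 0) (at 0)" by (simp add: filterlim_at_split)
    then show ?thesis using 2 by (simp add: DERIV_def flat_def)
  next
    case 3
    have "((\<lambda>x. poly q (1 / x) * exp (- 1 / x)) has_real_derivative flat (monom 1 2 * (q - pderiv q)) x) (at x)"
      using 3 by (auto intro!: derivative_eq_intros DERIV_chain2[OF poly_DERIV]
         simp: flat_def poly_monom power2_eq_square field_simps)
    then show ?thesis
      by (rule has_field_derivative_transform_within_open[of _ _ _ "{0<..}"]) (use 3 in \<open>auto simp: flat_def\<close>)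
  qed
qed

lemma smooth_flat: "smooth (flat q)"
  by (rule smooth_coinduct[of _ "range flat"]) (use flat_der in auto)

definition bump :: "real \<Rightarrow> real" where
  "bump x = flat [:1:] (x + 1) * flat [:1:] (1 - x)"

lemma smooth_bump: "smooth bump"
  unfolding bump_def[abs_def]
  using smooth_affine[OF smooth_flat, of "[:1:]" 1 1] smooth_affine[OF smooth_flat, of "[:1:]" "-1" 1]
  by (intro smooth_mult) (simp_all add: add.commute)

lemma bump_pos: "\<bar>x\<bar> < 1 \<Longrightarrow> 0 < bump x"
  by (auto simp: bump_def flat_def abs_less_iff)

lemma bump_zero: "1 \<le> \<bar>x\<bar> \<Longrightarrow> bump x = 0"
  by (auto simp: bump_def flat_def)

lemma bump_bounds: "0 \<le> bump x" "bump x \<le> 1"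
proof -
  have "0 \<le> flat [:1:] x" "flat [:1:] x \<le> 1" for x by (auto simp: flat_def)
  then show "0 \<le> bump x" "bump x \<le> 1" unfolding bump_def by (auto intro: mult_le_one)
qed

lemma test_functions_iff:
  "f \<in> test_functions \<longleftrightarrow> smooth f \<and> (\<exists>r>0. \<forall>x. r \<le> \<bar>x\<bar> \<longrightarrow> f x = 0)"
proof -
  have "compact (closure {x. f x \<noteq> 0}) \<longleftrightarrow> (\<exists>r>0. \<forall>x. r \<le> \<bar>x\<bar> \<longrightarrow> f x = 0)"
  proof -
    have "compact (closure {x. f x \<noteq> 0}) \<longleftrightarrow> bounded {x. f x \<noteq> 0}" by (rule compact_closure)
    also have "\<dots> \<longleftrightarrow> (\<exists>r>0. \<forall>x. r \<le> \<bar>x\<bar> \<longrightarrow> f x = 0)"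
    proof
      assume "bounded {x. f x \<noteq> 0}"
      then obtain B where "0 < B" "\<And>x. f x \<noteq> 0 \<Longrightarrow> \<bar>x\<bar> \<le> B" by (auto simp: bounded_pos)
      then show "\<exists>r>0. \<forall>x. r \<le> \<bar>x\<bar> \<longrightarrow> f x = 0" by (intro exI[of _ "B + 1"]) force
    next
      assume "\<exists>r>0. \<forall>x. r \<le> \<bar>x\<bar> \<longrightarrow> f x = 0"
      then obtain r where "\<And>x. r \<le> \<bar>x\<bar> \<Longrightarrow> f x = 0" by blast
      then have "\<bar>x\<bar> \<le> r" if "f x \<noteq> 0" for x using that by force
      then show "bounded {x. f x \<noteq> 0}" by (auto simp: bounded_iff)
    qed
    finally show ?thesis .
  qed
  then show ?thesis by (simp add: test_functions_def smooth_def)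
qed

lemma test_add:
  assumes "f \<in> test_functions" "g \<in> test_functions"
  shows "(\<lambda>x. f x + g x) \<in> test_functions"
proof -
  obtain r r' where "0 < r" "\<And>x. r \<le> \<bar>x\<bar> \<Longrightarrow> f x = 0" "\<And>x. r' \<le> \<bar>x\<bar> \<Longrightarrow> g x = 0"
    using assms by (auto simp: test_functions_iff)
  then have "0 < max r r'" "\<forall>x. max r r' \<le> \<bar>x\<bar> \<longrightarrow> f x + g x = 0" by auto
  then show ?thesis using assms by (auto simp: test_functions_iff intro: smooth_add)
qed

lemma test_mult:
  assumes "f \<in> test_functions" "smooth g"
  shows "(\<lambda>x. f x * g x) \<in> test_functions" "(\<lambda>x. g x * f x) \<in> test_functions"
  using assms by (auto simp: test_functions_iff intro: smooth_mult)

lemma test_cmult: "f \<in> test_functions \<Longrightarrow> (\<lambda>x. c * f x) \<in> test_functions"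
  by (rule test_mult(2)[OF _ smooth_const])

lemma test_affine:
  assumes "f \<in> test_functions" "a \<noteq> 0" shows "(\<lambda>x. f (a * x + c)) \<in> test_functions"
proof -
  obtain r where r: "0 < r" "\<And>x. r \<le> \<bar>x\<bar> \<Longrightarrow> f x = 0" using assms by (auto simp: test_functions_iff)
  have "f (a * x + c) = 0" if "(r + \<bar>c\<bar>) / \<bar>a\<bar> \<le> \<bar>x\<bar>" for x
  proof (rule r(2))
    have "r + \<bar>c\<bar> \<le> \<bar>a * x\<bar>" using that assms(2) by (simp add: pos_divide_le_eq abs_mult mult.commute)
    then show "r \<le> \<bar>a * x + c\<bar>" by linarith
  qed
  moreover have "0 < (r + \<bar>c\<bar>) / \<bar>a\<bar>" using r assms(2) by (simp add: add_pos_nonneg)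
  ultimately show ?thesis using assms smooth_affine by (auto simp: test_functions_iff)
qed

lemma test_bump: "bump \<in> test_functions"
  using smooth_bump bump_zero by (auto simp: test_functions_iff intro!: exI[of _ 1])

lemma test_bounded_deriv:
  assumes "f \<in> test_functions" obtains L where "0 \<le> L" "\<And>x. \<bar>deriv f x\<bar> \<le> L" "\<And>x y. \<bar>f x - f y\<bar> \<le> L * \<bar>x - y\<bar>"
proof -
  obtain r where r: "0 < r" "\<And>x. r \<le> \<bar>x\<bar> \<Longrightarrow> f x = 0" and s: "smooth f" using assms by (auto simp: test_functions_iff)
  have "compact (deriv f ` {-r..r})"
    by (rule compact_continuous_image[OF continuous_on_subset[OF smooth_cont[OF smooth_deriv[OF s]]]]) auto
  then have "bounded (deriv f ` {-r..r})" by (rule compact_imp_bounded)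
  then obtain L where L: "\<And>x. x \<in> {-r..r} \<Longrightarrow> \<bar>deriv f x\<bar> \<le> L" by (fastforce simp: bounded_iff)
  have L0: "0 \<le> L" using order_trans[OF abs_ge_zero L[of 0]] r by simp
  have dL: "\<bar>deriv f x\<bar> \<le> L" for x
  proof (cases "x \<in> {-r..r}")
    case False
    then have x: "x \<in> - {-r..r}" by simp
    have "((\<lambda>_. 0) has_real_derivative 0) (at x)" by simp
    then have "(f has_real_derivative 0) (at x)"
      by (rule has_field_derivative_transform_within_open[OF _ _ x]) (use r in \<open>auto simp: open_Compl\<close>)
    then show ?thesis using L0 by (simp add: DERIV_imp_deriv)
  qed (rule L)
  have "\<bar>f x - f y\<bar> \<le> L * \<bar>x - y\<bar>" for x y
    using field_differentiable_bound[of UNIV f "deriv f" L x y] dL smooth_der[OF s] by simp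
  then show ?thesis using that L0 dL by blast
qed

section \<open>Convergence in \<open>L\<^sup>p\<close> and density of test functions\<close>

text \<open>The \<open>p\<close>-th power of the norm. Working with it instead of the norm allows
  convexity of \<open>u powr p\<close> to take the place of Minkowski's inequality.\<close>

definition pint :: "real \<Rightarrow> (real \<Rightarrow> real) \<Rightarrow> real" where
  "pint p f = (\<integral>x. \<bar>f x\<bar> powr p \<partial>lborel)"

lemma pint_nonneg: "0 \<le> pint p f"
  by (simp add: pint_def)

lemma Lp_norm_powr: "p \<noteq> 0 \<Longrightarrow> Lp_norm p f powr p = pint p f"
  by (simp add: Lp_norm_def powr_powr pint_nonneg flip: pint_def)

lemma Lp_norm_eq: "Lp_norm p f = pint p f powr (1 / p)"
  by (simp add: Lp_norm_def pint_def)

lemma Lp_D: "f \<in> Lp p \<Longrightarrow> f \<in> borel_measurable lborel" "f \<in> Lp p \<Longrightarrow> integrable lborel (\<lambda>x. \<bar>f x\<bar> powr p)"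
  by (simp_all add: Lp_def)

text \<open>Convexity of the power at the points \<open>u / t\<close> and \<open>v / (1 - t)\<close>
  with weights \<open>t\<close> and \<open>1 - t\<close>. The free weight matters: as
  \<open>t\<close> tends to 1 the factor of \<open>u powr p\<close> tends to 1, so that sharp
  constants survive limits.\<close>

lemma powr_add_le_nonneg:
  fixes u v t p :: real
  assumes p: "1 < p" and t: "0 < t" "t < 1" and uv: "0 \<le> u" "0 \<le> v"
  shows "(u + v) powr p \<le> t powr (1 - p) * u powr p + (1 - t) powr (1 - p) * v powr p"
proof -
  have ge1: "1 \<le> s powr (1 - p)" if "0 < s" "s < 1" for s
    using powr_mono'[of "1 - p" 0 s] that p by simp
  consider "u = 0" | "v = 0" | "0 < u" "0 < v" using uv by linarith
  then show ?thesis
  proof cases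
    case 1
    then show ?thesis using ge1[of "1 - t"] t by (simp add: mult_le_cancel_right1)
  next
    case 2
    then show ?thesis using ge1[of t] t by (simp add: mult_le_cancel_right1)
  next
    case 3
    have "(t * (u / t) + (1 - t) * (v / (1 - t))) powr p \<le> t * (u / t) powr p + (1 - t) * (v / (1 - t)) powr p"
      using convex_onD[OF powr_convex[of p], of "1 - t" "u / t" "v / (1 - t)"] 3 t p by simp
    moreover have "s * (w / s) powr p = s powr (1 - p) * w powr p" if "0 < s" "0 < w" for s w :: real
      using that by (simp add: powr_divide powr_diff)
    ultimately show ?thesis using 3 t by simp
  qed
qed

lemma abs_powr_add_le:
  fixes u v t p :: real
  assumes "1 < p" "0 < t" "t < 1"
  shows "\<bar>u + v\<bar> powr p \<le> t powr (1 - p) * \<bar>u\<bar> powr p + (1 - t) powr (1 - p) * \<bar>v\<bar> powr p"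
proof -
  have "\<bar>u + v\<bar> powr p \<le> (\<bar>u\<bar> + \<bar>v\<bar>) powr p" using assms by (intro powr_mono2) auto
  also have "\<dots> \<le> t powr (1 - p) * \<bar>u\<bar> powr p + (1 - t) powr (1 - p) * \<bar>v\<bar> powr p"
    by (rule powr_add_le_nonneg) (use assms in auto)
  finally show ?thesis .
qed

lemma Lp_add_bound:
  assumes p: "1 < p" and f: "f \<in> Lp p" and g: "g \<in> Lp p" and t: "0 < t" "t < 1"
  shows "(\<lambda>x. f x + g x) \<in> Lp p" "pint p (\<lambda>x. f x + g x) \<le> t powr (1 - p) * pint p f + (1 - t) powr (1 - p) * pint p g"
proof -
  note [measurable] = Lp_D(1)[OF f] Lp_D(1)[OF g]
  have i: "integrable lborel (\<lambda>x. t powr (1 - p) * \<bar>f x\<bar> powr p + (1 - t) powr (1 - p) * \<bar>g x\<bar> powr p)"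
    by (intro Bochner_Integration.integrable_add integrable_mult_right Lp_D(2) f g)
  have "norm (\<bar>f x + g x\<bar> powr p) \<le> norm (t powr (1 - p) * \<bar>f x\<bar> powr p + (1 - t) powr (1 - p) * \<bar>g x\<bar> powr p)" for x
    unfolding real_norm_def abs_of_nonneg[OF powr_ge_zero] by (rule order_trans[OF abs_powr_add_le[OF p t] abs_ge_self])
  then have j: "integrable lborel (\<lambda>x. \<bar>f x + g x\<bar> powr p)"
    by (intro Bochner_Integration.integrable_bound[OF i] AE_I2) measurable
  then show "(\<lambda>x. f x + g x) \<in> Lp p" by (simp add: Lp_def)
  have "pint p (\<lambda>x. f x + g x) \<le> (\<integral>x. t powr (1 - p) * \<bar>f x\<bar> powr p + (1 - t) powr (1 - p) * \<bar>g x\<bar> powr p \<partial>lborel)"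
    unfolding pint_def by (rule integral_mono[OF j i]) (rule abs_powr_add_le[OF p t])
  also have "\<dots> = t powr (1 - p) * pint p f + (1 - t) powr (1 - p) * pint p g"
    using Lp_D(2)[OF f] Lp_D(2)[OF g] by (simp add: pint_def)
  finally show "pint p (\<lambda>x. f x + g x) \<le> t powr (1 - p) * pint p f + (1 - t) powr (1 - p) * pint p g" .
qed

lemma Lp_cmult:
  assumes "f \<in> Lp p" shows "(\<lambda>x. c * f x) \<in> Lp p" "pint p (\<lambda>x. c * f x) = \<bar>c\<bar> powr p * pint p f"
  using assms by (auto simp: Lp_def pint_def abs_mult powr_mult)

lemma Lp_add: "1 < p \<Longrightarrow> f \<in> Lp p \<Longrightarrow> g \<in> Lp p \<Longrightarrow> (\<lambda>x. f x + g x) \<in> Lp p"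
  using Lp_add_bound(1)[of p f g "1/2"] by simp

lemma Lp_diff: "1 < p \<Longrightarrow> f \<in> Lp p \<Longrightarrow> g \<in> Lp p \<Longrightarrow> (\<lambda>x. f x - g x) \<in> Lp p"
  using Lp_add[of p f "\<lambda>x. -1 * g x"] Lp_cmult(1)[of g p "-1"] by simp

text \<open>The weight \<open>t = 1/2\<close> yields the factor \<open>2 powr (p - 1)\<close> of a
  quasi-triangle inequality, good enough wherever only convergence matters.\<close>

definition qc :: "real \<Rightarrow> real" where "qc p = (1/2) powr (1 - p)"

lemma qc_pos: "0 < qc p" by (simp add: qc_def)

lemma pint_minus: "pint p (\<lambda>x. f x - g x) = pint p (\<lambda>x. g x - f x)"
  by (simp add: pint_def abs_minus_commute)

lemma pint_triangle:
  assumes p: "1 < p" and "f \<in> Lp p" "g \<in> Lp p" "h \<in> Lp p"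
  shows "pint p (\<lambda>x. f x - h x) \<le> qc p * (pint p (\<lambda>x. f x - g x) + pint p (\<lambda>x. g x - h x))"
  using Lp_add_bound(2)[OF p Lp_diff[OF p assms(2,3)] Lp_diff[OF p assms(3,4)], of "1/2"]
  by (simp add: qc_def distrib_left)

lemma pint_zero_AE:
  assumes "f \<in> Lp p" "pint p f = 0" shows "AE x in lborel. f x = 0"
proof -
  have "AE x in lborel. \<bar>f x\<bar> powr p = 0"
    using integral_nonneg_eq_0_iff_AE[OF Lp_D(2)[OF assms(1)]] assms(2) by (simp add: pint_def)
  then show ?thesis by eventually_elim simp
qed

lemma pint_cong_AE:
  assumes "f \<in> borel_measurable lborel" "g \<in> borel_measurable lborel" "AE x in lborel. f x = g x"
  shows "pint p f = pint p g"
  unfolding pint_def by (rule integral_cong_AE) (use assms in \<open>auto elim: eventually_mono\<close>)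

definition Lp_conv :: "real \<Rightarrow> (nat \<Rightarrow> real \<Rightarrow> real) \<Rightarrow> (real \<Rightarrow> real) \<Rightarrow> bool" where
  "Lp_conv p u f \<longleftrightarrow> (\<forall>n. u n \<in> Lp p) \<and> f \<in> Lp p \<and> (\<lambda>n. pint p (\<lambda>x. u n x - f x)) \<longlonglongrightarrow> 0"

lemma Lp_convI:
  assumes "\<And>n. u n \<in> Lp p" "f \<in> Lp p" "\<And>n. pint p (\<lambda>x. u n x - f x) \<le> e n" "e \<longlonglongrightarrow> 0"
  shows "Lp_conv p u f"
  unfolding Lp_conv_def using assms
  by (auto intro: tendsto_sandwich[OF _ _ tendsto_const assms(4)] simp: pint_nonneg always_eventually)

lemma Lp_conv_add:
  assumes p: "1 < p" and "Lp_conv p u f" "Lp_conv p v g"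
  shows "Lp_conv p (\<lambda>n x. u n x + v n x) (\<lambda>x. f x + g x)"
proof (rule Lp_convI)
  have uf: "\<And>n. u n \<in> Lp p" "f \<in> Lp p" "\<And>n. v n \<in> Lp p" "g \<in> Lp p" using assms by (auto simp: Lp_conv_def)
  show "(\<lambda>x. u n x + v n x) \<in> Lp p" "(\<lambda>x. f x + g x) \<in> Lp p" for n by (intro Lp_add p uf)+
  show "pint p (\<lambda>x. u n x + v n x - (f x + g x)) \<le> qc p * (pint p (\<lambda>x. u n x - f x) + pint p (\<lambda>x. v n x - g x))" for n
    using Lp_add_bound(2)[OF p Lp_diff[OF p uf(1,2)] Lp_diff[OF p uf(3,4)], of "1/2" n n]
    by (simp add: qc_def distrib_left algebra_simps)
  have "(\<lambda>n. qc p * (pint p (\<lambda>x. u n x - f x) + pint p (\<lambda>x. v n x - g x))) \<longlonglongrightarrow> qc p * (0 + 0)"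
    using assms by (intro tendsto_intros) (auto simp: Lp_conv_def)
  then show "(\<lambda>n. qc p * (pint p (\<lambda>x. u n x - f x) + pint p (\<lambda>x. v n x - g x))) \<longlonglongrightarrow> 0" by simp
qed

lemma Lp_conv_cmult:
  assumes "1 < p" "Lp_conv p u f"
  shows "Lp_conv p (\<lambda>n x. c * u n x) (\<lambda>x. c * f x)"
proof (rule Lp_convI)
  have uf: "\<And>n. u n \<in> Lp p" "f \<in> Lp p" using assms by (auto simp: Lp_conv_def)
  show "(\<lambda>x. c * u n x) \<in> Lp p" "(\<lambda>x. c * f x) \<in> Lp p" for n by (intro Lp_cmult uf)+
  show "pint p (\<lambda>x. c * u n x - c * f x) \<le> \<bar>c\<bar> powr p * pint p (\<lambda>x. u n x - f x)" for n
    using Lp_cmult(2)[OF Lp_diff[OF assms(1) uf], of c n] by (simp add: right_diff_distrib)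
  have "(\<lambda>n. \<bar>c\<bar> powr p * pint p (\<lambda>x. u n x - f x)) \<longlonglongrightarrow> \<bar>c\<bar> powr p * 0"
    using assms by (intro tendsto_intros) (auto simp: Lp_conv_def)
  then show "(\<lambda>n. \<bar>c\<bar> powr p * pint p (\<lambda>x. u n x - f x)) \<longlonglongrightarrow> 0" by simp
qed

lemma Lp_conv_unique:
  assumes p: "1 < p" and "Lp_conv p u f" "Lp_conv p u g"
  shows "AE x in lborel. f x = g x"
proof -
  have uf: "\<And>n. u n \<in> Lp p" "f \<in> Lp p" "g \<in> Lp p" using assms by (auto simp: Lp_conv_def)
  have "pint p (\<lambda>x. f x - g x) \<le> qc p * (pint p (\<lambda>x. u n x - f x) + pint p (\<lambda>x. u n x - g x))" for n
    using pint_triangle[OF p uf(2) uf(1)[of n] uf(3)] pint_minus[of p f "u n"] by simp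
  moreover have "(\<lambda>n. qc p * (pint p (\<lambda>x. u n x - f x) + pint p (\<lambda>x. u n x - g x))) \<longlonglongrightarrow> qc p * (0 + 0)"
    using assms by (intro tendsto_intros) (auto simp: Lp_conv_def)
  ultimately have "pint p (\<lambda>x. f x - g x) \<le> qc p * (0 + 0)"
    by (intro LIMSEQ_le_const[of "\<lambda>n. qc p * (pint p (\<lambda>x. u n x - f x) + pint p (\<lambda>x. u n x - g x))"]) auto
  then have "pint p (\<lambda>x. f x - g x) = 0" using pint_nonneg[of p "\<lambda>x. f x - g x"] by simp
  from pint_zero_AE[OF Lp_diff[OF p uf(2,3)] this] show ?thesis by eventually_elim simp
qed

text \<open>Comparing \<open>g\<close> with \<open>v n\<close> and \<open>u n\<close> with
  \<open>f\<close> at weight \<open>t\<close> costs the factor \<open>t powr (1 - p)\<close> twice.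
  Letting \<open>n\<close> grow first and \<open>t\<close> tend to 1 afterwards preserves the
  constant \<open>K\<close> itself, as a sharp operator bound demands.\<close>

lemma Lp_conv_bound:
  assumes p: "1 < p" and u: "Lp_conv p u f" and v: "Lp_conv p v g" and K: "0 \<le> K"
    and le: "\<And>n. pint p (v n) \<le> K * pint p (u n)"
  shows "pint p g \<le> K * pint p f"
proof -
  have uf: "\<And>n. u n \<in> Lp p" "f \<in> Lp p" "\<And>n. v n \<in> Lp p" "g \<in> Lp p" using u v by (auto simp: Lp_conv_def)
  have b: "pint p g \<le> t powr (1 - p) * (K * (t powr (1 - p) * pint p f))" if t: "0 < t" "t < 1" for t
  proof -
    let ?c = "t powr (1 - p)" and ?d = "(1 - t) powr (1 - p)"
    have "pint p g \<le> ?c * (K * (?c * pint p f + ?d * pint p (\<lambda>x. u n x - f x))) + ?d * pint p (\<lambda>x. v n x - g x)" for n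
    proof -
      have "pint p g \<le> ?c * pint p (v n) + ?d * pint p (\<lambda>x. g x - v n x)"
        using Lp_add_bound(2)[OF p uf(3) Lp_diff[OF p uf(4,3)] t, of n n] by simp
      also have "pint p (\<lambda>x. g x - v n x) = pint p (\<lambda>x. v n x - g x)" by (rule pint_minus)
      also have "pint p (u n) \<le> ?c * pint p f + ?d * pint p (\<lambda>x. u n x - f x)"
        using Lp_add_bound(2)[OF p uf(2) Lp_diff[OF p uf(1,2)] t, of n] by simp
      then have "pint p (v n) \<le> K * (?c * pint p f + ?d * pint p (\<lambda>x. u n x - f x))"
        using le[of n] mult_left_mono[OF _ K] by (blast intro: order_trans)
      then have "?c * pint p (v n) \<le> ?c * (K * (?c * pint p f + ?d * pint p (\<lambda>x. u n x - f x)))"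
        by (rule mult_left_mono) simp
      finally show ?thesis by simp
    qed
    moreover have "(\<lambda>n. ?c * (K * (?c * pint p f + ?d * pint p (\<lambda>x. u n x - f x))) + ?d * pint p (\<lambda>x. v n x - g x))
      \<longlonglongrightarrow> ?c * (K * (?c * pint p f + ?d * 0)) + ?d * 0"
      using u v by (intro tendsto_intros) (auto simp: Lp_conv_def)
    ultimately have "pint p g \<le> ?c * (K * (?c * pint p f + ?d * 0)) + ?d * 0"
      by (intro LIMSEQ_le_const[where X = "\<lambda>n. ?c * (K * (?c * pint p f + ?d * pint p (\<lambda>x. u n x - f x))) + ?d * pint p (\<lambda>x. v n x - g x)"]) auto
    then show ?thesis by simp
  qed
  have "((\<lambda>t. t powr (1 - p) * (K * (t powr (1 - p) * pint p f))) \<longlongrightarrow> 1 powr (1 - p) * (K * (1 powr (1 - p) * pint p f))) (at_left 1)"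
    by (intro tendsto_intros) auto
  moreover have "\<forall>\<^sub>F t in at_left (1::real). pint p g \<le> t powr (1 - p) * (K * (t powr (1 - p) * pint p f))"
    using eventually_at_left_real[of 0 "1::real"] by (auto elim!: eventually_mono intro: b)
  ultimately have "pint p g \<le> 1 powr (1 - p) * (K * (1 powr (1 - p) * pint p f))"
    by (intro tendsto_lowerbound) auto
  then show ?thesis by simp
qed

text \<open>Fatou's lemma for the nonnegative integrals of the \<open>p\<close>-th powers. No
  domination is at hand in its applications, so membership of the limit in \<open>Lp p\<close> is a
  conclusion and not a hypothesis.\<close>

lemma Lp_fatou:
  assumes u: "\<And>n. u n \<in> Lp p" and f: "f \<in> borel_measurable lborel"
    and lim: "AE x in lborel. (\<lambda>n. u n x) \<longlonglongrightarrow> f x" and p: "1 < p"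
    and le: "\<And>n. pint p (u n) \<le> c n" and c: "c \<longlonglongrightarrow> C"
  shows "f \<in> Lp p" "pint p f \<le> C"
proof -
  have um [measurable]: "\<And>n. u n \<in> borel_measurable lborel" using u Lp_D by blast
  note [measurable] = f
  have C: "0 \<le> C" by (rule LIMSEQ_le_const[OF c]) (use le pint_nonneg order_trans in blast)
  have "(\<integral>\<^sup>+x. ennreal (\<bar>f x\<bar> powr p) \<partial>lborel) = (\<integral>\<^sup>+x. liminf (\<lambda>n. ennreal (\<bar>u n x\<bar> powr p)) \<partial>lborel)"
  proof (rule nn_integral_cong_AE)
    show "AE x in lborel. ennreal (\<bar>f x\<bar> powr p) = liminf (\<lambda>n. ennreal (\<bar>u n x\<bar> powr p))"
      using lim
    proof eventually_elim
      case (elim x)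
      have "(\<lambda>n. ennreal (\<bar>u n x\<bar> powr p)) \<longlonglongrightarrow> ennreal (\<bar>f x\<bar> powr p)"
        using p by (intro tendsto_ennrealI tendsto_powr' tendsto_rabs elim tendsto_const) auto
      then show ?case by (intro lim_imp_Liminf[symmetric]) auto
    qed
  qed
  also have "\<dots> \<le> liminf (\<lambda>n. \<integral>\<^sup>+x. ennreal (\<bar>u n x\<bar> powr p) \<partial>lborel)"
    by (rule nn_integral_liminf) measurable
  also have "\<dots> \<le> liminf (\<lambda>n. ennreal (c n))"
  proof (intro Liminf_mono always_eventually allI)
    fix n
    have "(\<integral>\<^sup>+x. ennreal (\<bar>u n x\<bar> powr p) \<partial>lborel) = ennreal (pint p (u n))"
      unfolding pint_def by (rule nn_integral_eq_integral) (use u Lp_D in auto)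
    then show "(\<integral>\<^sup>+x. ennreal (\<bar>u n x\<bar> powr p) \<partial>lborel) \<le> ennreal (c n)" using le by (simp add: ennreal_leI)
  qed
  also have "\<dots> = ennreal C" by (intro lim_imp_Liminf tendsto_ennrealI c) auto
  finally have b: "(\<integral>\<^sup>+x. ennreal (\<bar>f x\<bar> powr p) \<partial>lborel) \<le> ennreal C" .
  have i: "integrable lborel (\<lambda>x. \<bar>f x\<bar> powr p)"
    by (rule integrableI_bounded) (use b in \<open>auto intro: le_less_trans\<close>)
  then show "f \<in> Lp p" by (simp add: Lp_def f)
  have "ennreal (pint p f) \<le> ennreal C"
    using b nn_integral_eq_integral[OF i] by (simp add: pint_def)
  then show "pint p f \<le> C" using C by (simp add: ennreal_le_iff)
qed

text \<open>With the weights \<open>2 ^ n\<close> the summability of the increments follows from a bound of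
  each increment by a summable sequence of integrals; no triangle inequality is needed.\<close>

lemma fast_Cauchy_AE_convergent:
  assumes d: "\<And>n. (\<lambda>x. u (Suc n) x - u n x) \<in> Lp p" and p: "1 < p"
    and le: "\<And>n. pint p (\<lambda>x. u (Suc n) x - u n x) \<le> (1/2) ^ n * (1 / 2 ^ n) powr p"
  shows "AE x in lborel. convergent (\<lambda>n. u n x)"
proof -
  define w where "w n x = (2 ^ n) powr p * \<bar>u (Suc n) x - u n x\<bar> powr p" for n x
  have wm: "w n \<in> borel_measurable lborel" and wi: "integrable lborel (w n)" for n
  proof -
    note [measurable] = Lp_D(1)[OF d[of n]]
    show "w n \<in> borel_measurable lborel" unfolding w_def[abs_def] by measurable
    show "integrable lborel (w n)" unfolding w_def[abs_def] by (intro integrable_mult_right Lp_D(2)[OF d])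
  qed
  have "(\<integral>\<^sup>+x. (\<Sum>n. ennreal (w n x)) \<partial>lborel) = (\<Sum>n. \<integral>\<^sup>+x. ennreal (w n x) \<partial>lborel)"
    by (rule nn_integral_suminf) (use wm in measurable)
  also have "\<dots> \<le> (\<Sum>n. ennreal ((1/2) ^ n))"
  proof (intro suminf_le)
    fix n
    have "(\<integral>\<^sup>+x. ennreal (w n x) \<partial>lborel) = ennreal (\<integral>x. w n x \<partial>lborel)"
      by (rule nn_integral_eq_integral[OF wi]) (simp add: w_def)
    also have "(\<integral>x. w n x \<partial>lborel) = (2 ^ n) powr p * pint p (\<lambda>x. u (Suc n) x - u n x)"
      by (simp add: w_def pint_def)
    also have "\<dots> \<le> (2 ^ n) powr p * ((1/2) ^ n * (1 / 2 ^ n) powr p)" by (intro mult_left_mono le) simp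
    also have "\<dots> = (1/2) ^ n * ((2 ^ n * (1 / 2 ^ n)) powr p)" by (simp only: powr_mult mult_ac)
    also have "\<dots> = (1/2) ^ n" by simp
    finally show "(\<integral>\<^sup>+x. ennreal (w n x) \<partial>lborel) \<le> ennreal ((1/2) ^ n)" by (simp add: ennreal_leI)
  qed auto
  also have "\<dots> = ennreal (\<Sum>n. (1/2) ^ n)" by (rule suminf_ennreal2) (auto intro: summable_geometric)
  also have "\<dots> < \<infinity>" by simp
  finally have fin: "(\<integral>\<^sup>+x. (\<Sum>n. ennreal (w n x)) \<partial>lborel) \<noteq> \<infinity>" by simp
  have "AE x in lborel. (\<Sum>n. ennreal (w n x)) \<noteq> \<infinity>"
    by (rule nn_integral_PInf_AE[OF _ fin]) (use wm in measurable)
  then show ?thesis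
  proof eventually_elim
    case (elim x)
    define S where "S = enn2real (\<Sum>n. ennreal (w n x))"
    have wS: "w n x \<le> S" for n
    proof -
      have "ennreal (w n x) \<le> (\<Sum>n. ennreal (w n x))"
        using sum_le_suminf[of "\<lambda>n. ennreal (w n x)" "{n}"] by simp
      also have "\<dots> = ennreal S" using elim by (simp add: S_def ennreal_enn2real less_top)
      finally show ?thesis by (simp add: ennreal_le_iff S_def)
    qed
    have b: "\<bar>u (Suc n) x - u n x\<bar> \<le> S powr (1/p) * (1/2) ^ n" for n
    proof -
      have "(2 ^ n * \<bar>u (Suc n) x - u n x\<bar>) powr p \<le> S" using wS[of n] by (simp add: w_def powr_mult)
      then have "((2 ^ n * \<bar>u (Suc n) x - u n x\<bar>) powr p) powr (1/p) \<le> S powr (1/p)"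
        using p by (intro powr_mono2) auto
      then have "2 ^ n * \<bar>u (Suc n) x - u n x\<bar> \<le> S powr (1/p)" using p by (simp add: powr_powr)
      then show ?thesis by (simp add: field_simps power_one_over)
    qed
    have "summable (\<lambda>n. u (Suc n) x - u n x)"
      by (rule summable_comparison_test'[of "\<lambda>n. S powr (1/p) * (1/2) ^ n" 0])
         (use b in \<open>auto intro!: summable_mult summable_geometric\<close>)
    then have "convergent (\<lambda>n. \<Sum>i<n. u (Suc i) x - u i x)" by (simp add: summable_iff_convergent)
    then have "convergent (\<lambda>n. u n x - u 0 x)" unfolding sum_lessThan_telescope[of "\<lambda>i. u i x"] .
    then have "convergent (\<lambda>n. (u n x - u 0 x) + u 0 x)" by (intro convergent_add convergent_const)
    then show ?case by simp
  qed
qed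

lemma test_Lp: assumes "f \<in> test_functions" "1 < p" shows "f \<in> Lp p"
proof -
  obtain r where r: "0 < r" "\<And>x. r \<le> \<bar>x\<bar> \<Longrightarrow> f x = 0" and s: "smooth f" using assms by (auto simp: test_functions_iff)
  have m: "f \<in> borel_measurable lborel" using borel_measurable_continuous_onI[OF smooth_cont[OF s]] by simp
  have "compact (f ` {-r..r})" by (rule compact_continuous_image[OF continuous_on_subset[OF smooth_cont[OF s]]]) auto
  then have "bounded (f ` {-r..r})" by (rule compact_imp_bounded)
  then obtain L where L: "\<And>x. x \<in> {-r..r} \<Longrightarrow> \<bar>f x\<bar> \<le> L" by (fastforce simp: bounded_iff)
  have L0: "0 \<le> L" using order_trans[OF abs_ge_zero L[of 0]] r by simp
  have fL: "\<bar>f x\<bar> \<le> L" for x using L[of x] r(2)[of x] L0 by (cases "x \<in> {-r..r}") (auto simp: abs_le_iff)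
  have "integrable lborel (\<lambda>x. \<bar>f x\<bar> powr p)"
  proof (rule integrable_bounded_support[of _ "L powr p" r])
    show "(\<lambda>x. \<bar>f x\<bar> powr p) \<in> borel_measurable lborel" using m by measurable
    show "\<bar>\<bar>f x\<bar> powr p\<bar> \<le> L powr p" for x using fL assms(2) by (simp add: powr_mono2)
  qed (use r in auto)
  then show ?thesis using m by (simp add: Lp_def)
qed

section \<open>Density of the test functions\<close>

definition approximable :: "real \<Rightarrow> (real \<Rightarrow> real) \<Rightarrow> bool" where
  "approximable p f \<longleftrightarrow> f \<in> Lp p \<and> (\<forall>e>0. \<exists>g\<in>test_functions. pint p (\<lambda>x. f x - g x) < e)"

lemma approximable_limit:
  assumes p: "1 < p" and f: "f \<in> Lp p" and h: "\<And>e. 0 < e \<Longrightarrow> \<exists>h. approximable p h \<and> pint p (\<lambda>x. f x - h x) < e"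
  shows "approximable p f"
  unfolding approximable_def
proof (intro conjI f allI impI)
  fix e :: real assume e: "0 < e"
  define e' where "e' = e / (2 * qc p)"
  have e': "0 < e'" using e qc_pos[of p] by (simp add: e'_def)
  obtain h where h: "approximable p h" "pint p (\<lambda>x. f x - h x) < e'" using h[OF e'] by blast
  then obtain g where g: "g \<in> test_functions" "pint p (\<lambda>x. h x - g x) < e'" using e' by (auto simp: approximable_def)
  have "pint p (\<lambda>x. f x - g x) \<le> qc p * (pint p (\<lambda>x. f x - h x) + pint p (\<lambda>x. h x - g x))"
    by (rule pint_triangle[OF p f _ test_Lp[OF g(1) p]]) (use h in \<open>simp add: approximable_def\<close>)
  also have "\<dots> < qc p * (e' + e')" using h(2) g(2) qc_pos[of p] by (intro mult_strict_left_mono) auto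
  also have "\<dots> = e" using qc_pos[of p] by (simp add: e'_def field_simps)
  finally show "\<exists>g\<in>test_functions. pint p (\<lambda>x. f x - g x) < e" using g(1) by blast
qed

lemma approximable_test: "f \<in> test_functions \<Longrightarrow> 1 < p \<Longrightarrow> approximable p f"
  unfolding approximable_def using test_Lp by (auto intro!: bexI[of _ f] simp: pint_def)

text \<open>Dominated pointwise limits converge in \<open>p\<close>-th mean. This closure property
  carries density from test functions to intervals, from intervals to Borel sets, and from simple
  functions to all of \<open>Lp p\<close>.\<close>

lemma approximable_dominated:
  assumes p: "1 < p" and u: "\<And>n. approximable p (u n)" and G: "G \<in> Lp p"
    and b: "\<And>n x. \<bar>u n x\<bar> \<le> G x" and lim: "\<And>x. (\<lambda>n. u n x) \<longlonglongrightarrow> f x"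
  shows "approximable p f"
proof (rule approximable_limit[OF p])
  have um [measurable]: "u n \<in> borel_measurable lborel" for n using u[of n] by (simp add: approximable_def Lp_def)
  have fm [measurable]: "f \<in> borel_measurable lborel" by (rule borel_measurable_LIMSEQ_real[OF lim um])
  have fG: "\<bar>f x\<bar> \<le> G x" for x by (rule LIMSEQ_le_const2[OF tendsto_rabs[OF lim]]) (use b in auto)
  have G0: "0 \<le> G x" for x using order_trans[OF abs_ge_zero fG] .
  have "integrable lborel (\<lambda>x. \<bar>f x\<bar> powr p)"
    by (rule Bochner_Integration.integrable_bound[OF Lp_D(2)[OF G]])
       (use fG G0 p in \<open>auto intro!: AE_I2 powr_mono2\<close>)
  then show f: "f \<in> Lp p" by (simp add: Lp_def fm)
  have "(\<lambda>n. pint p (\<lambda>x. f x - u n x)) \<longlonglongrightarrow> (\<integral>x. 0 \<partial>(lborel :: real measure))"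
    unfolding pint_def
  proof (rule integral_dominated_convergence)
    show "integrable lborel (\<lambda>x. \<bar>2 * G x\<bar> powr p)" using Lp_cmult(1)[OF G, of 2] by (simp add: Lp_def)
    show "AE x in lborel. (\<lambda>n. \<bar>f x - u n x\<bar> powr p) \<longlonglongrightarrow> 0"
    proof (rule AE_I2)
      fix x
      have "(\<lambda>n. \<bar>f x - u n x\<bar>) \<longlonglongrightarrow> \<bar>f x - f x\<bar>" by (intro tendsto_intros lim)
      then have "(\<lambda>n. \<bar>f x - u n x\<bar> powr p) \<longlonglongrightarrow> \<bar>f x - f x\<bar> powr p"
        using p by (intro tendsto_powr'[OF _ tendsto_const]) auto
      then show "(\<lambda>n. \<bar>f x - u n x\<bar> powr p) \<longlonglongrightarrow> 0" by simp
    qed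
    show "AE x in lborel. norm (\<bar>f x - u n x\<bar> powr p) \<le> \<bar>2 * G x\<bar> powr p" for n
    proof (rule AE_I2)
      fix x
      have "\<bar>f x - u n x\<bar> \<le> \<bar>2 * G x\<bar>" using fG[of x] b[of n x] by linarith
      then show "norm (\<bar>f x - u n x\<bar> powr p) \<le> \<bar>2 * G x\<bar> powr p" using p by (simp add: powr_mono2)
    qed
  qed measurable
  then have l: "(\<lambda>n. pint p (\<lambda>x. f x - u n x)) \<longlonglongrightarrow> 0" by simp
  fix e :: real assume "0 < e"
  then obtain n where "pint p (\<lambda>x. f x - u n x) < e"
    using order_tendstoD(2)[OF l] by (auto simp: eventually_sequentially)
  then show "\<exists>h. approximable p h \<and> pint p (\<lambda>x. f x - h x) < e" using u by blast
qed

lemma approximable_cmult: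
  assumes p: "1 < p" and f: "approximable p f" shows "approximable p (\<lambda>x. c * f x)"
proof (cases "c = 0")
  case True
  have "(\<lambda>x. 0 * bump x) \<in> test_functions" by (rule test_cmult[OF test_bump])
  then show ?thesis using True approximable_test[OF _ p] by simp
next
  case False
  have fL: "f \<in> Lp p" using f by (simp add: approximable_def)
  show ?thesis
    unfolding approximable_def
  proof (intro conjI Lp_cmult fL allI impI)
    fix e :: real assume "0 < e"
    then have "0 < e / \<bar>c\<bar> powr p" using False by simp
    then obtain g where g: "g \<in> test_functions" "pint p (\<lambda>x. f x - g x) < e / \<bar>c\<bar> powr p"
      using f unfolding approximable_def by blast
    have "pint p (\<lambda>x. c * f x - c * g x) = \<bar>c\<bar> powr p * pint p (\<lambda>x. f x - g x)"
      using Lp_cmult(2)[OF Lp_diff[OF p fL test_Lp[OF g(1) p]], of c] by (simp add: right_diff_distrib)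
    also have "\<dots> < e" using g(2) False by (simp add: pos_less_divide_eq mult.commute)
    finally show "\<exists>g\<in>test_functions. pint p (\<lambda>x. c * f x - g x) < e"
      by (intro bexI[of _ "\<lambda>x. c * g x"] test_cmult g(1))
  qed
qed

lemma approximable_add:
  assumes p: "1 < p" and f: "approximable p f" and g: "approximable p g" shows "approximable p (\<lambda>x. f x + g x)"
  unfolding approximable_def
proof (intro conjI allI impI)
  have L: "f \<in> Lp p" "g \<in> Lp p" using f g by (auto simp: approximable_def)
  then show "(\<lambda>x. f x + g x) \<in> Lp p" by (rule Lp_add[OF p])
  fix e :: real assume e: "0 < e"
  define e' where "e' = e / (2 * qc p)"
  have e': "0 < e'" using e qc_pos[of p] by (simp add: e'_def)
  obtain u where u: "u \<in> test_functions" "pint p (\<lambda>x. f x - u x) < e'" using f e' unfolding approximable_def by blast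
  obtain v where v: "v \<in> test_functions" "pint p (\<lambda>x. g x - v x) < e'" using g e' unfolding approximable_def by blast
  have "pint p (\<lambda>x. f x + g x - (u x + v x)) = pint p (\<lambda>x. (f x - u x) + (g x - v x))" by (simp add: algebra_simps)
  also have "\<dots> \<le> qc p * (pint p (\<lambda>x. f x - u x) + pint p (\<lambda>x. g x - v x))"
    using Lp_add_bound(2)[OF p Lp_diff[OF p L(1) test_Lp[OF u(1) p]] Lp_diff[OF p L(2) test_Lp[OF v(1) p]], of "1/2"]
    by (simp add: qc_def distrib_left)
  also have "\<dots> < qc p * (e' + e')" using u(2) v(2) qc_pos[of p] by (intro mult_strict_left_mono) auto
  also have "\<dots> = e" using qc_pos[of p] by (simp add: e'_def field_simps)
  finally show "\<exists>g'\<in>test_functions. pint p (\<lambda>x. f x + g x - g' x) < e"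
    by (intro bexI[of _ "\<lambda>x. u x + v x"] test_add u(1) v(1))
qed

lemma approximable_zero: "1 < p \<Longrightarrow> approximable p (\<lambda>_. 0)"
  using approximable_cmult[of p bump 0] approximable_test[OF test_bump] by simp

lemma approximable_sum:
  assumes "1 < p" "finite I" "\<And>i. i \<in> I \<Longrightarrow> approximable p (u i)"
  shows "approximable p (\<lambda>x. \<Sum>i\<in>I. u i x)"
  using assms(2,3) by (induction I) (auto intro: approximable_zero approximable_add assms(1))

lemma indicator_Lp:
  fixes A :: "real set"
  assumes "A \<in> sets borel" "A \<subseteq> {-N..N}" shows "indicator A \<in> Lp p"
proof -
  have "integrable lborel (indicator A :: real \<Rightarrow> real)"
    by (rule Bochner_Integration.integrable_bound[OF integrable_interval(1)[of "-N" N]])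
       (use assms in \<open>auto intro!: AE_I2 simp: indicator_def\<close>)
  moreover have "(\<lambda>x. \<bar>indicator A x :: real\<bar> powr p) = indicator A" by (auto simp: indicator_def)
  ultimately show ?thesis using assms by (simp add: Lp_def)
qed

text \<open>For a test function \<phi> with values in \<open>(0, 1]\<close> on the interval and 0
  outside it, the test functions \<open>1 - (1 - \<phi> x) ^ n\<close> increase to the
  indicator.\<close>

lemma approximable_interval:
  assumes p: "1 < p" shows "approximable p (indicator {a<..<b})"
proof (cases "a < b")
  case False
  then have "indicator {a<..<b} = (\<lambda>_::real. 0::real)" by (auto simp: indicator_def)
  then show ?thesis using approximable_zero[OF p] by simp
next
  case True
  \<comment> \<open>The affine map takes \<open>a\<close> and \<open>b\<close> to -1 and 1, the ends
    of the support of \<open>bump\<close>.\<close>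
  define \<phi> where "\<phi> x = bump (2 / (b - a) * x + - (a + b) / (b - a))" for x
  have e: "2 / (b - a) * x + - (a + b) / (b - a) = (2 * x - a - b) / (b - a)" for x
    by (simp add: diff_divide_distrib add_divide_distrib)
  have \<phi>t: "\<phi> \<in> test_functions" unfolding \<phi>_def[abs_def] by (rule test_affine[OF test_bump]) (use True in auto)
  have pos: "0 < \<phi> x" if "x \<in> {a<..<b}" for x
    unfolding \<phi>_def e by (rule bump_pos) (use that True in \<open>auto simp: abs_divide abs_less_iff divide_less_eq\<close>)
  have zero: "\<phi> x = 0" if "x \<notin> {a<..<b}" for x
  proof -
    have "b - a \<le> \<bar>2 * x - a - b\<bar>" using that True by auto
    then have "1 \<le> \<bar>(2 * x - a - b) / (b - a)\<bar>" using True by (simp add: abs_divide le_divide_eq)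
    then show ?thesis unfolding \<phi>_def e by (rule bump_zero)
  qed
  have bd: "0 \<le> \<phi> x" "\<phi> x \<le> 1" for x using bump_bounds by (simp_all add: \<phi>_def)
  have sm: "smooth \<phi>" using \<phi>t by (simp add: test_functions_iff)
  obtain N where N: "{a<..<b} \<subseteq> {-N..N}"
    using True by (intro that[of "\<bar>a\<bar> + \<bar>b\<bar>"]) auto
  show ?thesis
  proof (rule approximable_dominated[OF p, of "\<lambda>n x. 1 - (1 - \<phi> x) ^ n" "indicator {a<..<b}"])
    show "approximable p (\<lambda>x. 1 - (1 - \<phi> x) ^ n)" for n
    proof (rule approximable_test[OF _ p])
      have "smooth (\<lambda>x. 1 - (1 - \<phi> x) ^ n)" by (intro smooth_diff smooth_power smooth_const sm)
      moreover obtain r where "0 < r" "\<And>x. r \<le> \<bar>x\<bar> \<Longrightarrow> \<phi> x = 0" using \<phi>t by (auto simp: test_functions_iff)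
      ultimately show "(\<lambda>x. 1 - (1 - \<phi> x) ^ n) \<in> test_functions"
        by (auto simp: test_functions_iff intro!: exI[of _ r])
    qed
    show "indicator {a<..<b} \<in> Lp p" by (rule indicator_Lp[OF _ N]) auto
    show "\<bar>1 - (1 - \<phi> x) ^ n\<bar> \<le> indicator {a<..<b} x" for n x
    proof (cases "x \<in> {a<..<b}")
      case True
      have "0 \<le> (1 - \<phi> x) ^ n" "(1 - \<phi> x) ^ n \<le> 1" using bd[of x] by (auto intro: power_le_one)
      then show ?thesis using True by simp
    qed (simp add: zero)
    show "(\<lambda>n. 1 - (1 - \<phi> x) ^ n) \<longlonglongrightarrow> indicator {a<..<b} x" for x
    proof (cases "x \<in> {a<..<b}")
      case True
      have "(\<lambda>n. (1 - \<phi> x) ^ n) \<longlonglongrightarrow> 0" using bd[of x] pos[OF True] by (intro LIMSEQ_power_zero) auto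
      then have "(\<lambda>n. 1 - (1 - \<phi> x) ^ n) \<longlonglongrightarrow> 1 - 0" by (rule tendsto_diff[OF tendsto_const])
      then show ?thesis using True by simp
    qed (simp add: zero)
  qed
qed

text \<open>Dynkin's argument: open intervals are stable under intersection and generate the Borel
  sets. Intersecting with \<open>{-N<..<N}\<close> keeps complements of finite measure, so that
  their indicators stay in \<open>Lp p\<close>.\<close>

lemma approximable_borel:
  fixes A :: "real set"
  assumes p: "1 < p" and A: "A \<in> sets borel"
  shows "approximable p (indicator (A \<inter> {-N<..<N}))"
proof -
  let ?G = "range (\<lambda>(a::real, b). {a<..<b})"
  have b: "sets borel = sigma_sets UNIV ?G"
    unfolding borel_eq_box box_real by (subst sets_measure_of) auto
  have As: "A \<in> sigma_sets UNIV ?G" using A b by simp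
  have I: "Int_stable ?G"
  proof (rule Int_stableI_image)
    fix i j :: "real \<times> real"
    show "\<exists>k\<in>UNIV. (case i of (a, b) \<Rightarrow> {a<..<b}) \<inter> (case j of (a, b) \<Rightarrow> {a<..<b}) = (case k of (a, b) \<Rightarrow> {a<..<b})"
      by (intro bexI[of _ "(max (fst i) (fst j), min (snd i) (snd j))"]) (auto split: prod.splits)
  qed
  have S: "?G \<subseteq> Pow UNIV" by simp
  from I S As show ?thesis
  proof (induction A rule: sigma_sets_induct_disjoint[consumes 3, case_names basic empty compl union])
    case (basic A)
    then obtain a b where "A = {a<..<b}" by auto
    then have "A \<inter> {-N<..<N} = {max a (-N)<..<min b N}" by auto
    then show ?case using approximable_interval[OF p] by simp
  next
    case (compl A)
    have "indicator ((UNIV - A) \<inter> {-N<..<N}) = (\<lambda>x. indicator {-N<..<N} x + (-1) * indicator (A \<inter> {-N<..<N}) x :: real)"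
      by (auto simp: indicator_def)
    then show ?case
      using approximable_add[OF p approximable_interval[OF p] approximable_cmult[OF p compl(2)], of "-N" N "-1"] by simp
  next
    case (union A)
    show ?case
    proof (rule approximable_dominated[OF p, of "\<lambda>n x. \<Sum>i<n. indicator (A i \<inter> {-N<..<N}) x" "indicator {-N<..<N}"])
      have d: "disjoint_family (\<lambda>i. A i \<inter> {-N<..<N})" using union(1) by (auto simp: disjoint_family_on_def)
      show "approximable p (\<lambda>x. \<Sum>i<n. indicator (A i \<inter> {-N<..<N}) x)" for n
        by (intro approximable_sum p union) auto
      show "indicator {-N<..<N} \<in> Lp p" by (rule indicator_Lp[of _ N]) auto
      have "(\<Sum>i<n. indicator (A i \<inter> {-N<..<N}) x) = (indicator (\<Union>i<n. A i \<inter> {-N<..<N}) x :: real)" for n x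
        by (rule indicator_UN_disjoint[symmetric]) (use d in \<open>auto simp: disjoint_family_on_def\<close>)
      then show "\<bar>\<Sum>i<n. indicator (A i \<inter> {-N<..<N}) x\<bar> \<le> (indicator {-N<..<N} x :: real)" for n x
        by (auto simp: indicator_def)
      have U: "(\<Union> (range A)) \<inter> {-N<..<N} = (\<Union>i. A i \<inter> {-N<..<N})" by auto
      show "(\<lambda>n. \<Sum>i<n. indicator (A i \<inter> {-N<..<N}) x) \<longlonglongrightarrow> (indicator (\<Union> (range A) \<inter> {-N<..<N}) x :: real)" for x
        unfolding U using indicator_sums[OF _, of "\<lambda>i. A i \<inter> {-N<..<N}" x] d
        by (auto simp: sums_def disjoint_family_on_def)
    qed
  next
    case empty
    have "indicator ({} \<inter> {-N<..<N}) = (\<lambda>_::real. 0::real)" by (auto simp: indicator_def)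
    then show ?case using approximable_zero[OF p] by simp
  qed
qed

text \<open>Simple functions dominated by \<open>2 * \<bar>f\<bar>\<close> converge pointwise to
  \<open>f\<close>. Restricting the \<open>i\<close>-th one to \<open>{- real i<..<real i}\<close>
  makes its level sets bounded and preserves both the domination and the limit.\<close>

lemma Lp_approximable:
  assumes p: "1 < p" and f: "f \<in> Lp p" shows "approximable p f"
proof -
  have fm: "f \<in> borel_measurable borel" using Lp_D(1)[OF f] by simp
  obtain S where S: "\<And>i. simple_function borel (S i)" "\<And>x. (\<lambda>i. S i x) \<longlonglongrightarrow> f x"
     "\<And>i x. dist (S i x) 0 \<le> 2 * dist (f x) 0"
    using borel_measurable_implies_sequence_metric[OF fm, of 0] by auto
  show ?thesis
  proof (rule approximable_dominated[OF p, of "\<lambda>i x. S i x * indicator {- real i<..<real i} x" "\<lambda>x. \<bar>2 * f x\<bar>"])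
    fix i
    let ?I = "{- real i<..<real i}"
    have fin: "finite (range (S i))" using simple_functionD(1)[OF S(1)[of i]] by simp
    have "S i x * indicator ?I x = (\<Sum>y\<in>range (S i). y * indicator ((S i -` {y}) \<inter> ?I) x)" for x
    proof -
      have "(\<Sum>y\<in>range (S i). y * indicator ((S i -` {y}) \<inter> ?I) x)
          = (\<Sum>y\<in>range (S i). if y = S i x then y * indicator ?I x else 0)"
        by (intro sum.cong) (auto simp: indicator_def)
      also have "\<dots> = S i x * indicator ?I x" using fin by simp
      finally show ?thesis by simp
    qed
    moreover have "approximable p (\<lambda>x. \<Sum>y\<in>range (S i). y * indicator ((S i -` {y}) \<inter> ?I) x)"
    proof (intro approximable_sum approximable_cmult approximable_borel p fin)
      show "S i -` {y} \<in> sets borel" for y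
        using simple_functionD(2)[OF S(1)[of i], of "{y}"] by simp
    qed
    ultimately show "approximable p (\<lambda>x. S i x * indicator ?I x)" by simp
  next
    have "(\<lambda>x. \<bar>2 * f x\<bar>) \<in> borel_measurable lborel" using Lp_D(1)[OF f] by measurable
    then show "(\<lambda>x. \<bar>2 * f x\<bar>) \<in> Lp p" using Lp_cmult(1)[OF f, of 2] by (simp add: Lp_def)
    show "\<bar>S i x * indicator {- real i<..<real i} x\<bar> \<le> \<bar>2 * f x\<bar>" for i x
      using S(3)[of i x] by (auto simp: indicator_def abs_mult)
    show "(\<lambda>i. S i x * indicator {- real i<..<real i} x) \<longlonglongrightarrow> f x" for x
    proof (rule Lim_transform_eventually[OF S(2)])
      obtain n :: nat where "\<bar>x\<bar> < real n" using reals_Archimedean2 by blast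
      then have x: "x \<in> {- real i<..<real i}" if "n \<le> i" for i using that by (auto simp: abs_less_iff)
      show "\<forall>\<^sub>F i in sequentially. S i x = S i x * indicator {- real i<..<real i} x"
        using eventually_ge_at_top[of n] by eventually_elim (simp only: x indicator_simps mult_1_right)
    qed
  qed
qed

section \<open>The upper bound and the extension to \<open>L\<^sup>p\<close>\<close>

lemma test_lip_bump:
  assumes "f \<in> test_functions" shows "\<exists>r L. lip_bump f r L"
proof -
  obtain r where r: "0 < r" "\<And>x. r \<le> \<bar>x\<bar> \<Longrightarrow> f x = 0" using assms by (auto simp: test_functions_iff)
  obtain L where L: "0 \<le> L" "\<And>x. \<bar>deriv f x\<bar> \<le> L" "\<And>x y. \<bar>f x - f y\<bar> \<le> L * \<bar>x - y\<bar>"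
    by (rule test_bounded_deriv[OF assms]) (rule that)
  show ?thesis using r L by (intro exI[of _ r] exI[of _ L]) (unfold_locales, auto)
qed

lemma hilbert_test_eq:
  assumes "f \<in> test_functions"
  shows "integrable lborel (\<lambda>s. indicator {0<..} s * ((f (x - s) - f (x + s)) / s))"
    and "hilbert f x = 1 / pi * (\<integral>s. indicator {0<..} s * ((f (x - s) - f (x + s)) / s) \<partial>lborel)"
proof -
  obtain r L where "lip_bump f r L" using test_lip_bump[OF assms] by blast
  then interpret lip_bump f r L .
  show "integrable lborel (\<lambda>s. indicator {0<..} s * ((f (x - s) - f (x + s)) / s))"
    using hk_integrable[of x] by (simp add: hk_def[abs_def])
  show "hilbert f x = 1 / pi * (\<integral>s. indicator {0<..} s * ((f (x - s) - f (x + s)) / s) \<partial>lborel)"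
    using hilbert_eq[of x] by (simp add: hk_def[abs_def])
qed

lemma hilbert_add:
  assumes "f \<in> test_functions" "g \<in> test_functions"
  shows "hilbert (\<lambda>x. f x + g x) x = hilbert f x + hilbert g x"
proof -
  have "indicator {0<..} s * ((f (x - s) + g (x - s) - (f (x + s) + g (x + s))) / s)
     = indicator {0<..} s * ((f (x - s) - f (x + s)) / s) + indicator {0<..} s * ((g (x - s) - g (x + s)) / s)" for s
    by (simp add: algebra_simps add_divide_distrib diff_divide_distrib)
  then show ?thesis
    unfolding hilbert_test_eq(2)[OF test_add[OF assms]] hilbert_test_eq(2)[OF assms(1)] hilbert_test_eq(2)[OF assms(2)]
    using Bochner_Integration.integral_add[OF hilbert_test_eq(1)[OF assms(1), of x] hilbert_test_eq(1)[OF assms(2), of x]]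
    by (simp add: distrib_left)
qed

lemma hilbert_cmult:
  assumes "f \<in> test_functions"
  shows "hilbert (\<lambda>x. c * f x) x = c * hilbert f x"
proof -
  have "indicator {0<..} s * ((c * f (x - s) - c * f (x + s)) / s)
     = c * (indicator {0<..} s * ((f (x - s) - f (x + s)) / s))" for s
    by (simp add: algebra_simps diff_divide_distrib)
  then show ?thesis
    unfolding hilbert_test_eq(2)[OF test_cmult[OF assms]] hilbert_test_eq(2)[OF assms]
    by (simp only: integral_mult_right_zero) simp
qed

lemma hilbert_test_bound:
  assumes f: "f \<in> test_functions" and p: "1 < p"
  shows "hilbert f \<in> Lp p"
    and "pint p (\<lambda>x. a * f x + b * hilbert f x) \<le> B_const a b p * pint p f"
proof -
  obtain r L where "lip_bump f r L" using test_lip_bump[OF f] by blast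
  then interpret lip_bump f r L .
  define F0 where "F0 x = Complex (f x) (hilbert f x)" for x
  note [measurable] = hilbert_measurable
  have "norm (\<bar>hilbert f x\<bar> powr p) \<le> norm (majorant x powr p)" for x
  proof -
    have "\<bar>hilbert f x\<bar> \<le> majorant x"
      using order_trans[OF abs_Im_le_cmod boundary_majorant[of x]] by simp
    then show ?thesis using p by (simp add: powr_mono2)
  qed
  then have "integrable lborel (\<lambda>x. \<bar>hilbert f x\<bar> powr p)"
    by (intro Bochner_Integration.integrable_bound[OF majorant_integrable[OF p]] AE_I2) measurable
  then show H: "hilbert f \<in> Lp p" using hilbert_measurable by (simp add: Lp_def)
  have fL: "f \<in> Lp p" by (rule test_Lp[OF f p])
  obtain g where g: "trig_convex p g" "\<And>t. g t \<le> hfun p (B_const a b p) a b t"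
    using B_const_minorant[OF p, of a b] by blast
  have D: "cmod (Fext (Complex x y)) \<le> majorant x" if "0 < y" "y \<le> 1" for x y using Fext_majorant that by blast
  note hom = hom_integral_nonneg[OF p g(1) Fext_holomorphic Fext_decay D majorant_integrable[OF p] Fext_lim]
  \<comment> \<open>In polar form this is \<open>g \<theta> \<le> hfun p B a b \<theta>\<close>,
    with \<open>B = B_const a b p\<close>, multiplied by the \<open>p\<close>-th power of the
    modulus of the boundary value.\<close>
  have pw: "\<bar>a * f x + b * hilbert f x\<bar> powr p \<le> B_const a b p * \<bar>f x\<bar> powr p - hom p g (Complex (f x) (hilbert f x))" for x
  proof -
    let ?w = "Complex (f x) (hilbert f x)"
    define \<rho> where "\<rho> = cmod ?w"
    define \<theta> where "\<theta> = Arg ?w"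
    have "?w = of_real \<rho> * cis \<theta>" using rcis_cmod_Arg[of ?w] by (simp add: rcis_def \<rho>_def \<theta>_def)
    then have fx: "f x = \<rho> * cos \<theta>" "hilbert f x = \<rho> * sin \<theta>" by (simp_all add: complex_eq_iff)
    have \<rho>: "0 \<le> \<rho>" by (simp add: \<rho>_def)
    have "a * f x + b * hilbert f x = \<rho> * (a * cos \<theta> + b * sin \<theta>)" by (simp add: fx algebra_simps)
    then have "\<bar>a * f x + b * hilbert f x\<bar> powr p = \<rho> powr p * \<bar>a * cos \<theta> + b * sin \<theta>\<bar> powr p"
      using \<rho> by (simp add: abs_mult powr_mult)
    also have "\<dots> \<le> \<rho> powr p * (B_const a b p * \<bar>cos \<theta>\<bar> powr p - g \<theta>)"
      using g(2)[of \<theta>] by (intro mult_left_mono) (auto simp: hfun_def)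
    also have "\<dots> = B_const a b p * \<bar>f x\<bar> powr p - \<rho> powr p * g \<theta>"
      using \<rho> by (simp add: fx(1) abs_mult powr_mult algebra_simps)
    also have "\<rho> powr p * g \<theta> = hom p g ?w" by (simp add: hom_def \<rho>_def \<theta>_def)
    finally show ?thesis .
  qed
  have afb: "(\<lambda>x. a * f x + b * hilbert f x) \<in> Lp p" by (intro Lp_add p Lp_cmult fL H)
  have "pint p (\<lambda>x. a * f x + b * hilbert f x) \<le> (\<integral>x. B_const a b p * \<bar>f x\<bar> powr p - hom p g (Complex (f x) (hilbert f x)) \<partial>lborel)"
    unfolding pint_def
    by (rule integral_mono[OF Lp_D(2)[OF afb] Bochner_Integration.integrable_diff[OF integrable_mult_right[OF Lp_D(2)[OF fL]] hom(1)] pw])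
  also have "\<dots> = B_const a b p * pint p f - (\<integral>x. hom p g (Complex (f x) (hilbert f x)) \<partial>lborel)"
    using Lp_D(2)[OF fL] hom(1) by (simp add: pint_def)
  also have "\<dots> \<le> B_const a b p * pint p f" using hom(2) by simp
  finally show "pint p (\<lambda>x. a * f x + b * hilbert f x) \<le> B_const a b p * pint p f" .
qed

lemma hilbert_pint: "f \<in> test_functions \<Longrightarrow> 1 < p \<Longrightarrow> pint p (hilbert f) \<le> B_const 0 1 p * pint p f"
  using hilbert_test_bound(2)[of f p 0 1] by simp

lemma hilbert_diff:
  assumes "f \<in> test_functions" "g \<in> test_functions"
  shows "(\<lambda>x. f x - g x) \<in> test_functions" "hilbert (\<lambda>x. f x - g x) = (\<lambda>x. hilbert f x - hilbert g x)"
  using test_add[OF assms(1) test_cmult[OF assms(2), of "-1"]]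
    hilbert_add[OF assms(1) test_cmult[OF assms(2), of "-1"]] hilbert_cmult[OF assms(2), of "-1"]
  by (auto simp: fun_eq_iff)

text \<open>The difference of the two approximating sequences tends to 0, and the bound for
  \<open>a = 0\<close>, \<open>b = 1\<close> transfers this to the Hilbert transforms. The limit
  therefore depends on \<open>f\<close> alone.\<close>

lemma hilbert_Lp_conv:
  assumes p: "1 < p" and t: "\<And>n. u n \<in> test_functions" "\<And>n. v n \<in> test_functions"
    and u: "Lp_conv p u f" and v: "Lp_conv p v f" and h: "Lp_conv p (\<lambda>n. hilbert (u n)) g"
  shows "Lp_conv p (\<lambda>n. hilbert (v n)) g"
proof (rule Lp_convI)
  have L: "\<And>n. u n \<in> Lp p" "\<And>n. v n \<in> Lp p" "f \<in> Lp p" "g \<in> Lp p" using u v h by (auto simp: Lp_conv_def)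
  show "hilbert (v n) \<in> Lp p" for n by (rule hilbert_test_bound(1)[OF t(2) p])
  show "g \<in> Lp p" by (rule L)
  let ?K = "B_const 0 1 p"
  let ?e = "\<lambda>n. qc p * (?K * (qc p * (pint p (\<lambda>x. v n x - f x) + pint p (\<lambda>x. u n x - f x))) + pint p (\<lambda>x. hilbert (u n) x - g x))"
  show "pint p (\<lambda>x. hilbert (v n) x - g x) \<le> ?e n" for n
  proof -
    have "pint p (\<lambda>x. hilbert (v n) x - g x) \<le> qc p * (pint p (\<lambda>x. hilbert (v n) x - hilbert (u n) x) + pint p (\<lambda>x. hilbert (u n) x - g x))"
      by (rule pint_triangle[OF p]) (intro hilbert_test_bound(1) t p L)+
    moreover have "pint p (\<lambda>x. hilbert (v n) x - hilbert (u n) x) \<le> ?K * pint p (\<lambda>x. v n x - u n x)"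
      using hilbert_pint[OF hilbert_diff(1)[OF t(2,1)] p] hilbert_diff(2)[OF t(2,1)] by metis
    moreover have "pint p (\<lambda>x. v n x - u n x) \<le> qc p * (pint p (\<lambda>x. v n x - f x) + pint p (\<lambda>x. u n x - f x))"
      using pint_triangle[OF p L(2,3,1), of n n] pint_minus[of p f "u n"] by simp
    then have "?K * pint p (\<lambda>x. v n x - u n x) \<le> ?K * (qc p * (pint p (\<lambda>x. v n x - f x) + pint p (\<lambda>x. u n x - f x)))"
      by (rule mult_left_mono[OF _ B_const_nonneg[OF p]])
    ultimately have "pint p (\<lambda>x. hilbert (v n) x - hilbert (u n) x) + pint p (\<lambda>x. hilbert (u n) x - g x)
       \<le> ?K * (qc p * (pint p (\<lambda>x. v n x - f x) + pint p (\<lambda>x. u n x - f x))) + pint p (\<lambda>x. hilbert (u n) x - g x)"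
      and *: "pint p (\<lambda>x. hilbert (v n) x - g x) \<le> qc p * (pint p (\<lambda>x. hilbert (v n) x - hilbert (u n) x) + pint p (\<lambda>x. hilbert (u n) x - g x))"
      by linarith+
    from mult_left_mono[OF this(1) less_imp_le[OF qc_pos[of p]]] * show ?thesis by linarith
  qed
  have "?e \<longlonglongrightarrow> qc p * (?K * (qc p * (0 + 0)) + 0)"
    using u v h by (intro tendsto_intros) (auto simp: Lp_conv_def)
  then show "?e \<longlonglongrightarrow> 0" by simp
qed

section \<open>The bounded extension\<close>

context
  fixes p :: real
  assumes p: "1 < p"
begin

text \<open>Small enough for \<open>fast_Cauchy_AE_convergent\<close> to apply to the Hilbert
  transforms: the quasi-triangle constant, the Hilbert bound and the two errors of consecutive terms
  are divided out in advance. The summand 1 keeps the divisor positive.\<close>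

definition err :: "nat \<Rightarrow> real" where
  "err n = (1/2) ^ n * (1 / 2 ^ n) powr p / (2 * qc p * (B_const 0 1 p + 1))"

definition approx :: "(real \<Rightarrow> real) \<Rightarrow> nat \<Rightarrow> real \<Rightarrow> real" where
  "approx f n = (SOME g. g \<in> test_functions \<and> pint p (\<lambda>x. f x - g x) < err n)"

text \<open>A pointwise limit, so that a definite function results. The sequence converges almost
  everywhere for \<open>f\<close> in \<open>Lp p\<close>, and the operator identities accordingly
  hold almost everywhere.\<close>

definition hilbert_Lp :: "(real \<Rightarrow> real) \<Rightarrow> real \<Rightarrow> real" where
  "hilbert_Lp f x = lim (\<lambda>n. hilbert (approx f n) x)"

lemma err_pos: "0 < err n"
  using qc_pos[of p] B_const_nonneg[OF p, of 0 1] by (simp add: err_def)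

lemma err_Suc: "err (Suc n) \<le> err n"
proof -
  have "(1 / 2 ^ Suc n) powr p \<le> (1 / 2 ^ n :: real) powr p" using p by (intro powr_mono2) (auto simp: field_simps)
  moreover have "(1/2) ^ Suc n \<le> (1/2 :: real) ^ n" by simp
  ultimately have "(1/2) ^ Suc n * (1 / 2 ^ Suc n) powr p \<le> (1/2) ^ n * (1 / 2 ^ n :: real) powr p" by (intro mult_mono) auto
  then show ?thesis unfolding err_def using qc_pos[of p] B_const_nonneg[OF p, of 0 1] by (intro divide_right_mono) auto
qed

lemma err_lim: "err \<longlonglongrightarrow> 0"
proof (rule tendsto_sandwich[OF _ _ tendsto_const])
  let ?c = "2 * qc p * (B_const 0 1 p + 1)"
  have c: "0 < ?c" using qc_pos[of p] B_const_nonneg[OF p, of 0 1] by simp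
  show "\<forall>\<^sub>F n in sequentially. 0 \<le> err n" using err_pos by (intro always_eventually) (simp add: less_imp_le)
  have "err n \<le> (1/2) ^ n / ?c" for n
  proof -
    have "(1 / 2 ^ n :: real) powr p \<le> 1" using p by (intro powr_le1) auto
    then have "(1/2) ^ n * (1 / 2 ^ n :: real) powr p \<le> (1/2) ^ n" by (simp add: mult_left_le)
    then show ?thesis unfolding err_def using c by (intro divide_right_mono) auto
  qed
  then show "\<forall>\<^sub>F n in sequentially. err n \<le> (1/2) ^ n / ?c" by simp
  have "(\<lambda>n. (1/2 :: real) ^ n / ?c) \<longlonglongrightarrow> 0 / ?c" by (intro tendsto_divide LIMSEQ_power_zero tendsto_const) (use c in auto)
  then show "(\<lambda>n. (1/2 :: real) ^ n / ?c) \<longlonglongrightarrow> 0" by simp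
qed

lemma approx_test:
  assumes "f \<in> Lp p" shows "approx f n \<in> test_functions" "pint p (\<lambda>x. f x - approx f n x) < err n"
proof -
  have "\<exists>g. g \<in> test_functions \<and> pint p (\<lambda>x. f x - g x) < err n"
    using Lp_approximable[OF p assms] err_pos[of n] unfolding approximable_def by blast
  from someI_ex[OF this] show "approx f n \<in> test_functions" "pint p (\<lambda>x. f x - approx f n x) < err n"
    by (auto simp: approx_def)
qed

lemma approx_conv: assumes "f \<in> Lp p" shows "Lp_conv p (approx f) f"
proof (rule Lp_convI[OF _ assms _ err_lim])
  show "approx f n \<in> Lp p" for n by (rule test_Lp[OF approx_test(1)[OF assms] p])
  show "pint p (\<lambda>x. approx f n x - f x) \<le> err n" for n
    using approx_test(2)[OF assms, of n] pint_minus[of p f "approx f n"] by simp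
qed

text \<open>Fast approximation gives convergence almost everywhere. With \<open>n\<close> fixed and
  \<open>m\<close> tending to infinity in the Cauchy estimate \<open>d\<close>, Fatou's lemma
  upgrades the pointwise limit to a limit in \<open>Lp p\<close>.\<close>

lemma hilbert_Lp_conv_approx:
  assumes f: "f \<in> Lp p" shows "Lp_conv p (\<lambda>n. hilbert (approx f n)) (hilbert_Lp f)"
proof -
  let ?K = "B_const 0 1 p"
  let ?h = "\<lambda>n. hilbert (approx f n)"
  note t = approx_test(1)[OF f]
  have hL: "?h n \<in> Lp p" for n by (rule hilbert_test_bound(1)[OF t p])
  have K: "0 \<le> ?K" by (rule B_const_nonneg[OF p])
  have d: "pint p (\<lambda>x. ?h m x - ?h n x) \<le> ?K * (qc p * (err m + err n))" for m n
  proof -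
    have "pint p (\<lambda>x. ?h m x - ?h n x) \<le> ?K * pint p (\<lambda>x. approx f m x - approx f n x)"
      using hilbert_pint[OF hilbert_diff(1)[OF t t] p] hilbert_diff(2)[OF t t] by metis
    also have "pint p (\<lambda>x. approx f m x - approx f n x) \<le> qc p * (pint p (\<lambda>x. approx f m x - f x) + pint p (\<lambda>x. f x - approx f n x))"
      by (rule pint_triangle[OF p test_Lp[OF t p] f test_Lp[OF t p]])
    also have "\<dots> \<le> qc p * (err m + err n)"
      using approx_test(2)[OF f, of m] approx_test(2)[OF f, of n] pint_minus[of p f "approx f m"] qc_pos[of p]
      by (intro mult_left_mono add_mono) auto
    finally show ?thesis using K by (simp add: mult_left_mono)
  qed
  have AEc: "AE x in lborel. convergent (\<lambda>n. ?h n x)"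
  proof (rule fast_Cauchy_AE_convergent[OF _ p])
    show "(\<lambda>x. ?h (Suc n) x - ?h n x) \<in> Lp p" for n by (intro Lp_diff p hL)
    fix n
    have "pint p (\<lambda>x. ?h (Suc n) x - ?h n x) \<le> ?K * (qc p * (err (Suc n) + err n))" by (rule d)
    also have "\<dots> \<le> (?K + 1) * (qc p * (err n + err n))"
      using err_Suc[of n] K qc_pos[of p] err_pos[of n] err_pos[of "Suc n"] by (intro mult_mono add_mono) auto
    also have "\<dots> = (2 * qc p * (?K + 1)) * err n" by (simp add: algebra_simps)
    also have "\<dots> = (1/2) ^ n * (1 / 2 ^ n) powr p"
      using qc_pos[of p] K by (simp add: err_def)
    finally show "pint p (\<lambda>x. ?h (Suc n) x - ?h n x) \<le> (1/2) ^ n * (1 / 2 ^ n) powr p" .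
  qed
  have hm [measurable]: "?h n \<in> borel_measurable lborel" for n using hL Lp_D by blast
  have Tm [measurable]: "hilbert_Lp f \<in> borel_measurable lborel"
    unfolding hilbert_Lp_def[abs_def] by (rule borel_measurable_lim_metric) (rule hm)
  have lim: "AE x in lborel. (\<lambda>m. ?h m x - ?h n x) \<longlonglongrightarrow> hilbert_Lp f x - ?h n x" for n
    using AEc
  proof eventually_elim
    case (elim x)
    then have "(\<lambda>m. ?h m x) \<longlonglongrightarrow> hilbert_Lp f x" by (simp add: hilbert_Lp_def convergent_LIMSEQ_iff)
    then show ?case by (intro tendsto_diff tendsto_const)
  qed
  have c: "(\<lambda>m. ?K * (qc p * (err m + err n))) \<longlonglongrightarrow> ?K * (qc p * (0 + err n))" for n
    by (intro tendsto_intros err_lim)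
  note fat = Lp_fatou[OF Lp_diff[OF p hL hL] _ lim p d c]
  have dL: "(\<lambda>x. hilbert_Lp f x - ?h n x) \<in> Lp p" for n by (rule fat(1)) measurable
  have dp: "pint p (\<lambda>x. hilbert_Lp f x - ?h n x) \<le> ?K * (qc p * (0 + err n))" for n by (rule fat(2)) measurable
  have TL: "hilbert_Lp f \<in> Lp p" using Lp_add[OF p dL[of 0] hL[of 0]] by simp
  show ?thesis
  proof (rule Lp_convI[OF hL TL])
    show "pint p (\<lambda>x. ?h n x - hilbert_Lp f x) \<le> ?K * (qc p * (0 + err n))" for n
      using dp[of n] pint_minus[of p "?h n" "hilbert_Lp f"] by simp
    have "(\<lambda>n. ?K * (qc p * (0 + err n))) \<longlonglongrightarrow> ?K * (qc p * (0 + 0))" by (intro tendsto_intros err_lim)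
    then show "(\<lambda>n. ?K * (qc p * (0 + err n))) \<longlonglongrightarrow> 0" by simp
  qed
qed

lemma hilbert_Lp_char:
  assumes "\<And>n. u n \<in> test_functions" "Lp_conv p u f"
  shows "Lp_conv p (\<lambda>n. hilbert (u n)) (hilbert_Lp f)"
proof -
  have f: "f \<in> Lp p" using assms(2) by (simp add: Lp_conv_def)
  show ?thesis
    by (rule hilbert_Lp_conv[OF p approx_test(1)[OF f] assms(1) approx_conv[OF f] assms(2) hilbert_Lp_conv_approx[OF f]])
qed

lemma Lp_norm_le_of_pint:
  assumes "0 \<le> K" "pint p g \<le> K * pint p f" shows "Lp_norm p g \<le> K powr (1/p) * Lp_norm p f"
proof -
  have "pint p g powr (1/p) \<le> (K * pint p f) powr (1/p)" using p assms pint_nonneg by (intro powr_mono2) auto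
  then show ?thesis by (simp add: Lp_norm_eq powr_mult)
qed

text \<open>Every identity compares two limits in \<open>Lp p\<close> of one and the same sequence:
  such limits agree almost everywhere, and by \<open>hilbert_Lp_char\<close> any approximation by
  test functions may be used to compute them.\<close>

lemma hilbert_Lp_extension: "hilbert_extension p hilbert_Lp"
  unfolding hilbert_extension_def bounded_linear_Lp_def
proof (intro conjI ballI allI)
  show TL: "hilbert_Lp f \<in> Lp p" if "f \<in> Lp p" for f
    using hilbert_Lp_conv_approx[OF that] by (simp add: Lp_conv_def)
  show "AE x in lborel. hilbert_Lp (\<lambda>y. f y + g y) x = hilbert_Lp f x + hilbert_Lp g x" if f: "f \<in> Lp p" and g: "g \<in> Lp p" for f g
  proof (rule Lp_conv_unique[OF p])
    have eq: "hilbert (\<lambda>x. approx f n x + approx g n x) = (\<lambda>x. hilbert (approx f n) x + hilbert (approx g n) x)" for n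
      using hilbert_add[OF approx_test(1)[OF f] approx_test(1)[OF g]] by (simp add: fun_eq_iff)
    show "Lp_conv p (\<lambda>n x. hilbert (approx f n) x + hilbert (approx g n) x) (hilbert_Lp (\<lambda>y. f y + g y))"
      using hilbert_Lp_char[OF test_add[OF approx_test(1)[OF f] approx_test(1)[OF g]] Lp_conv_add[OF p approx_conv[OF f] approx_conv[OF g]]]
      by (simp add: eq)
    show "Lp_conv p (\<lambda>n x. hilbert (approx f n) x + hilbert (approx g n) x) (\<lambda>x. hilbert_Lp f x + hilbert_Lp g x)"
      by (intro Lp_conv_add p hilbert_Lp_conv_approx f g)
  qed
  show "AE x in lborel. hilbert_Lp (\<lambda>y. c * f y) x = c * hilbert_Lp f x" if f: "f \<in> Lp p" for c f
  proof (rule Lp_conv_unique[OF p])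
    have eq: "hilbert (\<lambda>x. c * approx f n x) = (\<lambda>x. c * hilbert (approx f n) x)" for n
      using hilbert_cmult[OF approx_test(1)[OF f]] by (simp add: fun_eq_iff)
    show "Lp_conv p (\<lambda>n x. c * hilbert (approx f n) x) (hilbert_Lp (\<lambda>y. c * f y))"
      using hilbert_Lp_char[of "\<lambda>n x. c * approx f n x", OF test_cmult[OF approx_test(1)[OF f]] Lp_conv_cmult[OF p approx_conv[OF f]]]
      by (simp add: eq)
    show "Lp_conv p (\<lambda>n x. c * hilbert (approx f n) x) (\<lambda>x. c * hilbert_Lp f x)"
      by (intro Lp_conv_cmult p hilbert_Lp_conv_approx f)
  qed
  show "\<exists>K. \<forall>f\<in>Lp p. Lp_norm p (hilbert_Lp f) \<le> K * Lp_norm p f"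
  proof (intro exI ballI)
    fix f assume f: "f \<in> Lp p"
    have "pint p (hilbert_Lp f) \<le> B_const 0 1 p * pint p f"
      by (rule Lp_conv_bound[OF p approx_conv[OF f] hilbert_Lp_conv_approx[OF f] B_const_nonneg[OF p]])
         (intro hilbert_pint approx_test(1) f p)
    then show "Lp_norm p (hilbert_Lp f) \<le> B_const 0 1 p powr (1/p) * Lp_norm p f"
      by (rule Lp_norm_le_of_pint[OF B_const_nonneg[OF p]])
  qed
  show "AE x in lborel. hilbert_Lp f x = hilbert f x" if f: "f \<in> test_functions" for f
  proof (rule Lp_conv_unique[OF p])
    have fL: "f \<in> Lp p" by (rule test_Lp[OF f p])
    \<comment> \<open>The constant sequence is an admissible approximation of a test function by
      test functions.\<close>
    show "Lp_conv p (\<lambda>n. hilbert f) (hilbert_Lp f)"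
      by (rule hilbert_Lp_char) (use f fL in \<open>auto simp: Lp_conv_def pint_def\<close>)
    show "Lp_conv p (\<lambda>n. hilbert f) (hilbert f)"
      using hilbert_test_bound(1)[OF f p] by (simp add: Lp_conv_def pint_def)
  qed
qed

text \<open>Linearity identifies \<open>hilbert (approx f n) - T f\<close> almost everywhere with
  \<open>T\<close> applied to \<open>approx f n - f\<close>, whose norm boundedness controls.
  Estimates for test functions thus pass to every extension \<open>T\<close>, whichever
  representatives it picks.\<close>

lemma extension_conv:
  assumes T: "hilbert_extension p T" and f: "f \<in> Lp p"
  shows "Lp_conv p (\<lambda>n. hilbert (approx f n)) (T f)"
proof -
  have TL: "T f \<in> Lp p" if "f \<in> Lp p" for f using T that by (simp add: hilbert_extension_def bounded_linear_Lp_def)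
  have add: "AE x in lborel. T (\<lambda>y. f y + g y) x = T f x + T g x" if "f \<in> Lp p" "g \<in> Lp p" for f g
    using T that by (simp add: hilbert_extension_def bounded_linear_Lp_def)
  have cm: "AE x in lborel. T (\<lambda>y. c * f y) x = c * T f x" if "f \<in> Lp p" for f c
    using T that by (simp add: hilbert_extension_def bounded_linear_Lp_def)
  have ext: "AE x in lborel. T f x = hilbert f x" if "f \<in> test_functions" for f
    using T that by (simp add: hilbert_extension_def)
  obtain K where K: "\<And>f. f \<in> Lp p \<Longrightarrow> Lp_norm p (T f) \<le> K * Lp_norm p f"
    using T unfolding hilbert_extension_def bounded_linear_Lp_def by blast
  note t = approx_test(1)[OF f]
  have tL: "approx f n \<in> Lp p" for n by (rule test_Lp[OF t p])
  show ?thesis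
  proof (rule Lp_convI[OF hilbert_test_bound(1)[OF t p] TL[OF f]])
    fix n
    let ?d = "\<lambda>y. approx f n y + (-1) * f y"
    have dL: "?d \<in> Lp p" "(\<lambda>y. (-1) * f y) \<in> Lp p" by (intro Lp_add p tL Lp_cmult f)+
    have AE: "AE x in lborel. T ?d x = hilbert (approx f n) x - T f x"
      using add[OF tL[of n] dL(2)] cm[OF f, of "-1"] ext[OF t[of n]] by eventually_elim simp
    have "pint p (\<lambda>x. hilbert (approx f n) x - T f x) = pint p (T ?d)"
    proof (rule pint_cong_AE)
      show "(\<lambda>x. hilbert (approx f n) x - T f x) \<in> borel_measurable lborel"
        by (rule Lp_D(1)[OF Lp_diff[OF p hilbert_test_bound(1)[OF t p] TL[OF f]]])
      show "T ?d \<in> borel_measurable lborel" by (rule Lp_D(1)[OF TL[OF dL(1)]])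
    qed (use AE in \<open>auto elim: eventually_mono\<close>)
    also have "\<dots> = Lp_norm p (T ?d) powr p" using p by (simp add: Lp_norm_powr)
    \<comment> \<open>The bound \<open>K\<close> comes without a sign, whereas monotonicity of the
      power needs a nonnegative factor.\<close>
    also have "\<dots> \<le> (\<bar>K\<bar> * Lp_norm p ?d) powr p"
    proof (rule powr_mono2)
      have n: "0 \<le> Lp_norm p ?d" by (simp add: Lp_norm_def)
      show "Lp_norm p (T ?d) \<le> \<bar>K\<bar> * Lp_norm p ?d"
        using K[OF dL(1)] mult_right_mono[OF abs_ge_self[of K] n] by linarith
    qed (use p in \<open>auto simp: Lp_norm_def\<close>)
    also have "\<dots> = \<bar>K\<bar> powr p * pint p ?d" using p by (simp add: powr_mult Lp_norm_powr)
    also have "pint p ?d = pint p (\<lambda>x. approx f n x - f x)" by simp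
    finally show "pint p (\<lambda>x. hilbert (approx f n) x - T f x) \<le> \<bar>K\<bar> powr p * pint p (\<lambda>x. approx f n x - f x)" .
  next
    have "(\<lambda>n. \<bar>K\<bar> powr p * pint p (\<lambda>x. approx f n x - f x)) \<longlonglongrightarrow> \<bar>K\<bar> powr p * 0"
      using approx_conv[OF f] by (intro tendsto_intros) (auto simp: Lp_conv_def)
    then show "(\<lambda>n. \<bar>K\<bar> powr p * pint p (\<lambda>x. approx f n x - f x)) \<longlonglongrightarrow> 0" by simp
  qed
qed

lemma extension_bound:
  assumes T: "hilbert_extension p T" and f: "f \<in> Lp p"
  shows "(\<lambda>x. a * f x + b * T f x) \<in> Lp p"
    and "pint p (\<lambda>x. a * f x + b * T f x) \<le> B_const a b p * pint p f"
proof -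
  have c: "Lp_conv p (\<lambda>n x. a * approx f n x + b * hilbert (approx f n) x) (\<lambda>x. a * f x + b * T f x)"
    by (intro Lp_conv_add Lp_conv_cmult p approx_conv f extension_conv T)
  then show "(\<lambda>x. a * f x + b * T f x) \<in> Lp p" by (simp add: Lp_conv_def)
  show "pint p (\<lambda>x. a * f x + b * T f x) \<le> B_const a b p * pint p f"
    by (rule Lp_conv_bound[OF p approx_conv[OF f] c B_const_nonneg[OF p]]) (intro hilbert_test_bound(2) approx_test(1) f p)
qed

lemma extension_bounded_linear:
  assumes T: "hilbert_extension p T"
  shows "bounded_linear_Lp p (\<lambda>f x. a * f x + b * T f x)"
  unfolding bounded_linear_Lp_def
proof (intro conjI ballI allI)
  show "(\<lambda>x. a * f x + b * T f x) \<in> Lp p" if "f \<in> Lp p" for f by (rule extension_bound(1)[OF T that])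
  show "AE x in lborel. a * (f x + g x) + b * T (\<lambda>y. f y + g y) x = a * f x + b * T f x + (a * g x + b * T g x)"
    if "f \<in> Lp p" "g \<in> Lp p" for f g
  proof -
    have "AE x in lborel. T (\<lambda>y. f y + g y) x = T f x + T g x"
      using T that by (simp add: hilbert_extension_def bounded_linear_Lp_def)
    then show ?thesis by eventually_elim (simp add: algebra_simps)
  qed
  show "AE x in lborel. a * (c * f x) + b * T (\<lambda>y. c * f y) x = c * (a * f x + b * T f x)" if "f \<in> Lp p" for f c
  proof -
    have "AE x in lborel. T (\<lambda>y. c * f y) x = c * T f x"
      using T that by (simp add: hilbert_extension_def bounded_linear_Lp_def)
    then show ?thesis by eventually_elim (simp add: algebra_simps)
  qed
  show "\<exists>K. \<forall>f\<in>Lp p. Lp_norm p (\<lambda>x. a * f x + b * T f x) \<le> K * Lp_norm p f"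
    using Lp_norm_le_of_pint[OF B_const_nonneg[OF p] extension_bound(2)[OF T]] by blast
qed

end

section \<open>Sharpness\<close>

text \<open>The half-circle means \<open>m\<close> of \<open>G\<close> about \<open>x\<close> satisfy \<open>\<i> * s * m' s = G (x - s) - G (x + s)\<close>; this
  evaluates the principal value integral of a holomorphic function.\<close>

lemma holomorphic_conjugate:
  fixes G :: "complex \<Rightarrow> complex" and x :: real
  assumes G: "G holomorphic_on {z. -1 < Im z}"
    and decay: "\<And>e. 0 < e \<Longrightarrow> \<exists>R. \<forall>z. 0 \<le> Im z \<longrightarrow> R \<le> cmod z \<longrightarrow> cmod (G z) < e"
    and int: "integrable lborel (\<lambda>s. indicator {0<..} s * ((Re (G (of_real (x - s))) - Re (G (of_real (x + s)))) / s))"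
  shows "(\<integral>s. indicator {0<..} s * ((Re (G (of_real (x - s))) - Re (G (of_real (x + s)))) / s) \<partial>lborel) = pi * Im (G (of_real x))"
proof -
  define S where "S = {z. -1 < Im z}"
  have oS: "open S" unfolding S_def by (rule open_halfspace_Im_gt)
  define G1 where "G1 = deriv G"
  have Gd: "(G has_field_derivative G1 z) (at z)" if "z \<in> S" for z
    using G oS that by (auto simp: G1_def S_def intro!: holomorphic_derivI)
  have Gc: "continuous_on S G" and G1c: "continuous_on S G1"
    using G oS by (auto simp: G1_def S_def intro!: holomorphic_on_imp_continuous_on holomorphic_deriv)
  define P where "P r \<theta> = of_real x + of_real r * cis \<theta>" for r \<theta> :: real
  have PS: "P r \<theta> \<in> S" if "0 \<le> r" "0 \<le> \<theta>" "\<theta> \<le> pi" for r \<theta>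
  proof -
    have "0 \<le> r * sin \<theta>" using that by (intro mult_nonneg_nonneg sin_ge_zero)
    then show ?thesis by (simp add: P_def S_def)
  qed
  have cP: "continuous_on A (\<lambda>z. P (fst z) (snd z))" for A
    unfolding P_def cis_conv_exp by (intro continuous_intros)
  \<comment> \<open>Not normalised: at radius 0 the value is \<open>pi * G x\<close>, and by
    \<open>decay\<close> it tends to 0 as the radius grows. Its total change gives the integral
    sought.\<close>
  define m where "m r = integral {0..pi} (\<lambda>\<theta>. G (P r \<theta>))" for r
  have PG: "continuous_on ({0..} \<times> {0..pi}) (\<lambda>z. G (P (fst z) (snd z)))"
    by (rule continuous_on_compose2[OF Gc cP]) (auto intro: PS)
  have mc: "continuous_on {0..} m"
    using integral_continuous_on_param[of "{0..}" 0 pi "\<lambda>r \<theta>. G (P r \<theta>)"] PG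
    by (simp add: m_def[abs_def] split_beta)
  have sect: "continuous_on {0..pi} (\<lambda>\<theta>. G (P r \<theta>))" if "0 \<le> r" for r
    by (rule continuous_on_compose2[OF PG, of _ "\<lambda>\<theta>. (r, \<theta>)", simplified]) (use that in \<open>auto intro!: continuous_intros\<close>)
  have md: "(m has_vector_derivative integral {0..pi} (\<lambda>\<theta>. G1 (P r \<theta>) * cis \<theta>)) (at r)" if r: "0 < r" for r
  proof -
    have "((\<lambda>r. integral (cbox 0 pi) (\<lambda>\<theta>. G (P r \<theta>))) has_vector_derivative integral (cbox 0 pi) (\<lambda>\<theta>. G1 (P r \<theta>) * cis \<theta>)) (at r within {0<..})"
    proof (rule leibniz_rule_vector_derivative)
      fix r \<theta> :: real assume rt: "r \<in> {0<..}" "\<theta> \<in> cbox 0 pi"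
      have "((\<lambda>r. P r \<theta>) has_vector_derivative cis \<theta>) (at r)"
        unfolding P_def using has_vector_derivative_real_field[of "\<lambda>w. of_real x + w * cis \<theta>" "cis \<theta>" r UNIV]
        by (auto intro!: derivative_eq_intros)
      from field_vector_diff_chain_at[OF this Gd[OF PS]] rt
      have "((\<lambda>r. G (P r \<theta>)) has_vector_derivative cis \<theta> * G1 (P r \<theta>)) (at r)" by (simp add: o_def)
      then show "((\<lambda>r. G (P r \<theta>)) has_vector_derivative G1 (P r \<theta>) * cis \<theta>) (at r within {0<..})"
        by (simp add: mult.commute has_vector_derivative_at_within)
    next
      fix r :: real assume "r \<in> {0<..}"
      then show "(\<lambda>\<theta>. G (P r \<theta>)) integrable_on cbox 0 pi"
        using sect[of r] by (auto intro!: integrable_continuous_interval)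
    next
      have "continuous_on ({0<..} \<times> cbox 0 pi) (\<lambda>z. G1 (P (fst z) (snd z)))"
        by (rule continuous_on_compose2[OF G1c cP]) (auto intro!: PS)
      then show "continuous_on ({0<..} \<times> cbox 0 pi) (\<lambda>(r, \<theta>). G1 (P r \<theta>) * cis \<theta>)"
        unfolding split_beta cis_conv_exp by (intro continuous_intros)
    qed (use r in \<open>auto simp: convex_real_interval\<close>)
    then show ?thesis using r by (simp add: m_def[abs_def] at_within_open[of _ "{0<..}"])
  qed
  \<comment> \<open>Multiplied by \<open>\<i> * r\<close>, the integrand is the angular derivative
    of \<open>G (P r \<theta>)\<close>; so the integral sees only the end points
    \<open>x + r\<close> and \<open>x - r\<close> of the half-circle.\<close>
  have arc: "integral {0..pi} (\<lambda>\<theta>. G1 (P r \<theta>) * cis \<theta>) = (G (of_real (x - r)) - G (of_real (x + r))) / (\<i> * r)" if r: "0 < r" for r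
  proof -
    have "((\<lambda>\<theta>. \<i> * r * (G1 (P r \<theta>) * cis \<theta>)) has_integral G (P r pi) - G (P r 0)) {0..pi}"
    proof (rule fundamental_theorem_of_calculus)
      fix \<theta> assume t: "\<theta> \<in> {0..pi}"
      have "((\<lambda>\<theta>. P r \<theta>) has_vector_derivative of_real r * (\<i> * cis \<theta>)) (at \<theta>)"
        unfolding P_def cis_conv_exp
      proof (rule has_vector_derivative_real_field)
        show "((\<lambda>w. of_real x + of_real r * exp (\<i> * w)) has_field_derivative of_real r * (\<i> * exp (\<i> * of_real \<theta>))) (at (of_real \<theta>))"
          by (auto intro!: derivative_eq_intros)
      qed
      from field_vector_diff_chain_at[OF this Gd[OF PS]] t r
      have "((\<lambda>\<theta>. G (P r \<theta>)) has_vector_derivative of_real r * (\<i> * cis \<theta>) * G1 (P r \<theta>)) (at \<theta>)" by (simp add: o_def)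
      then show "((\<lambda>\<theta>. G (P r \<theta>)) has_vector_derivative \<i> * r * (G1 (P r \<theta>) * cis \<theta>)) (at \<theta> within {0..pi})"
        by (simp add: mult_ac has_vector_derivative_at_within)
    qed simp
    then have "integral {0..pi} (\<lambda>\<theta>. \<i> * r * (G1 (P r \<theta>) * cis \<theta>)) = G (P r pi) - G (P r 0)" by (rule integral_unique)
    then have "\<i> * r * integral {0..pi} (\<lambda>\<theta>. G1 (P r \<theta>) * cis \<theta>) = G (of_real (x - r)) - G (of_real (x + r))"
      by (simp add: P_def)
    then show ?thesis using r by (simp add: field_simps)
  qed
  have ftc: "((\<lambda>s. (G (of_real (x - s)) - G (of_real (x + s))) / (\<i> * s)) has_integral m R - m 0) {0..R}" if R: "0 < R" for R
  proof (rule fundamental_theorem_of_calculus_interior)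
    show "continuous_on {0..R} m" by (rule continuous_on_subset[OF mc]) auto
    show "(m has_vector_derivative (G (of_real (x - s)) - G (of_real (x + s))) / (\<i> * s)) (at s)" if "s \<in> {0<..<R}" for s
      using md[of s] arc[of s] that by simp
  qed (use R in simp)
  have m0: "m 0 = pi * G (of_real x)" by (simp add: m_def P_def scaleR_conv_of_real)
  define k where "k s = indicator {0<..} s * ((Re (G (of_real (x - s))) - Re (G (of_real (x + s)))) / s)" for s
  have kint: "integrable lborel k" using int by (simp add: k_def[abs_def])
  have part: "(\<integral>s. indicator {0..real (Suc n)} s * k s \<partial>lborel) = pi * Im (G (of_real x)) - Im (m (real (Suc n)))" for n
  proof -
    let ?R = "real (Suc n)"
    have i: "integrable lborel (\<lambda>s. indicator {0..?R} s * k s)"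
      using integrable_real_mult_indicator[OF _ kint, of "{0..?R}"] by (simp add: mult.commute)
    have "(\<integral>s. indicator {0..?R} s * k s \<partial>lborel) = integral {0..?R} (\<lambda>s. indicator {0..?R} s * k s)"
      by (rule lborel_integral_eq_interval[OF i]) simp
    \<comment> \<open>For real \<open>s\<close> the quotient \<open>Re z / s\<close> is
      \<open>- Im (z / (\<i> * s))\<close>, the form in which \<open>ftc\<close> applies.\<close>
    also have "\<dots> = integral {0..?R} (\<lambda>s. - Im ((G (of_real (x - s)) - G (of_real (x + s))) / (\<i> * s)))"
    proof (rule integral_cong)
      fix s assume "s \<in> {0..?R}"
      then show "indicator {0..?R} s * k s = - Im ((G (of_real (x - s)) - G (of_real (x + s))) / (\<i> * s))"
        by (cases "s = 0") (auto simp: k_def Im_divide power2_eq_square)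
    qed
    also have "\<dots> = - Im (m ?R - m 0)"
    proof -
      have "((\<lambda>s. Im ((G (of_real (x - s)) - G (of_real (x + s))) / (\<i> * s))) has_integral Im (m ?R - m 0)) {0..?R}"
        using has_integral_linear[OF ftc[of ?R] bounded_linear_Im] by (simp add: o_def)
      then show ?thesis by (intro integral_unique has_integral_neg)
    qed
    finally show ?thesis by (simp add: m0)
  qed
  have mlim: "(\<lambda>n. m (real (Suc n))) \<longlonglongrightarrow> 0"
  proof (rule LIMSEQ_I)
    fix e :: real assume e: "0 < e"
    \<comment> \<open>The half-circle has angular length \<open>pi\<close>, and
      \<open>pi < 4\<close>.\<close>
    obtain R where R: "\<And>z. 0 \<le> Im z \<Longrightarrow> R \<le> cmod z \<Longrightarrow> cmod (G z) < e / 4" using decay[of "e/4"] e by auto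
    obtain N :: nat where N: "R + \<bar>x\<bar> < real N" using reals_Archimedean2 by blast
    have "norm (m (real (Suc n)) - 0) < e" if n: "N \<le> n" for n
    proof -
      have "norm (integral {0..pi} (\<lambda>\<theta>. G (P (real (Suc n)) \<theta>))) \<le> e / 4 * (pi - 0)"
      proof (rule integral_bound)
        fix \<theta> assume t: "\<theta> \<in> {0..pi}"
        have "R + \<bar>x\<bar> \<le> real (Suc n)" using N n by linarith
        moreover have "real (Suc n) - \<bar>x\<bar> \<le> cmod (P (real (Suc n)) \<theta>)"
          using norm_triangle_ineq2[of "of_real (real (Suc n)) * cis \<theta>" "of_real (- x)"]
          by (simp add: P_def norm_mult add.commute del: of_nat_Suc)
        moreover have "0 \<le> Im (P (real (Suc n)) \<theta>)" using t by (auto simp: P_def intro!: mult_nonneg_nonneg sin_ge_zero)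
        ultimately show "norm (G (P (real (Suc n)) \<theta>)) \<le> e / 4" by (intro less_imp_le[OF R]) linarith+
      qed (use sect in auto)
      also have "\<dots> < e" using pi_less_4 e by simp
      finally show ?thesis by (simp add: m_def)
    qed
    then show "\<exists>no. \<forall>n\<ge>no. norm (m (real (Suc n)) - 0) < e" by blast
  qed
  have "(\<lambda>n. \<integral>s. indicator {0..real (Suc n)} s * k s \<partial>lborel) \<longlonglongrightarrow> (\<integral>s. k s \<partial>lborel)"
  proof (rule integral_dominated_convergence[OF _ _ integrable_norm[OF kint]])
    show "AE s in lborel. (\<lambda>n. indicator {0..real (Suc n)} s * k s) \<longlonglongrightarrow> k s"
    proof (rule AE_I2)
      fix s :: real
      obtain N :: nat where N: "s < real N" using reals_Archimedean2 by blast
      have "indicator {0..real (Suc n)} s * k s = k s" if "N \<le> n" for n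
        using N that by (cases "0 < s") (auto simp: k_def indicator_def)
      then have "\<forall>\<^sub>F n in sequentially. k s = indicator {0..real (Suc n)} s * k s"
        by (auto simp: eventually_sequentially)
      then show "(\<lambda>n. indicator {0..real (Suc n)} s * k s) \<longlonglongrightarrow> k s"
        by (rule Lim_transform_eventually[OF tendsto_const])
    qed
    show "AE s in lborel. norm (indicator {0..real (Suc n)} s * k s) \<le> norm (k s)" for n
      by (intro AE_I2) (auto simp: indicator_def)
  qed (use kint in auto)
  moreover have "(\<lambda>n. pi * Im (G (of_real x)) - Im (m (real (Suc n)))) \<longlonglongrightarrow> pi * Im (G (of_real x)) - Im 0"
    by (intro tendsto_intros mlim)
  ultimately have "(\<integral>s. k s \<partial>lborel) = pi * Im (G (of_real x)) - Im 0"
    unfolding part by (rule LIMSEQ_unique)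
  then show ?thesis by (simp add: k_def[abs_def])
qed

section \<open>Complex powers as nearly extremal functions\<close>

text \<open>\<open>exp (- of_real s * Ln (w + \<i>))\<close> is \<open>w + \<i>\<close> to the power
  \<open>- s\<close>. The shift moves the branch point to \<open>- \<i>\<close>, so that the
  function is holomorphic across the real line. Differentiation adds 1 to \<open>s\<close> and
  multiplies \<open>c\<close> by \<open>- s\<close>, which keeps it within the family.\<close>

lemma Ln_shift_der:
  "((\<lambda>w. c * exp (- of_real s * Ln (w + \<i>))) has_field_derivative c * (- of_real s) * exp (- of_real (s + 1) * Ln (w + \<i>))) (at w)"
  if "-1 < Im w" for c :: complex and s :: real
proof -
  have n: "w + \<i> \<notin> \<real>\<^sub>\<le>\<^sub>0" using that by (auto simp: complex_nonpos_Reals_iff)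
  then have nz: "w + \<i> \<noteq> 0" by auto
  have "exp (- of_real (s + 1) * Ln (w + \<i>)) = exp (- of_real s * Ln (w + \<i>)) * exp (- Ln (w + \<i>))"
    by (simp add: algebra_simps flip: exp_add)
  also have "exp (- Ln (w + \<i>)) = 1 / (w + \<i>)" using nz by (simp add: exp_minus divide_inverse)
  finally show ?thesis using n by (auto intro!: derivative_eq_intros simp: divide_inverse)
qed

lemma cmod_Ln_power:
  assumes "w \<noteq> 0" shows "cmod (exp (- of_real s * Ln w)) = cmod w powr (- s)"
  using assms by (simp add: norm_exp_eq_Re powr_def)

lemma cmod_shift_ge: "1 \<le> cmod (of_real x + \<i>)" "\<bar>x\<bar> \<le> cmod (of_real x + \<i>)"
  using abs_Im_le_cmod[of "of_real x + \<i>"] abs_Re_le_cmod[of "of_real x + \<i>"] by auto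

lemma shift_nz: "of_real x + \<i> \<noteq> 0" by (simp add: complex_eq_iff)

lemma shift_powr_le_1: "0 \<le> s \<Longrightarrow> cmod (of_real x + \<i>) powr (- s) \<le> 1"
  using powr_mono2'[of "- s" 1 "cmod (of_real x + \<i>)"] cmod_shift_ge(1)[of x] by simp

lemma integral_abs_powr_tail:
  assumes "1 < q" shows "integrable lborel (\<lambda>x. cmod (of_real x + \<i>) powr (- q))"
proof -
  define h where "h x = indicator {-1..1} x + indicator {1..} x * x powr (- q) + indicator {1..} (- x) * (- x) powr (- q)" for x :: real
  have i: "integrable lborel (\<lambda>x. indicator {1..} x * x powr (- q))" using assms by (intro integrable_powr_tail) auto
  then have "integrable lborel (\<lambda>x. indicator {1..} (- x) * (- x) powr (- q))"
    using lborel_integrable_real_affine[of "\<lambda>x. indicator {1..} x * x powr (- q)" "-1" 0] by simp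
  then have hi: "integrable lborel h"
    unfolding h_def[abs_def] by (intro Bochner_Integration.integrable_add integrable_interval i)
  have b: "cmod (of_real x + \<i>) powr (- q) \<le> h x" for x
  proof (cases "\<bar>x\<bar> \<le> 1")
    case True
    have "cmod (of_real x + \<i>) powr (- q) \<le> 1 powr (- q)"
      using assms cmod_shift_ge[of x] by (intro powr_mono2') auto
    then have "cmod (of_real x + \<i>) powr (- q) \<le> 1" by simp
    moreover have "1 \<le> h x" using True by (auto simp: h_def indicator_def)
    ultimately show ?thesis by linarith
  next
    case False
    have "cmod (of_real x + \<i>) powr (- q) \<le> \<bar>x\<bar> powr (- q)"
      using assms cmod_shift_ge(2)[of x] False by (intro powr_mono2') auto
    also have "\<dots> \<le> h x" using False by (cases "0 < x") (auto simp: h_def indicator_def)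
    finally show ?thesis .
  qed
  show ?thesis
  proof (rule Bochner_Integration.integrable_bound[OF hi])
    have "continuous_on UNIV (\<lambda>x. cmod (of_real x + \<i>) powr (- q))"
      using shift_nz by (intro continuous_intros) auto
    then show "(\<lambda>x. cmod (of_real x + \<i>) powr (- q)) \<in> borel_measurable lborel"
      by (simp add: borel_measurable_continuous_onI)
    show "AE x in lborel. norm (cmod (of_real x + \<i>) powr (- q)) \<le> norm (h x)"
      using b by (intro AE_I2) (simp add: order_trans[OF _ abs_ge_self])
  qed
qed

context
  fixes \<beta> \<psi> :: real
  assumes \<beta>: "0 < \<beta>" "\<beta> \<le> 1"
begin

definition ext_fun :: "complex \<Rightarrow> complex" where "ext_fun z = cis \<psi> * exp (- of_real \<beta> * Ln (z + \<i>))"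
definition re_ext :: "real \<Rightarrow> real" where "re_ext x = Re (ext_fun (of_real x))"
definition im_ext :: "real \<Rightarrow> real" where "im_ext x = Im (ext_fun (of_real x))"

lemma ext_fun_holomorphic: "ext_fun holomorphic_on {z. -1 < Im z}"
proof (rule holomorphic_onI)
  fix z assume "z \<in> {z. -1 < Im z}"
  then have "-1 < Im z" by simp
  from has_field_derivative_at_within[OF Ln_shift_der[OF this]]
  show "ext_fun field_differentiable at z within {z. -1 < Im z}"
    unfolding ext_fun_def[abs_def] field_differentiable_def by blast
qed

lemma ext_fun_norm: "z + \<i> \<noteq> 0 \<Longrightarrow> cmod (ext_fun z) = cmod (z + \<i>) powr (- \<beta>)"
  using cmod_Ln_power[of "z + \<i>" \<beta>] by (simp only: ext_fun_def norm_mult norm_cis mult_1 simp_thms)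

lemma ext_fun_decay:
  assumes e: "0 < e" shows "\<exists>R. \<forall>z. 0 \<le> Im z \<longrightarrow> R \<le> cmod z \<longrightarrow> cmod (ext_fun z) < e"
proof -
  \<comment> \<open>The radius with \<open>Q powr (- \<beta>) = e / 2\<close>; the additional 1
    below compensates for the shift by \<i>.\<close>
  define Q where "Q = (e/2) powr (- (1/\<beta>))"
  have Q: "0 < Q" using e by (simp add: Q_def)
  have "cmod (ext_fun z) < e" if z: "0 \<le> Im z" "Q + 1 \<le> cmod z" for z
  proof -
    have "Q \<le> cmod (z + \<i>)" using norm_triangle_ineq2[of z "- \<i>"] z by simp
    then have "cmod (z + \<i>) powr (- \<beta>) \<le> Q powr (- \<beta>)" using \<beta> Q by (intro powr_mono2') auto
    also have "Q powr (- \<beta>) = e / 2" using \<beta> e by (simp add: Q_def powr_powr)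
    finally have "cmod (z + \<i>) powr (- \<beta>) < e" using e by simp
    moreover have "z + \<i> \<noteq> 0" using \<open>Q \<le> cmod (z + \<i>)\<close> Q by auto
    ultimately show ?thesis by (simp add: ext_fun_norm)
  qed
  then show ?thesis by blast
qed

lemma Re_Ln_shift_der:
  "((\<lambda>x. Re (c * exp (- of_real s * Ln (of_real x + \<i>)))) has_real_derivative
     Re (c * (- of_real s) * exp (- of_real (s + 1) * Ln (of_real x + \<i>)))) (at x)"
proof -
  have "((\<lambda>x. c * exp (- of_real s * Ln (of_real x + \<i>))) has_vector_derivative
     c * (- of_real s) * exp (- of_real (s + 1) * Ln (of_real x + \<i>))) (at x)"
    by (rule has_vector_derivative_real_field[OF Ln_shift_der]) simp
  from bounded_linear.has_vector_derivative[OF bounded_linear_Re this]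
  show ?thesis by (simp only: has_real_derivative_iff_has_vector_derivative)
qed

lemma re_ext_smooth: "smooth re_ext"
proof (rule smooth_coinduct[of _ "range (\<lambda>(c, s) x. Re (c * exp (- of_real s * Ln (of_real x + \<i>))))"])
  show "re_ext \<in> range (\<lambda>(c, s) x. Re (c * exp (- of_real s * Ln (of_real x + \<i>))))"
    by (intro image_eqI[of _ _ "(cis \<psi>, \<beta>)"]) (auto simp: re_ext_def[abs_def] ext_fun_def)
next
  fix f assume "f \<in> range (\<lambda>(c, s) x. Re (c * exp (- of_real s * Ln (of_real x + \<i>))))"
  then obtain c s where f: "f = (\<lambda>x. Re (c * exp (- of_real s * Ln (of_real x + \<i>))))" by auto
  show "\<exists>f'\<in>range (\<lambda>(c, s) x. Re (c * exp (- of_real s * Ln (of_real x + \<i>)))). \<forall>x. (f has_real_derivative f' x) (at x)"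
  proof (rule bexI)
    show "\<forall>x. (f has_real_derivative Re (c * (- of_real s) * exp (- of_real (s + 1) * Ln (of_real x + \<i>)))) (at x)"
      unfolding f using Re_Ln_shift_der by blast
    show "(\<lambda>x. Re (c * (- of_real s) * exp (- of_real (s + 1) * Ln (of_real x + \<i>))))
       \<in> range (\<lambda>(c, s) x. Re (c * exp (- of_real s * Ln (of_real x + \<i>))))"
      by (intro image_eqI[of _ _ "(c * (- of_real s), s + 1)"]) (simp_all only: prod.case UNIV_I)
  qed
qed

lemma re_ext_bound: "\<bar>re_ext x\<bar> \<le> cmod (of_real x + \<i>) powr (- \<beta>)"
  using abs_Re_le_cmod[of "ext_fun (of_real x)"] ext_fun_norm[OF shift_nz] by (simp add: re_ext_def)

lemma re_ext_le_1: "\<bar>re_ext x\<bar> \<le> 1"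
  using re_ext_bound[of x] shift_powr_le_1[of \<beta> x] \<beta> by linarith

text \<open>The derivative is at most
  \<open>\<beta> * cmod (x + \<i>) powr (- (\<beta> + 1))\<close> in modulus, and
  \<open>\<beta> \<le> 1\<close> while \<open>cmod (x + \<i>) \<ge> 1\<close>.\<close>

lemma re_ext_lip: "\<bar>re_ext x - re_ext y\<bar> \<le> 1 * \<bar>x - y\<bar>"
proof -
  define d where "d x = Re (cis \<psi> * (- of_real \<beta>) * exp (- of_real (\<beta> + 1) * Ln (of_real x + \<i>)))" for x
  have der: "(re_ext has_real_derivative d x) (at x)" for x
    unfolding re_ext_def[abs_def] ext_fun_def d_def by (rule Re_Ln_shift_der)
  have "\<bar>d x\<bar> \<le> 1" for x
  proof -
    have "\<bar>d x\<bar> \<le> cmod (cis \<psi> * (- of_real \<beta>) * exp (- of_real (\<beta> + 1) * Ln (of_real x + \<i>)))"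
      unfolding d_def by (rule abs_Re_le_cmod)
    also have "\<dots> = \<beta> * cmod (of_real x + \<i>) powr (- (\<beta> + 1))"
      unfolding norm_mult cmod_Ln_power[OF shift_nz] using \<beta> by simp
    also have "\<dots> \<le> 1 * 1" using \<beta> shift_powr_le_1[of "\<beta> + 1" x] by (intro mult_mono) auto
    finally show ?thesis by simp
  qed
  then show ?thesis using field_differentiable_bound[of UNIV re_ext d 1 x y] der by simp
qed

lemma im_ext_cont: "continuous_on UNIV im_ext" and re_ext_cont: "continuous_on UNIV re_ext"
proof -
  have "continuous_on UNIV (\<lambda>x. ext_fun (of_real x))"
    by (rule continuous_on_compose2[OF holomorphic_on_imp_continuous_on[OF ext_fun_holomorphic]])
       (auto intro!: continuous_intros)
  then show "continuous_on UNIV im_ext" "continuous_on UNIV re_ext"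
    unfolding im_ext_def[abs_def] re_ext_def[abs_def] by (intro continuous_intros; assumption)+
qed

text \<open>The bump is normalised to 1 at 0 and stretched by \<open>Suc n\<close>: the cutoffs tend
  to 1 pointwise while their Lipschitz constants stay bounded in \<open>n\<close>.\<close>

definition cut_ext :: "nat \<Rightarrow> real \<Rightarrow> real" where
  "cut_ext n x = (1 / bump 0 * bump (1 / real (Suc n) * x + 0)) * re_ext x"

lemma bump0: "0 < bump 0" by (rule bump_pos) simp

lemma cut_ext_test: "cut_ext n \<in> test_functions"
proof -
  have "(\<lambda>x. bump (1 / real (Suc n) * x + 0)) \<in> test_functions" by (rule test_affine[OF test_bump]) simp
  then have "(\<lambda>x. 1 / bump 0 * bump (1 / real (Suc n) * x + 0)) \<in> test_functions" by (rule test_cmult)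
  from test_mult(1)[OF this re_ext_smooth] show ?thesis unfolding cut_ext_def[abs_def] .
qed

lemma cut_ext_le: "\<bar>cut_ext n x\<bar> \<le> 1 / bump 0 * \<bar>re_ext x\<bar>"
proof -
  have "\<bar>1 / bump 0 * bump (1 / real (Suc n) * x + 0)\<bar> \<le> 1 / bump 0"
    using bump_bounds[of "1 / real (Suc n) * x + 0"] bump0 by (simp add: abs_mult divide_right_mono)
  then show ?thesis unfolding cut_ext_def abs_mult[of _ "re_ext x"] by (intro mult_right_mono) auto
qed

lemma cut_ext_lim: "(\<lambda>n. cut_ext n x) \<longlonglongrightarrow> re_ext x"
proof -
  have y0: "(\<lambda>n. 1 / real (Suc n)) \<longlonglongrightarrow> 0" by (rule LIMSEQ_Suc[OF lim_1_over_n])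
  have "(\<lambda>n. 1 / real (Suc n) * x + 0) \<longlonglongrightarrow> 0 * x + 0" by (intro tendsto_intros y0)
  moreover have "isCont bump (0 * x + 0)" using smooth_cont[OF smooth_bump] by (simp add: continuous_on_eq_continuous_at)
  ultimately have "(\<lambda>n. bump (1 / real (Suc n) * x + 0)) \<longlonglongrightarrow> bump (0 * x + 0)" by (rule isCont_tendsto_compose[rotated])
  then have "(\<lambda>n. (1 / bump 0 * bump (1 / real (Suc n) * x + 0)) * re_ext x) \<longlonglongrightarrow> (1 / bump 0 * bump (0 * x + 0)) * re_ext x"
    by (intro tendsto_mult tendsto_const)
  then show ?thesis using bump0 by (simp add: cut_ext_def)
qed

lemma cut_ext_lip: obtains L where "0 \<le> L" "\<And>n x y. \<bar>cut_ext n x - cut_ext n y\<bar> \<le> L * \<bar>x - y\<bar>"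
proof -
  obtain Lb where Lb: "0 \<le> Lb" "\<And>x. \<bar>deriv bump x\<bar> \<le> Lb" "\<And>x y. \<bar>bump x - bump y\<bar> \<le> Lb * \<bar>x - y\<bar>"
    by (rule test_bounded_deriv[OF test_bump]) (rule that)
  define L where "L = 1 / bump 0 * (1 + Lb)"
  have "\<bar>cut_ext n x - cut_ext n y\<bar> \<le> L * \<bar>x - y\<bar>" for n x y
  proof -
    define u v where "u = bump (1 / real (Suc n) * x + 0)" and "v = bump (1 / real (Suc n) * y + 0)"
    have "\<bar>u - v\<bar> \<le> Lb * \<bar>(1 / real (Suc n) * x + 0) - (1 / real (Suc n) * y + 0)\<bar>" unfolding u_def v_def by (rule Lb)
    also have "\<dots> = Lb * (1 / real (Suc n) * \<bar>x - y\<bar>)" by (simp add: abs_mult abs_divide flip: diff_divide_distrib)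
    also have "\<dots> \<le> Lb * (1 * \<bar>x - y\<bar>)" using Lb by (intro mult_left_mono mult_right_mono) auto
    finally have uv: "\<bar>u - v\<bar> \<le> Lb * \<bar>x - y\<bar>" by simp
    have v: "\<bar>v\<bar> \<le> 1" using bump_bounds by (simp add: v_def)
    have "cut_ext n x - cut_ext n y = 1 / bump 0 * ((u - v) * re_ext x + v * (re_ext x - re_ext y))"
      by (simp add: cut_ext_def u_def v_def algebra_simps diff_divide_distrib)
    also have "\<bar>\<dots>\<bar> \<le> 1 / bump 0 * (\<bar>u - v\<bar> * \<bar>re_ext x\<bar> + \<bar>v\<bar> * \<bar>re_ext x - re_ext y\<bar>)"
      using bump0 abs_triangle_ineq[of "(u - v) * re_ext x" "v * (re_ext x - re_ext y)"]
      by (simp add: abs_mult divide_right_mono)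
    also have "\<dots> \<le> 1 / bump 0 * ((Lb * \<bar>x - y\<bar>) * 1 + 1 * (1 * \<bar>x - y\<bar>))"
      using bump0 Lb(1) by (intro mult_left_mono add_mono mult_mono uv v re_ext_le_1 re_ext_lip) auto
    also have "\<dots> = L * \<bar>x - y\<bar>" by (simp add: L_def algebra_simps add_divide_distrib)
    finally show ?thesis .
  qed
  moreover have "0 \<le> L" using bump0 Lb by (simp add: L_def)
  ultimately show ?thesis using that by blast
qed

text \<open>Dominated convergence in the folded principal value: up to \<open>s0\<close> the
  Lipschitz bound uniform in \<open>n\<close> dominates, beyond it the decay of order
  \<open>s powr (- \<beta> - 1)\<close>. The limiting kernel belongs to the boundary value of a
  holomorphic function, so \<open>holomorphic_conjugate\<close> evaluates its integral.\<close>

lemma hilbert_cut_ext_lim: "(\<lambda>n. hilbert (cut_ext n) x) \<longlonglongrightarrow> im_ext x"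
proof -
  obtain L where L: "0 \<le> L" "\<And>n x y. \<bar>cut_ext n x - cut_ext n y\<bar> \<le> L * \<bar>x - y\<bar>" by (rule cut_ext_lip) (rule that)
  define c where "c = 1 / bump 0"
  have c: "0 < c" using bump0 by (simp add: c_def)
  \<comment> \<open>From here on both \<open>\<bar>x - s\<bar>\<close> and
    \<open>\<bar>x + s\<bar>\<close> are at least \<open>s / 2\<close>.\<close>
  define s0 where "s0 = 2 * \<bar>x\<bar> + 1"
  define q where "q = 1 + \<beta>"
  define w where "w s = 2 * L * indicator {0<..s0} s + (2 * c * (1/2) powr (- \<beta>)) * (indicator {s0..} s * s powr (- q))" for s
  define K where "K n s = indicator {0<..} s * ((cut_ext n (x - s) - cut_ext n (x + s)) / s)" for n s
  define k where "k s = indicator {0<..} s * ((re_ext (x - s) - re_ext (x + s)) / s)" for s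
  have wi: "integrable lborel w"
    unfolding w_def[abs_def]
    by (intro Bochner_Integration.integrable_add integrable_mult_right integrable_interval integrable_powr_tail)
       (use \<beta> in \<open>auto simp: s0_def q_def add_nonneg_pos\<close>)
  have Kw: "\<bar>K n s\<bar> \<le> w s" for n s
  proof -
    consider "s \<le> 0" | "0 < s" "s \<le> s0" | "s0 < s" by linarith
    then show ?thesis
    proof cases
      case 1
      then show ?thesis using L c by (simp add: K_def w_def)
    next
      case 2
      have "\<bar>cut_ext n (x - s) - cut_ext n (x + s)\<bar> \<le> L * \<bar>(x - s) - (x + s)\<bar>" by (rule L)
      also have "\<dots> = 2 * L * s" using 2 by simp
      finally have "\<bar>K n s\<bar> \<le> 2 * L" using 2 by (simp add: K_def abs_divide divide_le_eq)
      moreover have "2 * L \<le> w s" using 2 c by (simp add: w_def)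
      ultimately show ?thesis by linarith
    next
      case 3
      have s: "0 < s" using 3 by (simp add: s0_def)
      have half: "\<bar>cut_ext n y\<bar> \<le> c * ((1/2) powr (- \<beta>) * s powr (- \<beta>))" if "s / 2 \<le> \<bar>y\<bar>" for y
      proof -
        have "\<bar>cut_ext n y\<bar> \<le> c * \<bar>re_ext y\<bar>" using cut_ext_le by (simp add: c_def)
        also have "\<dots> \<le> c * cmod (of_real y + \<i>) powr (- \<beta>)" using c re_ext_bound by simp
        also have "cmod (of_real y + \<i>) powr (- \<beta>) \<le> (1/2 * s) powr (- \<beta>)"
          using s \<beta> that cmod_shift_ge(2)[of y] by (intro powr_mono2') auto
        also have "(1/2 * s) powr (- \<beta>) = (1/2) powr (- \<beta>) * s powr (- \<beta>)" by (rule powr_mult)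
        finally show ?thesis using c by simp
      qed
      have "s / 2 \<le> \<bar>x - s\<bar>" "s / 2 \<le> \<bar>x + s\<bar>" using 3 by (auto simp: s0_def)
      then have "\<bar>cut_ext n (x - s) - cut_ext n (x + s)\<bar> \<le> 2 * (c * ((1/2) powr (- \<beta>) * s powr (- \<beta>)))"
        using half[of "x - s"] half[of "x + s"] by linarith
      then have "\<bar>K n s\<bar> \<le> 2 * (c * ((1/2) powr (- \<beta>) * s powr (- \<beta>))) / s"
        using s by (simp add: K_def abs_divide divide_right_mono)
      also have "\<dots> = 2 * c * (1/2) powr (- \<beta>) * (s powr (- \<beta>) / s)" by simp
      also have "s powr (- \<beta>) / s = s powr (- \<beta> - 1)" using s by (simp only: powr_diff) simp
      also have "- \<beta> - 1 = - q" by (simp add: q_def)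
      also have "2 * c * (1/2) powr (- \<beta>) * s powr (- q) \<le> w s" using 3 s L by (simp add: w_def)
      finally show ?thesis .
    qed
  qed
  have Klim: "(\<lambda>n. K n s) \<longlonglongrightarrow> k s" for s
  proof (cases "s = 0")
    case False
    then show ?thesis unfolding K_def k_def by (intro tendsto_intros cut_ext_lim)
  qed (simp add: K_def k_def)
  have Ki: "integrable lborel (K n)" for n
    using hilbert_test_eq(1)[OF cut_ext_test, of n x] by (simp add: K_def[abs_def])
  have km: "k \<in> borel_measurable lborel" by (rule borel_measurable_LIMSEQ_real[OF Klim]) (use Ki in auto)
  have kw: "\<bar>k s\<bar> \<le> w s" for s by (rule LIMSEQ_le_const2[OF tendsto_rabs[OF Klim]]) (use Kw in auto)
  have "integrable lborel k"
    by (rule Bochner_Integration.integrable_bound[OF wi km]) (use kw in \<open>auto intro: order_trans[OF _ abs_ge_self]\<close>)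
  then have "(\<integral>s. k s \<partial>lborel) = pi * im_ext x"
    using holomorphic_conjugate[OF ext_fun_holomorphic ext_fun_decay, of x] by (simp add: k_def[abs_def] re_ext_def im_ext_def)
  moreover have "(\<lambda>n. \<integral>s. K n s \<partial>lborel) \<longlonglongrightarrow> (\<integral>s. k s \<partial>lborel)"
    by (rule integral_dominated_convergence[OF km _ wi]) (use Ki Klim Kw in auto)
  ultimately have "(\<lambda>n. 1 / pi * (\<integral>s. K n s \<partial>lborel)) \<longlonglongrightarrow> 1 / pi * (pi * im_ext x)"
    by (intro tendsto_mult tendsto_const) simp
  moreover have "hilbert (cut_ext n) x = 1 / pi * (\<integral>s. K n s \<partial>lborel)" for n
    using hilbert_test_eq(2)[OF cut_ext_test, of n x] by (simp add: K_def[abs_def])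
  ultimately show ?thesis by simp
qed

text \<open>The assumed inequality is applied to \<open>cut_ext n\<close>. Its right-hand side
  converges by domination, \<open>re_ext\<close> being \<open>p\<close>-integrable for
  \<open>\<beta> * p > 1\<close>. On the left only pointwise convergence of the Hilbert transforms
  is known, and Fatou's lemma gives the needed direction.\<close>

lemma ext_inequality:
  assumes p: "1 < p" and bp: "1 < \<beta> * p"
    and C: "\<And>f. f \<in> test_functions \<Longrightarrow> pint p (\<lambda>x. a * f x + b * hilbert f x) \<le> C * pint p f"
  shows "0 \<le> (\<integral>x. C * \<bar>re_ext x\<bar> powr p - \<bar>a * re_ext x + b * im_ext x\<bar> powr p \<partial>lborel)"
    and "integrable lborel (\<lambda>x. C * \<bar>re_ext x\<bar> powr p - \<bar>a * re_ext x + b * im_ext x\<bar> powr p)"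
proof -
  have m: "re_ext \<in> borel_measurable lborel" "im_ext \<in> borel_measurable lborel"
    using borel_measurable_continuous_onI[OF re_ext_cont] borel_measurable_continuous_onI[OF im_ext_cont] by auto
  have bnd: "\<bar>re_ext x\<bar> powr p \<le> cmod (of_real x + \<i>) powr (- (\<beta> * p))" for x
  proof -
    have "\<bar>re_ext x\<bar> powr p \<le> (cmod (of_real x + \<i>) powr (- \<beta>)) powr p" using re_ext_bound p by (intro powr_mono2) auto
    then show ?thesis by (simp add: powr_powr)
  qed
  have "integrable lborel (\<lambda>x. \<bar>re_ext x\<bar> powr p)"
  proof (rule Bochner_Integration.integrable_bound[OF integral_abs_powr_tail[OF bp]])
    show "(\<lambda>x. \<bar>re_ext x\<bar> powr p) \<in> borel_measurable lborel" using m by measurable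
  qed (use bnd in auto)
  then have reL: "re_ext \<in> Lp p" using m by (simp add: Lp_def)
  let ?c = "1 / bump 0"
  have cL: "(\<lambda>x. ?c * re_ext x) \<in> Lp p" by (rule Lp_cmult(1)[OF reL])
  have conv: "(\<lambda>n. pint p (cut_ext n)) \<longlonglongrightarrow> pint p re_ext"
    unfolding pint_def
  proof (rule integral_dominated_convergence[OF _ _ Lp_D(2)[OF cL]])
    show "(\<lambda>x. \<bar>re_ext x\<bar> powr p) \<in> borel_measurable lborel" using m by measurable
    show "(\<lambda>x. \<bar>cut_ext n x\<bar> powr p) \<in> borel_measurable lborel" for n
      using Lp_D(2)[OF test_Lp[OF cut_ext_test p]] by auto
    show "AE x in lborel. (\<lambda>n. \<bar>cut_ext n x\<bar> powr p) \<longlonglongrightarrow> \<bar>re_ext x\<bar> powr p"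
      using p by (intro AE_I2 tendsto_powr' tendsto_rabs cut_ext_lim tendsto_const) auto
    show "AE x in lborel. norm (\<bar>cut_ext n x\<bar> powr p) \<le> \<bar>?c * re_ext x\<bar> powr p" for n
    proof (rule AE_I2)
      fix x
      have "\<bar>cut_ext n x\<bar> \<le> \<bar>?c * re_ext x\<bar>" using cut_ext_le[of n x] bump0 by (simp add: abs_mult)
      then show "norm (\<bar>cut_ext n x\<bar> powr p) \<le> \<bar>?c * re_ext x\<bar> powr p" using p by (simp add: powr_mono2)
    qed
  qed
  have L: "(\<lambda>x. a * cut_ext n x + b * hilbert (cut_ext n) x) \<in> Lp p" for n
    by (intro Lp_add p Lp_cmult test_Lp[OF cut_ext_test p] hilbert_test_bound(1)[OF cut_ext_test p])
  have lim: "AE x in lborel. (\<lambda>n. a * cut_ext n x + b * hilbert (cut_ext n) x) \<longlonglongrightarrow> a * re_ext x + b * im_ext x"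
    by (intro AE_I2 tendsto_intros cut_ext_lim hilbert_cut_ext_lim)
  have mm: "(\<lambda>x. a * re_ext x + b * im_ext x) \<in> borel_measurable lborel" using m by measurable
  have cc: "(\<lambda>n. C * pint p (cut_ext n)) \<longlonglongrightarrow> C * pint p re_ext" by (intro tendsto_intros conv)
  note fat = Lp_fatou[OF L mm lim p C[OF cut_ext_test] cc]
  show "integrable lborel (\<lambda>x. C * \<bar>re_ext x\<bar> powr p - \<bar>a * re_ext x + b * im_ext x\<bar> powr p)"
    by (intro Bochner_Integration.integrable_diff integrable_mult_right Lp_D(2) reL fat(1))
  show "0 \<le> (\<integral>x. C * \<bar>re_ext x\<bar> powr p - \<bar>a * re_ext x + b * im_ext x\<bar> powr p \<partial>lborel)"
    using fat(2) Lp_D(2)[OF reL] Lp_D(2)[OF fat(1)] by (simp add: pint_def)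
qed

text \<open>The argument of \<open>x + \<i>\<close> is \<open>pi / 2 - arctan x\<close>, falling
  from \<open>pi\<close> at minus infinity to 0 at plus infinity. The phase hence runs from
  \<open>\<psi> - \<beta> * pi\<close> to \<psi>, and for \<beta> near \<open>1 / p\<close> these
  are nearly the two angles of a pair.\<close>

lemma ext_polar:
  "re_ext x = cmod (of_real x + \<i>) powr (- \<beta>) * cos (\<psi> - \<beta> * (pi / 2 - arctan x))"
  "im_ext x = cmod (of_real x + \<i>) powr (- \<beta>) * sin (\<psi> - \<beta> * (pi / 2 - arctan x))"
proof -
  let ?w = "of_real x + \<i>"
  define A where "A = pi / 2 - arctan x"
  have A: "0 < A" "A < pi" using arctan_bounded[of x] by (auto simp: A_def)
  have cs: "cos A = x / sqrt (1 + x\<^sup>2)" "sin A = 1 / sqrt (1 + x\<^sup>2)"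
    by (simp_all add: A_def cos_diff sin_diff sin_arctan cos_arctan)
  have "0 < sqrt (1 + x\<^sup>2)" by (simp add: add_pos_nonneg)
  then have "of_real (sqrt (1 + x\<^sup>2)) * exp (\<i> * of_real A) = ?w"
    by (simp add: complex_eq_iff cs flip: cis_conv_exp)
  then have "Arg ?w = A" by (rule Arg_unique) (use A \<open>0 < sqrt (1 + x\<^sup>2)\<close> in auto)
  then have Ln: "Ln ?w = of_real (ln (cmod ?w)) + \<i> * of_real A"
    using Arg_eq_Im_Ln[OF shift_nz, of x] Re_Ln[OF shift_nz, of x] by (simp add: complex_eq_iff)
  have "ext_fun (of_real x) = cis \<psi> * exp (of_real (- \<beta> * ln (cmod ?w)) + \<i> * of_real (- \<beta> * A))"
  proof -
    have "- of_real \<beta> * (of_real (ln (cmod ?w)) + \<i> * of_real A) = of_real (- \<beta> * ln (cmod ?w)) + \<i> * of_real (- \<beta> * A)"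
      by (simp add: algebra_simps)
    then show ?thesis by (simp only: ext_fun_def Ln)
  qed
  also have "\<dots> = of_real (cmod ?w powr (- \<beta>)) * (cis \<psi> * cis (- \<beta> * A))"
  proof -
    have "exp (- \<beta> * ln (cmod ?w)) = cmod ?w powr (- \<beta>)" using shift_nz[of x] by (simp add: powr_def)
    then show ?thesis by (simp only: exp_add exp_of_real cis_conv_exp[symmetric] mult_ac)
  qed
  also have "cis \<psi> * cis (- \<beta> * A) = cis (\<psi> - \<beta> * A)" by (simp add: cis_mult)
  finally have "ext_fun (of_real x) = of_real (cmod ?w powr (- \<beta>)) * cis (\<psi> - \<beta> * A)" .
  then show "re_ext x = cmod ?w powr (- \<beta>) * cos (\<psi> - \<beta> * (pi / 2 - arctan x))"
    "im_ext x = cmod ?w powr (- \<beta>) * sin (\<psi> - \<beta> * (pi / 2 - arctan x))"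
    by (simp_all add: re_ext_def im_ext_def A_def)
qed

lemma ext_hfun:
  assumes p: "1 < p"
  shows "C * \<bar>re_ext x\<bar> powr p - \<bar>a * re_ext x + b * im_ext x\<bar> powr p
    = cmod (of_real x + \<i>) powr (- (\<beta> * p)) * hfun p C a b (\<psi> - \<beta> * (pi / 2 - arctan x))"
proof -
  define \<rho> where "\<rho> = cmod (of_real x + \<i>) powr (- \<beta>)"
  define t where "t = \<psi> - \<beta> * (pi / 2 - arctan x)"
  have r: "re_ext x = \<rho> * cos t" "im_ext x = \<rho> * sin t" using ext_polar[of x] by (simp_all add: \<rho>_def t_def)
  have \<rho>: "0 \<le> \<rho>" by (simp add: \<rho>_def)
  have "a * re_ext x + b * im_ext x = \<rho> * (a * cos t + b * sin t)" by (simp add: r algebra_simps)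
  then have 1: "\<bar>a * re_ext x + b * im_ext x\<bar> powr p = \<rho> powr p * \<bar>a * cos t + b * sin t\<bar> powr p"
    using \<rho> by (simp add: abs_mult powr_mult)
  have 2: "\<bar>re_ext x\<bar> powr p = \<rho> powr p * \<bar>cos t\<bar> powr p" using \<rho> by (simp add: r(1) abs_mult powr_mult)
  have 3: "cmod (of_real x + \<i>) powr (- (\<beta> * p)) = \<rho> powr p" by (simp add: \<rho>_def powr_powr)
  show ?thesis unfolding 1 2 3 t_def[symmetric] hfun_def by (simp add: algebra_simps)
qed

end

section \<open>Concentration of mass at infinity\<close>

lemma hfun_cont: "1 < p \<Longrightarrow> continuous_on A (hfun p B a b)"
  by (rule DERIV_continuous_on) (use hfun_der has_field_derivative_at_within in blast)

text \<open>As \<open>\<beta>\<close> decreases to \<open>1 / p\<close> the \<open>p\<close>-th power of \<open>\<bar>x + \<i>\<bar> powr (- \<beta>)\<close> barely stays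
  integrable, so its mass escapes to infinity, where the phases are \<open>\<psi>\<close> and \<open>\<psi> - pi / p\<close>.\<close>

lemma sharp_pair:
  assumes p: "1 < p"
    and C: "\<And>f. f \<in> test_functions \<Longrightarrow> pint p (\<lambda>x. a * f x + b * hilbert f x) \<le> C * pint p f"
  shows "0 \<le> hfun p C a b \<psi> + hfun p C a b (\<psi> - pi / p)"
proof (rule ccontr)
  let ?k = "hfun p C a b"
  assume neg: "\<not> 0 \<le> ?k \<psi> + ?k (\<psi> - pi / p)"
  \<comment> \<open>A third of the deficit: continuity may cost \<delta> at each of the two angles
    and still leave a sum of at most \<open>- \<delta>\<close>.\<close>
  define \<delta> where "\<delta> = - (?k \<psi> + ?k (\<psi> - pi / p)) / 3"
  have \<delta>: "0 < \<delta>" "?k \<psi> + ?k (\<psi> - pi / p) = - 3 * \<delta>" using neg by (auto simp: \<delta>_def)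
  have kc: "continuous_on UNIV ?k" by (rule hfun_cont[OF p])
  obtain M where M: "0 \<le> M" "\<And>t. \<bar>?k t\<bar> \<le> M" by (rule periodic_bounded[OF kc hfun_periodic]) (rule that)
  have near: "\<exists>\<eta>>0. \<forall>t. \<bar>t - s\<bar> < \<eta> \<longrightarrow> ?k t \<le> ?k s + \<delta>" for s
  proof -
    have "isCont ?k s" using kc by (simp add: continuous_on_eq_continuous_at)
    then obtain \<eta> where "0 < \<eta>" "\<And>t. \<bar>t - s\<bar> < \<eta> \<Longrightarrow> \<bar>?k t - ?k s\<bar> < \<delta>"
      using \<delta>(1) unfolding continuous_at_real_range real_norm_def by blast
    then show ?thesis by (intro exI[of _ \<eta>]) (force simp: abs_less_iff)
  qed
  obtain \<eta>1 where \<eta>1: "0 < \<eta>1" "\<And>t. \<bar>t - \<psi>\<bar> < \<eta>1 \<Longrightarrow> ?k t \<le> ?k \<psi> + \<delta>" using near[of \<psi>] by blast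
  obtain \<eta>2 where \<eta>2: "0 < \<eta>2" "\<And>t. \<bar>t - (\<psi> - pi / p)\<bar> < \<eta>2 \<Longrightarrow> ?k t \<le> ?k (\<psi> - pi / p) + \<delta>"
    using near[of "\<psi> - pi / p"] by blast
  define \<eta> where "\<eta> = min \<eta>1 \<eta>2"
  have \<eta>: "0 < \<eta>" "\<eta> \<le> \<eta>1" "\<eta> \<le> \<eta>2" using \<eta>1 \<eta>2 by (auto simp: \<eta>_def)
  have "((\<lambda>x. pi / 2 - arctan x) \<longlongrightarrow> pi / 2 - pi / 2) at_top" by (intro tendsto_diff tendsto_const tendsto_arctan_at_top)
  then have "\<forall>\<^sub>F x in at_top. pi / 2 - arctan x < \<eta> / 2" using \<eta>(1) by (intro order_tendstoD(2)) auto
  then obtain X' where X': "\<And>x. X' \<le> x \<Longrightarrow> pi / 2 - arctan x < \<eta> / 2" by (auto simp: eventually_at_top_linorder)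
  define X0 where "X0 = max X' 1"
  have X0: "1 \<le> X0" "\<And>x. X0 \<le> x \<Longrightarrow> pi / 2 - arctan x < \<eta> / 2" using X' by (auto simp: X0_def)
  \<comment> \<open>On \<open>{X0..X1}\<close> the quantity \<open>c0 / x\<close> will bound
    \<open>\<delta> * E x\<close> from below: the factor \<open>2 powr (- (p / 2))\<close> stems
    from \<open>cmod (x + \<i>) \<le> sqrt 2 * x\<close>, the factor 1/2 from
    \<open>x powr (- (\<epsilon> * p)) \<ge> 1 / 2\<close>.\<close>
  define c0 where "c0 = \<delta> * (2 powr (- (p / 2)) / 2)"
  have c0: "0 < c0" using \<delta> by (simp add: c0_def)
  \<comment> \<open>\<open>D\<close> is the integral of \<open>1 / x\<close> over
    \<open>{X0..X1}\<close>. It is fixed before \<epsilon>, so large that the negative contribution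
    \<open>c0 * D\<close> outweighs \<open>2 * M * X0\<close>, the most that the part below
    \<open>X0\<close> can contribute.\<close>
  define D where "D = 2 * M * X0 / c0 + 1"
  have "0 \<le> 2 * M * X0 / c0" using M(1) X0(1) c0 by simp
  then have D: "0 < D" "2 * M * X0 < c0 * D" using c0 by (simp_all add: D_def distrib_left)
  define X1 where "X1 = X0 * exp D"
  have X1: "X0 < X1" using D X0 by (simp add: X1_def)
  then have lX1: "0 < ln X1" using X0 by simp
  \<comment> \<open>The three bounds ensure \<open>\<beta> \<le> 1\<close>, that the phase at minus
    infinity is off by at most \<open>\<eta> / 2\<close>, and that
    \<open>x powr (- (\<epsilon> * p)) \<ge> 1 / 2\<close> up to \<open>X1\<close>.\<close>
  define \<epsilon> where "\<epsilon> = min (1 - 1 / p) (min (\<eta> / (2 * pi)) (ln 2 / (p * ln X1)))"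
  have \<epsilon>: "0 < \<epsilon>" "\<epsilon> \<le> 1 - 1 / p" "\<epsilon> * pi \<le> \<eta> / 2" "\<epsilon> * p * ln X1 \<le> ln 2"
  proof -
    show "0 < \<epsilon>" using p \<eta>(1) lX1 by (simp add: \<epsilon>_def)
    show "\<epsilon> \<le> 1 - 1 / p" by (simp add: \<epsilon>_def)
    have "\<epsilon> \<le> \<eta> / (2 * pi)" by (simp add: \<epsilon>_def)
    then show "\<epsilon> * pi \<le> \<eta> / 2" by (simp add: field_simps)
    have "\<epsilon> \<le> ln 2 / (p * ln X1)" by (simp add: \<epsilon>_def)
    then show "\<epsilon> * p * ln X1 \<le> ln 2" using p lX1 by (simp add: field_simps)
  qed
  define \<beta> where "\<beta> = 1 / p + \<epsilon>"
  have \<beta>: "0 < \<beta>" "\<beta> \<le> 1" using \<epsilon> p by (auto simp: \<beta>_def add_pos_pos)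
  have bp: "1 < \<beta> * p" "\<beta> * p = 1 + \<epsilon> * p" using \<epsilon> p by (auto simp: \<beta>_def distrib_right)
  define E where "E x = cmod (of_real x + \<i>) powr (- (\<beta> * p))" for x
  define u where "u x = E x * ?k (\<psi> - \<beta> * (pi / 2 - arctan x))" for x
  have u: "u x = C * \<bar>re_ext \<beta> \<psi> x\<bar> powr p - \<bar>a * re_ext \<beta> \<psi> x + b * im_ext \<beta> \<psi> x\<bar> powr p" for x
    using ext_hfun[OF \<beta> p] by (simp add: u_def E_def)
  have ui: "integrable lborel u" and unn: "0 \<le> (\<integral>x. u x \<partial>lborel)"
    using ext_inequality[OF \<beta> p bp(1) C, of \<psi>] by (simp_all add: u[abs_def])
  have E1: "0 \<le> E x" "E x \<le> 1" for x
    using shift_powr_le_1[of "\<beta> * p" x] bp(1) by (simp_all add: E_def)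
  have Em: "E (- x) = E x" for x
  proof -
    have "cmod (of_real (- x) + \<i>) = cmod (of_real x + \<i>)" by (simp add: cmod_def)
    then show ?thesis by (simp add: E_def)
  qed
  \<comment> \<open>Folding pairs the two ends of the line, so that only the sum of
    \<open>?k\<close> at the two angles matters.\<close>
  define w where "w x = indicator {0<..} x * (u x + u (- x))" for x
  have wi: "integrable lborel w" using integral_fold(1)[OF ui] by (simp add: w_def[abs_def])
  have wnn: "0 \<le> (\<integral>x. w x \<partial>lborel)" using unn integral_fold(2)[OF ui] by (simp add: w_def[abs_def])
  \<comment> \<open>A majorant of \<open>w\<close>: crude up to \<open>X0\<close>, negative of order
    \<open>1 / x\<close> between \<open>X0\<close> and \<open>X1\<close>, and 0 beyond
    \<open>X1\<close>, where \<open>w\<close> is at most 0.\<close>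
  define v where "v x = 2 * M * indicator {0<..X0} x - c0 * (indicator {X0..X1} x * (1 / x))" for x
  have ind: "integrable lborel (\<lambda>x. indicator {X0..X1} x * (1 / x))"
  proof (rule integrable_bounded_support[of _ 1 X1])
    show "\<bar>indicator {X0..X1} x * (1 / x)\<bar> \<le> 1" for x using X0(1) by (auto simp: indicator_def)
    show "indicator {X0..X1} x * (1 / x) = 0" if "X1 < \<bar>x\<bar>" for x using that X0(1) by (auto simp: indicator_def)
  qed measurable
  have indv: "(\<integral>x. indicator {X0..X1} x * (1 / x) \<partial>lborel) = D"
  proof -
    have "(\<integral>x. indicator {X0..X1} x * (1 / x) \<partial>lborel) = integral {X0..X1} (\<lambda>x. indicator {X0..X1} x * (1 / x))"
      by (rule lborel_integral_eq_interval[OF ind]) simp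
    also have "\<dots> = integral {X0..X1} (\<lambda>x. 1 / x)" by (rule integral_cong) simp
    also have "\<dots> = ln X1 - ln X0"
    proof (rule integral_unique, rule fundamental_theorem_of_calculus)
      fix x assume "x \<in> {X0..X1}"
      then have "(ln has_real_derivative 1 / x) (at x)" using X0(1) by (auto intro!: derivative_eq_intros simp: divide_inverse)
      then show "(ln has_vector_derivative 1 / x) (at x within {X0..X1})"
        by (simp add: has_field_derivative_at_within flip: has_real_derivative_iff_has_vector_derivative)
    qed (use X1 in simp)
    also have "\<dots> = D" using X0(1) by (simp add: X1_def ln_mult)
    finally show ?thesis .
  qed
  have vi: "integrable lborel v"
    unfolding v_def[abs_def] by (intro Bochner_Integration.integrable_diff integrable_mult_right integrable_interval ind)
  have vv: "(\<integral>x. v x \<partial>lborel) = 2 * M * X0 - c0 * D"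
  proof -
    have "(\<integral>x. v x \<partial>lborel) = (\<integral>x. 2 * M * indicator {0<..X0} x \<partial>lborel) - (\<integral>x. c0 * (indicator {X0..X1} x * (1 / x)) \<partial>lborel)"
      unfolding v_def by (intro Bochner_Integration.integral_diff integrable_mult_right integrable_interval ind)
    also have "\<dots> = 2 * M * (\<integral>x. indicator {0<..X0} x \<partial>lborel) - c0 * D"
      by (simp only: integral_mult_right_zero indv)
    finally show ?thesis using X0(1) by simp
  qed
  have wv: "w x \<le> v x" for x
  proof -
    let ?m = "?k (\<psi> - \<beta> * (pi / 2 - arctan x)) + ?k (\<psi> - \<beta> * (pi / 2 + arctan x))"
    have wx: "w x = E x * ?m" if "0 < x" using that by (simp add: w_def u_def Em arctan_minus distrib_left)
    have "\<bar>?m\<bar> \<le> 2 * M"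
      using M(2)[of "\<psi> - \<beta> * (pi / 2 - arctan x)"] M(2)[of "\<psi> - \<beta> * (pi / 2 + arctan x)"] by linarith
    then have m2: "\<bar>E x * ?m\<bar> \<le> 1 * (2 * M)" unfolding abs_mult using E1 by (intro mult_mono) auto
    have far: "?m \<le> - \<delta>" if x: "X0 \<le> x"
    proof -
      have A: "0 < pi / 2 - arctan x" "pi / 2 - arctan x < \<eta> / 2" using X0(2)[OF x] arctan_bounded[of x] by auto
      have bA: "\<beta> * (pi / 2 - arctan x) < \<eta> / 2" "0 < \<beta> * (pi / 2 - arctan x)"
      proof -
        have "\<beta> * (pi / 2 - arctan x) \<le> 1 * (pi / 2 - arctan x)" using A \<beta> by (intro mult_right_mono) auto
        then show "\<beta> * (pi / 2 - arctan x) < \<eta> / 2"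
          unfolding mult_1_left by (rule le_less_trans[OF _ A(2)])
        show "0 < \<beta> * (pi / 2 - arctan x)" using A \<beta> by (intro mult_pos_pos) auto
      qed
      then have "\<bar>(\<psi> - \<beta> * (pi / 2 - arctan x)) - \<psi>\<bar> < \<eta>1" using \<eta> by auto
      then have 1: "?k (\<psi> - \<beta> * (pi / 2 - arctan x)) \<le> ?k \<psi> + \<delta>" by (rule \<eta>1(2))
      have "\<beta> * (pi / 2 + arctan x) = \<beta> * pi - \<beta> * (pi / 2 - arctan x)" by (simp add: algebra_simps)
      also have "\<beta> * pi = pi / p + \<epsilon> * pi" by (simp add: \<beta>_def distrib_right)
      finally have "(\<psi> - \<beta> * (pi / 2 + arctan x)) - (\<psi> - pi / p) = \<beta> * (pi / 2 - arctan x) - \<epsilon> * pi" by simp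
      moreover have "\<bar>y - e\<bar> < \<eta>2" if "y < \<eta> / 2" "0 < y" "e \<le> \<eta> / 2" "0 < e" for y e
        using that \<eta> by (auto simp: abs_less_iff)
      from this[OF bA \<epsilon>(3) mult_pos_pos[OF \<epsilon>(1) pi_gt_zero]]
      have "\<bar>\<beta> * (pi / 2 - arctan x) - \<epsilon> * pi\<bar> < \<eta>2" .
      ultimately have "\<bar>(\<psi> - \<beta> * (pi / 2 + arctan x)) - (\<psi> - pi / p)\<bar> < \<eta>2" by simp
      then have 2: "?k (\<psi> - \<beta> * (pi / 2 + arctan x)) \<le> ?k (\<psi> - pi / p) + \<delta>" by (rule \<eta>2(2))
      show ?thesis using 1 2 \<delta>(2) by linarith
    qed
    consider "x \<le> 0" | "0 < x" "x < X0" | "X0 \<le> x" "x \<le> X1" | "X1 < x" by linarith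
    then show ?thesis
    proof cases
      case 1
      then show ?thesis using X0(1) by (simp add: w_def v_def)
    next
      case 2
      then show ?thesis using m2 wx by (simp add: v_def)
    next
      case 3
      then have x0: "1 \<le> x" using X0(1) by linarith
      have "2 powr (- (p / 2)) / 2 * (1 / x) \<le> E x"
      proof -
        have "cmod (of_real x + \<i>) = sqrt (x\<^sup>2 + 1)" by (simp add: cmod_def)
        also have "\<dots> \<le> sqrt (2 * x\<^sup>2)" using x0 by (simp add: power_increasing)
        also have "\<dots> = sqrt 2 * x" using x0 by (simp add: real_sqrt_mult)
        finally have "(sqrt 2 * x) powr (- (\<beta> * p)) \<le> E x"
          unfolding E_def using bp(1) cmod_shift_ge(1)[of x] by (intro powr_mono2') auto
        moreover have "(sqrt 2 * x) powr (- (\<beta> * p)) = sqrt 2 powr (- (\<beta> * p)) * x powr (- (\<beta> * p))" by (rule powr_mult)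
        moreover have "2 powr (- (p / 2)) \<le> sqrt 2 powr (- (\<beta> * p))"
        proof -
          have "sqrt 2 powr (- (\<beta> * p)) = 2 powr (- (\<beta> * p / 2))"
            by (simp add: powr_half_sqrt[symmetric] powr_powr)
          moreover have "- (p / 2) \<le> - (\<beta> * p / 2)" using \<beta> p mult_right_mono[of \<beta> 1 p] by simp
          ultimately show ?thesis by (simp add: powr_mono)
        qed
        moreover have "1 / 2 * (1 / x) \<le> x powr (- (\<beta> * p))"
        proof -
          have "ln x \<le> ln X1" using 3 x0 by simp
          then have "\<epsilon> * p * ln x \<le> \<epsilon> * p * ln X1" using \<epsilon> p by (intro mult_left_mono) auto
          then have "- ln 2 \<le> - (\<epsilon> * p) * ln x" using \<epsilon>(4) by simp
          then have "exp (- ln 2) \<le> x powr (- (\<epsilon> * p))" using x0 by (simp add: powr_def)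
          then have "1 / 2 \<le> x powr (- (\<epsilon> * p))" by (simp add: exp_minus)
          then have "1 / 2 * (1 / x) \<le> x powr (- (\<epsilon> * p)) * (1 / x)" using x0 by (intro mult_right_mono) auto
          also have "\<dots> = x powr (- (\<epsilon> * p) - 1)" using x0 by (simp only: powr_diff) simp
          also have "- (\<epsilon> * p) - 1 = - (\<beta> * p)" using bp(2) by simp
          finally show ?thesis .
        qed
        ultimately have "2 powr (- (p / 2)) * (1 / 2 * (1 / x)) \<le> E x"
          using x0 mult_mono[of "2 powr (- (p / 2))" "sqrt 2 powr (- (\<beta> * p))" "1 / 2 * (1 / x)" "x powr (- (\<beta> * p))"]
          by simp
        then show ?thesis by simp
      qed
      then have "\<delta> * (2 powr (- (p / 2)) / 2 * (1 / x)) \<le> \<delta> * E x" using \<delta> by (intro mult_left_mono) auto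
      then have c: "c0 * (1 / x) \<le> \<delta> * E x" by (simp add: c0_def)
      have "E x * ?m \<le> E x * (- \<delta>)" using far[OF 3(1)] E1(1) by (intro mult_left_mono) auto
      then have "w x \<le> - (c0 * (1 / x))" using wx c x0 by (simp add: mult.commute)
      also have "\<dots> \<le> v x" using 3 M by (simp add: v_def)
      finally show ?thesis .
    next
      case 4
      then have x: "0 < x" "X0 \<le> x" using X1 X0(1) by auto
      have "E x * ?m \<le> E x * (- \<delta>)" using far[OF x(2)] E1(1) by (intro mult_left_mono) auto
      also have "\<dots> \<le> 0" using E1(1)[of x] \<delta>(1) by (simp add: mult_nonneg_nonpos)
      finally have "w x \<le> 0" using wx[OF x(1)] by simp
      also have "0 \<le> v x" using 4 X1 M by (simp add: v_def)
      finally show ?thesis .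
    qed
  qed
  have "0 \<le> (\<integral>x. v x \<partial>lborel)" using wnn integral_mono[OF wi vi wv] by simp
  then show False using vv D(2) by simp
qed

lemma B_const_sharp:
  assumes p: "1 < p"
    and C: "\<And>f. f \<in> test_functions \<Longrightarrow> pint p (\<lambda>x. a * f x + b * hilbert f x) \<le> C * pint p f"
  shows "B_const a b p \<le> C"
proof (rule B_const_least[OF p])
  fix t
  show "0 \<le> hfun p C a b t + hfun p C a b (t + pi / p)"
    using sharp_pair[OF p C, of "t + pi / p"] by (simp add: add.commute)
qed

text \<open>For the lower bound, the \<open>p\<close>-th power of the operator norm is itself an
  admissible constant on test functions, where \<open>T\<close> agrees with \<open>hilbert\<close>
  almost everywhere; by sharpness it is at least \<open>B_const a b p\<close>.\<close>

lemma extension_onorm: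
  assumes p: "1 < p" and T: "hilbert_extension p T"
  shows "Lp_onorm p (\<lambda>f x. a * f x + b * T f x) = B_const a b p powr (1 / p)"
proof -
  let ?A = "\<lambda>f x. a * f x + b * T f x"
  let ?B = "B_const a b p"
  have B: "0 \<le> ?B" by (rule B_const_nonneg[OF p])
  have nn: "0 \<le> Lp_norm p f" for f by (simp add: Lp_norm_def)
  have le: "Lp_norm p (?A f) / Lp_norm p f \<le> ?B powr (1 / p)" if f: "f \<in> Lp p" for f
  proof (cases "Lp_norm p f = 0")
    case False
    have "Lp_norm p (?A f) \<le> ?B powr (1 / p) * Lp_norm p f"
      by (rule Lp_norm_le_of_pint[OF p B extension_bound(2)[OF p T f]])
    then show ?thesis using False nn[of f] by (simp add: divide_le_eq)
  qed simp
  have bdd: "bdd_above ((\<lambda>f. Lp_norm p (?A f) / Lp_norm p f) ` Lp p)"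
    using le by (rule bdd_aboveI2)
  have bump: "bump \<in> Lp p" by (rule test_Lp[OF test_bump p])
  define S where "S = Lp_onorm p ?A"
  have up: "Lp_norm p (?A f) / Lp_norm p f \<le> S" if "f \<in> Lp p" for f
    unfolding S_def Lp_onorm_def by (rule cSUP_upper[OF that bdd])
  have "S \<le> ?B powr (1 / p)" unfolding S_def Lp_onorm_def by (rule cSUP_least) (use bump le in auto)
  moreover have S0: "0 \<le> S" using up[OF bump] nn by (meson divide_nonneg_nonneg order_trans)
  moreover have "?B \<le> S powr p"
  proof (rule B_const_sharp[OF p])
    fix f assume f: "f \<in> test_functions"
    have fL: "f \<in> Lp p" by (rule test_Lp[OF f p])
    have AE: "AE x in lborel. T f x = hilbert f x" using T f by (simp add: hilbert_extension_def)
    have AE': "AE x in lborel. a * f x + b * hilbert f x = ?A f x" using AE by eventually_elim simp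
    have "pint p (\<lambda>x. a * f x + b * hilbert f x) = pint p (?A f)"
    proof (rule pint_cong_AE)
      show "(\<lambda>x. a * f x + b * hilbert f x) \<in> borel_measurable lborel"
        using Lp_D(1)[OF fL] Lp_D(1)[OF hilbert_test_bound(1)[OF f p]] by measurable
      show "?A f \<in> borel_measurable lborel" by (rule Lp_D(1)[OF extension_bound(1)[OF p T fL]])
    qed (rule AE')
    also have "\<dots> \<le> S powr p * pint p f"
    proof (cases "Lp_norm p f = 0")
      case True
      \<comment> \<open>A quotient with denominator 0 is 0 and says nothing about its numerator;
        here the numerator is controlled by \<open>extension_bound\<close> instead.\<close>
      then have "pint p f = 0" using Lp_norm_powr[of p f] p by simp
      then show ?thesis using extension_bound(2)[OF p T fL, of a b] by simp
    next
      case False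
      then have "Lp_norm p (?A f) \<le> S * Lp_norm p f" using up[OF fL] nn[of f] by (simp add: divide_le_eq)
      then have "Lp_norm p (?A f) powr p \<le> (S * Lp_norm p f) powr p" using p nn by (intro powr_mono2) auto
      then show ?thesis using p by (simp add: powr_mult Lp_norm_powr)
    qed
    finally show "pint p (\<lambda>x. a * f x + b * hilbert f x) \<le> S powr p * pint p f" .
  qed
  then have "?B powr (1 / p) \<le> (S powr p) powr (1 / p)" using B p by (intro powr_mono2) auto
  then have "?B powr (1 / p) \<le> S" using S0 p by (simp add: powr_powr)
  ultimately show ?thesis by (simp add: S_def)
qed

theorem theorem1:
  fixes p a b :: real
  assumes "1 < p"
  shows "(\<forall>f\<in>test_functions.
            (\<lambda>x. a * f x + b * hilbert f x) \<in> Lp p \<and>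
            Lp_norm p (\<lambda>x. a * f x + b * hilbert f x) powr p
              \<le> B_const a b p * Lp_norm p f powr p)
       \<and> (\<forall>C. (\<forall>f\<in>test_functions.
                 Lp_norm p (\<lambda>x. a * f x + b * hilbert f x) powr p \<le> C * Lp_norm p f powr p)
               \<longrightarrow> B_const a b p \<le> C)
       \<and> (\<exists>T. hilbert_extension p T)
       \<and> (\<forall>T. hilbert_extension p T
               \<longrightarrow> bounded_linear_Lp p (\<lambda>f x. a * f x + b * T f x) \<and>
                   Lp_onorm p (\<lambda>f x. a * f x + b * T f x) = B_const a b p powr (1 / p))"
proof (intro conjI ballI allI impI)
  have p0: "p \<noteq> 0" using assms by simp
  note norm = Lp_norm_powr[OF p0]
  fix f assume f: "f \<in> test_functions"
  show "(\<lambda>x. a * f x + b * hilbert f x) \<in> Lp p"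
    by (intro Lp_add Lp_cmult test_Lp[OF f] hilbert_test_bound(1)[OF f] assms)
  show "Lp_norm p (\<lambda>x. a * f x + b * hilbert f x) powr p \<le> B_const a b p * Lp_norm p f powr p"
    unfolding norm by (rule hilbert_test_bound(2)[OF f assms])
next
  have p0: "p \<noteq> 0" using assms by simp
  fix C assume "\<forall>f\<in>test_functions. Lp_norm p (\<lambda>x. a * f x + b * hilbert f x) powr p \<le> C * Lp_norm p f powr p"
  then show "B_const a b p \<le> C"
    unfolding Lp_norm_powr[OF p0] by (intro B_const_sharp[OF assms]) blast
next
  show "\<exists>T. hilbert_extension p T" using hilbert_Lp_extension[OF assms] by blast
next
  fix T assume T: "hilbert_extension p T"
  show "bounded_linear_Lp p (\<lambda>f x. a * f x + b * T f x)" by (rule extension_bounded_linear[OF assms T])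
  show "Lp_onorm p (\<lambda>f x. a * f x + b * T f x) = B_const a b p powr (1 / p)" by (rule extension_onorm[OF assms T])
qed

end
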